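(* Let $V$ be a commutative valuation domain with quotient field $F$ such that $J(V)$ is a principal ideal of $V$, let $K/F$ be a finite Galois extension with group $G$ which is tamely ramified and defectless, let $S$ be the integral closure of $V$ in $K$, and let $f:G\times G\to S\setminus\{0\}$ be a normalized $2$-cocycle. Then the following are equivalent: (1) $A_f$ is semihereditary; (2) $A_f$ is an extremal $V$-order; (3) $O_l(J(A_f))=A_f$; (4) for every maximal ideal $M$ of $S$, $f(\sigma,\sigma^{-1})\notin M^2$ for all $\sigma\in G$; (5) for every maximal ideal $M$ of $S$, $f(\sigma,\tau)\notin M^2$ for all $\sigma,\tau\in G$; (6) $J(A_f)$ is a projective ideal of $A_f$. When this happens then, for each maximal ideal $M$ of $S$, the graph $\mathrm{Gr}(f^M)$ is a chain.
   Context: $V$ has arbitrary Krull dimension. A normalized 2-cocycle satisfies $\sigma(f(\tau,\gamma))f(\sigma,\tau\gamma)=f(\sigma,\tau)f(\sigma\tau,\gamma)$, $f(1,\sigma)=f(\sigma,1)=1$; values need not be units. $A_f=\bigoplus_{\sigma\in G}Sx_\sigma$ (free left $S$-module) with $(sx_\sigma)(tx_\tau)=s\,\sigma(t)f(\sigma,\tau)x_{\sigma\tau}$, a $V$-order in $\Sigma_f=\bigoplus_\sigma Kx_\sigma=(K/F,G,f)$. $J(R)$ is the Jacobson radical, $U(R)$ the unit group. A $V$-order in a central simple $F$-algebra $Q$ is a subring $R\supseteq V$ with $RF=Q$, integral over $V$; $R$ is extremal if every $V$-order $B\supseteq R$ with $J(B)\supseteq J(R)$ equals $R$. $O_l(I)=\{x\in\Sigma_f: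 xI\subseteq I\}$. Semihereditary: finitely generated one-sided ideals are projective. $H=\{\sigma\in G:f(\sigma,\sigma^{-1})\in U(S)\}$. For a maximal ideal $M$ of $S$, define a preorder on $G/H$ by $\sigma H\le_M\tau H$ iff $f(\sigma,\sigma^{-1}\tau)\notin M$; $\mathrm{Gr}(f^M)$ is the induced partial order on the equivalence classes (classes of mutually $\le_M$-comparable-both-ways cosets). "Chain" means totally ordered. Tamely ramified and defectless: for a maximal ideal $M$ of $S$, with $e=[\Gamma_{S_M}:\Gamma_V]$, residue fields $\overline{S_M},\overline V$ and $r$ the number of maximal ideals of $S$, $[K:F]=e[\overline{S_M}:\overline V]r$, $\mathrm{char}\,\overline V\nmid e$ and $\overline{S_M}/\overline V$ separable. *)

theory Defs
  imports "HOL-Algebra.Algebra"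
begin

definition Kring :: "'k::field ring" where
  "Kring = \<lparr>carrier = UNIV, monoid.mult = (*), monoid.one = 1, ring.zero = 0, ring.add = (+)\<rparr>"

definition subR :: "'k::field set \<Rightarrow> 'k ring" where
  "subR A = Kring\<lparr>carrier := A\<rparr>"

definition lideal :: "('a,'m) ring_scheme \<Rightarrow> 'a set \<Rightarrow> bool" where
  "lideal R I \<longleftrightarrow> I \<subseteq> carrier R \<and> \<zero>\<^bsub>R\<^esub> \<in> I \<and>
     (\<forall>x\<in>I. \<forall>y\<in>I. x \<oplus>\<^bsub>R\<^esub> y \<in> I) \<and> (\<forall>x\<in>I. \<ominus>\<^bsub>R\<^esub> x \<in> I) \<and>
     (\<forall>r\<in>carrier R. \<forall>x\<in>I. r \<otimes>\<^bsub>R\<^esub> x \<in> I)"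

definition rideal :: "('a,'m) ring_scheme \<Rightarrow> 'a set \<Rightarrow> bool" where
  "rideal R I \<longleftrightarrow> I \<subseteq> carrier R \<and> \<zero>\<^bsub>R\<^esub> \<in> I \<and>
     (\<forall>x\<in>I. \<forall>y\<in>I. x \<oplus>\<^bsub>R\<^esub> y \<in> I) \<and> (\<forall>x\<in>I. \<ominus>\<^bsub>R\<^esub> x \<in> I) \<and>
     (\<forall>r\<in>carrier R. \<forall>x\<in>I. x \<otimes>\<^bsub>R\<^esub> r \<in> I)"

definition max_lideal :: "('a,'m) ring_scheme \<Rightarrow> 'a set \<Rightarrow> bool" where
  "max_lideal R I \<longleftrightarrow> lideal R I \<and> I \<noteq> carrier R \<and>
     (\<forall>L. lideal R L \<and> I \<subseteq> L \<longrightarrow> L = I \<or> L = carrier R)"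

definition jac :: "('a,'m) ring_scheme \<Rightarrow> 'a set" where
  "jac R = carrier R \<inter> \<Inter>{I. max_lideal R I}"

definition fg_lideal :: "('a,'m) ring_scheme \<Rightarrow> 'a set \<Rightarrow> bool" where
  "fg_lideal R I \<longleftrightarrow> lideal R I \<and>
     (\<exists>Y. finite Y \<and> Y \<subseteq> I \<and> I = \<Inter>{L. lideal R L \<and> Y \<subseteq> L})"

definition fg_rideal :: "('a,'m) ring_scheme \<Rightarrow> 'a set \<Rightarrow> bool" where
  "fg_rideal R I \<longleftrightarrow> rideal R I \<and>
     (\<exists>Y. finite Y \<and> Y \<subseteq> I \<and> I = \<Inter>{L. rideal R L \<and> Y \<subseteq> L})"

text \<open>A one-sided ideal I of R, viewed as an R-module with scalar action act
  (act r x = r x for left modules, act r x = x r for right modules), is projective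
  iff it is a direct summand of a free module, i.e. iff the canonical epimorphism
  from the free module R^(I) (finitely supported families (c_z)_{z\<in>I}) onto I,
  c \<mapsto> \<Sum> act (c z) z, admits an R-linear section s.\<close>
definition proj_mod :: "('a,'m) ring_scheme \<Rightarrow> ('a \<Rightarrow> 'a \<Rightarrow> 'a) \<Rightarrow> 'a set \<Rightarrow> bool" where
  "proj_mod R act I \<longleftrightarrow> (\<exists>s.
     (\<forall>x\<in>I. (\<forall>z. s x z \<in> carrier R) \<and> (\<forall>z. z \<notin> I \<longrightarrow> s x z = \<zero>\<^bsub>R\<^esub>) \<and>
             finite {z. s x z \<noteq> \<zero>\<^bsub>R\<^esub>}) \<and>
     (\<forall>x\<in>I. \<forall>y\<in>I. s (x \<oplus>\<^bsub>R\<^esub> y) = (\<lambda>z. s x z \<oplus>\<^bsub>R\<^esub> s y z)) \<and>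
     (\<forall>r\<in>carrier R. \<forall>x\<in>I. s (act r x) = (\<lambda>z. act r (s x z))) \<and>
     (\<forall>x\<in>I. finsum R (\<lambda>z. act (s x z) z) {z. s x z \<noteq> \<zero>\<^bsub>R\<^esub>} = x))"

definition proj_left :: "('a,'m) ring_scheme \<Rightarrow> 'a set \<Rightarrow> bool" where
  "proj_left R I \<longleftrightarrow> proj_mod R (\<lambda>r x. r \<otimes>\<^bsub>R\<^esub> x) I"

definition proj_right :: "('a,'m) ring_scheme \<Rightarrow> 'a set \<Rightarrow> bool" where
  "proj_right R I \<longleftrightarrow> proj_mod R (\<lambda>r x. x \<otimes>\<^bsub>R\<^esub> r) I"

definition semihereditary :: "('a,'m) ring_scheme \<Rightarrow> bool" where
  "semihereditary R \<longleftrightarrow> (\<forall>I. fg_lideal R I \<longrightarrow> proj_left R I) \<and>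
                         (\<forall>I. fg_rideal R I \<longrightarrow> proj_right R I)"

definition gal :: "'k::field set \<Rightarrow> ('k \<Rightarrow> 'k) set" where
  "gal F = {\<sigma>. bij \<sigma> \<and> (\<forall>x y. \<sigma> (x + y) = \<sigma> x + \<sigma> y) \<and> (\<forall>x y. \<sigma> (x * y) = \<sigma> x * \<sigma> y)
               \<and> \<sigma> 1 = 1 \<and> (\<forall>x\<in>F. \<sigma> x = x)}"

definition finite_galois :: "'k::field set \<Rightarrow> bool" where
  "finite_galois F \<longleftrightarrow> subfield F Kring \<and> finite (gal F) \<and> {x. \<forall>\<sigma>\<in>gal F. \<sigma> x = x} = F"

definition valuation_domain_of :: "'k::field set \<Rightarrow> 'k set \<Rightarrow> bool" where
  "valuation_domain_of F V \<longleftrightarrow> subring V Kring \<and> V \<subseteq> F \<and>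
     (\<forall>x\<in>F. x \<noteq> 0 \<longrightarrow> x \<in> V \<or> inverse x \<in> V) \<and>
     (\<forall>x\<in>F. \<exists>a\<in>V. \<exists>b\<in>V. b \<noteq> 0 \<and> x = a / b)"

definition int_closure :: "'k::field set \<Rightarrow> 'k set" where
  "int_closure V = {x. \<exists>n c. (\<forall>i<n. c i \<in> V) \<and> x ^ n + (\<Sum>i<n. c i * x ^ i) = 0}"

definition localize :: "'k::field set \<Rightarrow> 'k set \<Rightarrow> 'k set" where
  "localize S M = {s / t | s t. s \<in> S \<and> t \<in> S \<and> t \<notin> M}"

text \<open>Ramification index e = [\<Gamma>_{S_M} : \<Gamma>_V], where \<Gamma>_{S_M} = K*/U(S_M) and
  \<Gamma>_V = F*/U(V) embeds as F* U(S_M)/U(S_M).\<close>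
definition ram_index :: "'k::field set \<Rightarrow> 'k set \<Rightarrow> nat" where
  "ram_index F SM = card {(\<lambda>y. x * y) ` {a * u | a u. a \<in> F \<and> a \<noteq> 0 \<and> u \<in> Units (subR SM)}
                          | x. x \<noteq> 0}"

definition residue_field :: "'k::field set \<Rightarrow> 'k set ring" where
  "residue_field SM = subR SM Quot jac (subR SM)"

definition residue_sub :: "'k::field set \<Rightarrow> 'k set \<Rightarrow> 'k set set" where
  "residue_sub SM V = {a_r_coset (subR SM) (jac (subR SM)) v | v. v \<in> V}"

definition res_char :: "'k::field set \<Rightarrow> nat" where
  "res_char V = (if \<exists>n>0. of_nat n \<in> jac (subR V)
                 then (LEAST n. n > 0 \<and> of_nat n \<in> jac (subR V)) else 0)"

text \<open>Formal derivative of a HOL-Algebra polynomial (coefficient list, leading first).\<close>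
definition pderiv_alg :: "('a,'m) ring_scheme \<Rightarrow> 'a list \<Rightarrow> 'a list" where
  "pderiv_alg R p = ring.normalize R
     (map (\<lambda>i. add_pow R (length p - 1 - i) (p ! i)) [0..<length p - 1])"

definition separable_ext :: "('a,'m) ring_scheme \<Rightarrow> 'a set \<Rightarrow> bool" where
  "separable_ext R K \<longleftrightarrow> (\<forall>x\<in>carrier R. \<exists>p\<in>carrier (K[X]\<^bsub>R\<^esub>). p \<noteq> [] \<and> ring.eval R p x = \<zero>\<^bsub>R\<^esub> \<and>
     (\<exists>a\<in>carrier (K[X]\<^bsub>R\<^esub>). \<exists>b\<in>carrier (K[X]\<^bsub>R\<^esub>).
        a \<otimes>\<^bsub>K[X]\<^bsub>R\<^esub>\<^esub> p \<oplus>\<^bsub>K[X]\<^bsub>R\<^esub>\<^esub> b \<otimes>\<^bsub>K[X]\<^bsub>R\<^esub>\<^esub> pderiv_alg R p = \<one>\<^bsub>K[X]\<^bsub>R\<^esub>\<^esub>))"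

definition tame_defectless :: "'k::field set \<Rightarrow> 'k set \<Rightarrow> 'k set \<Rightarrow> bool" where
  "tame_defectless F V S \<longleftrightarrow> (\<forall>M. maximalideal M (subR S) \<longrightarrow>
     (let SM = localize S M; e = ram_index F SM;
          fM = ring.dim (residue_field SM) (residue_sub SM V) (carrier (residue_field SM));
          r = card {N. maximalideal N (subR S)}
      in ring.dim Kring F UNIV = e * fM * r \<and> \<not> (res_char V dvd e) \<and>
         separable_ext (residue_field SM) (residue_sub SM V)))"

definition normalized_cocycle ::
    "('k::field \<Rightarrow> 'k) set \<Rightarrow> 'k set \<Rightarrow> (('k \<Rightarrow> 'k) \<Rightarrow> ('k \<Rightarrow> 'k) \<Rightarrow> 'k) \<Rightarrow> bool" where
  "normalized_cocycle G S f \<longleftrightarrow>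
     (\<forall>\<sigma>\<in>G. \<forall>\<tau>\<in>G. f \<sigma> \<tau> \<in> S - {0}) \<and>
     (\<forall>\<sigma>\<in>G. \<forall>\<tau>\<in>G. \<forall>\<gamma>\<in>G. \<sigma> (f \<tau> \<gamma>) * f \<sigma> (\<tau> \<circ> \<gamma>) = f \<sigma> \<tau> * f (\<sigma> \<circ> \<tau>) \<gamma>) \<and>
     (\<forall>\<sigma>\<in>G. f id \<sigma> = 1 \<and> f \<sigma> id = 1)"

text \<open>Elements of \<Sigma>_f = \<Oplus> K x_\<sigma> are the coefficient functions G \<rightarrow> K (zero off G);
  (s x_\<sigma>)(t x_\<tau>) = s \<sigma>(t) f(\<sigma>,\<tau>) x_{\<sigma>\<tau>}.\<close>
definition cp_mult :: "('k::field \<Rightarrow> 'k) set \<Rightarrow> (('k \<Rightarrow> 'k) \<Rightarrow> ('k \<Rightarrow> 'k) \<Rightarrow> 'k)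
    \<Rightarrow> (('k \<Rightarrow> 'k) \<Rightarrow> 'k) \<Rightarrow> (('k \<Rightarrow> 'k) \<Rightarrow> 'k) \<Rightarrow> (('k \<Rightarrow> 'k) \<Rightarrow> 'k)" where
  "cp_mult G f a b = (\<lambda>\<rho>. if \<rho> \<in> G then
      (\<Sum>\<sigma>\<in>G. a \<sigma> * \<sigma> (b (Hilbert_Choice.inv \<sigma> \<circ> \<rho>)) * f \<sigma> (Hilbert_Choice.inv \<sigma> \<circ> \<rho>))
      else 0)"

definition Sigma_f :: "('k::field \<Rightarrow> 'k) set \<Rightarrow> (('k \<Rightarrow> 'k) \<Rightarrow> ('k \<Rightarrow> 'k) \<Rightarrow> 'k)
    \<Rightarrow> (('k \<Rightarrow> 'k) \<Rightarrow> 'k) ring" where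
  "Sigma_f G f = \<lparr>carrier = {a. \<forall>\<sigma>. \<sigma> \<notin> G \<longrightarrow> a \<sigma> = 0},
                  monoid.mult = cp_mult G f,
                  monoid.one = (\<lambda>\<sigma>. if \<sigma> = id then 1 else 0),
                  ring.zero = (\<lambda>_. 0),
                  ring.add = (\<lambda>a b \<sigma>. a \<sigma> + b \<sigma>)\<rparr>"

definition emb :: "'k::field \<Rightarrow> (('k \<Rightarrow> 'k) \<Rightarrow> 'k)" where
  "emb c = (\<lambda>\<sigma>. if \<sigma> = id then c else 0)"

definition A_f_set :: "('k::field \<Rightarrow> 'k) set \<Rightarrow> 'k set \<Rightarrow> (('k \<Rightarrow> 'k) \<Rightarrow> 'k) set" where
  "A_f_set G S = {a. (\<forall>\<sigma>. \<sigma> \<notin> G \<longrightarrow> a \<sigma> = 0) \<and> (\<forall>\<sigma>. a \<sigma> \<in> S)}"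

abbreviation subSig where
  "subSig G f B \<equiv> (Sigma_f G f)\<lparr>carrier := B\<rparr>"

definition V_order ::
    "('k::field \<Rightarrow> 'k) set \<Rightarrow> (('k \<Rightarrow> 'k) \<Rightarrow> ('k \<Rightarrow> 'k) \<Rightarrow> 'k) \<Rightarrow> 'k set \<Rightarrow> 'k set
      \<Rightarrow> (('k \<Rightarrow> 'k) \<Rightarrow> 'k) set \<Rightarrow> bool" where
  "V_order G f F V B \<longleftrightarrow> subring B (Sigma_f G f) \<and> emb ` V \<subseteq> B \<and>
     carrier (Sigma_f G f) = {finsum (Sigma_f G f) (\<lambda>i. b i \<otimes>\<^bsub>Sigma_f G f\<^esub> emb (c i)) {..<(n::nat)}
                               | n b c. \<forall>i<n. b i \<in> B \<and> c i \<in> F} \<and>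
     (\<forall>x\<in>B. \<exists>(n::nat) c. (\<forall>i<n. c i \<in> V) \<and>
        x [^]\<^bsub>Sigma_f G f\<^esub> n \<oplus>\<^bsub>Sigma_f G f\<^esub>
          finsum (Sigma_f G f) (\<lambda>i. emb (c i) \<otimes>\<^bsub>Sigma_f G f\<^esub> x [^]\<^bsub>Sigma_f G f\<^esub> i) {..<(n::nat)}
        = \<zero>\<^bsub>Sigma_f G f\<^esub>)"

definition extremal ::
    "('k::field \<Rightarrow> 'k) set \<Rightarrow> (('k \<Rightarrow> 'k) \<Rightarrow> ('k \<Rightarrow> 'k) \<Rightarrow> 'k) \<Rightarrow> 'k set \<Rightarrow> 'k set
      \<Rightarrow> (('k \<Rightarrow> 'k) \<Rightarrow> 'k) set \<Rightarrow> bool" where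
  "extremal G f F V R \<longleftrightarrow> V_order G f F V R \<and>
     (\<forall>B. V_order G f F V B \<and> R \<subseteq> B \<and> jac (subSig G f R) \<subseteq> jac (subSig G f B) \<longrightarrow> B = R)"

definition left_order ::
    "('k::field \<Rightarrow> 'k) set \<Rightarrow> (('k \<Rightarrow> 'k) \<Rightarrow> ('k \<Rightarrow> 'k) \<Rightarrow> 'k)
      \<Rightarrow> (('k \<Rightarrow> 'k) \<Rightarrow> 'k) set \<Rightarrow> (('k \<Rightarrow> 'k) \<Rightarrow> 'k) set" where
  "left_order G f I = {x \<in> carrier (Sigma_f G f). \<forall>y\<in>I. x \<otimes>\<^bsub>Sigma_f G f\<^esub> y \<in> I}"

definition Hgrp :: "('k::field \<Rightarrow> 'k) set \<Rightarrow> 'k set \<Rightarrow> (('k \<Rightarrow> 'k) \<Rightarrow> ('k \<Rightarrow> 'k) \<Rightarrow> 'k)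
    \<Rightarrow> ('k \<Rightarrow> 'k) set" where
  "Hgrp G S f = {\<sigma>\<in>G. f \<sigma> (Hilbert_Choice.inv \<sigma>) \<in> Units (subR S)}"

definition gal_lcosets :: "('k \<Rightarrow> 'k) set \<Rightarrow> ('k \<Rightarrow> 'k) set \<Rightarrow> ('k \<Rightarrow> 'k) set set" where
  "gal_lcosets G H = {(\<lambda>h. \<sigma> \<circ> h) ` H | \<sigma>. \<sigma> \<in> G}"

definition coset_le :: "('k::field \<Rightarrow> 'k) set \<Rightarrow> 'k set \<Rightarrow> (('k \<Rightarrow> 'k) \<Rightarrow> ('k \<Rightarrow> 'k) \<Rightarrow> 'k)
    \<Rightarrow> 'k set \<Rightarrow> ('k \<Rightarrow> 'k) set \<Rightarrow> ('k \<Rightarrow> 'k) set \<Rightarrow> bool" where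
  "coset_le G S f M C D \<longleftrightarrow> (\<exists>\<sigma>\<in>G. \<exists>\<tau>\<in>G.
      C = (\<lambda>h. \<sigma> \<circ> h) ` Hgrp G S f \<and> D = (\<lambda>h. \<tau> \<circ> h) ` Hgrp G S f \<and>
      f \<sigma> (Hilbert_Choice.inv \<sigma> \<circ> \<tau>) \<notin> M)"

definition Gr_classes :: "('k::field \<Rightarrow> 'k) set \<Rightarrow> 'k set \<Rightarrow> (('k \<Rightarrow> 'k) \<Rightarrow> ('k \<Rightarrow> 'k) \<Rightarrow> 'k)
    \<Rightarrow> 'k set \<Rightarrow> ('k \<Rightarrow> 'k) set set set" where
  "Gr_classes G S f M = {{D \<in> gal_lcosets G (Hgrp G S f). coset_le G S f M C D \<and> coset_le G S f M D C}
                         | C. C \<in> gal_lcosets G (Hgrp G S f)}"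

definition Gr_le :: "('k::field \<Rightarrow> 'k) set \<Rightarrow> 'k set \<Rightarrow> (('k \<Rightarrow> 'k) \<Rightarrow> ('k \<Rightarrow> 'k) \<Rightarrow> 'k)
    \<Rightarrow> 'k set \<Rightarrow> ('k \<Rightarrow> 'k) set set \<Rightarrow> ('k \<Rightarrow> 'k) set set \<Rightarrow> bool" where
  "Gr_le G S f M P Q \<longleftrightarrow> (\<exists>C\<in>P. \<exists>D\<in>Q. coset_le G S f M C D)"

definition Gr_chain :: "('k::field \<Rightarrow> 'k) set \<Rightarrow> 'k set \<Rightarrow> (('k \<Rightarrow> 'k) \<Rightarrow> ('k \<Rightarrow> 'k) \<Rightarrow> 'k)
    \<Rightarrow> 'k set \<Rightarrow> bool" where
  "Gr_chain G S f M \<longleftrightarrow> (\<forall>P\<in>Gr_classes G S f M. \<forall>Q\<in>Gr_classes G S f M.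
      Gr_le G S f M P Q \<or> Gr_le G S f M Q P)"

end

theory Submission
 imports Defs "Jordan_Normal_Form.Char_Poly"
begin

text \<open>Left multiplication on the free right \<open>K\<close>-module \<open>\<Sigma>\<^sub>f\<close> is given by matrices whose characteristic
  polynomials have coefficients in \<open>F\<close>; this yields integrality criteria and shows that elements of the radical
  of an order have identity coefficient of trace in \<open>J(V)\<close>. Tameness makes the trace form nondegenerate modulo
  \<open>J(V)\<close>, and so \<open>J(A\<^sub>f)\<close> is the set of all \<open>\<Sum> a\<^sub>\<sigma> x\<^sub>\<sigma>\<close> with \<open>a\<^sub>\<sigma> f(\<sigma>,\<sigma>\<inverse>) \<in> J(S)\<close>. Since \<open>J(V)\<close> is principal, so is
  \<open>J(S)\<close>, and conditions (2), (3) and (6) become local divisibility statements about \<open>f\<close> at the maximal ideals of \<open>S\<close>,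
  each equivalent to (4). For (4) implies (1), a finitely generated left ideal \<open>L\<close> gives at a maximal ideal \<open>M\<close> the lattices
  \<open>(x\<^sub>\<sigma>\<inverse> L)\<^sub>M\<close>, which form a chain with respect to inclusion; simultaneous coordinates for them, averaged over the group with
  an element of trace one, form a dual basis of \<open>L\<close>. Right ideals are handled through the opposite crossed product.\<close>

hide_const (open) Polynomials.degree Polynomials.lead_coeff UnivPoly.coeff UnivPoly.monom Ring_Hom.ring_hom

section \<open>Determinants of matrices indexed by a finite set\<close>

text \<open>Since \<open>V\<close> may have any rank and need not be Noetherian, neither completions
  nor a structure theory of orders is used. \<open>S\<close> has finitely many maximal ideals,
  permuted transitively by \<open>G\<close>, and its localizations are valuation rings of
  \<open>K\<close> meeting \<open>F\<close> in \<open>V\<close>; so one localization decides whether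
  an element of \<open>F\<close> lies in \<open>V\<close> or in \<open>J(V)\<close>. Tameness and
  defectlessness make the order of the inertia group a unit, whence there is an element with unit
  trace lying in all maximal ideals but one. This is why coordinates at a single maximal ideal
  already give a global dual basis. The relation \<open>f(sigma, sigma^-1 tau) \<notin> M\<close> is
  a preorder on the finite group; divisibility problems are settled by choosing minimal or maximal
  elements for it, or by following a cycle. The square of \<open>M\<close> enters because every
  non-unit can be divided by \<open>f(sigma, sigma^-1)\<close> at \<open>M\<close> exactly when the
  latter has at most the value of a generator of \<open>J(S)\<close>. If \<open>J(V) = 0\<close>
  there is no nonzero generator; then \<open>S = K\<close>, the cocycle conditions hold trivially,
  and this case is split off.\<close>

definition is_subring :: "'a::comm_ring_1 set \<Rightarrow> bool" where
 "is_subring R \<longleftrightarrow> 1 \<in> R \<and> (\<forall>x\<in>R. \<forall>y\<in>R. x - y \<in> R) \<and> (\<forall>x\<in>R. \<forall>y\<in>R. x * y \<in> R)"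

definition is_ideal :: "'a::comm_ring_1 set \<Rightarrow> 'a set \<Rightarrow> bool" where
 "is_ideal R I \<longleftrightarrow> I \<subseteq> R \<and> 0 \<in> I \<and> (\<forall>x\<in>I. \<forall>y\<in>I. x + y \<in> I) \<and> (\<forall>r\<in>R. \<forall>x\<in>I. r * x \<in> I)"

lemma is_subringD:
 assumes "is_subring R"
 shows "1 \<in> R" "0 \<in> R" "x \<in> R ==> - x \<in> R" "x \<in> R ==> y \<in> R ==> x - y \<in> R"
  "x \<in> R ==> y \<in> R ==> x + y \<in> R" "x \<in> R ==> y \<in> R ==> x * y \<in> R"
proof -
 show 1: "1 \<in> R" and d: "x \<in> R ==> y \<in> R ==> x - y \<in> R" and "x \<in> R ==> y \<in> R ==> x * y \<in> R"
  for x y using assms by (auto simp: is_subring_def)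
 show 0: "0 \<in> R" using d[OF 1 1] by simp
 show m: "x \<in> R ==> - x \<in> R" for x using d[OF 0, of x] by simp
 show "x \<in> R ==> y \<in> R ==> x + y \<in> R" using d[OF _ m, of x y] by simp
qed

lemma is_subring_sum:
 assumes "is_subring R" "\<And>i. i \<in> A ==> g i \<in> R"
 shows "sum g A \<in> R"
 using assms(2) by (induct A rule: infinite_finite_induct) (auto intro: is_subringD[OF assms(1)])

lemma is_subring_prod:
 assumes "is_subring R" "\<And>i. i \<in> A ==> g i \<in> R"
 shows "prod g A \<in> R"
 using assms(2) by (induct A rule: infinite_finite_induct) (auto intro: is_subringD[OF assms(1)])

lemma is_subring_power:
 assumes "is_subring R" "x \<in> R"
 shows "x ^ n \<in> R"
 using assms(2) by (induct n) (auto intro: is_subringD[OF assms(1)])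

lemma is_idealD:
 assumes "is_subring R" "is_ideal R I"
 shows "x \<in> I ==> x \<in> R" "0 \<in> I" "x \<in> I ==> y \<in> I ==> x + y \<in> I" "r \<in> R ==> x \<in> I ==> r * x \<in> I"
  "r \<in> R ==> x \<in> I ==> x * r \<in> I" "x \<in> I ==> - x \<in> I" "x \<in> I ==> y \<in> I ==> x - y \<in> I"
proof -
 show "x \<in> I ==> x \<in> R" "0 \<in> I" and p: "x \<in> I ==> y \<in> I ==> x + y \<in> I"
  and m: "r \<in> R ==> x \<in> I ==> r * x \<in> I" for x y r
  using assms(2) by (auto simp: is_ideal_def)
 show "r \<in> R ==> x \<in> I ==> x * r \<in> I" using m by (simp add: mult.commute)
 show n: "x \<in> I ==> - x \<in> I" for x
  using m[of "-1" x] is_subringD[OF assms(1)] by auto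
 show "x \<in> I ==> y \<in> I ==> x - y \<in> I" using p[OF _ n, of x y] by simp
qed

lemma is_ideal_sum:
 assumes "is_subring R" "is_ideal R I" "\<And>i. i \<in> A ==> g i \<in> I"
 shows "sum g A \<in> I"
 using assms(3) by (induct A rule: infinite_finite_induct) (auto intro: is_idealD[OF assms(1,2)])

text \<open>Exchange the factors one at a time. The lemma is applied to field elements and also to
  polynomials over \<open>R\<close> with the ideal of polynomials over \<open>I\<close>; this
  expresses congruences between products of linear factors without quotient rings.\<close>

lemma prod_diff_in_ideal:
 assumes "is_subring R" "is_ideal R I" "\<And>i. i \<in> A ==> g i \<in> R" "\<And>i. i \<in> A ==> h i \<in> R"
  "\<And>i. i \<in> A ==> g i - h i \<in> I"
 shows "prod g A - prod h A \<in> I"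
 using assms(3-5)
proof (induct A rule: infinite_finite_induct)
 case (insert a A)
 have "prod g (insert a A) - prod h (insert a A) = g a * (prod g A - prod h A) + (g a - h a) * prod h A"
  using insert by (simp add: algebra_simps)
 moreover have "g a * (prod g A - prod h A) \<in> I" "(g a - h a) * prod h A \<in> I"
  using insert is_idealD(4,5)[OF assms(1,2)] is_subring_prod[OF assms(1), of A h] by auto
 ultimately show ?case using is_idealD(3)[OF assms(1,2)] by auto
qed (auto intro: is_idealD[OF assms(1,2)])

lemma is_subring_polys:
 assumes "is_subring R"
 shows "is_subring {p. \<forall>i. coeff p i \<in> R}"
 unfolding is_subring_def
 by (auto simp: coeff_mult intro!: is_subring_sum[OF assms] is_subringD[OF assms])

lemma is_ideal_polys:
 assumes "is_subring R" "is_ideal R I"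
 shows "is_ideal {p. \<forall>i. coeff p i \<in> R} {p. \<forall>i. coeff p i \<in> I}"
 unfolding is_ideal_def
 by (auto simp: coeff_mult intro!: is_ideal_sum[OF assms] intro: is_idealD[OF assms])

text \<open>Rows and columns will be indexed by automorphisms or by pairs of exponents, while
  matrices are indexed by numbers. One fixed enumeration serves rows and columns alike, so nothing
  below depends on which one is chosen.\<close>

definition fenum :: "'g set \<Rightarrow> nat \<Rightarrow> 'g" where
 "fenum U = (SOME e. bij_betw e {0..<card U} U)"

definition fmat :: "'g set \<Rightarrow> ('g \<Rightarrow> 'g \<Rightarrow> 'a) \<Rightarrow> 'a mat" where
 "fmat U A = mat (card U) (card U) (\<lambda>(i,j). A (fenum U i) (fenum U j))"

definition fdet :: "'g set \<Rightarrow> ('g \<Rightarrow> 'g \<Rightarrow> 'a::comm_ring_1) \<Rightarrow> 'a" where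
 "fdet U A = det (fmat U A)"

definition fmul :: "'g set \<Rightarrow> ('g \<Rightarrow> 'g \<Rightarrow> 'a::comm_ring_1) \<Rightarrow> ('g \<Rightarrow> 'g \<Rightarrow> 'a) \<Rightarrow> 'g \<Rightarrow> 'g \<Rightarrow> 'a" where
 "fmul U A B = (\<lambda>x y. \<Sum>z\<in>U. A x z * B z y)"

definition fone :: "'g \<Rightarrow> 'g \<Rightarrow> 'a::comm_ring_1" where
 "fone x y = (if x = y then 1 else 0)"

definition fcp :: "'g set \<Rightarrow> ('g \<Rightarrow> 'g \<Rightarrow> 'a::comm_ring_1) \<Rightarrow> 'a poly" where
 "fcp U A = fdet U (\<lambda>x y. [:0,1:] * fone x y - [:A x y:])"

primrec fpow :: "'g set \<Rightarrow> ('g \<Rightarrow> 'g \<Rightarrow> 'a::comm_ring_1) \<Rightarrow> nat \<Rightarrow> 'g \<Rightarrow> 'g \<Rightarrow> 'a" where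
 "fpow U A 0 = fone"
| "fpow U A (Suc i) = fmul U A (fpow U A i)"

context
 fixes U :: "'g set"
 assumes fin: "finite U"
begin

lemma fenum_bij: "bij_betw (fenum U) {0..<card U} U"
 unfolding fenum_def by (rule someI_ex[OF ex_bij_betw_nat_finite[OF fin]])

lemma fenum_in: "i < card U ==> fenum U i \<in> U"
 using fenum_bij by (auto simp: bij_betw_def)

lemma fenum_eq_iff: "i < card U ==> j < card U ==> fenum U i = fenum U j \<longleftrightarrow> i = j"
 using fenum_bij by (auto simp: bij_betw_def inj_on_def)

lemma fenum_surj: "x \<in> U ==> \<exists>i<card U. fenum U i = x"
 using fenum_bij by (force simp: bij_betw_def)

lemma fenum_sum: "(\<Sum>i = 0..<card U. h (fenum U i)) = sum h U"
 using sum.reindex_bij_betw[OF fenum_bij] .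

lemma fmat_carrier [simp]: "fmat U A \<in> carrier_mat (card U) (card U)"
 by (simp add: fmat_def)

lemma fmat_cong:
 assumes "\<And>x y. x \<in> U ==> y \<in> U ==> A x y = B x y"
 shows "fmat U A = fmat U B"
 unfolding fmat_def by (rule eq_matI) (auto simp: assms fenum_in)

lemma fdet_cong:
 assumes "\<And>x y. x \<in> U ==> y \<in> U ==> A x y = B x y"
 shows "fdet U A = fdet U B"
 using fmat_cong[OF assms] by (simp add: fdet_def)

lemma fmat_fmul: "fmat U (fmul U A B) = fmat U A * fmat U B"
 by (rule eq_matI)
  (auto simp: fmat_def fmul_def scalar_prod_def fenum_sum[symmetric] intro!: sum.cong)

lemma fdet_fmul: "fdet U (fmul U A B) = fdet U A * fdet U B"
 unfolding fdet_def fmat_fmul by (rule det_mult[OF fmat_carrier fmat_carrier])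

lemma fmat_scalar: "fmat U (\<lambda>x y. c * fone x y) = c \<cdot>\<^sub>m 1\<^sub>m (card U)"
 by (rule eq_matI) (auto simp: fmat_def fone_def fenum_eq_iff)

lemma fdet_scalar: "fdet U (\<lambda>x y. c * fone x y) = c ^ card U"
 unfolding fdet_def fmat_scalar by simp

lemma fdet_adj: "\<exists>B. \<forall>x\<in>U. \<forall>y\<in>U. fmul U A B x y = fdet U A * fone x y"
proof -
 let ?n = "card U"
 \<comment> \<open>\<open>h\<close> inverts the enumeration on \<open>U\<close>; it carries the
   adjugate back to a matrix indexed by \<open>U\<close>.\<close>
 define h where "h = inv_into {0..<?n} (fenum U)"
 have h: "h (fenum U i) = i" if "i < ?n" for i
  using fenum_bij that by (auto simp: h_def bij_betw_def)
 define D where "D = adj_mat (fmat U A)"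
 have Dc: "D \<in> carrier_mat ?n ?n" and AD: "fmat U A * D = fdet U A \<cdot>\<^sub>m 1\<^sub>m ?n"
  using adj_mat[OF fmat_carrier, of A] by (auto simp: D_def fdet_def)
 define B where "B = (\<lambda>x y. D $$ (h x, h y))"
 have BD: "fmat U B = D"
  by (rule eq_matI) (use Dc in \<open>auto simp: fmat_def B_def h\<close>)
 have "fmul U A B x y = fdet U A * fone x y" if xy: "x \<in> U" "y \<in> U" for x y
 proof -
  obtain i j where ij: "i < ?n" "j < ?n" "x = fenum U i" "y = fenum U j"
   using fenum_surj xy by metis
  have "fmat U (fmul U A B) = fmat U (\<lambda>x y. fdet U A * fone x y)"
   unfolding fmat_fmul BD AD fmat_scalar ..
  hence "fmat U (fmul U A B) $$ (i,j) = fmat U (\<lambda>x y. fdet U A * fone x y) $$ (i,j)" by simp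
  thus ?thesis using ij by (simp add: fmat_def)
 qed
 thus ?thesis by blast
qed

lemma fdet_in_subring:
 assumes "is_subring R" "\<And>x y. x \<in> U ==> y \<in> U ==> A x y \<in> R"
 shows "fdet U A \<in> R"
proof -
 have s: "signof p \<in> R" for p :: "nat \<Rightarrow> nat"
  using is_subringD[OF assms(1)] by (cases p rule: sign_cases) auto
 have lt: "p i < card U" if "p permutes {0..<card U}" "i < card U" for p i
  using that permutes_in_image[OF that(1), of i] by auto
 show ?thesis
  unfolding fdet_def det_def'[OF fmat_carrier]
  by (intro is_subring_sum is_subring_prod assms(1) is_subringD(6)[OF assms(1)] s)
   (use assms(2) lt in \<open>auto simp: fmat_def fenum_in\<close>)
qed

lemma fdet_diff_in_ideal:
 assumes "is_subring R" "is_ideal R I" "\<And>x y. x \<in> U ==> y \<in> U ==> A x y \<in> R"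
  "\<And>x y. x \<in> U ==> y \<in> U ==> B x y \<in> R"
  "\<And>x y. x \<in> U ==> y \<in> U ==> A x y - B x y \<in> I"
 shows "fdet U A - fdet U B \<in> I"
proof -
 let ?P = "{p. p permutes {0..<card U}}"
 have s: "signof p \<in> R" for p :: "nat \<Rightarrow> nat"
  using is_subringD[OF assms(1)] by (cases p rule: sign_cases) auto
 have lt: "p i < card U" if "p permutes {0..<card U}" "i < card U" for p i
  using that permutes_in_image[OF that(1), of i] by auto
 have "fdet U A - fdet U B = (\<Sum>p\<in>?P. signof p * ((\<Prod>i = 0..<card U. fmat U A $$ (i, p i)) - (\<Prod>i = 0..<card U. fmat U B $$ (i, p i))))"
  unfolding fdet_def det_def'[OF fmat_carrier] by (simp add: sum_subtractf right_diff_distrib)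
 also have "\<dots> \<in> I"
  by (intro is_ideal_sum[OF assms(1,2)] is_idealD(4)[OF assms(1,2)] s prod_diff_in_ideal[OF assms(1,2)])
   (use assms(3-5) lt in \<open>auto simp: fmat_def fenum_in\<close>)
 finally show ?thesis .
qed

lemma fcp_char_poly: "fcp U A = char_poly (fmat U A)"
proof -
 have "fmat U (\<lambda>x y. [:0,1:] * fone x y - [:A x y:]) = char_poly_matrix (fmat U A)"
  by (rule eq_matI) (auto simp: fmat_def fone_def fenum_eq_iff char_poly_matrix_def)
 thus ?thesis by (simp add: fcp_def fdet_def char_poly_def)
qed

lemma fcp_monic: "degree (fcp U A) = card U" "coeff (fcp U A) (card U) = 1"
 using degree_monic_char_poly[OF fmat_carrier, of A] by (auto simp: fcp_char_poly)

lemma fcp_coeff_in_subring: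
 assumes "is_subring R" "\<And>x y. x \<in> U ==> y \<in> U ==> A x y \<in> R"
 shows "coeff (fcp U A) i \<in> R"
proof -
 have "fcp U A \<in> {p. \<forall>i. coeff p i \<in> R}"
  unfolding fcp_def
  by (rule fdet_in_subring[OF is_subring_polys[OF assms(1)]])
   (use assms(2) is_subringD[OF assms(1)] in \<open>auto simp: fone_def coeff_pCons split: nat.splits\<close>)
 thus ?thesis by simp
qed

text \<open>Modulo \<open>I\<close> the matrix vanishes, so its characteristic polynomial is
  congruent to that of the zero matrix, which is \<open>X ^ card U\<close>.\<close>

lemma fcp_coeff_in_ideal:
 assumes "is_subring R" "is_ideal R I" "\<And>x y. x \<in> U ==> y \<in> U ==> A x y \<in> I" "i < card U"
 shows "coeff (fcp U A) i \<in> I"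
proof -
 note R = is_subringD[OF assms(1)] and I = is_idealD[OF assms(1,2)]
 have "fcp U A - fdet U (\<lambda>x y. [:0,1:] * fone x y) \<in> {p. \<forall>i. coeff p i \<in> I}"
  unfolding fcp_def
  by (rule fdet_diff_in_ideal[OF is_subring_polys[OF assms(1)] is_ideal_polys[OF assms(1,2)]])
   (use assms(3) R I in \<open>auto simp: fone_def coeff_pCons split: nat.splits\<close>)
 hence "coeff (fcp U A - [:0,1:] ^ card U) i \<in> I" unfolding fdet_scalar by simp
 moreover have "coeff ([:0,1:] ^ card U :: 'a poly) i = 0"
 proof -
  have "[:0,1:] ^ card U = monom (1::'a) (card U)" by (simp add: monom_altdef)
  thus ?thesis using assms(4) by (simp only: coeff_monom) simp
 qed
 ultimately show ?thesis by simp
qed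

lemma fmul_assoc: "fmul U A (fmul U B C) x y = fmul U (fmul U A B) C x y"
 unfolding fmul_def sum_distrib_left sum_distrib_right
 by (subst sum.swap) (simp add: mult.assoc)

lemma fmul_one_left: "x \<in> U ==> fmul U fone A x y = A x y"
 using fin by (simp add: fmul_def fone_def if_distrib[of "\<lambda>c. c * _"] cong: if_cong)

lemma fmul_one_right: "y \<in> U ==> fmul U A fone x y = A x y"
 using fin by (simp add: fmul_def fone_def if_distrib[of "\<lambda>c. _ * c"] cong: if_cong)

lemma fpow_commute: "x \<in> U ==> y \<in> U ==> fmul U (fpow U A i) A x y = fpow U A (Suc i) x y"
proof (induct i arbitrary: x y)
 case 0 thus ?case by (simp add: fmul_one_left fmul_one_right)
next
 case (Suc i)
 have "fmul U (fpow U A (Suc i)) A x y = fmul U A (fmul U (fpow U A i) A) x y"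
  by (simp add: fmul_assoc)
 also have "\<dots> = fmul U A (fpow U A (Suc i)) x y"
  unfolding fmul_def[of U A] using Suc by (intro sum.cong) auto
 finally show ?case by simp
qed

theorem fcp_cayley_hamilton:
 fixes A :: "'g \<Rightarrow> 'g \<Rightarrow> 'a::comm_ring_1"
 assumes "x \<in> U" "y \<in> U"
 shows "(\<Sum>i\<le>card U. coeff (fcp U A) i * fpow U A i x y) = 0"
proof -
 define C where "C = (\<lambda>x y. [:0,1:] * fone x y - [:A x y:])"
 \<comment> \<open>\<open>B\<close> is the adjugate of \<open>X - A\<close> over the polynomial
   ring.\<close>
 obtain B where B: "\<And>x y. x \<in> U ==> y \<in> U ==> fmul U C B x y = fcp U A * fone x y"
  using fdet_adj[of C] unfolding fcp_def C_def by blast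
 define b where "b i x y = coeff (B x y) i" for i x y
 \<comment> \<open>Comparing coefficients of \<open>X ^ i\<close> expresses each coefficient of the
   characteristic polynomial by two neighbouring coefficient matrices of \<open>B\<close>. After
   multiplication by \<open>A ^ i\<close> the sum over \<open>i\<close> telescopes.\<close>
 have key: "coeff (fcp U A) i * fone x y = (case i of 0 \<Rightarrow> 0 | Suc k \<Rightarrow> b k x y) - fmul U A (b i) x y"
  if "x \<in> U" "y \<in> U" for i x y
 proof -
  have "coeff (fcp U A) i * fone x y = coeff (fmul U C B x y) i"
   using B[OF that] by (simp add: fone_def)
  also have "fmul U C B x y = (\<Sum>z\<in>U. [:0,1:] * (fone x z * B z y)) - (\<Sum>z\<in>U. smult (A x z) (B z y))"
   unfolding fmul_def C_def by (simp add: left_diff_distrib sum_subtractf mult.assoc)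
  also have "(\<Sum>z\<in>U. [:0,1:] * (fone x z * B z y)) = [:0,1:] * fmul U fone B x y"
   by (simp add: fmul_def sum_distrib_left)
  also have "\<dots> = pCons 0 (B x y)" using fmul_one_left[OF that(1), of B y] by simp
  also have "coeff (pCons 0 (B x y) - (\<Sum>z\<in>U. smult (A x z) (B z y))) i
    = (case i of 0 \<Rightarrow> 0 | Suc k \<Rightarrow> b k x y) - fmul U A (b i) x y"
   by (cases i) (auto simp: coeff_sum b_def fmul_def)
  finally show ?thesis .
 qed
 \<comment> \<open>The entries of \<open>B\<close> have bounded degree, so the last term of the
   telescope vanishes.\<close>
 obtain N where N: "\<And>i x y. i \<ge> N ==> x \<in> U ==> y \<in> U ==> b i x y = 0"
 proof
  define N where "N = Suc (Max (insert 0 ((\<lambda>(x,y). degree (B x y)) ` (U \<times> U))))"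
  fix i x y assume "i \<ge> N" "x \<in> U" "y \<in> U"
  moreover have "degree (B x y) \<le> Max (insert 0 ((\<lambda>(x,y). degree (B x y)) ` (U \<times> U)))"
   using fin \<open>x \<in> U\<close> \<open>y \<in> U\<close> by (intro Max_ge) auto
  ultimately show "b i x y = 0" by (auto simp: b_def N_def intro!: coeff_eq_0)
 qed
 define T where "T i = (case i of 0 \<Rightarrow> 0 | Suc k \<Rightarrow> fmul U (fpow U A i) (b k) x y)" for i
 have step: "coeff (fcp U A) i * fpow U A i x y = T i - T (Suc i)" for i
 proof -
  have "coeff (fcp U A) i * fpow U A i x y = fmul U (fpow U A i) (\<lambda>x y. coeff (fcp U A) i * fone x y) x y"
   by (subst fmul_one_right[OF assms(2), of "fpow U A i" x, symmetric])
    (simp add: fmul_def sum_distrib_left mult_ac)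
  also have "\<dots> = fmul U (fpow U A i) (\<lambda>x y. (case i of 0 \<Rightarrow> 0 | Suc k \<Rightarrow> b k x y) - fmul U A (b i) x y) x y"
   unfolding fmul_def[of U "fpow U A i"] using key assms by (intro sum.cong) auto
  also have "\<dots> = fmul U (fpow U A i) (\<lambda>x y. (case i of 0 \<Rightarrow> 0 | Suc k \<Rightarrow> b k x y)) x y
    - fmul U (fpow U A i) (fmul U A (b i)) x y"
   by (simp add: fmul_def[of U "fpow U A i"] right_diff_distrib sum_subtractf)
  also have "fmul U (fpow U A i) (fmul U A (b i)) x y = fmul U (fpow U A (Suc i)) (b i) x y"
  proof -
   have "fmul U (fmul U (fpow U A i) A) (b i) x y = fmul U (fpow U A (Suc i)) (b i) x y"
    unfolding fmul_def[of U _ "b i"]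
    by (rule sum.cong[OF refl]) (simp add: fpow_commute[OF assms(1)] del: fpow.simps)
   thus ?thesis by (simp only: fmul_assoc)
  qed
  also have "fmul U (fpow U A i) (\<lambda>x y. (case i of 0 \<Rightarrow> 0 | Suc k \<Rightarrow> b k x y)) x y = T i"
   unfolding T_def by (cases i) (auto simp: fmul_def)
  finally show ?thesis by (simp add: T_def)
 qed
 let ?M = "N + card U"
 have "(\<Sum>i\<le>card U. coeff (fcp U A) i * fpow U A i x y) = (\<Sum>i<Suc ?M. coeff (fcp U A) i * fpow U A i x y)"
 proof (rule sum.mono_neutral_left)
  have "coeff (fcp U A) i = 0" if "\<not> i \<le> card U" for i
   using that by (intro coeff_eq_0) (simp add: fcp_monic)
  thus "\<forall>i\<in>{..<Suc ?M} - {..card U}. coeff (fcp U A) i * fpow U A i x y = 0" by auto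
 qed auto
 also have "\<dots> = (\<Sum>i<Suc ?M. T i - T (Suc i))" by (simp only: step)
 also have "\<dots> = T 0 - T (Suc ?M)" by (rule sum_lessThan_telescope')
 also have "\<dots> = 0"
 proof -
  have "fmul U Z (b ?M) x y = 0" for Z
   unfolding fmul_def by (rule sum.neutral) (use N assms in auto)
  thus ?thesis by (simp only: T_def nat.case diff_zero)
 qed
 finally show ?thesis .
qed

text \<open>If \<open>g(A) = 0\<close>, then \<open>g(X)\<close> times the identity equals
  \<open>g(X) - g(A)\<close>, a matrix multiple of \<open>X - A\<close>; taking determinants gives
  the divisibility. Over any commutative ring this takes the place of comparing minimal and
  characteristic polynomials.\<close>

lemma fcp_dvd_power:
 fixes A :: "'g \<Rightarrow> 'g \<Rightarrow> 'a::comm_ring_1"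
 assumes "\<And>x y. x \<in> U ==> y \<in> U ==> (\<Sum>i\<le>m. coeff g i * fpow U A i x y) = 0" "degree g \<le> m"
 shows "fcp U A dvd g ^ card U"
proof -
 define C where "C = (\<lambda>x y. [:0,1:] * fone x y - [:A x y:])"
 \<comment> \<open>\<open>R i\<close> is the quotient of \<open>X ^ i - A ^ i\<close> by
   \<open>X - A\<close>.\<close>
 define R where "R i x y = (\<Sum>k<i. [:0,1:] ^ k * [:fpow U A (i - Suc k) x y:])" for i x y
 have CR: "fmul U C (R i) x y = [:0,1:] ^ i * fone x y - [:fpow U A i x y:]"
  if "x \<in> U" "y \<in> U" for i x y
 proof -
  have C: "fmul U C Z x y = [:0,1:] * Z x y - (\<Sum>z\<in>U. [:A x z:] * Z z y)" for Z
  proof -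
   have "fmul U C Z x y = [:0,1:] * fmul U fone Z x y - (\<Sum>z\<in>U. [:A x z:] * Z z y)"
    unfolding fmul_def C_def
    by (simp add: left_diff_distrib sum_subtractf sum_distrib_left mult.assoc)
   thus ?thesis using fmul_one_left[OF that(1)] by simp
  qed
  have pc: "(\<Sum>z\<in>U. [:A x z:] * [:fpow U A k z y:]) = [:fpow U A (Suc k) x y:]" for k
  proof -
   have "(\<Sum>z\<in>Z. [:h z:]) = [:sum h Z:]" for Z and h :: "'g \<Rightarrow> 'a"
    by (induct Z rule: infinite_finite_induct) auto
   thus ?thesis by (simp add: fmul_def mult.commute)
  qed
  have "fmul U C (R i) x y = (\<Sum>k<i. [:0,1:] ^ Suc k * [:fpow U A (i - Suc k) x y:])
    - (\<Sum>k<i. [:0,1:] ^ k * [:fpow U A (i - k) x y:])"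
  proof -
   have "(\<Sum>z\<in>U. [:A x z:] * R i z y) = (\<Sum>k<i. \<Sum>z\<in>U. [:A x z:] * ([:0,1:] ^ k * [:fpow U A (i - Suc k) z y:]))"
    unfolding R_def sum_distrib_left by (rule sum.swap)
   also have "\<dots> = (\<Sum>k<i. [:0,1:] ^ k * (\<Sum>z\<in>U. [:A x z:] * [:fpow U A (i - Suc k) z y:]))"
    unfolding sum_distrib_left by (intro sum.cong refl) (simp only: ac_simps)
   also have "\<dots> = (\<Sum>k<i. [:0,1:] ^ k * [:fpow U A (i - k) x y:])"
    unfolding pc by (intro sum.cong refl) (simp add: Suc_diff_Suc)
   finally show ?thesis
    unfolding C by (simp add: R_def sum_distrib_left mult.assoc)
  qed
  also have "\<dots> = (\<Sum>k<i. (\<lambda>k. [:0,1:] ^ k * [:fpow U A (i - k) x y:]) (Suc k) - (\<lambda>k. [:0,1:] ^ k * [:fpow U A (i - k) x y:]) k)"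
   by (simp only: sum_subtractf)
  also have "\<dots> = [:0,1:] ^ i * [:fpow U A (i - i) x y:] - [:0,1:] ^ 0 * [:fpow U A (i - 0) x y:]"
   by (rule sum_lessThan_telescope)
  finally show ?thesis by (simp add: fone_def one_pCons)
 qed
 define RR where "RR x y = (\<Sum>i\<le>m. [:coeff g i:] * R i x y)" for x y
 have "fmul U C RR x y = g * fone x y" if "x \<in> U" "y \<in> U" for x y
 proof -
  have "fmul U C RR x y = (\<Sum>i\<le>m. [:coeff g i:] * fmul U C (R i) x y)"
   unfolding fmul_def RR_def sum_distrib_left by (subst sum.swap) (intro sum.cong refl, simp only: ac_simps)
  also have "\<dots> = (\<Sum>i\<le>m. [:coeff g i:] * [:0,1:] ^ i) * fone x y - (\<Sum>i\<le>m. [:coeff g i * fpow U A i x y:])"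
  proof -
   have *: "[:coeff g i:] * ([:0,1:] ^ i * fone x y - [:fpow U A i x y:])
     = [:coeff g i:] * [:0,1:] ^ i * fone x y - [:coeff g i * fpow U A i x y:]" for i
    by (simp add: right_diff_distrib)
   show ?thesis unfolding CR[OF that] * sum_subtractf sum_distrib_right ..
  qed
  also have "(\<Sum>i\<le>m. [:coeff g i * fpow U A i x y:]) = [:\<Sum>i\<le>m. coeff g i * fpow U A i x y:]"
   by (induct m) auto
  also have "\<dots> = 0" using assms(1)[OF that] by simp
  also have "(\<Sum>i\<le>m. [:coeff g i:] * [:0,1:] ^ i) = g"
  proof -
   have "g = (\<Sum>i\<le>m. monom (coeff g i) i)"
    using assms(2) by (simp add: poly_as_sum_of_monoms')
   thus ?thesis by (simp add: monom_altdef)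
  qed
  finally show ?thesis by simp
 qed
 hence "fdet U (fmul U C RR) = g ^ card U"
  using fdet_cong[of "fmul U C RR" "\<lambda>x y. g * fone x y"] fdet_scalar[of g] by metis
 hence "g ^ card U = fcp U A * fdet U RR" unfolding fdet_fmul fcp_def C_def by (rule sym)
 thus ?thesis by (rule dvdI)
qed

text \<open>\<open>A\<close> is conjugate to \<open>B\<close> by a monomial matrix: a permutation
  matrix for \<open>p\<close> times the diagonal matrix of \<open>d\<close>. This covers both Galois
  conjugation of the matrix of a left multiplication and a rescaling of the basis.\<close>

lemma fcp_similar:
 fixes A B :: "'g \<Rightarrow> 'g \<Rightarrow> 'a::field"
 assumes bij: "bij_betw p U U" and d: "\<And>x. x \<in> U ==> d x \<noteq> 0"
  and AB: "\<And>x y. x \<in> U ==> y \<in> U ==> A x y = d x * B (p x) (p y) / d y"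
 shows "fcp U A = fcp U B"
proof -
 define P where "P = (\<lambda>x z. if z = p x then [:d x:] else 0)"
 define Q where "Q = (\<lambda>z y. if z = p y then [:1 / d y:] else 0)"
 have pX: "p x \<in> U" if "x \<in> U" for x using bij that by (auto simp: bij_betw_def)
 have pe: "p x = p y \<longleftrightarrow> x = y" if "x \<in> U" "y \<in> U" for x y
  using bij that by (auto simp: bij_betw_def inj_on_def)
 have L: "fmul U P Z x y = [:d x:] * Z (p x) y" if "x \<in> U" for Z x y
  using fin pX[OF that] by (simp add: fmul_def P_def if_distrib[of "\<lambda>c. c * _"] cong: if_cong)
 have R: "fmul U Z Q x y = Z x (p y) * [:1 / d y:]" if "y \<in> U" for Z x y
  using fin pX[OF that] by (simp add: fmul_def Q_def if_distrib[of "\<lambda>c. _ * c"] cong: if_cong)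
 define C where "C A = (\<lambda>x y. [:0,1:] * fone x y - [:A x y:])" for A :: "'g \<Rightarrow> 'g \<Rightarrow> 'a"
 have "fmul U (fmul U P (C B)) Q x y = C A x y" if "x \<in> U" "y \<in> U" for x y
 proof -
  have "[:d x:] * ([:0,1:] * fone (p x) (p y) - [:B (p x) (p y):]) * [:1 / d y:]
    = [:0,1:] * (fone (p x) (p y) * [:d x / d y:]) - [:d x * B (p x) (p y) / d y:]"
   by (simp add: algebra_simps)
  also have "fone (p x) (p y) * [:d x / d y:] = fone x y"
   using d that pe[OF that] by (simp add: fone_def one_pCons)
  finally show ?thesis
   unfolding R[OF that(2)] L[OF that(1)] C_def using AB[OF that] by simp
 qed
 hence "fdet U (C A) = fdet U P * fdet U (C B) * fdet U Q"
  using fdet_cong[of "fmul U (fmul U P (C B)) Q" "C A"] by (simp add: fdet_fmul)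
 moreover have "fmul U P Q x y = 1 * fone x y" if "x \<in> U" "y \<in> U" for x y
  using that pe[OF that] d by (auto simp: R P_def fone_def one_pCons)
 hence "fdet U P * fdet U Q = 1"
  using fdet_cong[of "fmul U P Q" "\<lambda>x y. 1 * fone x y"] fdet_scalar[of 1] by (simp add: fdet_fmul)
 ultimately have "fdet U (C A) = fdet U (C B)" by (simp add: mult.commute mult.left_commute)
 thus ?thesis by (simp add: fcp_def C_def)
qed

lemma fcp_hom:
 assumes "comm_ring_hom h"
 shows "fcp U (\<lambda>x y. h (A x y)) = map_poly h (fcp U A)"
proof -
 interpret comm_ring_hom h by fact
 have "fmat U (\<lambda>x y. h (A x y)) = map_mat h (fmat U A)"
  by (rule eq_matI) (auto simp: fmat_def)
 thus ?thesis unfolding fcp_char_poly using char_poly_hom[OF fmat_carrier] by simp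
qed

end

lemma coeff_prod_linear:
 fixes a :: "'i \<Rightarrow> 'a::comm_ring_1"
 assumes "finite Y" "Y \<noteq> {}"
 shows "coeff (\<Prod>i\<in>Y. [:- a i, 1:]) (card Y - 1) = - sum a Y"
proof -
 have top: "coeff (\<Prod>i\<in>Y. [:- a i, 1:]) (card Y) = 1" if "finite Y" for Y
  using that
 proof (induct Y)
  case (insert y Y)
  have "degree (\<Prod>i\<in>Y. [:- a i, 1:]) \<le> card Y"
   by (rule order.trans[OF degree_prod_sum_le[OF insert(1)]])
    (rule order.trans[OF sum_bounded_above[of _ _ 1]], auto)
  hence "coeff (\<Prod>i\<in>Y. [:- a i, 1:]) (Suc (card Y)) = 0" by (intro coeff_eq_0) auto
  thus ?case using insert by simp
 qed auto
 show ?thesis using assms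
 proof (induct Y rule: finite_ne_induct)
  case (insert y Y)
  then obtain m where m: "card Y = Suc m" by (metis card_0_eq not0_implies_Suc)
  show ?case using insert top[of Y] by (simp add: m)
 qed simp
qed

text \<open>Only the identity permutation contributes to the coefficient below the leading one: any
  other permutation moves some \<open>i\<close> and also \<open>p i\<close>, so at least two factors
  of its product are constants.\<close>

lemma (in -) fcp_trace:
 fixes A :: "'g \<Rightarrow> 'g \<Rightarrow> 'a::comm_ring_1"
 assumes fin: "finite U" and "U \<noteq> {}"
 shows "coeff (fcp U A) (card U - 1) = - (\<Sum>x\<in>U. A x x)"
proof -
 let ?n = "card U" and ?D = "\<lambda>x y. [:0,1:] * fone x y - [:A x y:]"
 let ?P = "{p. p permutes {0..<?n}}"
 have n: "?n > 0" using assms by (simp add: card_gt_0_iff)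
 define h where "h p = signof p * (\<Prod>i = 0..<?n. fmat U ?D $$ (i, p i))" for p
 have z: "coeff (h p) (?n - 1) = 0" if p: "p permutes {0..<?n}" "p \<noteq> id" for p
 proof -
  obtain i where i: "p i \<noteq> i" using p(2) by (auto simp: fun_eq_iff)
  hence i': "i < ?n" using p(1) by (metis atLeastLessThan_iff permutes_not_in zero_le)
  hence pi: "p i < ?n" using permutes_in_image[OF p(1), of i] by auto
  have ppi: "p (p i) \<noteq> p i" using i permutes_inj[OF p(1)] by (auto simp: inj_def)
  have "degree (\<Prod>j = 0..<?n. fmat U ?D $$ (j, p j)) \<le> (\<Sum>j = 0..<?n. degree (fmat U ?D $$ (j, p j)))"
   by (rule order.trans[OF degree_prod_sum_le]) auto
  also have "\<dots> \<le> (\<Sum>j = 0..<?n. if j \<in> {0..<?n} - {i, p i} then 1 else 0)"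
  proof (rule sum_mono)
   fix j assume j: "j \<in> {0..<?n}"
   hence pj: "p j < ?n" using permutes_in_image[OF p(1), of j] by auto
   have "degree (fmat U ?D $$ (j, p j)) = 0" if "p j \<noteq> j"
    using j pj that fenum_eq_iff[OF fin, of j "p j"] by (simp add: fmat_def fone_def)
   moreover have "degree (fmat U ?D $$ (j, p j)) \<le> 1"
    using j pj by (auto simp: fmat_def fone_def)
   ultimately show "degree (fmat U ?D $$ (j, p j)) \<le> (if j \<in> {0..<?n} - {i, p i} then 1 else 0)"
    using i ppi j by (cases "p j = j") auto
  qed
  also have "\<dots> = card ({0..<?n} - {i, p i})"
   by (subst sum.If_cases) (auto intro!: arg_cong[where f = card])
  also have "\<dots> = ?n - 2" using i i' pi by (subst card_Diff_subset) auto
  finally have "degree (\<Prod>j = 0..<?n. fmat U ?D $$ (j, p j)) \<le> ?n - 2" .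
  moreover have "?n \<ge> 2" using i i' pi by linarith
  ultimately have "coeff (\<Prod>j = 0..<?n. fmat U ?D $$ (j, p j)) (?n - 1) = 0"
   by (intro coeff_eq_0) auto
  thus ?thesis by (cases p rule: sign_cases) (auto simp: h_def)
 qed
 have "fcp U A = (\<Sum>p\<in>?P. h p)"
  unfolding fcp_def fdet_def det_def'[OF fmat_carrier[OF fin]] h_def ..
 also have "\<dots> = h id + (\<Sum>p\<in>?P - {id}. h p)"
  by (rule sum.remove) (auto simp: finite_permutations permutes_id)
 finally have "coeff (fcp U A) (?n - 1) = coeff (h id) (?n - 1)"
  using z by (simp add: coeff_sum)
 also have "h id = (\<Prod>i = 0..<?n. (\<lambda>x. [:- A x x, 1:]) (fenum U i))"
  unfolding h_def by (simp, intro prod.cong) (auto simp: fmat_def fone_def)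
 also have "\<dots> = (\<Prod>x\<in>U. [:- A x x, 1:])"
  by (rule prod.reindex_bij_betw[OF fenum_bij[OF fin]])
 also have "coeff \<dots> (?n - 1) = - (\<Sum>x\<in>U. A x x)"
  by (rule coeff_prod_linear) fact+
 finally show ?thesis .
qed

section \<open>The Jacobson radical\<close>

context ring
begin

lemma lidealD:
 assumes "lideal R I"
 shows "x \<in> I ==> x \<in> carrier R" "\<zero> \<in> I" "x \<in> I ==> y \<in> I ==> x \<oplus> y \<in> I"
  "x \<in> I ==> \<ominus> x \<in> I" "r \<in> carrier R ==> x \<in> I ==> r \<otimes> x \<in> I"
  "x \<in> I ==> y \<in> I ==> x \<ominus> y \<in> I"
 using assms by (auto simp: lideal_def a_minus_def)

lemma lideal_one: "lideal R I ==> \<one> \<in> I ==> I = carrier R"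
 using lidealD by (metis (no_types, opaque_lifting) r_one subsetI subset_antisym)

lemma max_lideal_exists:
 assumes "lideal R I" "\<one> \<notin> I"
 shows "\<exists>L. max_lideal R L \<and> I \<subseteq> L"
proof -
 let ?A = "{L. lideal R L \<and> I \<subseteq> L \<and> \<one> \<notin> L}"
 have "\<exists>M\<in>?A. \<forall>Y\<in>?A. M \<subseteq> Y \<longrightarrow> Y = M"
 proof (rule subset_Zorn_nonempty)
  show "?A \<noteq> {}" using assms by auto
  fix C assume C: "C \<noteq> {}" "subset.chain ?A C"
  have mem: "lideal R L" "I \<subseteq> L" "\<one> \<notin> L" if "L \<in> C" for L
   using that C(2) by (auto simp: subset.chain_def)
  have tot: "L \<subseteq> L' \<or> L' \<subseteq> L" if "L \<in> C" "L' \<in> C" for L L'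
   using C(2) that by (auto simp: subset.chain_def)
  have "x \<oplus> y \<in> \<Union>C" if "x \<in> \<Union>C" "y \<in> \<Union>C" for x y
  proof -
   obtain L L' where L: "L \<in> C" "x \<in> L" "L' \<in> C" "y \<in> L'" using \<open>x \<in> \<Union>C\<close> \<open>y \<in> \<Union>C\<close> by auto
   from tot[OF L(1,3)] show ?thesis using L mem lidealD(3) by (metis UnionI subsetD)
  qed
  moreover have "\<zero> \<in> \<Union>C" using C(1) mem lidealD(2) by blast
  moreover have "\<Union>C \<subseteq> carrier R" using mem lidealD(1) by blast
  moreover have "\<ominus> x \<in> \<Union>C" if "x \<in> \<Union>C" for x using that mem lidealD(4) by blast
  moreover have "r \<otimes> x \<in> \<Union>C" if "r \<in> carrier R" "x \<in> \<Union>C" for r x using that mem lidealD(5) by blast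
  ultimately have "lideal R (\<Union>C)" unfolding lideal_def by blast
  thus "\<Union>C \<in> ?A" using mem C(1) by blast
 qed
 then obtain M where M: "lideal R M" "I \<subseteq> M" "\<one> \<notin> M"
  "\<And>L. lideal R L ==> I \<subseteq> L ==> \<one> \<notin> L ==> M \<subseteq> L ==> L = M" by auto
 have "max_lideal R M"
  unfolding max_lideal_def using M lideal_one by (metis one_closed order.trans)
 thus ?thesis using M by blast
qed

lemma lideal_principal:
 assumes "x \<in> carrier R"
 shows "lideal R {r \<otimes> x | r. r \<in> carrier R}"
proof -
 have "\<exists>r. \<zero> = r \<otimes> x \<and> r \<in> carrier R" using assms by (intro exI[of _ \<zero>]) auto
 moreover have "\<exists>r. a \<otimes> x \<oplus> b \<otimes> x = r \<otimes> x \<and> r \<in> carrier R"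
  if "a \<in> carrier R" "b \<in> carrier R" for a b
  using that assms by (intro exI[of _ "a \<oplus> b"]) (auto simp: l_distr)
 moreover have "\<exists>r. \<ominus> (a \<otimes> x) = r \<otimes> x \<and> r \<in> carrier R" if "a \<in> carrier R" for a
  using that assms by (intro exI[of _ "\<ominus> a"]) (auto simp: l_minus)
 moreover have "\<exists>r. b \<otimes> (a \<otimes> x) = r \<otimes> x \<and> r \<in> carrier R"
  if "a \<in> carrier R" "b \<in> carrier R" for a b
  using that assms by (intro exI[of _ "b \<otimes> a"]) (auto simp: m_assoc)
 ultimately show ?thesis using assms unfolding lideal_def by auto
qed

lemma lideal_sum:
 assumes I: "lideal R I" and J: "lideal R J"
 shows "lideal R {a \<oplus> b | a b. a \<in> I \<and> b \<in> J}"
proof -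
 note I = lidealD[OF I] and J = lidealD[OF J]
 have "\<exists>a b. \<zero> = a \<oplus> b \<and> a \<in> I \<and> b \<in> J" using I J by (intro exI[of _ \<zero>]) auto
 moreover have "\<exists>a'' b''. (a \<oplus> b) \<oplus> (a' \<oplus> b') = a'' \<oplus> b'' \<and> a'' \<in> I \<and> b'' \<in> J"
  if "a \<in> I" "b \<in> J" "a' \<in> I" "b' \<in> J" for a b a' b'
  using that I J by (intro exI[of _ "a \<oplus> a'"] exI[of _ "b \<oplus> b'"]) (auto simp: a_ac)
 moreover have "\<exists>a'' b''. \<ominus> (a \<oplus> b) = a'' \<oplus> b'' \<and> a'' \<in> I \<and> b'' \<in> J"
  if "a \<in> I" "b \<in> J" for a b
  using that I J by (intro exI[of _ "\<ominus> a"] exI[of _ "\<ominus> b"]) (auto simp: minus_add)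
 moreover have "\<exists>a'' b''. r \<otimes> (a \<oplus> b) = a'' \<oplus> b'' \<and> a'' \<in> I \<and> b'' \<in> J"
  if "a \<in> I" "b \<in> J" "r \<in> carrier R" for a b r
  using that I J by (intro exI[of _ "r \<otimes> a"] exI[of _ "r \<otimes> b"]) (auto simp: r_distr)
 moreover have "a \<oplus> b \<in> carrier R" if "a \<in> I" "b \<in> J" for a b using that I J by auto
 ultimately show ?thesis unfolding lideal_def by (auto; blast)
qed

text \<open>Were \<open>J\<close> not inside \<open>L\<close>, then \<open>L + J\<close> would be
  everything, and from \<open>1 = a + b\<close> the element \<open>a = 1 - b\<close> of
  \<open>L\<close> would have a left inverse.\<close>

lemma max_lideal_absorbs:
 assumes L: "max_lideal R L" and J: "lideal R J"
  and inv: "\<And>y. y \<in> J ==> \<exists>u\<in>carrier R. u \<otimes> (\<one> \<ominus> y) = \<one>"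
 shows "J \<subseteq> L"
proof (rule ccontr)
 assume n: "\<not> J \<subseteq> L"
 have L': "lideal R L" using L by (simp add: max_lideal_def)
 let ?K = "{a \<oplus> b | a b. a \<in> L \<and> b \<in> J}"
 have "L \<subseteq> ?K" using lidealD(1)[OF L'] lidealD(2)[OF J] by (force intro: exI[of _ \<zero>])
 moreover have "J \<subseteq> ?K" using lidealD(1)[OF J] lidealD(2)[OF L'] by (force intro: exI[of _ \<zero>])
 ultimately have "?K = carrier R"
  using L lideal_sum[OF L' J] n unfolding max_lideal_def by blast
 then obtain a b where ab: "a \<in> L" "b \<in> J" "\<one> = a \<oplus> b" using one_closed by blast
 have c: "a \<in> carrier R" "b \<in> carrier R" using ab lidealD(1) L' J by auto
 have "a = \<one> \<ominus> b" unfolding ab(3) using c by (simp add: a_minus_def a_assoc r_neg)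
 then obtain u where "u \<in> carrier R" "u \<otimes> a = \<one>" using inv[OF ab(2)] by auto
 hence "\<one> \<in> L" using lidealD(5)[OF L'] ab(1) by metis
 thus False using lideal_one[OF L'] L by (simp add: max_lideal_def)
qed

text \<open>If \<open>1 - r y\<close> had no left inverse, it would lie in a maximal left ideal
  together with \<open>y\<close>, which would then contain 1. Membership in a radical thus becomes
  solvability of equations, the form in which every later radical is computed.\<close>

theorem jac_iff:
 "y \<in> jac R \<longleftrightarrow> y \<in> carrier R \<and> (\<forall>r\<in>carrier R. \<exists>u\<in>carrier R. u \<otimes> (\<one> \<ominus> r \<otimes> y) = \<one>)"
proof
 assume y: "y \<in> jac R"
 hence yc: "y \<in> carrier R" and yL: "\<And>L. max_lideal R L ==> y \<in> L" by (auto simp: jac_def)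
 have "\<exists>u\<in>carrier R. u \<otimes> (\<one> \<ominus> r \<otimes> y) = \<one>" if r: "r \<in> carrier R" for r
 proof (rule ccontr)
  assume n: "\<not> ?thesis"
  let ?x = "\<one> \<ominus> r \<otimes> y"
  have x: "?x \<in> carrier R" using r yc by auto
  obtain L where L: "max_lideal R L" "{u \<otimes> ?x | u. u \<in> carrier R} \<subseteq> L"
   using max_lideal_exists[OF lideal_principal[OF x]] n by (auto dest: sym)
  have L': "lideal R L" using L by (simp add: max_lideal_def)
  have "\<one> \<otimes> ?x \<in> L" using L(2) by blast
  hence "?x \<in> L" using x by simp
  moreover have "r \<otimes> y \<in> L" using yL[OF L(1)] r lidealD(5)[OF L'] by auto
  ultimately have "?x \<oplus> r \<otimes> y \<in> L" using lidealD(3)[OF L'] by auto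
  moreover have "?x \<oplus> r \<otimes> y = \<one>" using r yc by (simp add: a_minus_def a_assoc l_neg)
  ultimately show False using lideal_one[OF L'] L(1) by (simp add: max_lideal_def)
 qed
 thus "y \<in> carrier R \<and> (\<forall>r\<in>carrier R. \<exists>u\<in>carrier R. u \<otimes> (\<one> \<ominus> r \<otimes> y) = \<one>)" using yc by auto
next
 assume y: "y \<in> carrier R \<and> (\<forall>r\<in>carrier R. \<exists>u\<in>carrier R. u \<otimes> (\<one> \<ominus> r \<otimes> y) = \<one>)"
 have "y \<in> L" if L: "max_lideal R L" for L
 proof -
  have "{r \<otimes> y | r. r \<in> carrier R} \<subseteq> L"
   by (rule max_lideal_absorbs[OF L lideal_principal]) (use y in auto)
  moreover have "\<one> \<otimes> y \<in> {r \<otimes> y | r. r \<in> carrier R}" by blast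
  ultimately show ?thesis using y by auto
 qed
 thus "y \<in> jac R" using y by (auto simp: jac_def)
qed

lemma jac_lmult: "y \<in> jac R ==> r \<in> carrier R ==> r \<otimes> y \<in> jac R"
 unfolding jac_iff by (auto simp: m_assoc[symmetric])

end

section \<open>Subrings of a field as rings\<close>

lemma subR_simps [simp]:
 "carrier (subR A) = A" "monoid.mult (subR A) = (*)" "monoid.one (subR A) = 1"
 "ring.zero (subR A) = 0" "ring.add (subR A) = (+)"
 by (simp_all add: subR_def Kring_def)

lemma Kring_subR: "Kring = subR UNIV"
 by (simp add: subR_def Kring_def)

lemma cring_subR:
 assumes "is_subring A"
 shows "cring (subR A)"
proof (rule cringI)
 note A = is_subringD[OF assms]
 show "abelian_group (subR A)"
  by (rule abelian_groupI) (auto simp: A intro: bexI[of _ "- x" for x])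
 show "Group.comm_monoid (subR A)"
  by (rule comm_monoidI) (auto simp: A)
qed (simp add: distrib_right)

lemma is_subring_UNIV: "is_subring UNIV"
 by (simp add: is_subring_def)

lemma minus_subR:
 assumes "is_subring A" "x \<in> A"
 shows "\<ominus>\<^bsub>subR A\<^esub> x = - x"
proof -
 interpret cring "subR A" by (rule cring_subR) fact
 show ?thesis using minus_equality[of "- x" x] assms by (auto simp: is_subringD)
qed

lemma diff_subR: "is_subring A ==> x \<in> A ==> y \<in> A ==> x \<ominus>\<^bsub>subR A\<^esub> y = x - y"
 by (simp add: a_minus_def minus_subR)

lemma field_Kring: "field Kring"
 unfolding Kring_subR
proof (rule cring.cring_fieldI[OF cring_subR[OF is_subring_UNIV]])
 show "Units (subR UNIV) = carrier (subR UNIV) - {\<zero>\<^bsub>subR UNIV\<^esub>}"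
  by (auto simp: Units_def) (metis mult.commute right_inverse)
qed

lemma is_subring_of_subring:
 assumes "subring A Kring"
 shows "is_subring A"
proof -
 have m: "\<ominus>\<^bsub>Kring\<^esub> x = - x" for x :: 'a
  using minus_subR[OF is_subring_UNIV, of x] by (simp add: Kring_subR)
 show ?thesis
  unfolding is_subring_def using subringE[OF assms]
  by (auto simp: Kring_subR) (metis (no_types) Kring_subR m diff_conv_add_uminus subR_simps(5))
qed

lemma jac_subR_iff:
 assumes "is_subring A"
 shows "y \<in> jac (subR A) \<longleftrightarrow> y \<in> A \<and> (\<forall>r\<in>A. \<exists>u\<in>A. u * (1 - r * y) = 1)"
proof -
 interpret cring "subR A" by (rule cring_subR) fact
 show ?thesis unfolding jac_iff using assms by (auto simp: diff_subR is_subringD)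
qed

text \<open>Maximality elementwise: outside \<open>M\<close> everything is invertible modulo
  \<open>M\<close>. Witnesses can then be used in calculations; \<open>ismax_iff\<close> identifies
  the notion with \<open>maximalideal\<close>.\<close>

definition ismax :: "'a::field set \<Rightarrow> 'a set \<Rightarrow> bool" where
 "ismax S M \<longleftrightarrow> is_ideal S M \<and> 1 \<notin> M \<and> (\<forall>s\<in>S - M. \<exists>u\<in>S. 1 - u * s \<in> M)"

lemma is_ideal_iff_ideal:
 assumes "is_subring S"
 shows "is_ideal S I \<longleftrightarrow> ideal I (subR S)"
proof
 interpret cring "subR S" by (rule cring_subR) fact
 assume I: "is_ideal S I"
 note I' = is_idealD[OF assms I]
 show "ideal I (subR S)"
 proof (rule idealI)
  show "subgroup I (add_monoid (subR S))"
   by (rule add.subgroupI) (use I' minus_subR[OF assms] in \<open>auto simp: a_inv_def[symmetric]\<close>)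
 qed (use I' ring_axioms in auto)
next
 assume "ideal I (subR S)"
 then interpret ideal I "subR S" .
 have "I \<subseteq> S" using a_subset by simp
 moreover have "0 \<in> I" using additive_subgroup.zero_closed[OF is_additive_subgroup] by simp
 moreover have "x + y \<in> I" if "x \<in> I" "y \<in> I" for x y
  using additive_subgroup.a_closed[OF is_additive_subgroup that] by simp
 moreover have "r * x \<in> I" if "r \<in> S" "x \<in> I" for r x
  using I_l_closed[OF that(2), of r] that(1) by simp
 ultimately show "is_ideal S I" unfolding is_ideal_def by blast
qed

lemma ideal_extend:
 assumes "is_subring S" "is_ideal S I" "s \<in> S"
 shows "is_ideal S {a + u * s | a u. a \<in> I \<and> u \<in> S}"
proof -
 note S = is_subringD[OF assms(1)] and I = is_idealD[OF assms(1,2)]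
 have "\<exists>a u. 0 = a + u * s \<and> a \<in> I \<and> u \<in> S" using S I by (intro exI[of _ 0]) auto
 moreover have "\<exists>a'' u''. (a + u * s) + (a' + u' * s) = a'' + u'' * s \<and> a'' \<in> I \<and> u'' \<in> S"
  if "a \<in> I" "a' \<in> I" "u \<in> S" "u' \<in> S" for a u a' u'
  using that S I by (intro exI[of _ "a + a'"] exI[of _ "u + u'"]) (auto simp: algebra_simps)
 moreover have "\<exists>a'' u''. r * (a + u * s) = a'' + u'' * s \<and> a'' \<in> I \<and> u'' \<in> S"
  if "a \<in> I" "u \<in> S" "r \<in> S" for a u r
  using that S(6) I(4) by (intro exI[of _ "r * a"] exI[of _ "r * u"]) (auto simp: distrib_left mult.assoc)
 moreover have "a + u * s \<in> S" if "a \<in> I" "u \<in> S" for a u using that S I assms(3) by auto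
 ultimately show ?thesis unfolding is_ideal_def by (auto; blast)
qed

lemma ismax_iff:
 assumes S: "is_subring S"
 shows "maximalideal M (subR S) \<longleftrightarrow> ismax S M"
proof
 note S' = is_subringD[OF S]
 interpret cring "subR S" by (rule cring_subR) fact
 assume "maximalideal M (subR S)"
 then interpret maximalideal M "subR S" .
 have M: "is_ideal S M" using is_ideal is_ideal_iff_ideal[OF S] by auto
 note M' = is_idealD[OF S M]
 have "1 \<notin> M" using I_notcarr one_imp_carrier by auto
 moreover have "\<exists>u\<in>S. 1 - u * s \<in> M" if s: "s \<in> S - M" for s
 proof -
  let ?K = "{a + u * s | a u. a \<in> M \<and> u \<in> S}"
  have "ideal ?K (subR S)" using ideal_extend[OF S M] s is_ideal_iff_ideal[OF S] by auto
  moreover have "a = a + 0 * s \<and> a \<in> M \<and> 0 \<in> S" if "a \<in> M" for a using that S' by auto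
  hence "M \<subseteq> ?K" by blast
  moreover have "a + u * s \<in> S" if "a \<in> M" "u \<in> S" for a u
   using S'(5)[OF M'(1)[OF that(1)] S'(6)[OF that(2)]] s by blast
  hence "?K \<subseteq> S" by blast
  moreover have "s = 0 + 1 * s \<and> 0 \<in> M \<and> 1 \<in> S" using S'(1) M'(2) by simp
  hence sK: "s \<in> ?K" by blast
  ultimately have "?K = M \<or> ?K = carrier (subR S)" by (intro I_maximal) simp_all
  hence "?K = S" using sK s by force
  hence "1 \<in> ?K" using S'(1) by simp
  then obtain a u where au: "a \<in> M" "u \<in> S" "a + u * s = 1" by auto
  hence "a = 1 - u * s" by (simp add: eq_diff_eq)
  thus ?thesis using au by blast
 qed
 ultimately show "ismax S M" using M by (auto simp: ismax_def)
next
 assume M: "ismax S M"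
 interpret cring "subR S" by (rule cring_subR) fact
 have i: "is_ideal S M" and 1: "1 \<notin> M" and m: "\<And>s. s \<in> S - M ==> \<exists>u\<in>S. 1 - u * s \<in> M"
  using M by (auto simp: ismax_def)
 show "maximalideal M (subR S)"
 proof (rule maximalidealI)
  show "ideal M (subR S)" using i is_ideal_iff_ideal[OF S] by auto
  show "carrier (subR S) \<noteq> M" using 1 is_subringD[OF S] by auto
  fix J assume J: "ideal J (subR S)" "M \<subseteq> J" "J \<subseteq> carrier (subR S)"
  have J': "is_ideal S J" using J is_ideal_iff_ideal[OF S] by auto
  show "J = M \<or> J = carrier (subR S)"
  proof (rule disjCI)
   assume "J \<noteq> carrier (subR S)"
   hence "1 \<notin> J" using J ideal.one_imp_carrier[OF J(1)] by auto
   have "J \<subseteq> M"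
   proof
    fix s assume s: "s \<in> J"
    show "s \<in> M"
    proof (rule ccontr)
     assume "s \<notin> M"
     then obtain u where u: "u \<in> S" "1 - u * s \<in> M" using m[of s] s is_idealD(1)[OF S J'] by auto
     hence "(1 - u * s) + u * s \<in> J" using J(2) s is_idealD[OF S J'] by blast
     thus False using \<open>1 \<notin> J\<close> by simp
    qed
   qed
   thus "J = M" using J by auto
  qed
 qed
qed

text \<open>In a commutative ring left ideals are ideals, so the Zorn argument for maximal left
  ideals is reused.\<close>

lemma ismax_exists:
 assumes S: "is_subring S" and I: "is_ideal S I" "1 \<notin> I"
 shows "\<exists>M. ismax S M \<and> I \<subseteq> M"
proof -
 interpret cring "subR S" by (rule cring_subR) fact
 have lid: "lideal (subR S) J \<longleftrightarrow> is_ideal S J" for J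
 proof
  assume "lideal (subR S) J"
  thus "is_ideal S J" by (auto simp: lideal_def is_ideal_def)
 next
  assume J: "is_ideal S J"
  show "lideal (subR S) J" unfolding lideal_def
   using is_idealD[OF S J] by (auto simp: minus_subR[OF S])
 qed
 obtain M where M: "max_lideal (subR S) M" "I \<subseteq> M" using max_lideal_exists[of I] I lid by auto
 have Mi: "is_ideal S M" using M lid by (auto simp: max_lideal_def)
 have "maximalideal M (subR S)"
 proof (rule maximalidealI)
  show "ideal M (subR S)" using Mi is_ideal_iff_ideal[OF S] by auto
  show "carrier (subR S) \<noteq> M" using M by (auto simp: max_lideal_def)
  show "J = M \<or> J = carrier (subR S)" if "ideal J (subR S)" "M \<subseteq> J" "J \<subseteq> carrier (subR S)" for J
   using that M lid is_ideal_iff_ideal[OF S] by (auto simp: max_lideal_def)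
 qed
 thus ?thesis using M ismax_iff[OF S] by auto
qed

lemma ismaxD:
 assumes S: "is_subring S" and M: "ismax S M"
 shows "is_ideal S M" "1 \<notin> M" "s \<in> S ==> s \<notin> M ==> \<exists>u\<in>S. 1 - u * s \<in> M"
  "x \<in> M ==> x \<in> S"
  "x \<in> S ==> y \<in> S ==> x * y \<in> M ==> x \<in> M \<or> y \<in> M"
  "x \<in> S ==> 1 - x \<in> M ==> x \<notin> M"
proof -
 show i: "is_ideal S M" and 1: "1 \<notin> M" and m: "\<And>s. s \<in> S ==> s \<notin> M ==> \<exists>u\<in>S. 1 - u * s \<in> M"
  using M by (auto simp: ismax_def)
 note M' = is_idealD[OF S i]
 show "x \<in> M ==> x \<in> S" by (rule M')
 show "x \<in> S ==> 1 - x \<in> M ==> x \<notin> M" using 1 M'(3)[of "1 - x" x] by auto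
 show "x \<in> M \<or> y \<in> M" if xy: "x \<in> S" "y \<in> S" "x * y \<in> M"
 proof (rule disjCI)
  assume "y \<notin> M"
  then obtain u where u: "u \<in> S" "1 - u * y \<in> M" using m xy by auto
  have "x * (1 - u * y) + u * (x * y) \<in> M" using M' u xy by auto
  thus "x \<in> M" by (simp add: algebra_simps)
 qed
qed

lemma ismax_prod:
 assumes S: "is_subring S" and M: "ismax S M" and "finite A" "\<And>i. i \<in> A ==> g i \<in> S" "prod g A \<in> M"
 shows "\<exists>i\<in>A. g i \<in> M"
 using assms(3-5)
proof (induct A)
 case empty thus ?case using ismaxD(2)[OF S M] by auto
next
 case (insert a A)
 have "prod g A \<in> S" by (rule is_subring_prod[OF S]) (use insert in auto)
 hence "g a \<in> M \<or> prod g A \<in> M" using ismaxD(5)[OF S M] insert by auto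
 thus ?case using insert by auto
qed

lemma one_minus_prod_in:
 assumes S: "is_subring S" and I: "is_ideal S I" and "finite A" "\<And>i. i \<in> A ==> g i \<in> S" "\<And>i. i \<in> A ==> 1 - g i \<in> I"
 shows "1 - prod g A \<in> I"
 using prod_diff_in_ideal[OF S I, of A "\<lambda>_. 1" g] assms is_subringD[OF S] by auto

lemma ismax_ne_comaximal:
 assumes S: "is_subring S" and M: "ismax S M" and M': "ismax S M'" and "M \<noteq> M'"
 shows "\<exists>a\<in>M. 1 - a \<in> M'"
proof -
 have "\<not> M \<subseteq> M'"
 proof
  assume sub: "M \<subseteq> M'"
  then obtain s where s: "s \<in> M'" "s \<notin> M" using \<open>M \<noteq> M'\<close> by auto
  then obtain u where u: "u \<in> S" "1 - u * s \<in> M"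
   using ismaxD(3)[OF S M] ismaxD(4)[OF S M'] by blast
  have "(1 - u * s) + u * s \<in> M'"
   using u s sub is_idealD[OF S ismaxD(1)[OF S M']] by blast
  thus False using ismaxD(2)[OF S M'] by simp
 qed
 then obtain s where s: "s \<in> M" "s \<notin> M'" by auto
 then obtain u where u: "u \<in> S" "1 - u * s \<in> M'" using ismaxD(3,4)[OF S] M M' by metis
 thus ?thesis using s is_idealD(4)[OF S ismaxD(1)[OF S M]] by blast
qed

section \<open>Valuation rings\<close>

definition is_val :: "'a::field set \<Rightarrow> bool" where
 "is_val R \<longleftrightarrow> is_subring R \<and> (\<forall>x. x \<noteq> 0 \<longrightarrow> x \<in> R \<or> inverse x \<in> R)"

text \<open>The maximal ideal of a valuation ring. Zero is listed separately because
  \<open>inverse 0 = 0\<close> does lie in \<open>R\<close>. The set is also formed for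
  \<open>V\<close>, which is a valuation ring of \<open>F\<close> but in general not of the ambient
  field.\<close>

definition nonunits :: "'a::field set \<Rightarrow> 'a set" where
 "nonunits R = {x\<in>R. x = 0 \<or> inverse x \<notin> R}"

text \<open>Comparability is only asked for on \<open>C\<close>: with \<open>C\<close> inside
  \<open>F\<close> the lemma also serves for \<open>V\<close>.\<close>

lemma finite_val_max:
 fixes R :: "'a::field set"
 assumes R: "is_subring R" and "finite C" "C \<noteq> {}" "0 \<notin> C"
  and tot: "\<And>x y. x \<in> C ==> y \<in> C ==> x / y \<in> R \<or> y / x \<in> R"
 shows "\<exists>c\<in>C. \<forall>x\<in>C. x / c \<in> R"
 using assms(2-5)
proof (induct C rule: finite_ne_induct)
 case (singleton x) thus ?case using is_subringD[OF R] by auto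
next
 case (insert y C)
 then obtain c where c: "c \<in> C" "\<And>x. x \<in> C ==> x / c \<in> R" by auto
 have nz: "c \<noteq> 0" "y \<noteq> 0" using insert c by auto
 consider "y / c \<in> R" | "c / y \<in> R" using insert(6)[of y c] c by auto
 thus ?case
 proof cases
  case 1 thus ?thesis using c by auto
 next
  case 2
  have "x / y \<in> R" if "x \<in> C" for x
  proof -
   have "x / y = (x / c) * (c / y)" using nz by (simp add: field_simps)
   thus ?thesis using c(2)[OF that] 2 is_subringD(6)[OF R] by metis
  qed
  moreover have "y / y \<in> R" using nz is_subringD[OF R] by simp
  ultimately show ?thesis by auto
 qed
qed

context
 fixes R :: "'a::field set"
 assumes R: "is_val R"
begin

lemma val_subring: "is_subring R" using R by (simp add: is_val_def)

lemma val_total: "x / y \<in> R \<or> y / x \<in> R"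
proof (cases "x / y = 0")
 case False thus ?thesis using R unfolding is_val_def by (metis inverse_divide)
next
 case True thus ?thesis using is_subringD[OF val_subring] by metis
qed

lemma nonunits_add:
 assumes "x \<in> nonunits R" "y \<in> nonunits R"
 shows "x + y \<in> nonunits R"
proof -
 note R' = is_subringD[OF val_subring]
 have gen: "x + y \<in> nonunits R" if "x \<in> nonunits R" "y \<in> nonunits R" "x / y \<in> R" "y \<noteq> 0" for x y
 proof -
  have R1: "x \<in> R" "y \<in> R" using that by (auto simp: nonunits_def)
  have "inverse (x + y) \<notin> R" if "x + y \<noteq> 0"
  proof
   assume "inverse (x + y) \<in> R"
   moreover have "inverse y = inverse (x + y) * (x / y + 1)"
    using \<open>y \<noteq> 0\<close> that by (simp add: field_simps)
   ultimately have "inverse y \<in> R" using R' \<open>x / y \<in> R\<close> by metis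
   thus False using \<open>y \<in> nonunits R\<close> \<open>y \<noteq> 0\<close> by (auto simp: nonunits_def)
  qed
  thus ?thesis using R' R1 by (auto simp: nonunits_def)
 qed
 consider "x = 0" | "y = 0" | "x \<noteq> 0" "y \<noteq> 0" "x / y \<in> R" | "x \<noteq> 0" "y \<noteq> 0" "y / x \<in> R"
  using val_total by metis
 thus ?thesis
 proof cases
  case 3 thus ?thesis using gen assms by blast
 next
  case 4 thus ?thesis using gen[of y x] assms by (simp add: add.commute)
 qed (use assms in auto)
qed

lemma nonunits_mult:
 assumes "r \<in> R" "x \<in> nonunits R"
 shows "r * x \<in> nonunits R"
proof -
 note R' = is_subringD[OF val_subring]
 have "inverse (r * x) \<notin> R" if "r * x \<noteq> 0"
 proof
  assume "inverse (r * x) \<in> R"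
  hence "r * inverse (r * x) \<in> R" using R'(6) assms(1) by blast
  moreover have "r * inverse (r * x) = inverse x" using that by simp
  ultimately show False using that assms(2) unfolding nonunits_def
   by (metis (mono_tags, lifting) mem_Collect_eq mult_zero_right)
 qed
 moreover have "r * x \<in> R" using assms R'(6) unfolding nonunits_def by blast
 ultimately show ?thesis unfolding nonunits_def by blast
qed

lemma nonunits_ideal: "is_ideal R (nonunits R)"
 unfolding is_ideal_def
 using nonunits_add nonunits_mult is_subringD[OF val_subring] by (auto simp: nonunits_def)

lemma one_notin_nonunits: "1 \<notin> nonunits R"
 using is_subringD[OF val_subring] by (auto simp: nonunits_def)

lemma unit_inverse: "x \<in> R ==> x \<notin> nonunits R ==> x \<noteq> 0 \<and> inverse x \<in> R"
 by (auto simp: nonunits_def)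

lemma notin_val: "x \<notin> R ==> x \<noteq> 0 \<and> inverse x \<in> nonunits R"
proof -
 assume x: "x \<notin> R"
 hence "x \<noteq> 0" using is_subringD(2)[OF val_subring] by blast
 moreover from this have "inverse x \<in> R" using R x unfolding is_val_def by blast
 ultimately show ?thesis using x unfolding nonunits_def by simp
qed

lemma not_div_nonunits:
 assumes "x / y \<notin> R"
 shows "x \<noteq> 0 \<and> y \<noteq> 0 \<and> y / x \<in> nonunits R"
 using notin_val[OF assms] by auto

end

lemma nonunits_one_minus:
 assumes R: "is_val R" and x: "x \<in> nonunits R"
 shows "1 - x \<in> R" "1 - x \<notin> nonunits R"
proof -
 show "1 - x \<in> R" using x is_subringD[OF val_subring[OF R]] by (auto simp: nonunits_def)
 show "1 - x \<notin> nonunits R"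
  using nonunits_add[OF R x, of "1 - x"] one_notin_nonunits[OF R] by auto
qed

text \<open>Compare the lowest coefficient of minimal value of each factor: their product is a
  coefficient of the product that is not a multiple of a nonunit.\<close>
lemma monic_factor_of_power_mod_nonunits:
 assumes R: "is_val R" and p: "lead_coeff p = 1" and q: "lead_coeff q = 1"
  and pq: "\<And>i. i < degree p + degree q ==> coeff (p * q) i \<in> nonunits R"
  and i: "i < degree p"
 shows "coeff p i \<in> nonunits R"
proof -
 note R' = is_subringD[OF val_subring[OF R]] and N = is_idealD[OF val_subring[OF R] nonunits_ideal[OF R]]
 \<comment> \<open>For a monic polynomial let \<open>k\<close> be the lowest index at which the
   coefficient has minimal value. The inverse of that coefficient is integral because the leading
   coefficient 1 is a multiple of it.\<close>
 have low: "\<exists>k c. k \<le> degree p \<and> coeff p k = c \<and> c \<noteq> 0 \<and> (\<forall>i. coeff p i / c \<in> R) \<and>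
   (\<forall>i<k. coeff p i / c \<in> nonunits R) \<and> inverse c \<in> R" if p: "lead_coeff p = 1" for p
 proof -
  let ?C = "{coeff p i | i. coeff p i \<noteq> 0}"
  have fin: "finite ?C"
  proof (rule finite_subset[of _ "coeff p ` {..degree p}"])
   show "?C \<subseteq> coeff p ` {..degree p}" by (auto simp: le_degree)
  qed auto
  have "1 \<in> ?C" using p by (auto intro: exI[of _ "degree p"])
  hence "?C \<noteq> {}" by blast
  then obtain c where c: "c \<in> ?C" "\<And>x. x \<in> ?C ==> x / c \<in> R"
   using finite_val_max[OF val_subring[OF R] fin] val_total[OF R] by auto
  have cn0: "c \<noteq> 0" using c by auto
  have all: "coeff p i / c \<in> R" for i using c(2)[of "coeff p i"] R' by (cases "coeff p i = 0") auto
  let ?P = "\<lambda>k. coeff p k \<noteq> 0 \<and> c / coeff p k \<in> R"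
  define k where "k = (LEAST k. ?P k)"
  have ex: "\<exists>k. ?P k" using c(1) cn0 R' by auto
  have k: "?P k" unfolding k_def using ex by (rule LeastI_ex)
  have lt: "\<not> ?P i" if "i < k" for i using that not_less_Least unfolding k_def by blast
  let ?c = "coeff p k"
  have all': "coeff p i / ?c \<in> R" for i
  proof -
   have "coeff p i / ?c = (coeff p i / c) * (c / ?c)" using cn0 by simp
   thus ?thesis using all k R' by metis
  qed
  have "coeff p i / ?c \<in> nonunits R" if "i < k" for i
  proof -
   have "c / coeff p i \<notin> R" if "coeff p i \<noteq> 0" using lt[OF \<open>i < k\<close>] that by auto
   moreover have "c / coeff p i = (c / ?c) * (?c / coeff p i)" using k by simp
   ultimately have "?c / coeff p i \<notin> R" if "coeff p i \<noteq> 0" using that k R' by metis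
   thus ?thesis using all'[of i] unfolding nonunits_def by (auto simp: inverse_divide)
  qed
  moreover have "k \<le> degree p" using k by (auto intro: le_degree)
  moreover have "inverse ?c \<in> R" using all'[of "degree p"] p by (simp add: field_simps)
  ultimately show ?thesis using k all' by auto
 qed
 obtain k c where k: "k \<le> degree p" "coeff p k = c" "c \<noteq> 0" "\<And>i. coeff p i / c \<in> R"
  "\<And>i. i < k ==> coeff p i / c \<in> nonunits R" "inverse c \<in> R" using low[OF p] by blast
 obtain l d where l: "l \<le> degree q" "coeff q l = d" "d \<noteq> 0" "\<And>i. coeff q i / d \<in> R"
  "\<And>i. i < l ==> coeff q i / d \<in> nonunits R" "inverse d \<in> R" using low[OF q] by blast
 \<comment> \<open>Every term of this convolution other than the one at \<open>i = k\<close>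
   contains a non-unit factor, so the quotient is a unit. By hypothesis \<open>k + l\<close> must
   then be the top degree, hence \<open>k = degree p\<close> and \<open>c = 1\<close>.\<close>
 have "coeff (p * q) (k + l) / (c * d) = (\<Sum>i\<le>k+l. (coeff p i / c) * (coeff q (k + l - i) / d))"
  by (simp add: coeff_mult sum_divide_distrib)
 also have "\<dots> = 1 + (\<Sum>i\<in>{..k+l} - {k}. (coeff p i / c) * (coeff q (k + l - i) / d))"
  using k l by (subst sum.remove[of _ k]) auto
 also have "\<dots> = 1 - (- (\<Sum>i\<in>{..k+l} - {k}. (coeff p i / c) * (coeff q (k + l - i) / d)))" by simp
 finally have e: "coeff (p * q) (k + l) / (c * d) = 1 - (- (\<Sum>i\<in>{..k+l} - {k}. (coeff p i / c) * (coeff q (k + l - i) / d)))" .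
 have "(coeff p i / c) * (coeff q (k + l - i) / d) \<in> nonunits R" if "i \<in> {..k+l} - {k}" for i
 proof (cases "i < k")
  case True thus ?thesis using k(5) l(4) N by blast
 next
  case False
  hence "k + l - i < l" using that by auto
  thus ?thesis using k(4) l(5) N by blast
 qed
 hence "- (\<Sum>i\<in>{..k+l} - {k}. (coeff p i / c) * (coeff q (k + l - i) / d)) \<in> nonunits R"
  by (intro N(6) is_ideal_sum[OF val_subring[OF R] nonunits_ideal[OF R]])
 hence nu: "coeff (p * q) (k + l) / (c * d) \<notin> nonunits R" unfolding e by (rule nonunits_one_minus[OF R])
 have "\<not> k + l < degree p + degree q"
 proof
  assume "k + l < degree p + degree q"
  hence "coeff (p * q) (k + l) * (inverse c * inverse d) \<in> nonunits R"
   by (intro N(5)[OF R'(6)[OF k(6) l(6)] pq])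
  thus False using nu by (simp add: field_simps)
 qed
 hence "k = degree p" using k(1) l(1) by auto
 thus ?thesis using k(2,5) p i by auto
qed

section \<open>Integral closure in a Galois extension\<close>

locale galois_ext =
 fixes F :: "'k::field set"
 assumes galois: "finite_galois F"
begin

abbreviation G where "G \<equiv> gal F"

lemma finite_G [simp]: "finite G" using galois by (simp add: finite_galois_def)

lemma fixed_in_F: "(\<And>si. si \<in> G ==> si x = x) ==> x \<in> F"
 using galois by (auto simp: finite_galois_def)

lemma F_subring: "is_subring F"
 using galois is_subring_of_subring subfieldE(1) unfolding finite_galois_def by blast

lemma gal_simps:
 assumes "si \<in> G"
 shows "si 0 = 0" "si 1 = 1" "si (x + y) = si x + si y" "si (x * y) = si x * si y"
  "si (- x) = - si x" "si (x - y) = si x - si y" "si x = 0 \<longleftrightarrow> x = 0"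
  "si (inverse x) = inverse (si x)" "si (x / y) = si x / si y" "si (x ^ n) = si x ^ n"
  "si x = si y \<longleftrightarrow> x = y" "c \<in> F ==> si c = c"
proof -
 have b: "bij si" and a: "\<And>x y. si (x + y) = si x + si y" and m: "\<And>x y. si (x * y) = si x * si y" and o: "si 1 = 1"
  and "c \<in> F ==> si c = c" for c
  using assms by (auto simp: gal_def)
 show "si 1 = 1" "si (x + y) = si x + si y" "si (x * y) = si x * si y" "c \<in> F ==> si c = c" by fact+
 show z: "si 0 = 0" using a[of 0 0] by (metis add_0 add_cancel_right_right)
 show inj: "si x = si y \<longleftrightarrow> x = y" for x y using b by (auto simp: bij_def inj_def)
 show "si x = 0 \<longleftrightarrow> x = 0" using inj[of x 0] z by simp
 show n: "si (- x) = - si x" for x using a[of x "- x"] z by (simp add: minus_unique)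
 show "si (x - y) = si x - si y" using a[of x "- y"] n by simp
 show i: "si (inverse x) = inverse (si x)" for x
 proof (cases "x = 0")
  case False
  hence "si x * si (inverse x) = 1" using m[of x "inverse x"] o by simp
  thus ?thesis by (metis inverse_unique)
 qed (simp add: z)
 show "si (x / y) = si x / si y" by (simp add: divide_inverse m i)
 show "si (x ^ n) = si x ^ n" by (induct n) (auto simp: o m)
qed

lemma gal_sum:
 assumes "si \<in> G" shows "si (sum g A) = (\<Sum>i\<in>A. si (g i))"
 by (induct A rule: infinite_finite_induct) (auto simp: gal_simps[OF assms])

lemma gal_prod:
 assumes "si \<in> G" shows "si (prod g A) = (\<Prod>i\<in>A. si (g i))"
 by (induct A rule: infinite_finite_induct) (auto simp: gal_simps[OF assms])

lemma gal_hom: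
 assumes "si \<in> G" shows "comm_ring_hom si"
 by unfold_locales (simp_all add: gal_simps[OF assms])

lemma gal_bij: "si \<in> G ==> bij si" by (simp add: gal_def)

lemma id_in_G [simp]: "id \<in> G" by (simp add: gal_def)

lemma comp_in_G [simp]: "si \<in> G ==> tu \<in> G ==> si \<circ> tu \<in> G"
 by (auto simp: gal_def bij_comp)

lemma inv_app:
 assumes "si \<in> G"
 shows "inv_into UNIV si (si x) = x" "si (inv_into UNIV si x) = x"
 using gal_bij[OF assms] by (auto simp: bij_def surj_f_inv_f)

lemma inv_in_G [simp]:
 assumes s: "si \<in> G" shows "inv_into UNIV si \<in> G"
proof -
 note [simp] = gal_simps[OF s] inv_app[OF s]
 have i: "inv_into UNIV si x = y" if "si y = x" for x y using that by auto
 have "bij (inv_into UNIV si)" using gal_bij[OF s] by (rule bij_imp_bij_inv)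
 moreover have "inv_into UNIV si (x + y) = inv_into UNIV si x + inv_into UNIV si y" for x y
  by (rule i) (simp add: s)
 moreover have "inv_into UNIV si (x * y) = inv_into UNIV si x * inv_into UNIV si y" for x y
  by (rule i) (simp add: s)
 moreover have "inv_into UNIV si 1 = 1" by (rule i) (simp add: s)
 moreover have "inv_into UNIV si x = x" if "x \<in> F" for x by (rule i) (simp add: s that)
 ultimately show ?thesis by (simp add: gal_def)
qed

lemma inv_comp [simp]:
 assumes "si \<in> G"
 shows "inv_into UNIV si \<circ> si = id" "si \<circ> inv_into UNIV si = id"
  "inv_into UNIV si \<circ> (si \<circ> tu) = tu" "si \<circ> (inv_into UNIV si \<circ> tu) = tu"
 using inv_app[OF assms] by (auto simp: fun_eq_iff)

lemma inv_inv [simp]: "si \<in> G ==> inv_into UNIV (inv_into UNIV si) = si"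
 by (simp add: gal_bij inv_inv_eq)

lemma inv_of_comp [simp]:
 "si \<in> G ==> tu \<in> G ==> inv_into UNIV (si \<circ> tu) = inv_into UNIV tu \<circ> inv_into UNIV si"
 by (simp add: gal_bij o_inv_distrib)

lemma bij_left: "tu \<in> G ==> bij_betw (\<lambda>si. tu \<circ> si) G G"
 by (rule bij_betw_byWitness[where f' = "\<lambda>si. inv_into UNIV tu \<circ> si"]) auto

lemma bij_right: "tu \<in> G ==> bij_betw (\<lambda>si. si \<circ> tu) G G"
 by (rule bij_betw_byWitness[where f' = "\<lambda>si. si \<circ> inv_into UNIV tu"]) (auto simp: comp_assoc)

lemma bij_inv: "bij_betw (inv_into UNIV) G G"
 by (rule bij_betw_byWitness[where f' = "inv_into UNIV"]) auto

definition Tr :: "'k \<Rightarrow> 'k" where "Tr x = (\<Sum>si\<in>G. si x)"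

lemma Tr_gal: "tu \<in> G ==> Tr (tu x) = Tr x"
 unfolding Tr_def using sum.reindex_bij_betw[OF bij_right, of tu "\<lambda>si. si x"] by simp

lemma Tr_in_F: "Tr x \<in> F"
proof (rule fixed_in_F)
 fix tu assume t: "tu \<in> G"
 show "tu (Tr x) = Tr x"
  unfolding Tr_def gal_sum[OF t] using sum.reindex_bij_betw[OF bij_left[OF t], of "\<lambda>si. si x"] by simp
qed

lemma Tr_diff: "Tr (x - y) = Tr x - Tr y"
 unfolding Tr_def by (simp add: sum_subtractf[symmetric] gal_simps)

definition conj_poly :: "'k \<Rightarrow> 'k poly" where
 "conj_poly x = (\<Prod>si\<in>G. [:- si x, 1:])"

lemma G_nonempty: "G \<noteq> {}" using id_in_G by blast

lemma card_G_pos: "card G > 0" using G_nonempty by (simp add: card_gt_0_iff)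

text \<open>An automorphism permutes the factors, so it fixes the product coefficientwise.\<close>

lemma map_poly_prod_fixed:
 assumes "\<And>tu si. tu \<in> G ==> si \<in> G ==> map_poly tu (P si) = P (tu \<circ> si)"
 shows "coeff (\<Prod>si\<in>G. P si) i \<in> F"
proof (rule fixed_in_F)
 fix tu assume t: "tu \<in> G"
 interpret h: comm_ring_hom tu by (rule gal_hom[OF t])
 interpret m: map_poly_comm_ring_hom tu ..
 have "map_poly tu (\<Prod>si\<in>G. P si) = (\<Prod>si\<in>G. map_poly tu (P si))" by (rule m.hom_prod)
 also have "\<dots> = (\<Prod>si\<in>G. P (tu \<circ> si))" using assms t by (intro prod.cong) auto
 also have "\<dots> = (\<Prod>si\<in>G. P si)" by (rule prod.reindex_bij_betw[OF bij_left[OF t]])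
 finally have "map_poly tu (\<Prod>si\<in>G. P si) = (\<Prod>si\<in>G. P si)" .
 thus "tu (coeff (\<Prod>si\<in>G. P si) i) = coeff (\<Prod>si\<in>G. P si) i"
  by (metis coeff_map_poly h.hom_zero)
qed

lemma conj_poly_props:
 "coeff (conj_poly x) i \<in> F" "degree (conj_poly x) = card G" "lead_coeff (conj_poly x) = 1"
 "poly (conj_poly x) x = 0"
proof -
 show "coeff (conj_poly x) i \<in> F"
  unfolding conj_poly_def by (rule map_poly_prod_fixed) (simp add: map_poly_pCons gal_simps)
 show "degree (conj_poly x) = card G"
  unfolding conj_poly_def by (subst degree_prod_eq_sum_degree) auto
 show "lead_coeff (conj_poly x) = 1" unfolding conj_poly_def by (simp add: lead_coeff_prod)
 have "poly (conj_poly x) x = (\<Prod>si\<in>G. x - si x)" unfolding conj_poly_def by (simp add: poly_prod)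
 also have "\<dots> = 0" by (rule prod_zero) (auto intro: bexI[OF _ id_in_G])
 finally show "poly (conj_poly x) x = 0" .
qed

end

section \<open>The integral closure is a ring\<close>

lemma poly_monic_split:
 fixes p :: "'a::comm_ring_1 poly"
 assumes "lead_coeff p = 1" "degree p = n"
 shows "poly p x = x ^ n + (\<Sum>i<n. coeff p i * x ^ i)"
 using assms by (simp add: poly_altdef lessThan_Suc_atMost[symmetric] add.commute)

text \<open>The determinant trick: \<open>w\<close> is a left eigenvector of \<open>A\<close> with
  eigenvalue \<open>z\<close>. Hence \<open>w\<close> times the characteristic polynomial evaluated
  at \<open>A\<close>, which is zero, equals its value at \<open>z\<close> times \<open>w\<close>,
  and the nonzero entry \<open>w u0\<close> cancels.\<close>

lemma int_closure_det:
 fixes w :: "'g \<Rightarrow> 'k::field"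
 assumes V: "is_subring V" and U: "finite U" "u0 \<in> U" "w u0 \<noteq> 0"
  and A: "\<And>x y. x \<in> U ==> y \<in> U ==> A x y \<in> V"
  and z: "\<And>y. y \<in> U ==> z * w y = (\<Sum>x\<in>U. w x * A x y)"
 shows "z \<in> int_closure V"
proof -
 have pw: "(\<Sum>x\<in>U. w x * fpow U A i x y) = z ^ i * w y" if "y \<in> U" for i y
  using that
 proof (induct i)
  case 0
  thus ?case using fmul_one_right[OF U(1) 0, of "\<lambda>_. w"] by (simp add: fmul_def)
 next
  case (Suc i)
  have "(\<Sum>x\<in>U. w x * fpow U A (Suc i) x y) = (\<Sum>u\<in>U. (\<Sum>x\<in>U. w x * A x u) * fpow U A i u y)"
   by (simp add: fmul_def sum_distrib_left sum_distrib_right mult.assoc) (rule sum.swap)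
  also have "\<dots> = (\<Sum>u\<in>U. z * (w u * fpow U A i u y))"
   by (rule sum.cong) (auto simp: z[symmetric])
  also have "\<dots> = z * (z ^ i * w y)" using Suc by (simp add: sum_distrib_left[symmetric])
  finally show ?case by simp
 qed
 let ?n = "card U" and ?c = "coeff (fcp U A)"
 have "(\<Sum>i\<le>?n. ?c i * (\<Sum>x\<in>U. w x * fpow U A i x u0)) = (\<Sum>x\<in>U. w x * (\<Sum>i\<le>?n. ?c i * fpow U A i x u0))"
  unfolding sum_distrib_left by (subst sum.swap) (simp add: mult_ac)
 also have "\<dots> = 0" using fcp_cayley_hamilton[OF U(1) _ U(2), of _ A] by simp
 finally have "(\<Sum>i\<le>?n. ?c i * z ^ i) * w u0 = 0"
  by (simp add: pw[OF U(2)] sum_distrib_right mult.assoc)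
 hence "(\<Sum>i\<le>?n. ?c i * z ^ i) = 0" using U(3) by simp
 hence "z ^ ?n + (\<Sum>i<?n. ?c i * z ^ i) = 0"
  using fcp_monic[OF U(1), of A] by (simp add: lessThan_Suc_atMost[symmetric] add.commute)
 moreover have "?c i \<in> V" for i by (rule fcp_coeff_in_subring[OF U(1) V A])
 ultimately show ?thesis unfolding int_closure_def by blast
qed

lemma int_closure_subring:
 fixes V :: "'k::field set"
 assumes V: "is_subring V"
 shows "is_subring (int_closure V)"
proof -
 note V' = is_subringD[OF V]
 have gen: "x - y \<in> int_closure V \<and> x * y \<in> int_closure V"
  if x: "x \<in> int_closure V" and y: "y \<in> int_closure V" for x y
 proof -
  obtain m c where c: "\<And>i. i < m ==> c i \<in> V" "x ^ m + (\<Sum>i<m. c i * x ^ i) = 0"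
   using x by (auto simp: int_closure_def)
  obtain n d where d: "\<And>i. i < n ==> d i \<in> V" "y ^ n + (\<Sum>i<n. d i * y ^ i) = 0"
   using y by (auto simp: int_closure_def)
  have m: "m > 0" using c(2) by (cases m) auto
  have n: "n > 0" using d(2) by (cases n) auto
  define U where "U = {..<m} \<times> {..<n}"
  define w where "w = (\<lambda>(i,j). x ^ i * y ^ j)"
  \<comment> \<open>\<open>ok z\<close> says that multiplication by \<open>z\<close> maps the
    \<open>V\<close>-span of the monomials \<open>x ^ i * y ^ j\<close> with \<open>i < m\<close>
    and \<open>j < n\<close> into itself. Such \<open>z\<close> are integral by the determinant
    trick.\<close>
  define ok where "ok z \<longleftrightarrow> (\<exists>A. (\<forall>u\<in>U. \<forall>v\<in>U. A u v \<in> V) \<and> (\<forall>v\<in>U. z * w v = (\<Sum>u\<in>U. w u * A u v)))" for z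
  have U: "finite U" "(0,0) \<in> U" "w (0,0) \<noteq> 0" using m n by (auto simp: U_def w_def)
  have okS: "z \<in> int_closure V" if "ok z" for z
   using that int_closure_det[where w = w, OF V U] unfolding ok_def by metis
  have ok_diff: "ok (z - z')" if z: "ok z" "ok z'" for z z'
  proof -
   obtain A where A: "\<And>u v. u \<in> U ==> v \<in> U ==> A u v \<in> V" "\<And>v. v \<in> U ==> z * w v = (\<Sum>u\<in>U. w u * A u v)"
    using z(1) unfolding ok_def by blast
   obtain B where B: "\<And>u v. u \<in> U ==> v \<in> U ==> B u v \<in> V" "\<And>v. v \<in> U ==> z' * w v = (\<Sum>u\<in>U. w u * B u v)"
    using z(2) unfolding ok_def by blast
   show ?thesis unfolding ok_def
    by (rule exI[of _ "\<lambda>u v. A u v - B u v"])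
     (use A B V' in \<open>auto simp: left_diff_distrib right_diff_distrib sum_subtractf\<close>)
  qed
  have ok_mult: "ok (z * z')" if z: "ok z" "ok z'" for z z'
  proof -
   obtain A where A: "\<And>u v. u \<in> U ==> v \<in> U ==> A u v \<in> V" "\<And>v. v \<in> U ==> z * w v = (\<Sum>u\<in>U. w u * A u v)"
    using z(1) unfolding ok_def by blast
   obtain B where B: "\<And>u v. u \<in> U ==> v \<in> U ==> B u v \<in> V" "\<And>v. v \<in> U ==> z' * w v = (\<Sum>u\<in>U. w u * B u v)"
    using z(2) unfolding ok_def by blast
   have "z * z' * w v = (\<Sum>u\<in>U. w u * fmul U A B u v)" if v: "v \<in> U" for v
   proof -
    have "z * z' * w v = (\<Sum>u\<in>U. (z * w u) * B u v)"
     using B(2)[OF v] by (simp add: mult.assoc sum_distrib_left)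
    also have "\<dots> = (\<Sum>u\<in>U. (\<Sum>t\<in>U. w t * A t u) * B u v)" using A(2) by (intro sum.cong) auto
    also have "\<dots> = (\<Sum>t\<in>U. w t * fmul U A B t v)"
     unfolding sum_distrib_right fmul_def sum_distrib_left by (subst sum.swap) (simp add: mult.assoc)
    finally show ?thesis .
   qed
   moreover have "fmul U A B u v \<in> V" if "u \<in> U" "v \<in> U" for u v
    unfolding fmul_def by (rule is_subring_sum[OF V]) (use A B V' that in auto)
   ultimately show ?thesis unfolding ok_def by (intro exI[of _ "fmul U A B"]) auto
  qed
  \<comment> \<open>The matrix of \<open>x\<close> is a companion matrix in the first index:
    \<open>k\<close> is shifted to \<open>Suc k\<close>, and the last column uses the integral
    equation. The matrix of \<open>y\<close> does the same in the second index.\<close>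
  have "ok x" unfolding ok_def
  proof (intro exI[of _ "\<lambda>(i,j) (k,l). if j = l then (if Suc k < m then (if i = Suc k then 1 else 0) else - c i) else 0"] conjI ballI)
   fix v assume "v \<in> U"
   then obtain k l where v: "v = (k,l)" "k < m" "l < n" by (auto simp: U_def)
   have "(\<Sum>u\<in>U. w u * (\<lambda>(i,j) (k,l). if j = l then (if Suc k < m then (if i = Suc k then 1 else 0) else - c i) else 0) u v)
    = (\<Sum>i<m. \<Sum>j<n. if j = l then x ^ i * y ^ l * (if Suc k < m then (if i = Suc k then 1 else 0) else - c i) else 0)"
    unfolding U_def sum.cartesian_product by (intro sum.cong) (auto simp: w_def v)
   also have "\<dots> = (\<Sum>i<m. x ^ i * y ^ l * (if Suc k < m then (if i = Suc k then 1 else 0) else - c i))"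
    using v by simp
   also have "\<dots> = x * w v"
   proof (cases "Suc k < m")
    case True
    hence "(\<Sum>i<m. x ^ i * y ^ l * (if Suc k < m then (if i = Suc k then 1 else 0) else - c i)) = (\<Sum>i<m. if i = Suc k then x ^ i * y ^ l else 0)"
     by (intro sum.cong) auto
    thus ?thesis using True by (simp add: w_def v)
   next
    case False
    hence k: "m = Suc k" using v by auto
    have "(\<Sum>i<m. x ^ i * y ^ l * (- c i)) = - (\<Sum>i<m. c i * x ^ i) * y ^ l"
     by (simp add: sum_distrib_left sum_distrib_right sum_negf mult_ac)
    also have "\<dots> = x ^ m * y ^ l" using c(2) by (simp add: add_eq_0_iff2)
    finally show ?thesis using False by (simp add: w_def v k)
   qed
   finally show "x * w v = (\<Sum>u\<in>U. w u * (\<lambda>(i,j) (k,l). if j = l then (if Suc k < m then (if i = Suc k then 1 else 0) else - c i) else 0) u v)" by simp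
  qed (use c(1) V' in \<open>auto simp: U_def\<close>)
  moreover have "ok y" unfolding ok_def
  proof (intro exI[of _ "\<lambda>(i,j) (k,l). if i = k then (if Suc l < n then (if j = Suc l then 1 else 0) else - d j) else 0"] conjI ballI)
   fix v assume "v \<in> U"
   then obtain k l where v: "v = (k,l)" "k < m" "l < n" by (auto simp: U_def)
   have "(\<Sum>u\<in>U. w u * (\<lambda>(i,j) (k,l). if i = k then (if Suc l < n then (if j = Suc l then 1 else 0) else - d j) else 0) u v)
    = (\<Sum>i<m. \<Sum>j<n. if i = k then x ^ k * y ^ j * (if Suc l < n then (if j = Suc l then 1 else 0) else - d j) else 0)"
    unfolding U_def sum.cartesian_product by (intro sum.cong) (auto simp: w_def v)
   also have "\<dots> = (\<Sum>i<m. if i = k then (\<Sum>j<n. x ^ k * y ^ j * (if Suc l < n then (if j = Suc l then 1 else 0) else - d j)) else 0)"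
    by (intro sum.cong) auto
   also have "\<dots> = (\<Sum>j<n. x ^ k * y ^ j * (if Suc l < n then (if j = Suc l then 1 else 0) else - d j))"
    using v by simp
   also have "\<dots> = y * w v"
   proof (cases "Suc l < n")
    case True
    hence "(\<Sum>j<n. x ^ k * y ^ j * (if Suc l < n then (if j = Suc l then 1 else 0) else - d j)) = (\<Sum>j<n. if j = Suc l then x ^ k * y ^ j else 0)"
     by (intro sum.cong) auto
    thus ?thesis using True by (simp add: w_def v)
   next
    case False
    hence k: "n = Suc l" using v by auto
    have "(\<Sum>j<n. x ^ k * y ^ j * (- d j)) = - (\<Sum>i<n. d i * y ^ i) * x ^ k"
     by (simp add: sum_distrib_left sum_distrib_right sum_negf mult_ac)
    also have "\<dots> = y ^ n * x ^ k" using d(2) by (simp add: add_eq_0_iff2)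
    finally show ?thesis using False by (simp add: w_def v k)
   qed
   finally show "y * w v = (\<Sum>u\<in>U. w u * (\<lambda>(i,j) (k,l). if i = k then (if Suc l < n then (if j = Suc l then 1 else 0) else - d j) else 0) u v)" by simp
  qed (use d(1) V' in \<open>auto simp: U_def\<close>)
  ultimately show ?thesis using okS ok_diff ok_mult by blast
 qed
 have "1 \<in> int_closure V"
  unfolding int_closure_def using V'
  by (intro CollectI exI[of _ 1] exI[of _ "\<lambda>_. -1"]) auto
 thus ?thesis using gen unfolding is_subring_def by blast
qed

lemma subset_int_closure:
 assumes V: "is_subring V"
 shows "V \<subseteq> int_closure V"
proof
 fix v assume v: "v \<in> V"
 show "v \<in> int_closure V"
  unfolding int_closure_def using is_subringD(3)[OF V v]
  by (intro CollectI exI[of _ 1] exI[of _ "\<lambda>_. - v"]) auto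
qed

locale val_ext = galois_ext F for F :: "'k::field set" +
 fixes V S :: "'k set"
 assumes val: "valuation_domain_of F V" and S_def: "S = int_closure V"
begin

lemma V_subring: "is_subring V"
 using val is_subring_of_subring by (auto simp: valuation_domain_of_def)

lemma V_F: "V \<subseteq> F" and V_val: "x \<in> F ==> x \<noteq> 0 ==> x \<in> V \<or> inverse x \<in> V"
 and F_frac: "x \<in> F ==> \<exists>a\<in>V. \<exists>b\<in>V. b \<noteq> 0 \<and> x = a / b"
 using val by (auto simp: valuation_domain_of_def)

lemma F_inverse: "x \<in> F ==> inverse x \<in> F"
 by (rule fixed_in_F) (simp add: gal_simps)

lemma F_divide: "x \<in> F ==> y \<in> F ==> x / y \<in> F"
 using F_inverse is_subringD(6)[OF F_subring] by (simp add: divide_inverse)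

lemma S_subring: "is_subring S"
 unfolding S_def by (rule int_closure_subring[OF V_subring])

lemmas maxD = ismaxD[OF S_subring]

lemma V_S: "V \<subseteq> S" unfolding S_def by (rule subset_int_closure[OF V_subring])

lemmas V_rules = is_subringD[OF V_subring] and S_rules = is_subringD[OF S_subring]

text \<open>Otherwise \<open>inverse x\<close> lies in \<open>V\<close>, and dividing an integral
  equation of degree \<open>m + 1\<close> by \<open>x ^ m\<close> writes \<open>x\<close> as an
  element of \<open>V\<close>.\<close>

lemma S_int_F:
 assumes "x \<in> S" "x \<in> F" shows "x \<in> V"
proof (rule ccontr)
 assume n: "x \<notin> V"
 have x0: "x \<noteq> 0" using n V_rules by auto
 hence i: "inverse x \<in> V" using V_val assms n by auto
 obtain k c where c: "\<And>i. i < k ==> c i \<in> V" "x ^ k + (\<Sum>i<k. c i * x ^ i) = 0"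
  using assms unfolding S_def int_closure_def by blast
 then obtain m where k: "k = Suc m" by (cases k) auto
 have "(x ^ k + (\<Sum>i<k. c i * x ^ i)) * inverse x ^ m = x + (\<Sum>i<k. c i * inverse x ^ (m - i))"
 proof -
  have "x ^ i * inverse x ^ m = inverse x ^ (m - i)" if "i < k" for i
  proof -
   have "m = i + (m - i)" using that k by auto
   hence "inverse x ^ m = inverse x ^ i * inverse x ^ (m - i)" by (metis power_add)
   thus ?thesis using x0 by (simp add: field_simps)
  qed
  hence "(\<Sum>i<k. c i * x ^ i) * inverse x ^ m = (\<Sum>i<k. c i * inverse x ^ (m - i))"
   by (simp add: sum_distrib_right mult.assoc)
  moreover have "x ^ k * inverse x ^ m = x" using x0 by (simp add: k field_simps)
  ultimately show ?thesis by (simp only: distrib_right)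
 qed
 hence "x = - (\<Sum>i<k. c i * inverse x ^ (m - i))" using c(2) by (simp add: eq_neg_iff_add_eq_0)
 moreover have "(\<Sum>i<k. c i * inverse x ^ (m - i)) \<in> V"
  by (rule is_subring_sum[OF V_subring]) (use c(1) V_rules is_subring_power[OF V_subring i] in auto)
 ultimately show False using n V_rules by metis
qed

lemma gal_S:
 assumes "si \<in> G" "x \<in> S" shows "si x \<in> S"
proof -
 obtain k c where c: "\<And>i. i < k ==> c i \<in> V" "x ^ k + (\<Sum>i<k. c i * x ^ i) = 0"
  using assms unfolding S_def int_closure_def by blast
 have "si (c i) = c i" if "i < k" for i using c(1)[OF that] V_F gal_simps(12)[OF assms(1)] by auto
 hence "si x ^ k + (\<Sum>i<k. c i * si x ^ i) = si (x ^ k + (\<Sum>i<k. c i * x ^ i))"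
  by (auto simp: gal_sum[OF assms(1)] gal_simps[OF assms(1)] intro!: sum.cong)
 thus ?thesis unfolding S_def int_closure_def using c gal_simps(1)[OF assms(1)] by auto
qed

text \<open>The product of the Galois conjugates of the equation is monic, has coefficients in
  \<open>S\<close> fixed by \<open>G\<close>, hence in \<open>V\<close>, and still has the root
  \<open>x\<close>.\<close>

lemma S_integrally_closed:
 assumes c: "\<And>i. i < n ==> c i \<in> S" and x: "x ^ n + (\<Sum>i<n. c i * x ^ i) = 0"
 shows "x \<in> S"
proof -
 define p where "p = monom 1 n + (\<Sum>i<n. monom (c i) i)"
 have cp: "coeff p i = (if i = n then 1 else if i < n then c i else 0)" for i
  by (auto simp: p_def coeff_sum)
 have dp: "degree p = n"
 proof (rule antisym)
  show "degree p \<le> n" by (rule degree_le) (simp add: cp)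
  show "n \<le> degree p" by (rule le_degree) (simp add: cp)
 qed
 have lp: "lead_coeff p = 1" unfolding dp using cp[of n] by simp
 have pS: "coeff p i \<in> S" for i using c S_rules by (auto simp: cp)
 have px: "poly p x = 0"
  using x by (subst poly_monic_split[OF lp dp]) (simp add: cp cong: sum.cong_simp)
 define q where "q = (\<Prod>si\<in>G. map_poly si p)"
 have "q \<in> {p. \<forall>i. coeff p i \<in> S}"
  unfolding q_def by (rule is_subring_prod[OF is_subring_polys[OF S_subring]])
   (use pS gal_S in \<open>auto simp: coeff_map_poly gal_simps\<close>)
 moreover have "coeff q i \<in> F" for i
  unfolding q_def by (rule map_poly_prod_fixed) (auto simp: poly_eq_iff coeff_map_poly gal_simps)
 ultimately have qV: "coeff q i \<in> V" for i using S_int_F by auto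
 have "lead_coeff (map_poly si p) = 1" if "si \<in> G" for si
 proof -
  have "p \<noteq> 0" using lp by auto
  hence "degree (map_poly si p) = n" by (subst degree_map_poly) (auto simp: dp cp gal_simps[OF that])
  thus ?thesis by (simp add: coeff_map_poly cp gal_simps[OF that])
 qed
 hence lq: "lead_coeff q = 1" unfolding q_def by (simp add: lead_coeff_prod)
 have "poly q x = (\<Prod>si\<in>G. poly (map_poly si p) x)" unfolding q_def by (simp add: poly_prod)
 also have "\<dots> = 0"
  by (rule prod_zero) (use px in \<open>auto intro!: bexI[OF _ id_in_G] simp: map_poly_id\<close>)
 finally have "x ^ degree q + (\<Sum>i<degree q. coeff q i * x ^ i) = 0"
  using poly_monic_split[OF lq refl] by simp
 thus ?thesis using qV unfolding S_def int_closure_def by blast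
qed

lemma V_common_denom:
 assumes "finite A" "\<And>i. i \<in> A ==> c i \<in> F"
 shows "\<exists>v\<in>V. v \<noteq> 0 \<and> (\<forall>i\<in>A. v * c i \<in> V)"
 using assms
proof (induct A)
 case empty thus ?case using V_rules by (intro bexI[of _ 1]) auto
next
 case (insert a A)
 then obtain v where v: "v \<in> V" "v \<noteq> 0" "\<And>i. i \<in> A ==> v * c i \<in> V" by auto
 obtain r b where b: "r \<in> V" "b \<in> V" "b \<noteq> 0" "c a = r / b" using F_frac[of "c a"] insert(4) by auto
 have "v * b * c a = v * r" using b by simp
 hence "v * b * c a \<in> V" using v b V_rules by metis
 moreover have "v * b * c i \<in> V" if "i \<in> A" for i
  using v(3)[OF that] b V_rules(6)[of "v * c i" b] by (simp add: mult_ac)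
 ultimately show ?case using v b V_rules by (intro bexI[of _ "v * b"]) auto
qed

text \<open>Multiplying the polynomial of conjugates by \<open>v ^ card G\<close>, where
  \<open>v\<close> is a common denominator of its coefficients, gives a monic equation for
  \<open>v * x\<close>.\<close>

lemma K_frac: "\<exists>v\<in>V. v \<noteq> 0 \<and> v * x \<in> S"
proof -
 let ?p = "conj_poly x" and ?n = "card G"
 obtain v where v: "v \<in> V" "v \<noteq> 0" "\<And>i. i < ?n ==> v * coeff ?p i \<in> V"
  using V_common_denom[of "{..<?n}" "coeff ?p"] conj_poly_props(1) by auto
 have "x ^ ?n + (\<Sum>i<?n. coeff ?p i * x ^ i) = 0"
  using poly_monic_split[OF conj_poly_props(3,2), of x x] conj_poly_props(4) by simp
 hence "v ^ ?n * (x ^ ?n + (\<Sum>i<?n. coeff ?p i * x ^ i)) = 0" by simp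
 moreover have "v ^ ?n * (coeff ?p i * x ^ i) = (v ^ (?n - i) * coeff ?p i) * (v * x) ^ i" if "i < ?n" for i
 proof -
  have "v ^ ?n = v ^ (?n - i) * v ^ i" using that by (simp add: power_add[symmetric])
  thus ?thesis by (simp add: power_mult_distrib)
 qed
 ultimately have "(v * x) ^ ?n + (\<Sum>i<?n. (v ^ (?n - i) * coeff ?p i) * (v * x) ^ i) = 0"
  by (simp add: distrib_left sum_distrib_left power_mult_distrib)
 moreover have "v ^ (?n - i) * coeff ?p i \<in> V" if "i < ?n" for i
 proof -
  have "v ^ (?n - i) * coeff ?p i = v ^ (?n - i - 1) * (v * coeff ?p i)"
   using that by (cases "?n - i") auto
  thus ?thesis using v(3)[OF that] is_subring_power[OF V_subring v(1)] V_rules by metis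
 qed
 ultimately have "v * x \<in> S"
  unfolding S_def int_closure_def
  by (intro CollectI exI[of _ ?n] exI[of _ "\<lambda>i. v ^ (?n - i) * coeff ?p i"]) auto
 thus ?thesis using v by blast
qed

section \<open>The maximal ideal of V and the maximal ideals of S\<close>

abbreviation JV where "JV \<equiv> nonunits V"

text \<open>The lemmas about \<open>is_val\<close> do not apply to \<open>V\<close>, where only
  elements of \<open>F\<close> are comparable; the argument is carried out inside
  \<open>F\<close>.\<close>

lemma JV_ideal: "is_ideal V JV" and JV_one_minus: "x \<in> JV ==> 1 - x \<in> V \<and> inverse (1 - x) \<in> V"
proof -
 have gen: "x + y \<in> JV" if xy: "x \<in> JV" "y \<in> JV" "y \<noteq> 0" "x / y \<in> V" for x y
 proof -
  have m: "x \<in> V" "y \<in> V" using xy by (auto simp: nonunits_def)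
  have "inverse (x + y) \<notin> V" if "x + y \<noteq> 0"
  proof
   assume i: "inverse (x + y) \<in> V"
   have "inverse (x + y) * (x / y + 1) = inverse y" using xy that by (simp add: field_simps)
   moreover have "inverse (x + y) * (x / y + 1) \<in> V" using i xy V_rules by auto
   ultimately show False using xy by (auto simp: nonunits_def)
  qed
  thus ?thesis using m V_rules by (auto simp: nonunits_def)
 qed
 have add: "x + y \<in> JV" if xy: "x \<in> JV" "y \<in> JV" for x y
 proof -
  have m: "x \<in> F" "y \<in> F" using xy V_F by (auto simp: nonunits_def)
  show ?thesis
  proof (cases "x = 0 \<or> y = 0")
   case False
   hence "x / y \<in> V \<or> y / x \<in> V" using V_val[OF F_divide[OF m]] by (auto simp: inverse_divide)
   thus ?thesis using gen[of x y] gen[of y x] xy False by (auto simp: add.commute)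
  qed (use xy in auto)
 qed
 have "r * x \<in> JV" if "r \<in> V" "x \<in> JV" for r x
 proof -
  have "inverse (r * x) \<notin> V" if nz: "r * x \<noteq> 0"
  proof
   assume "inverse (r * x) \<in> V"
   hence "r * inverse (r * x) \<in> V" using V_rules(6)[OF \<open>r \<in> V\<close>] by blast
   moreover have "r * inverse (r * x) = inverse x" using nz by simp
   ultimately show False using \<open>x \<in> JV\<close> nz unfolding nonunits_def
    by (metis (mono_tags, lifting) mem_Collect_eq mult_zero_right)
  qed
  thus ?thesis using that V_rules by (auto simp: nonunits_def)
 qed
 thus i: "is_ideal V JV" unfolding is_ideal_def using add V_rules by (auto simp: nonunits_def)
 show "1 - x \<in> V \<and> inverse (1 - x) \<in> V" if x: "x \<in> JV"
 proof -
  have "1 \<notin> JV" using V_rules by (auto simp: nonunits_def)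
  hence "1 - x \<notin> JV" using add[OF x, of "1 - x"] by auto
  thus ?thesis using x V_rules by (auto simp: nonunits_def)
 qed
qed

lemmas JV_rules = is_idealD[OF V_subring JV_ideal]

lemma jac_V: "jac (subR V) = JV"
proof (rule Set.set_eqI, rule iffI)
 fix y assume y: "y \<in> jac (subR V)"
 have "inverse y \<notin> V" if "y \<noteq> 0"
 proof
  assume "inverse y \<in> V"
  then obtain u where "u * (1 - inverse y * y) = 1" using y unfolding jac_subR_iff[OF V_subring] by blast
  thus False using that by simp
 qed
 thus "y \<in> JV" using y unfolding jac_subR_iff[OF V_subring] by (auto simp: nonunits_def)
next
 fix y assume y: "y \<in> JV"
 have "\<exists>u\<in>V. u * (1 - r * y) = 1" if r: "r \<in> V" for r
 proof -
  have ry: "r * y \<in> JV" using JV_rules(4) r y by blast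
  have "1 - r * y \<noteq> 0"
  proof
   assume "1 - r * y = 0"
   hence "1 \<in> JV" using ry by simp
   thus False using V_rules(1) by (simp add: nonunits_def)
  qed
  thus ?thesis using JV_one_minus[OF ry] by (intro bexI[of _ "inverse (1 - r * y)"]) auto
 qed
 thus "y \<in> jac (subR V)" unfolding jac_subR_iff[OF V_subring] using y by (auto simp: nonunits_def)
qed

text \<open>If \<open>v\<close> were outside \<open>M\<close>, some \<open>1 - u * v\<close> would
  lie in \<open>M\<close>. Its norm has the form \<open>1 - v * s\<close> with \<open>s\<close> in
  \<open>S\<close> and in \<open>F\<close>, hence in \<open>V\<close>, so the norm is a unit; yet it
  has the factor \<open>1 - u * v\<close>.\<close>

lemma JV_in_max:
 assumes M: "ismax S M" and v: "v \<in> JV"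
 shows "v \<in> M"
proof (rule ccontr)
 assume "v \<notin> M"
 have vV: "v \<in> V" using v by (auto simp: nonunits_def)
 then obtain u where u: "u \<in> S" "1 - u * v \<in> M"
  using maxD(3)[OF M _ \<open>v \<notin> M\<close>] V_S by auto
 have ex: "\<exists>s\<in>S. (\<Prod>i\<in>A. 1 - v * g i) = 1 - v * s" if "finite A" "\<And>i. i \<in> A ==> g i \<in> S" for A and g :: "('k \<Rightarrow> 'k) \<Rightarrow> 'k"
  using that
 proof (induct A)
  case empty thus ?case using S_rules by (intro bexI[of _ 0]) auto
 next
  case (insert a A)
  then obtain s where s: "s \<in> S" "(\<Prod>i\<in>A. 1 - v * g i) = 1 - v * s" by auto
  have "(1 - v * g a) * (1 - v * s) = 1 - v * (g a + s - v * g a * s)" by (simp add: algebra_simps)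
  moreover have "g a + s - v * g a * s \<in> S" using insert s S_rules vV V_S by auto
  ultimately show ?case using insert s by auto
 qed
 obtain s where s: "s \<in> S" "(\<Prod>si\<in>G. 1 - v * si u) = 1 - v * s"
  using ex[of G "\<lambda>si. si u"] gal_S u by auto
 have N: "(\<Prod>si\<in>G. 1 - v * si u) = (\<Prod>si\<in>G. si (1 - u * v))"
  using vV V_F by (intro prod.cong) (auto simp: mult.commute gal_simps)
 have Nf: "(\<Prod>si\<in>G. si (1 - u * v)) \<in> F"
 proof (rule fixed_in_F)
  fix tu assume t: "tu \<in> G"
  show "tu (\<Prod>si\<in>G. si (1 - u * v)) = (\<Prod>si\<in>G. si (1 - u * v))"
   unfolding gal_prod[OF t] using prod.reindex_bij_betw[OF bij_left[OF t], of "\<lambda>si. si (1 - u * v)"] by simp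
 qed
 have v0: "v \<noteq> 0" using \<open>v \<notin> M\<close> is_idealD(2)[OF S_subring maxD(1)[OF M]] by auto
 have "s = (1 - (1 - v * s)) / v" using v0 by simp
 moreover have "1 - v * s \<in> F" using Nf N s by simp
 ultimately have "s \<in> F" using F_divide vV V_F is_subringD[OF F_subring] by (metis subsetD)
 hence "s \<in> V" using S_int_F s by auto
 hence vs: "v * s \<in> JV" using JV_rules(5) v by auto
 have "si (1 - u * v) \<in> S" if "si \<in> G" for si
  by (intro gal_S[OF that] S_rules(4,6) S_rules(1)) (use u vV V_S in auto)
 hence "(\<Prod>si\<in>G - {id}. si (1 - u * v)) \<in> S" by (intro is_subring_prod[OF S_subring]) auto
 hence "(1 - u * v) * (\<Prod>si\<in>G - {id}. si (1 - u * v)) \<in> M"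
  using u is_idealD(5)[OF S_subring maxD(1)[OF M]] by blast
 moreover have "(1 - u * v) * (\<Prod>si\<in>G - {id}. si (1 - u * v)) = 1 - v * s"
  using prod.remove[OF finite_G id_in_G, of "\<lambda>si. si (1 - u * v)"] N s by simp
 ultimately have "1 - v * s \<in> M" by simp
 hence "inverse (1 - v * s) * (1 - v * s) \<in> M"
  using JV_one_minus[OF vs] V_S is_idealD(4)[OF S_subring maxD(1)[OF M]] by blast
 moreover have "1 - v * s \<noteq> 0"
 proof
  assume "1 - v * s = 0"
  hence "1 \<in> JV" using vs by simp
  thus False using V_rules(1) by (simp add: nonunits_def)
 qed
 ultimately show False using maxD(2)[OF M] by simp
qed

lemma max_int_V:
 assumes M: "ismax S M" and v: "v \<in> V"
 shows "v \<in> M \<longleftrightarrow> v \<in> JV"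
proof
 assume vM: "v \<in> M"
 have "inverse v \<notin> V" if "v \<noteq> 0"
 proof
  assume "inverse v \<in> V"
  hence "inverse v * v \<in> M" using vM V_S is_idealD(4)[OF S_subring maxD(1)[OF M]] by blast
  thus False using that maxD(2)[OF M] by simp
 qed
 thus "v \<in> JV" using v by (auto simp: nonunits_def)
qed (rule JV_in_max[OF M])

lemma gal_max:
 assumes M: "ismax S M" and s: "si \<in> G"
 shows "ismax S (si ` M)"
proof -
 note Mi = is_idealD[OF S_subring maxD(1)[OF M]]
 let ?t = "inv_into UNIV si"
 have t: "?t \<in> G" using s by simp
 note [simp] = gal_simps[OF s] inv_app[OF s] gal_simps[OF t]
 have mem: "y \<in> si ` M \<longleftrightarrow> ?t y \<in> M" for y
  by (auto simp: image_iff intro!: bexI[of _ "?t y"])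
 have "is_ideal S (si ` M)"
  unfolding is_ideal_def
  using Mi gal_S[OF s] gal_S[OF t] by (auto simp: mem simp del: image_iff)
 moreover have "1 \<notin> si ` M" using t maxD(2)[OF M] by (simp add: mem)
 moreover have "\<exists>u\<in>S. 1 - u * y \<in> si ` M" if y: "y \<in> S - si ` M" for y
 proof -
  obtain u where "u \<in> S" "1 - u * ?t y \<in> M"
   using maxD(3)[OF M, of "?t y"] y gal_S[OF t] by (auto simp: mem)
  thus ?thesis using s t gal_S[OF s] by (intro bexI[of _ "si u"]) (auto simp: mem)
 qed
 ultimately show ?thesis unfolding ismax_def by blast
qed

lemma gal_max_mem:
 assumes "si \<in> G" shows "si x \<in> si ` M \<longleftrightarrow> x \<in> M"
 by (auto simp: image_iff gal_simps(11)[OF assms])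

text \<open>If \<open>M'\<close> is not conjugate to \<open>M\<close>, comaximality gives
  \<open>x\<close> in \<open>M'\<close> with \<open>1 - x\<close> in every conjugate of
  \<open>M\<close>. The norm of \<open>x\<close> lies in \<open>M'\<close> and in \<open>F\<close>,
  hence in \<open>JV\<close> and in \<open>M\<close>, so some conjugate of \<open>x\<close> lies in
  \<open>M\<close>, which is impossible.\<close>

lemma max_transitive:
 assumes M: "ismax S M" and M': "ismax S M'"
 shows "\<exists>si\<in>G. M' = si ` M"
proof (rule ccontr)
 assume n: "\<not> ?thesis"
 have "\<exists>a. a \<in> M' \<and> 1 - a \<in> si ` M" if "si \<in> G" for si
  using ismax_ne_comaximal[OF S_subring M' gal_max[OF M that]] n that by blast
 then obtain a where a: "\<And>si. si \<in> G ==> a si \<in> M'" "\<And>si. si \<in> G ==> 1 - a si \<in> si ` M" by metis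
 define x where "x = 1 - (\<Prod>si\<in>G. 1 - a si)"
 have aS: "a si \<in> S" if "si \<in> G" for si using a(1)[OF that] maxD(4)[OF M'] by auto
 hence bS: "1 - a si \<in> S" if "si \<in> G" for si using that S_rules by auto
 have x: "x \<in> M'" unfolding x_def
  by (rule one_minus_prod_in[OF S_subring maxD(1)[OF M']]) (use bS a in auto)
 have xS: "x \<in> S" using x maxD(4)[OF M'] by auto
 have y: "1 - x \<in> si ` M" if s: "si \<in> G" for si
 proof -
  have "1 - x = (1 - a si) * (\<Prod>si\<in>G - {si}. 1 - a si)"
   unfolding x_def using prod.remove[OF finite_G s, of "\<lambda>si. 1 - a si"] by simp
  moreover have "(\<Prod>si\<in>G - {si}. 1 - a si) \<in> S" by (rule is_subring_prod[OF S_subring]) (use bS in auto)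
  ultimately show ?thesis
   using a(2)[OF s] is_idealD(5)[OF S_subring maxD(1)[OF gal_max[OF M s]]] by metis
 qed
 let ?N = "\<Prod>si\<in>G. si x"
 have gx: "si x \<in> S" if "si \<in> G" for si using gal_S[OF that xS] .
 have NF: "?N \<in> F"
 proof (rule fixed_in_F)
  fix tu assume t: "tu \<in> G"
  show "tu ?N = ?N"
   unfolding gal_prod[OF t] using prod.reindex_bij_betw[OF bij_left[OF t], of "\<lambda>si. si x"] by simp
 qed
 moreover have "?N \<in> S" by (rule is_subring_prod[OF S_subring]) (use gx in auto)
 ultimately have NV: "?N \<in> V" using S_int_F by blast
 have "(\<Prod>si\<in>G - {id}. si x) \<in> S" by (rule is_subring_prod[OF S_subring]) (use gx in auto)
 hence "?N \<in> M'" using prod.remove[OF finite_G id_in_G, of "\<lambda>si. si x"] x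
   is_idealD(5)[OF S_subring maxD(1)[OF M']] by auto
 hence "?N \<in> M" using max_int_V[OF M NV] max_int_V[OF M' NV] by blast
 then obtain si where s: "si \<in> G" "si x \<in> M" using ismax_prod[OF S_subring M finite_G, of "\<lambda>si. si x"] gx by blast
 let ?t = "inv_into UNIV si"
 have "x \<in> ?t ` M" using s inv_app[OF s(1)] by (auto intro!: image_eqI[of _ _ "si x"])
 moreover have "1 - x \<in> ?t ` M" using y[of ?t] s by auto
 ultimately have "x + (1 - x) \<in> ?t ` M"
  using is_idealD(3)[OF S_subring maxD(1)[OF gal_max[OF M inv_in_G[OF s(1)]]]] by blast
 thus False using maxD(2)[OF gal_max[OF M inv_in_G[OF s(1)]]] by simp
qed

abbreviation Maxs where "Maxs \<equiv> {M. ismax S M}"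

lemma ex_max: "\<exists>M. ismax S M"
proof -
 have "is_ideal S {0}" using S_rules by (auto simp: is_ideal_def)
 thus ?thesis using ismax_exists[OF S_subring, of "{0}"] by auto
qed

lemma Maxs_eq: "ismax S M ==> Maxs = (\<lambda>si. si ` M) ` G"
 using max_transitive gal_max by fast

lemma finite_Maxs: "finite Maxs"
 using ex_max Maxs_eq by fastforce

text \<open>Chinese remaindering, available because there are finitely many maximal ideals. Such an
  \<open>e\<close> turns local statements at \<open>M\<close> into statements about
  \<open>S\<close>: it is a unit at \<open>M\<close>, while multiples of it lie in every other
  maximal ideal.\<close>

lemma max_idempotent:
 assumes M: "ismax S M"
 shows "\<exists>e\<in>S. 1 - e \<in> M \<and> (\<forall>M'\<in>Maxs. M' \<noteq> M \<longrightarrow> e \<in> M')"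
proof -
 have "\<exists>a. a \<in> M' \<and> 1 - a \<in> M" if "M' \<in> Maxs - {M}" for M'
  using ismax_ne_comaximal[OF S_subring _ M] that by auto
 then obtain a where a: "\<And>M'. M' \<in> Maxs - {M} ==> a M' \<in> M'" "\<And>M'. M' \<in> Maxs - {M} ==> 1 - a M' \<in> M" by metis
 have aS: "a M' \<in> S" if "M' \<in> Maxs - {M}" for M' using a(1)[OF that] that ismaxD(4)[OF S_subring] by auto
 let ?e = "\<Prod>M'\<in>Maxs - {M}. a M'"
 have fin: "finite (Maxs - {M})" using finite_Maxs by simp
 have "?e \<in> S" by (rule is_subring_prod[OF S_subring]) (rule aS)
 moreover have "1 - ?e \<in> M"
  by (rule one_minus_prod_in[OF S_subring maxD(1)[OF M] fin]) (use aS a in auto)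
 moreover have "?e \<in> M'" if m: "M' \<in> Maxs" "M' \<noteq> M" for M'
 proof -
  have "?e = a M' * (\<Prod>N\<in>Maxs - {M} - {M'}. a N)" using prod.remove[OF fin, of M' a] m by auto
  moreover have "(\<Prod>N\<in>Maxs - {M} - {M'}. a N) \<in> S" by (rule is_subring_prod[OF S_subring]) (use aS in auto)
  ultimately show ?thesis using a(1)[of M'] m is_idealD(5)[OF S_subring ismaxD(1)[OF S_subring]] by auto
 qed
 ultimately show ?thesis by blast
qed

end

section \<open>Localization at a maximal ideal\<close>

context val_ext
begin

abbreviation loc where "loc M \<equiv> localize S M"
abbreviation nloc where "nloc M \<equiv> nonunits (localize S M)"

lemma finite_F_max:
 assumes "finite C" "C \<noteq> {}" "0 \<notin> C" "C \<subseteq> F"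
 shows "\<exists>c\<in>C. \<forall>x\<in>C. x / c \<in> V"
proof (rule finite_val_max[OF V_subring assms(1-3)])
 fix x y assume xy: "x \<in> C" "y \<in> C"
 hence "x \<in> F" "y \<in> F" "x \<noteq> 0" "y \<noteq> 0" using assms by auto
 thus "x / y \<in> V \<or> y / x \<in> V" using V_val[OF F_divide, of x y] by (auto simp: inverse_divide)
qed

context
 fixes M
 assumes M: "ismax S M"
begin

lemmas M_rules = is_idealD[OF S_subring maxD(1)[OF M]]

lemma loc_memI: "s \<in> S ==> t \<in> S ==> t \<notin> M ==> s / t \<in> loc M"
 by (auto simp: localize_def)

lemma M_mult_notin: "s \<in> S ==> t \<in> S ==> s \<notin> M ==> t \<notin> M ==> s * t \<notin> M"
 using maxD(5)[OF M] by blast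

lemma notin_M_nz: "t \<notin> M ==> t \<noteq> 0"
 using M_rules(2) by blast

lemma S_loc: "s \<in> S ==> s \<in> loc M"
 using loc_memI[of s 1] S_rules(1) maxD(2)[OF M] by simp

lemma loc_subring: "is_subring (loc M)"
 unfolding is_subring_def
proof (intro conjI ballI)
 show "1 \<in> loc M" using S_loc S_rules(1) by blast
 fix x y assume "x \<in> loc M" "y \<in> loc M"
 then obtain s t s' t' where st: "s \<in> S" "t \<in> S" "t \<notin> M" "x = s / t" "s' \<in> S" "t' \<in> S" "t' \<notin> M" "y = s' / t'"
  unfolding localize_def by blast
 have tt: "t * t' \<in> S" "t * t' \<notin> M" using st S_rules(6) M_mult_notin by auto
 have nz: "t \<noteq> 0" "t' \<noteq> 0" using st notin_M_nz by auto
 have "x - y = (s * t' - s' * t) / (t * t')" using nz st by (simp add: field_simps)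
 moreover have "s * t' - s' * t \<in> S" using st S_rules(4,6) by auto
 ultimately show "x - y \<in> loc M" using loc_memI tt by metis
 have "x * y = (s * s') / (t * t')" using st by simp
 thus "x * y \<in> loc M" using loc_memI tt st S_rules(6) by metis
qed

lemmas loc_rules = is_subringD[OF loc_subring]

text \<open>Induction on the degree. The product \<open>b\<close> of the leading coefficient
  \<open>a\<close> with \<open>x\<close> is integral over \<open>S\<close>, so
  \<open>x = b / a\<close> or \<open>inverse x = a / b\<close> does it unless both lie in
  \<open>M\<close>. In that case \<open>b\<close> is added to the next coefficient, which lowers the
  degree and keeps some coefficient outside \<open>M\<close>.\<close>

lemma loc_of_poly:
 assumes "\<And>i. i \<le> n ==> a i \<in> S" "\<exists>i\<le>n. a i \<notin> M" "(\<Sum>i\<le>n. a i * x ^ i) = 0" "x \<noteq> 0"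
 shows "x \<in> loc M \<or> inverse x \<in> loc M"
 using assms(1-3)
proof (induct n arbitrary: a)
 case 0
 hence "a 0 = 0" by simp
 thus ?case using 0(2) M_rules(2) by auto
next
 case (Suc n)
 let ?a = "a (Suc n)"
 define b where "b = ?a * x"
 have aS: "?a \<in> S" using Suc(2) by auto
 have b: "b \<in> S"
 proof (cases "?a = 0")
  case True thus ?thesis using S_rules by (simp add: b_def)
 next
  case False
  \<comment> \<open>Multiplied by the \<open>n\<close>-th power of the leading coefficient, the
    equation becomes monic in \<open>b\<close>.\<close>
  show ?thesis
  proof (rule S_integrally_closed[of "Suc n" "\<lambda>i. a i * ?a ^ (n - i)"])
   show "a i * ?a ^ (n - i) \<in> S" if "i < Suc n" for i
    using that Suc(2)[of i] aS is_subring_power[OF S_subring] S_rules(6) by auto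
   have "a i * ?a ^ (n - i) * b ^ i = ?a ^ n * (a i * x ^ i)" if "i < Suc n" for i
   proof -
    have "?a ^ n = ?a ^ (n - i) * ?a ^ i" using that by (simp add: power_add[symmetric])
    thus ?thesis by (simp add: b_def power_mult_distrib)
   qed
   hence "b ^ Suc n + (\<Sum>i<Suc n. a i * ?a ^ (n - i) * b ^ i) = ?a ^ n * (?a * x ^ Suc n) + (\<Sum>i<Suc n. ?a ^ n * (a i * x ^ i))"
    by (intro arg_cong2[where f = "(+)"] sum.cong) (auto simp: b_def power_mult_distrib)
   also have "\<dots> = ?a ^ n * (\<Sum>i\<le>Suc n. a i * x ^ i)"
    by (simp only: sum_distrib_left[symmetric] distrib_left[symmetric] lessThan_Suc_atMost sum.atMost_Suc) (simp add: add.commute)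
   finally show "b ^ Suc n + (\<Sum>i<Suc n. a i * ?a ^ (n - i) * b ^ i) = 0" using Suc(4) by simp
  qed
 qed
 consider "?a \<notin> M" | "b \<notin> M" | "?a \<in> M" "b \<in> M" by blast
 thus ?case
 proof cases
  case 1
  hence "x = b / ?a" using notin_M_nz by (simp add: b_def)
  thus ?thesis using loc_memI[OF b aS 1] by simp
 next
  case 2
  hence "inverse x = ?a / b" using notin_M_nz[OF 2] by (simp add: b_def field_simps)
  thus ?thesis using loc_memI[OF aS b 2] by simp
 next
  case 3
  define a' where "a' = (\<lambda>i. if i = n then a n + b else a i)"
  have "(\<Sum>i\<le>n. a' i * x ^ i) = (\<Sum>i<n. a i * x ^ i) + (a n + b) * x ^ n"
   by (simp add: a'_def lessThan_Suc_atMost[symmetric])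
  also have "\<dots> = (\<Sum>i\<le>Suc n. a i * x ^ i)"
   by (simp add: b_def lessThan_Suc_atMost[symmetric] algebra_simps)
  finally have "(\<Sum>i\<le>n. a' i * x ^ i) = 0" using Suc(4) by simp
  moreover have "a' i \<in> S" if "i \<le> n" for i using that Suc(2) b S_rules(5) by (auto simp: a'_def)
  moreover have "\<exists>i\<le>n. a' i \<notin> M"
  proof -
   obtain i where i: "i \<le> Suc n" "a i \<notin> M" using Suc(3) by blast
   hence "i \<le> n" using 3 by (cases "i = Suc n") auto
   moreover have "a' i \<notin> M"
   proof (cases "i = n")
    case True
    show ?thesis
    proof
     assume "a' i \<in> M"
     moreover have "a' i = a n + b" using True by (simp add: a'_def)
     ultimately have "a n + b - b \<in> M" using M_rules(7)[OF _ 3(2)] by metis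
     thus False using i True by simp
    qed
   qed (use i in \<open>auto simp: a'_def\<close>)
   ultimately show ?thesis by blast
  qed
  ultimately show ?thesis using Suc(1)[of a'] by blast
 qed
qed

text \<open>Dividing the polynomial of conjugates by its coefficient of smallest value gives
  coefficients in \<open>V\<close>, one of which is 1 and so outside \<open>M\<close>; then
  \<open>loc_of_poly\<close> applies.\<close>

lemma loc_val: "is_val (loc M)"
 unfolding is_val_def
proof (intro conjI allI impI loc_subring)
 fix x :: 'k assume x: "x \<noteq> 0"
 let ?p = "conj_poly x"
 let ?C = "{c. c \<noteq> 0 \<and> (\<exists>i\<le>card G. c = coeff ?p i)}"
 have fin: "finite ?C" by (rule finite_subset[of _ "coeff ?p ` {..card G}"]) auto
 have one: "coeff ?p (card G) = 1" using conj_poly_props(2,3)[of x] by simp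
 hence "1 \<in> ?C" by (auto intro!: exI[of _ "card G"])
 hence "?C \<noteq> {}" by blast
 moreover have "?C \<subseteq> F" using conj_poly_props(1) by auto
 ultimately obtain c where c: "c \<in> ?C" "\<And>y. y \<in> ?C ==> y / c \<in> V" using finite_F_max[OF fin] by auto
 obtain k where k: "k \<le> card G" "c = coeff ?p k" "c \<noteq> 0" using c by blast
 show "x \<in> loc M \<or> inverse x \<in> loc M"
 proof (rule loc_of_poly[of "card G" "\<lambda>i. coeff ?p i / c", OF _ _ _ x])
  show "coeff ?p i / c \<in> S" if "i \<le> card G" for i
   using c(2)[of "coeff ?p i"] that V_S S_rules(2) by (cases "coeff ?p i = 0") auto
  show "\<exists>i\<le>card G. coeff ?p i / c \<notin> M" using k maxD(2)[OF M] by (intro exI[of _ k]) auto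
  have "(\<Sum>i\<le>card G. coeff ?p i * x ^ i) = 0"
   using conj_poly_props(2,4)[of x] by (simp add: poly_altdef)
  thus "(\<Sum>i\<le>card G. coeff ?p i / c * x ^ i) = 0"
   by (simp add: sum_divide_distrib[symmetric])
 qed
qed

lemmas nloc_rules = is_idealD[OF loc_subring nonunits_ideal[OF loc_val]]

lemma nloc_iff: "s \<in> S ==> s \<in> nloc M \<longleftrightarrow> s \<in> M"
proof
 assume s: "s \<in> S" "s \<in> nloc M"
 show "s \<in> M"
 proof (rule ccontr)
  assume "s \<notin> M"
  hence "1 / s \<in> loc M" "s \<noteq> 0" using loc_memI[OF S_rules(1)] s notin_M_nz by auto
  thus False using s by (auto simp: nonunits_def inverse_eq_divide)
 qed
next
 assume s: "s \<in> S" "s \<in> M"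
 have "inverse s \<notin> loc M" if "s \<noteq> 0"
 proof
  assume "inverse s \<in> loc M"
  then obtain a t where t: "a \<in> S" "t \<in> S" "t \<notin> M" "inverse s = a / t" unfolding localize_def by blast
  hence "t = a * s" using that notin_M_nz by (simp add: field_simps)
  thus False using t s M_rules(4) by blast
 qed
 thus "s \<in> nloc M" using S_loc s by (auto simp: nonunits_def)
qed

lemma loc_unit: "s \<in> S ==> s \<notin> M ==> s \<noteq> 0 \<and> inverse s \<in> loc M"
 using loc_memI[of 1 s] S_rules(1) notin_M_nz by (auto simp: inverse_eq_divide)

lemma loc_int_F: "x \<in> loc M ==> x \<in> F ==> x \<in> V"
proof (rule ccontr)
 assume x: "x \<in> loc M" "x \<in> F" "x \<notin> V"
 have x0: "x \<noteq> 0" using x V_rules(2) by blast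
 hence "inverse x \<in> JV" using x V_val by (auto simp: nonunits_def)
 hence "inverse x \<in> M" "inverse x \<in> S" using JV_in_max[OF M] maxD(4)[OF M] by auto
 hence "inverse x \<in> nloc M" using nloc_iff by blast
 thus False using x x0 by (simp add: nonunits_def)
qed

lemma nloc_int_F: "x \<in> F ==> x \<in> nloc M \<longleftrightarrow> x \<in> JV"
proof
 assume x: "x \<in> F" "x \<in> nloc M"
 hence "x \<in> V" using loc_int_F by (auto simp: nonunits_def)
 thus "x \<in> JV" using x(2) max_int_V[OF M] nloc_iff V_S by blast
next
 assume "x \<in> F" "x \<in> JV"
 thus "x \<in> nloc M" using JV_in_max[OF M] nloc_iff maxD(4)[OF M] by blast
qed

lemma loc_num:
 assumes "x \<in> loc M"
 shows "\<exists>t\<in>S. t \<notin> M \<and> x * t \<in> S"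
proof -
 obtain s t where "s \<in> S" "t \<in> S" "t \<notin> M" "x = s / t" using assms unfolding localize_def by blast
 thus ?thesis using notin_M_nz by (intro bexI[of _ t]) auto
qed

end

text \<open>Otherwise the ideal of denominators of \<open>x\<close> lies in a maximal ideal
  \<open>M\<close>, although \<open>x\<close> has a denominator outside \<open>M\<close>.\<close>

lemma mem_S_if_loc:
 assumes "\<And>M. ismax S M ==> x \<in> loc M"
 shows "x \<in> S"
proof (rule ccontr)
 assume n: "x \<notin> S"
 let ?I = "{s\<in>S. s * x \<in> S}"
 have "is_ideal S ?I" using S_rules by (auto simp: is_ideal_def distrib_right mult.assoc)
 moreover have "1 \<notin> ?I" using n by simp
 ultimately obtain M where M: "ismax S M" "?I \<subseteq> M" using ismax_exists[OF S_subring] by blast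
 obtain t where "t \<in> S" "t \<notin> M" "x * t \<in> S" using loc_num[OF M(1) assms[OF M(1)]] by blast
 thus False using M(2) by (auto simp: mult.commute)
qed

lemma loc_gal_imp:
 assumes M: "ismax S M" and s: "si \<in> G" and x: "x \<in> loc M"
 shows "si x \<in> loc (si ` M)"
proof -
 obtain a t where t: "a \<in> S" "t \<in> S" "t \<notin> M" "x = a / t" using x unfolding localize_def by blast
 have "si x = si a / si t" using t by (simp add: gal_simps[OF s])
 thus ?thesis using loc_memI[OF gal_max[OF M s]] t gal_S[OF s] gal_max_mem[OF s] by metis
qed

lemma gal_image_inv:
 assumes "si \<in> G" shows "inv_into UNIV si ` si ` M = M" "si ` inv_into UNIV si ` M = M"
 using inv_app[OF assms] by (simp_all add: image_image)

lemma loc_gal: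
 assumes M: "ismax S M" and s: "si \<in> G"
 shows "si x \<in> loc (si ` M) \<longleftrightarrow> x \<in> loc M"
 using loc_gal_imp[OF M s, of x] loc_gal_imp[OF gal_max[OF M s] inv_in_G[OF s], of "si x"]
  gal_image_inv[OF s] inv_app[OF s] by auto

lemma nloc_gal:
 assumes M: "ismax S M" and s: "si \<in> G"
 shows "si x \<in> nloc (si ` M) \<longleftrightarrow> x \<in> nloc M"
 using loc_gal[OF M s, of x] loc_gal[OF M s, of "inverse x"]
 by (auto simp: nonunits_def gal_simps[OF s])

section \<open>The radical of S and a generator of it\<close>

definition JS where "JS = {x\<in>S. \<forall>M. ismax S M \<longrightarrow> x \<in> M}"

lemma JS_ideal: "is_ideal S JS"
 unfolding is_ideal_def JS_def using M_rules S_rules by auto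

lemmas JS_rules = is_idealD[OF S_subring JS_ideal]

lemma JS_if_loc:
 assumes "\<And>M. ismax S M ==> x \<in> nloc M"
 shows "x \<in> JS"
proof -
 have "x \<in> S" using assms by (intro mem_S_if_loc) (auto simp: nonunits_def)
 thus ?thesis using assms nloc_iff by (auto simp: JS_def)
qed

lemma JS_gal:
 assumes s: "si \<in> G" shows "si x \<in> JS \<longleftrightarrow> x \<in> JS"
proof -
 have imp: "si x \<in> JS" if s: "si \<in> G" and x: "x \<in> JS" for si x
 proof -
  have "si x \<in> M" if M: "ismax S M" for M
  proof -
   have "x \<in> inv_into UNIV si ` M" using x gal_max[OF M inv_in_G[OF s]] by (auto simp: JS_def)
   thus ?thesis using inv_app[OF s] by auto
  qed
  thus ?thesis using x gal_S[OF s] by (auto simp: JS_def)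
 qed
 show ?thesis using imp[OF s, of x] imp[OF inv_in_G[OF s], of "si x"] inv_app[OF s] by auto
qed

lemma JS_int_F: "x \<in> F ==> x \<in> JS \<longleftrightarrow> x \<in> JV"
proof
 assume x: "x \<in> F" "x \<in> JS"
 obtain M where M: "ismax S M" using ex_max by blast
 have "x \<in> V" using x S_int_F by (auto simp: JS_def)
 thus "x \<in> JV" using x max_int_V[OF M] M by (auto simp: JS_def)
next
 assume "x \<in> F" "x \<in> JV"
 thus "x \<in> JS" using JV_in_max V_S by (auto simp: JS_def nonunits_def)
qed

lemma JV_JS: "x \<in> JV ==> x \<in> JS"
 using JS_int_F[of x] V_F by (auto simp: nonunits_def)

lemma Tr_JS: "x \<in> JS ==> Tr x \<in> JV"
proof -
 assume x: "x \<in> JS"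
 have "Tr x \<in> JS" unfolding Tr_def
  by (rule is_ideal_sum[OF S_subring JS_ideal]) (use x JS_gal in auto)
 thus ?thesis using JS_int_F Tr_in_F by blast
qed

text \<open>Modulo \<open>JS\<close> all conjugates of \<open>x\<close> vanish, so the polynomial of
  conjugates is congruent to \<open>X ^ card G\<close>. Its lower coefficients lie in
  \<open>F\<close> and in \<open>JS\<close>, hence are multiples of \<pi>.\<close>

lemma JS_power:
 assumes pi: "JV = {\<pi> * v | v. v \<in> V}" and x: "x \<in> JS"
 shows "\<exists>s\<in>S. x ^ card G = \<pi> * s"
proof -
 let ?p = "conj_poly x" and ?n = "card G"
 have "(\<Prod>si\<in>G. [:- si x, 1:]) - (\<Prod>si\<in>G. [:0,1:]) \<in> {p. \<forall>i. coeff p i \<in> JS}"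
  by (rule prod_diff_in_ideal[OF is_subring_polys[OF S_subring] is_ideal_polys[OF S_subring JS_ideal]])
   (use x JS_rules S_rules JS_gal in \<open>auto simp: coeff_pCons split: nat.splits\<close>)
 hence d: "coeff ?p i - coeff ([:0,1:] ^ ?n) i \<in> JS" for i by (simp add: conj_poly_def)
 have "coeff ?p i \<in> JV" if "i < ?n" for i
 proof -
  have "coeff ([:0,1:] ^ ?n) i = coeff (monom (1::'k) ?n) i" by (simp add: monom_altdef)
  hence "coeff ([:0,1:] ^ ?n :: 'k poly) i = 0" using that by simp
  thus ?thesis using d[of i] JS_int_F[OF conj_poly_props(1)] by simp
 qed
 hence "\<exists>v. v \<in> V \<and> coeff ?p i = \<pi> * v" if "i < ?n" for i using that pi by blast
 then obtain v where v: "\<And>i. i < ?n ==> v i \<in> V" "\<And>i. i < ?n ==> coeff ?p i = \<pi> * v i" by metis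
 have "x ^ ?n + (\<Sum>i<?n. coeff ?p i * x ^ i) = 0"
  using poly_monic_split[OF conj_poly_props(3,2), of x x] conj_poly_props(4) by simp
 hence "x ^ ?n = - (\<Sum>i<?n. coeff ?p i * x ^ i)" by (simp add: eq_neg_iff_add_eq_0)
 also have "\<dots> = \<pi> * (- (\<Sum>i<?n. v i * x ^ i))"
  using v(2) by (simp add: sum_distrib_left mult.assoc)
 finally have "x ^ ?n = \<pi> * (- (\<Sum>i<?n. v i * x ^ i))" .
 moreover have "- (\<Sum>i<?n. v i * x ^ i) \<in> S"
 proof (intro S_rules(3) is_subring_sum[OF S_subring])
  fix i assume "i \<in> {..<?n}"
  thus "v i * x ^ i \<in> S"
   using v(1)[of i] V_S S_rules(6) is_subring_power[OF S_subring JS_rules(1)[OF x]] by auto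
 qed
 ultimately show ?thesis by blast
qed

text \<open>By \<open>JS_power\<close>, \<pi> divides the power with exponent \<open>card G\<close>
  of every non-unit. If no generator existed, values of non-units could be halved again and again
  starting from \<pi>, and this bound would be violated.\<close>

lemma local_uniformizer:
 assumes pi: "JV = {\<pi> * v | v. v \<in> V}" "\<pi> \<noteq> 0" and M: "ismax S M"
 shows "\<exists>w\<in>M. w \<noteq> 0 \<and> (\<forall>x\<in>nloc M. x / w \<in> loc M)"
proof -
 note O = loc_rules[OF M] and N = nloc_rules[OF M]
 obtain e where e: "e \<in> S" "1 - e \<in> M" "\<And>M'. ismax S M' ==> M' \<noteq> M ==> e \<in> M'"
  using max_idempotent[OF M] by blast
 have eM: "e \<notin> M" using maxD(6)[OF M] e by blast
 have pw: "x ^ card G / \<pi> \<in> loc M" if x: "x \<in> nloc M" for x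
 proof -
  obtain t where t: "t \<in> S" "t \<notin> M" "x * t \<in> S" using loc_num[OF M N(1)[OF x]] by blast
  have "x * t \<in> nloc M" using N(5) x S_loc[OF M t(1)] by blast
  hence "x * t \<in> M" using nloc_iff[OF M] t by blast
  hence "x * t * e \<in> M'" if "ismax S M'" for M'
   using that e t M_rules(4,5)[OF that] M_rules(5)[OF M] by (cases "M' = M") auto
  hence "x * t * e \<in> JS" using t e S_rules(6) by (auto simp: JS_def)
  then obtain s where s: "s \<in> S" "(x * t * e) ^ card G = \<pi> * s" using JS_power[OF pi(1)] by blast
  have te: "t * e \<in> S" "t * e \<notin> M" using t e eM S_rules(6) M_mult_notin[OF M] by auto
  have "x ^ card G / \<pi> = s * inverse (t * e) ^ card G"
   using s(2) pi(2) notin_M_nz[OF M te(2)] by (simp add: field_simps power_mult_distrib)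
  moreover have "inverse (t * e) ^ card G \<in> loc M"
   using loc_unit[OF M te] is_subring_power[OF loc_subring[OF M]] by blast
  ultimately show ?thesis using O(6)[OF S_loc[OF M s(1)]] by metis
 qed
 have "\<exists>w\<in>nloc M. w \<noteq> 0 \<and> (\<forall>x\<in>nloc M. x / w \<in> loc M)"
 proof (rule ccontr)
  assume n: "\<not> ?thesis"
  have "\<exists>y\<in>nloc M. y \<noteq> 0 \<and> \<pi> / y ^ (2 ^ k) \<in> loc M" for k
  proof (induct k)
   case 0
   have "\<pi> * 1 \<in> JV" unfolding pi(1) using V_rules(1) by blast
   hence "\<pi> \<in> nloc M" using JV_JS nloc_iff[OF M] M by (auto simp: JS_def)
   thus ?case using pi(2) O(1) by (intro bexI[of _ \<pi>]) auto
  next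
   case (Suc k)
   then obtain y where y: "y \<in> nloc M" "y \<noteq> 0" "\<pi> / y ^ (2 ^ k) \<in> loc M" by blast
   \<comment> \<open>As \<open>y\<close> does not generate, it factors into the non-units
     \<open>x\<close> and \<open>y / x\<close>; the factor of smaller value, called
     \<open>z\<close>, has its square dividing \<open>y\<close>.\<close>
   then obtain x where x: "x \<in> nloc M" "x / y \<notin> loc M" using n by blast
   have x': "x \<noteq> 0" "y / x \<in> nloc M" using not_div_nonunits[OF loc_val[OF M] x(2)] by auto
   obtain z where z: "z \<in> nloc M" "z \<noteq> 0" "y / z\<^sup>2 \<in> loc M"
   proof (cases "x / (y / x) \<in> loc M")
    case True
    have "y / (y / x)\<^sup>2 = x / (y / x)" using x' y by (simp add: field_simps power2_eq_square)
    thus ?thesis using that[of "y / x"] x' True y(2) by simp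
   next
    case False
    hence "(y / x) / x \<in> loc M" using val_total[OF loc_val[OF M]] by blast
    hence "y / x\<^sup>2 \<in> loc M" by (simp add: power2_eq_square)
    thus ?thesis using that[of x] x(1) x'(1) by blast
   qed
   have "\<pi> / z ^ (2 ^ Suc k) = (\<pi> / y ^ (2 ^ k)) * (y / z\<^sup>2) ^ (2 ^ k)"
    using y by (simp add: power_divide power_mult[symmetric])
   thus ?case using z y is_subring_power[OF loc_subring[OF M] z(3)] O(6) by metis
  qed
  then obtain y where y: "y \<in> nloc M" "y \<noteq> 0" "\<pi> / y ^ (2 ^ card G) \<in> loc M" by blast
  \<comment> \<open>\<open>y ^ (2 ^ card G)\<close> divides \<pi> and \<pi> divides
    \<open>y ^ card G\<close>; as the first exponent is larger, \<open>y\<close> would be a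
    unit.\<close>
  have lt: "card G < 2 ^ card G" by (rule less_exp)
  define m where "m = 2 ^ card G - card G - 1"
  have m: "2 ^ card G = card G + Suc m" using lt unfolding m_def by linarith
  have "(y ^ card G / \<pi>) * (\<pi> / y ^ (2 ^ card G)) * y ^ m = inverse y"
   unfolding m using y(2) pi(2) by (simp add: power_add field_simps)
  moreover have "(y ^ card G / \<pi>) * (\<pi> / y ^ (2 ^ card G)) * y ^ m \<in> loc M"
   by (intro O(6) pw[OF y(1)] y(3) is_subring_power[OF loc_subring[OF M] N(1)[OF y(1)]])
  ultimately show False using y by (auto simp: nonunits_def)
 qed
 then obtain w where w: "w \<in> nloc M" "w \<noteq> 0" "\<And>x. x \<in> nloc M ==> x / w \<in> loc M" by blast
 obtain t where t: "t \<in> S" "t \<notin> M" "w * t \<in> S" using loc_num[OF M N(1)[OF w(1)]] by blast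
 have "w * t \<in> M" using nloc_iff[OF M] t N(5)[OF S_loc[OF M t(1)] w(1)] by blast
 moreover have "x / (w * t) \<in> loc M" if "x \<in> nloc M" for x
 proof -
  have "x / (w * t) = (x / w) * inverse t" by (simp add: field_simps)
  thus ?thesis using w(3)[OF that] loc_unit[OF M t(1,2)] O(6) by metis
 qed
 moreover have "w * t \<noteq> 0" using w notin_M_nz[OF M t(2)] by simp
 ultimately show ?thesis by blast
qed

lemma uniformizer:
 assumes pi: "JV = {\<pi> * v | v. v \<in> V}" "\<pi> \<noteq> 0"
 shows "\<exists>w\<in>S. w \<noteq> 0 \<and> (\<forall>M. ismax S M \<longrightarrow> w \<in> M \<and> (\<forall>x\<in>nloc M. x / w \<in> loc M))"
proof -
 obtain w where w: "\<And>M. ismax S M ==> w M \<in> M" "\<And>M. ismax S M ==> w M \<noteq> 0"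
  "\<And>M x. ismax S M ==> x \<in> nloc M ==> x / w M \<in> loc M"
  using local_uniformizer[OF pi] by metis
 obtain e where e: "\<And>M. ismax S M ==> e M \<in> S" "\<And>M. ismax S M ==> 1 - e M \<in> M"
  "\<And>M M'. ismax S M ==> ismax S M' ==> M' \<noteq> M ==> e M \<in> M'"
  using max_idempotent by (metis mem_Collect_eq)
 \<comment> \<open>The squares matter: in a term with \<open>M'\<close> different from
   \<open>M\<close>, one factor \<open>e M'\<close> pays for the division by \<open>w M\<close>, and
   the other keeps the quotient a non-unit at \<open>M\<close>.\<close>
 define p where "p = (\<Sum>M\<in>Maxs. (e M)\<^sup>2 * w M)"
 have wS: "w M \<in> S" if "ismax S M" for M using w(1)[OF that] maxD(4)[OF that] by blast
 have pS: "p \<in> S" unfolding p_def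
  by (rule is_subring_sum[OF S_subring]) (use e wS S_rules(6) is_subring_power[OF S_subring] in auto)
 have main: "p / w M \<in> loc M \<and> p / w M \<notin> nloc M" if M: "ismax S M" for M
 proof -
  note O = loc_rules[OF M] and N = nloc_rules[OF M]
  have "p / w M = (e M)\<^sup>2 + (\<Sum>M'\<in>Maxs - {M}. (e M')\<^sup>2 * w M' / w M)"
   unfolding p_def using sum.remove[OF finite_Maxs, of M "\<lambda>M. (e M)\<^sup>2 * w M"] M w(2)[OF M]
   by (simp add: add_divide_distrib sum_divide_distrib)
  moreover have "(\<Sum>M'\<in>Maxs - {M}. (e M')\<^sup>2 * w M' / w M) \<in> nloc M"
  proof (rule is_ideal_sum[OF loc_subring[OF M] nonunits_ideal[OF loc_val[OF M]]])
   fix M' assume M': "M' \<in> Maxs - {M}"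
   hence eM: "e M' \<in> M" using e(3)[of M' M] M by auto
   hence en: "e M' \<in> nloc M" using nloc_iff[OF M] maxD(4)[OF M] by blast
   have "(e M')\<^sup>2 * w M' / w M = (e M' / w M) * w M' * e M'" by (simp add: power2_eq_square)
   moreover have "(e M' / w M) * w M' \<in> loc M"
    by (rule O(6)[OF w(3)[OF M en] S_loc[OF M wS]]) (use M' in simp)
   ultimately show "(e M')\<^sup>2 * w M' / w M \<in> nloc M" using N(4) en by metis
  qed
  moreover have "(e M)\<^sup>2 \<in> S" "(e M)\<^sup>2 \<notin> M"
   using e(1)[OF M] M_mult_notin[OF M] maxD(6)[OF M _ e(2)[OF M]] S_rules(6)
   by (auto simp: power2_eq_square)
  moreover from this have "(e M)\<^sup>2 \<in> loc M" "(e M)\<^sup>2 \<notin> nloc M" using S_loc[OF M] nloc_iff[OF M] by auto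
  ultimately show ?thesis using O(5) N(1) N(7)[of "p / w M" "\<Sum>M'\<in>Maxs - {M}. (e M')\<^sup>2 * w M' / w M"] by auto
 qed
 have p0: "p \<noteq> 0"
 proof
  assume "p = 0"
  obtain M where M: "ismax S M" using ex_max by blast
  show False using main[OF M] nloc_rules(2)[OF M] \<open>p = 0\<close> by simp
 qed
 have "p \<in> M \<and> (\<forall>x\<in>nloc M. x / p \<in> loc M)" if M: "ismax S M" for M
 proof
  note O = loc_rules[OF M] and N = nloc_rules[OF M]
  have "p = (p / w M) * w M" using w(2)[OF M] by simp
  moreover have "w M \<in> nloc M" using nloc_iff[OF M] wS[OF M] w(1)[OF M] by blast
  ultimately have "p \<in> nloc M" using main[OF M] N(4) by metis
  thus "p \<in> M" using nloc_iff[OF M pS] by blast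
  have iw: "inverse (p / w M) \<in> loc M" using main[OF M] unit_inverse[OF loc_val[OF M]] by blast
  show "\<forall>x\<in>nloc M. x / p \<in> loc M"
  proof
   fix x assume "x \<in> nloc M"
   hence "(x / w M) * inverse (p / w M) \<in> loc M" using w(3)[OF M] iw O(6) by blast
   moreover have "(x / w M) * inverse (p / w M) = x / p" using w(2)[OF M] by (simp add: field_simps)
   ultimately show "x / p \<in> loc M" by metis
  qed
 qed
 thus ?thesis using pS p0 by blast
qed

lemma trivial_val:
 assumes "JV = {0}"
 shows "V = F" "S = UNIV" "ismax S M ==> M = {0}"
proof -
 show VF: "V = F"
 proof (rule antisym[OF V_F], rule subsetI)
  fix x assume x: "x \<in> F"
  show "x \<in> V"
  proof (rule ccontr)
   assume n: "x \<notin> V"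
   hence x0: "x \<noteq> 0" using V_rules(2) by blast
   hence "inverse x \<in> JV" using V_val[OF x x0] n by (simp add: nonunits_def)
   thus False using assms x0 by simp
  qed
 qed
 show SU: "S = UNIV"
 proof (rule antisym, simp, rule subsetI)
  fix x :: 'k
  obtain v where v: "v \<in> V" "v \<noteq> 0" "v * x \<in> S" using K_frac by blast
  have "inverse v \<in> S" using v VF F_inverse V_S by auto
  hence "inverse v * (v * x) \<in> S" using v(3) S_rules(6) by blast
  thus "x \<in> S" using v(2) by (simp add: field_simps)
 qed
 show "M = {0}" if M: "ismax S M"
 proof -
  have "x = 0" if "x \<in> M" for x
  proof (rule ccontr)
   assume "x \<noteq> 0"
   hence "inverse x * x = 1" by simp
   moreover have "inverse x * x \<in> M" using M_rules(4)[OF M _ that] SU by blast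
   ultimately show False using maxD(2)[OF M] by simp
  qed
  thus ?thesis using M_rules(2)[OF M] by blast
 qed
qed

section \<open>Squares of maximal ideals\<close>

abbreviation sq where "sq M \<equiv> ideal_prod (subR S) M M"

lemma sq_ideal: "ismax S M ==> is_ideal S (sq M)"
proof -
 assume M: "ismax S M"
 interpret cring "subR S" by (rule cring_subR[OF S_subring])
 have "ideal M (subR S)" using maxD(1)[OF M] is_ideal_iff_ideal[OF S_subring] by blast
 thus ?thesis using ideal_prod_is_ideal is_ideal_iff_ideal[OF S_subring] by blast
qed

lemma sq_gal:
 assumes M: "ismax S M" and s: "si \<in> G" and x: "x \<in> sq M"
 shows "si x \<in> sq (si ` M)"
 using x
proof (induct rule: ideal_prod.induct)
 case (prod i j)
 have "si i \<otimes>\<^bsub>subR S\<^esub> si j \<in> sq (si ` M)" using prod by (intro ideal_prod.prod) auto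
 thus ?case by (simp add: gal_simps[OF s])
next
 case (sum a b)
 thus ?case using ideal_prod.sum[of "si a" "subR S" "si ` M" "si ` M" "si b"] by (simp add: gal_simps[OF s])
qed

end

text \<open>\<open>w\<close> generates the maximal ideal of every localization at once. Divisibility
  by \<open>w\<close> then expresses membership in \<open>JS\<close>, and divisibility by its square
  membership in \<open>sq M\<close>.\<close>

locale val_ext_unif = val_ext F V S for F V S :: "'k::field set" +
 fixes w :: 'k
 assumes w_S: "w \<in> S" and w_nz: "w \<noteq> 0" and w_M: "\<And>M. ismax S M ==> w \<in> M"
  and w_div: "\<And>M x. ismax S M ==> x \<in> nloc M ==> x / w \<in> loc M"
begin

lemma w_nloc: "ismax S M ==> w \<in> nloc M"
 using nloc_iff w_S w_M by blast

lemma nloc_w: "ismax S M ==> x \<in> nloc M \<longleftrightarrow> x / w \<in> loc M"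
proof
 assume M: "ismax S M" and x: "x / w \<in> loc M"
 have "(x / w) * w \<in> nloc M" using nloc_rules(4)[OF M x w_nloc[OF M]] .
 thus "x \<in> nloc M" using w_nz by simp
qed (rule w_div)

lemma JS_w: "x \<in> JS \<longleftrightarrow> x / w \<in> S"
proof
 assume "x \<in> JS"
 thus "x / w \<in> S" using w_div nloc_iff by (intro mem_S_if_loc) (auto simp: JS_def)
next
 assume x: "x / w \<in> S"
 have "w \<in> JS" using w_S w_M by (simp add: JS_def)
 hence "(x / w) * w \<in> JS" using x JS_rules(4) by blast
 thus "x \<in> JS" using w_nz by simp
qed

lemma sq_w:
 assumes M: "ismax S M" and x: "x \<in> S"
 shows "x \<in> sq M \<longleftrightarrow> x / w\<^sup>2 \<in> loc M"
proof
 note O = loc_rules[OF M] and N = nloc_rules[OF M]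
 assume "x \<in> sq M"
 thus "x / w\<^sup>2 \<in> loc M"
 proof (induct rule: ideal_prod.induct)
  case (prod i j)
  hence "i / w \<in> loc M" "j / w \<in> loc M"
   using w_div[OF M] nloc_iff[OF M] maxD(4)[OF M] by auto
  hence "(i / w) * (j / w) \<in> loc M" using O(6) by blast
  thus ?case by (simp add: power2_eq_square)
 next
  case (sum a b) thus ?case using O(5) by (simp add: add_divide_distrib)
 qed
next
 assume "x / w\<^sup>2 \<in> loc M"
 then obtain t where t: "t \<in> S" "t \<notin> M" "x / w\<^sup>2 * t \<in> S" using loc_num[OF M] by blast
 define s where "s = x / w\<^sup>2 * t"
 have s: "s \<in> S" "x * t = s * w * w" using t w_nz by (auto simp: s_def power2_eq_square)
 obtain u where u: "u \<in> S" "1 - u * t \<in> M" using maxD(3)[OF M] t by blast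
 have i: "a * b \<in> sq M" if "a \<in> M" "b \<in> M" for a b
  using ideal_prod.prod[of a M b M "subR S"] that by simp
 have "x * (1 - u * t) \<in> M" using M_rules(4)[OF M] x u by blast
 hence "x * (1 - u * t) * (1 - u * t) \<in> sq M" using i u by blast
 moreover have "(2 * u - u * u * t) * s * w \<in> M"
 proof -
  have "2 * u - u * u * t = u + u - u * u * t" by simp
  moreover have "u + u - u * u * t \<in> S" by (intro S_rules(4-6) u t)
  ultimately show ?thesis using M_rules(4)[OF M _ w_M[OF M]] s S_rules(6) by metis
 qed
 hence "(2 * u - u * u * t) * s * w * w \<in> sq M" using i w_M[OF M] by blast
 \<comment> \<open>This is the identity \<open>1 = (1 - u t)^2 + (2 u - u^2 t) t\<close> multiplied
   by \<open>x\<close>, with \<open>x * t\<close> replaced by a multiple of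
   \<open>w * w\<close>.\<close>
 moreover have "x * (1 - u * t) * (1 - u * t) + (2 * u - u * u * t) * s * w * w = x"
 proof -
  have "(2 * u - u * u * t) * s * w * w = (2 * u - u * u * t) * (x * t)" unfolding s(2) by (simp add: mult.assoc)
  thus ?thesis by (simp add: algebra_simps)
 qed
 ultimately show "x \<in> sq M" using is_idealD(3)[OF S_subring sq_ideal[OF M]] by metis
qed

end

section \<open>The crossed product algebra\<close>

locale crossed = val_ext F V S for F V S :: "'k::field set" +
 fixes f :: "('k \<Rightarrow> 'k) \<Rightarrow> ('k \<Rightarrow> 'k) \<Rightarrow> 'k"
 assumes cocycle: "normalized_cocycle (gal F) S f"
begin

abbreviation iv :: "('k \<Rightarrow> 'k) \<Rightarrow> 'k \<Rightarrow> 'k" where "iv \<equiv> inv_into UNIV"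

lemma f_S: "si \<in> G ==> tu \<in> G ==> f si tu \<in> S"
 and f_nz: "si \<in> G ==> tu \<in> G ==> f si tu \<noteq> 0"
 and coc: "si \<in> G ==> tu \<in> G ==> \<gamma> \<in> G ==> si (f tu \<gamma>) * f si (tu \<circ> \<gamma>) = f si tu * f (si \<circ> tu) \<gamma>"
 and f_id [simp]: "si \<in> G ==> f id si = 1" "si \<in> G ==> f si id = 1"
 using cocycle by (auto simp: normalized_cocycle_def)

abbreviation CS where "CS \<equiv> {a :: ('k \<Rightarrow> 'k) \<Rightarrow> 'k. \<forall>si. si \<notin> G \<longrightarrow> a si = 0}"
abbreviation Sig where "Sig \<equiv> Sigma_f G f"
abbreviation mul where "mul \<equiv> cp_mult G f"

definition one :: "('k \<Rightarrow> 'k) \<Rightarrow> 'k" where "one = (\<lambda>si. if si = id then 1 else 0)"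
definition sm :: "'k \<Rightarrow> (('k \<Rightarrow> 'k) \<Rightarrow> 'k) \<Rightarrow> ('k \<Rightarrow> 'k) \<Rightarrow> 'k" where "sm c a = (\<lambda>rh. c * a rh)"
definition xs :: "('k \<Rightarrow> 'k) \<Rightarrow> 'k \<Rightarrow> ('k \<Rightarrow> 'k) \<Rightarrow> 'k" where "xs si s = (\<lambda>rh. if rh = si then s else 0)"

lemma Sig_simps [simp]:
 "carrier Sig = CS" "monoid.mult Sig = mul" "monoid.one Sig = one" "ring.zero Sig = (\<lambda>_. 0)"
 "ring.add Sig = (\<lambda>a b si. a si + b si)"
 by (auto simp: Sigma_f_def one_def)

lemma emb_one: "emb c = sm c one"
 by (auto simp: emb_def sm_def one_def)

lemma mul_CS: "mul a b \<in> CS" by (auto simp: cp_mult_def)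

lemma one_CS: "one \<in> CS" using id_in_G by (auto simp: one_def)

lemma sm_CS: "a \<in> CS ==> sm c a \<in> CS" by (auto simp: sm_def)

text \<open>The matrix of left multiplication by \<open>a\<close> on the right
  \<open>K\<close>-module with basis \<open>x_sigma\<close>. Since
  \<open>x_sigma k = sigma(k) x_sigma\<close>, moving scalars to the right produces the outer
  \<open>iv si\<close>. The column at \<open>id\<close> recovers \<open>a\<close>, so identities can
  be checked on matrices.\<close>

definition Q :: "(('k \<Rightarrow> 'k) \<Rightarrow> 'k) \<Rightarrow> ('k \<Rightarrow> 'k) \<Rightarrow> ('k \<Rightarrow> 'k) \<Rightarrow> 'k" where
 "Q a si rh = iv si (a (si \<circ> iv rh) * f (si \<circ> iv rh) rh)"

lemma Q_id: "si \<in> G ==> Q a si id = iv si (a si)"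
 by (simp add: Q_def)

lemma Q_inj:
 assumes "a \<in> CS" "b \<in> CS" "\<And>si. si \<in> G ==> Q a si id = Q b si id"
 shows "a = b"
proof
 fix si show "a si = b si"
 proof (cases "si \<in> G")
  case True
  thus ?thesis using assms(3)[OF True] by (simp add: Q_id gal_simps(11))
 qed (use assms in auto)
qed

lemma Q_mult:
 assumes s: "si \<in> G" and r: "rh \<in> G"
 shows "Q (mul a b) si rh = fmul G (Q a) (Q b) si rh"
proof -
 \<comment> \<open>The substitution turns the summation index of the matrix product into that of the
   crossed product; the cocycle identity then matches the two sums term by term.\<close>
 have b: "bij_betw (\<lambda>\<kappa>. iv \<kappa> \<circ> si) G G"
  by (rule bij_betw_byWitness[where f' = "\<lambda>ap. si \<circ> iv ap"]) (use s in \<open>auto simp: comp_assoc\<close>)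
 have "fmul G (Q a) (Q b) si rh = (\<Sum>ap\<in>G. Q a si (iv ap \<circ> si) * Q b (iv ap \<circ> si) rh)"
  unfolding fmul_def using sum.reindex_bij_betw[OF b, of "\<lambda>\<kappa>. Q a si \<kappa> * Q b \<kappa> rh"] by simp
 also have "\<dots> = (\<Sum>ap\<in>G. iv si (a ap * ap (b (iv ap \<circ> (si \<circ> iv rh))) * f ap (iv ap \<circ> (si \<circ> iv rh)) * f (si \<circ> iv rh) rh))"
 proof (rule sum.cong[OF refl])
  fix ap assume a: "ap \<in> G"
  let ?b = "iv ap \<circ> (si \<circ> iv rh)"
  have c: "ap (f ?b rh) * f ap (iv ap \<circ> si) = f ap ?b * f (si \<circ> iv rh) rh"
   using coc[OF a, of ?b rh] a s r by (simp add: comp_assoc)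
  have "Q a si (iv ap \<circ> si) = iv si (a ap * f ap (iv ap \<circ> si))"
   using a s by (simp add: Q_def comp_assoc)
  moreover have "Q b (iv ap \<circ> si) rh = iv si (ap (b ?b * f ?b rh))"
   using a s r by (simp add: Q_def comp_assoc)
  ultimately have "Q a si (iv ap \<circ> si) * Q b (iv ap \<circ> si) rh = iv si (a ap * f ap (iv ap \<circ> si) * ap (b ?b * f ?b rh))"
   by (simp add: gal_simps(4)[OF inv_in_G[OF s]])
  also have "a ap * f ap (iv ap \<circ> si) * ap (b ?b * f ?b rh) = a ap * ap (b ?b) * (ap (f ?b rh) * f ap (iv ap \<circ> si))"
   by (simp add: gal_simps(4)[OF a])
  also have "\<dots> = a ap * ap (b ?b) * f ap ?b * f (si \<circ> iv rh) rh"
   unfolding c by (simp add: mult.assoc)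
  finally show "Q a si (iv ap \<circ> si) * Q b (iv ap \<circ> si) rh = iv si (a ap * ap (b ?b) * f ap ?b * f (si \<circ> iv rh) rh)" .
 qed
 also have "\<dots> = iv si ((\<Sum>ap\<in>G. a ap * ap (b (iv ap \<circ> (si \<circ> iv rh))) * f ap (iv ap \<circ> (si \<circ> iv rh))) * f (si \<circ> iv rh) rh)"
  by (simp only: gal_sum[OF inv_in_G[OF s], symmetric] sum_distrib_right)
 also have "\<dots> = Q (mul a b) si rh"
  using s r by (simp add: Q_def cp_mult_def)
 finally show ?thesis by simp
qed

lemma Q_one: "si \<in> G ==> rh \<in> G ==> Q one si rh = fone si rh"
proof -
 assume s: "si \<in> G" and r: "rh \<in> G"
 have "si \<circ> iv rh = id \<longleftrightarrow> si = rh"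
 proof
  assume "si \<circ> iv rh = id"
  hence "si \<circ> iv rh \<circ> rh = rh" by simp
  thus "si = rh" using r by (simp add: comp_assoc)
 qed (use r in simp)
 thus ?thesis using r by (auto simp: Q_def one_def fone_def gal_simps[OF inv_in_G[OF s]] gal_simps[OF inv_in_G[OF r]])
qed

lemma Q_add: "si \<in> G ==> Q (\<lambda>rh. a rh + b rh) si rh = Q a si rh + Q b si rh"
 by (simp add: Q_def distrib_right gal_simps(3)[OF inv_in_G])

lemma Q_sm: "si \<in> G ==> c \<in> F ==> Q (sm c a) si rh = c * Q a si rh"
 using gal_simps(4,12)[OF inv_in_G, of si] by (simp add: Q_def sm_def mult.assoc)

text \<open>Associativity is inherited from matrix multiplication; the cocycle identity has entered
  through \<open>Q_mult\<close>.\<close>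

lemma mul_assoc: "mul (mul a b) c = mul a (mul b c)"
proof (rule Q_inj)
 fix si assume s: "si \<in> G"
 have "Q (mul (mul a b) c) si id = fmul G (fmul G (Q a) (Q b)) (Q c) si id"
  unfolding Q_mult[OF s id_in_G] fmul_def[of G _ "Q c"] using s Q_mult by (intro sum.cong) auto
 also have "\<dots> = fmul G (Q a) (fmul G (Q b) (Q c)) si id" by (simp add: fmul_assoc)
 also have "\<dots> = Q (mul a (mul b c)) si id"
  unfolding Q_mult[OF s id_in_G] fmul_def[of G "Q a"] using s Q_mult by (intro sum.cong) auto
 finally show "Q (mul (mul a b) c) si id = Q (mul a (mul b c)) si id" .
qed (rule mul_CS)+

lemma mul_one_left: "a \<in> CS ==> mul one a = a"
proof (rule Q_inj[OF mul_CS])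
 fix si assume s: "si \<in> G"
 have "Q (mul one a) si id = fmul G fone (Q a) si id"
  unfolding Q_mult[OF s id_in_G] fmul_def using s Q_one by (intro sum.cong) auto
 thus "Q (mul one a) si id = Q a si id" using fmul_one_left[OF finite_G s] by simp
qed

lemma mul_one_right: "a \<in> CS ==> mul a one = a"
proof (rule Q_inj[OF mul_CS])
 fix si assume s: "si \<in> G"
 have "Q (mul a one) si id = fmul G (Q a) fone si id"
  unfolding Q_mult[OF s id_in_G] fmul_def using s Q_one by (intro sum.cong) auto
 thus "Q (mul a one) si id = Q a si id" using fmul_one_right[OF finite_G id_in_G] by simp
qed

lemma mul_add_left: "mul (\<lambda>si. a si + b si) c = (\<lambda>si. mul a c si + mul b c si)"
 by (auto simp: cp_mult_def fun_eq_iff distrib_right sum.distrib)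

lemma mul_add_right: "mul c (\<lambda>si. a si + b si) = (\<lambda>si. mul c a si + mul c b si)"
proof -
 have "c si * si (a x + b x) * y = c si * si (a x) * y + c si * si (b x) * y" if "si \<in> G" for si x y
  by (simp add: gal_simps[OF that] algebra_simps)
 thus ?thesis by (auto simp: cp_mult_def fun_eq_iff sum.distrib)
qed

lemma mul_zero: "mul a (\<lambda>_. 0) = (\<lambda>_. 0)" "mul (\<lambda>_. 0) a = (\<lambda>_. 0)"
 by (auto simp: cp_mult_def fun_eq_iff gal_simps(1) intro!: sum.neutral)

lemma mul_sm_left: "mul (sm c a) b = sm c (mul a b)"
 by (auto simp: cp_mult_def fun_eq_iff sm_def sum_distrib_left mult.assoc)

lemma mul_sm_right:
 assumes "c \<in> F" shows "mul a (sm c b) = sm c (mul a b)"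
proof -
 have "(\<Sum>si\<in>G. a si * si (sm c b (iv si \<circ> rh)) * f si (iv si \<circ> rh))
   = (\<Sum>si\<in>G. c * (a si * si (b (iv si \<circ> rh)) * f si (iv si \<circ> rh)))" for rh
 proof (rule sum.cong[OF refl])
  fix si assume s: "si \<in> G"
  show "a si * si (sm c b (iv si \<circ> rh)) * f si (iv si \<circ> rh) = c * (a si * si (b (iv si \<circ> rh)) * f si (iv si \<circ> rh))"
   by (simp add: sm_def gal_simps(4)[OF s] gal_simps(12)[OF s assms])
 qed
 thus ?thesis by (auto simp: fun_eq_iff cp_mult_def sm_def[of c "\<lambda>rh. if rh \<in> G then _ rh else _ rh"] sum_distrib_left)
qed

lemma mul_emb_left: "b \<in> CS ==> mul (emb c) b = sm c b"
 by (simp add: emb_one mul_sm_left mul_one_left)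

lemma mul_emb_right: "b \<in> CS ==> c \<in> F ==> mul b (emb c) = sm c b"
 by (simp add: emb_one mul_sm_right mul_one_right)

lemma mul_sum_left: "mul (\<lambda>rh. \<Sum>i\<in>A. g i rh) b = (\<lambda>rh. \<Sum>i\<in>A. mul (g i) b rh)"
proof (induct A rule: infinite_finite_induct)
 case (insert x A) thus ?case by (simp add: mul_add_left)
qed (auto simp: mul_zero)

lemma mul_sum_right: "mul b (\<lambda>rh. \<Sum>i\<in>A. g i rh) = (\<lambda>rh. \<Sum>i\<in>A. mul b (g i) rh)"
proof (induct A rule: infinite_finite_induct)
 case (insert x A) thus ?case by (simp add: mul_add_right)
qed (auto simp: mul_zero)

lemma mul_minus_right: "mul b (\<lambda>rh. - a rh) = (\<lambda>rh. - mul b a rh)"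
proof -
 have "sm (- 1) a = (\<lambda>rh. - a rh)" for a by (simp add: sm_def)
 moreover have "- 1 \<in> F" using is_subringD[OF F_subring] by blast
 ultimately show ?thesis using mul_sm_right[of "- 1" b a] by metis
qed

lemma mul_minus_left: "mul (\<lambda>rh. - a rh) b = (\<lambda>rh. - mul a b rh)"
 using mul_sm_left[of "- 1" a b] by (simp add: sm_def)

lemma mul_xs_left: "si \<in> G ==> rh \<in> G ==> mul (xs si s) b rh = s * si (b (iv si \<circ> rh)) * f si (iv si \<circ> rh)"
proof -
 assume s: "si \<in> G" "rh \<in> G"
 have "mul (xs si s) b rh = (\<Sum>ap\<in>G. if ap = si then s * si (b (iv si \<circ> rh)) * f si (iv si \<circ> rh) else 0)"
  by (simp only: cp_mult_def if_True s xs_def) (rule sum.cong, auto)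
 thus ?thesis using s by simp
qed

lemma mul_xs_right:
 assumes s: "tu \<in> G" "rh \<in> G"
 shows "mul a (xs tu t) rh = a (rh \<circ> iv tu) * (rh \<circ> iv tu) t * f (rh \<circ> iv tu) tu"
proof -
 have e: "iv ap \<circ> rh = tu \<longleftrightarrow> ap = rh \<circ> iv tu" if "ap \<in> G" for ap
 proof
  assume "iv ap \<circ> rh = tu"
  hence "ap \<circ> tu \<circ> iv tu = rh \<circ> iv tu" using inv_comp(4)[OF that, of rh] by simp
  thus "ap = rh \<circ> iv tu" using s by (simp add: comp_assoc)
 qed (use s in \<open>simp add: comp_assoc\<close>)
 have "a ap * ap (xs tu t (iv ap \<circ> rh)) * f ap (iv ap \<circ> rh) = (if ap = rh \<circ> iv tu then a (rh \<circ> iv tu) * (rh \<circ> iv tu) t * f (rh \<circ> iv tu) tu else 0)"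
  if "ap \<in> G" for ap
  using e[OF that] by (auto simp: xs_def gal_simps(1)[OF that])
 hence "mul a (xs tu t) rh = (\<Sum>ap\<in>G. if ap = rh \<circ> iv tu then a (rh \<circ> iv tu) * (rh \<circ> iv tu) t * f (rh \<circ> iv tu) tu else 0)"
  using s by (simp add: cp_mult_def)
 thus ?thesis using s by simp
qed

lemma xs_CS: "si \<in> G ==> xs si s \<in> CS" by (auto simp: xs_def)

lemma mul_xs_xs:
 assumes s: "si \<in> G" "tu \<in> G"
 shows "mul (xs si s) (xs tu t) = xs (si \<circ> tu) (s * si t * f si tu)"
proof
 fix rh
 show "mul (xs si s) (xs tu t) rh = xs (si \<circ> tu) (s * si t * f si tu) rh"
 proof (cases "rh \<in> G")
  case True
  have "iv si \<circ> rh = tu \<longleftrightarrow> rh = si \<circ> tu"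
  proof
   assume "iv si \<circ> rh = tu"
   thus "rh = si \<circ> tu" using inv_comp(4)[OF s(1), of rh] by simp
  qed (use s in simp)
  thus ?thesis using True s by (auto simp: mul_xs_left) (auto simp: xs_def gal_simps(1)[OF s(1)])
 next
  case False
  hence "rh \<noteq> si \<circ> tu" using s by auto
  thus ?thesis using False by (simp add: cp_mult_def xs_def)
 qed
qed

lemma CS_decomp: "a \<in> CS ==> a = (\<lambda>rh. \<Sum>si\<in>G. xs si (a si) rh)"
proof
 fix rh assume a: "a \<in> CS"
 show "a rh = (\<Sum>si\<in>G. xs si (a si) rh)"
  using a by (cases "rh \<in> G") (auto simp: xs_def)
qed

lemma ring_Sig: "ring Sig"
proof (rule ringI)
 have "\<exists>y\<in>CS. (\<lambda>si. y si + x si) = (\<lambda>_. 0)" if "x \<in> CS" for x :: "('k \<Rightarrow> 'k) \<Rightarrow> 'k"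
  using that by (intro bexI[of _ "\<lambda>si. - x si"]) auto
 thus "abelian_group Sig" by (intro abelian_groupI) (auto simp: add_ac)
 show "Group.monoid Sig" by (rule Group.monoidI) (use mul_CS one_CS in \<open>auto simp: mul_assoc mul_one_left mul_one_right\<close>)
qed (auto simp: mul_add_left mul_add_right)

end

sublocale crossed \<subseteq> Sg: ring "Sigma_f (gal F) f" by (rule ring_Sig)

section \<open>Subrings of the crossed product and evaluation of polynomials\<close>

context crossed
begin

lemma minus_Sig: "a \<in> CS ==> \<ominus>\<^bsub>Sig\<^esub> a = (\<lambda>si. - a si)"
 by (rule Sg.minus_equality) auto

definition subB :: "(('k \<Rightarrow> 'k) \<Rightarrow> 'k) set \<Rightarrow> bool" where
 "subB B \<longleftrightarrow> B \<subseteq> CS \<and> one \<in> B \<and> (\<forall>a\<in>B. \<forall>b\<in>B. mul a b \<in> B) \<and> (\<forall>a\<in>B. \<forall>b\<in>B. (\<lambda>si. a si + b si) \<in> B) \<and>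
   (\<forall>a\<in>B. (\<lambda>si. - a si) \<in> B)"

lemma subB_iff: "subring B Sig \<longleftrightarrow> subB B"
proof
 assume s: "subring B Sig"
 have "B \<subseteq> CS" using subringE(1)[OF s] by simp
 moreover have "(\<lambda>si. - a si) \<in> B" if "a \<in> B" for a
  using subringE(5)[OF s that] minus_Sig[of a] that \<open>B \<subseteq> CS\<close> by auto
 ultimately show "subB B" using subringE(3,6,7)[OF s] by (auto simp: subB_def)
next
 assume s: "subB B"
 hence B: "B \<subseteq> CS" by (simp add: subB_def)
 show "subring B Sig"
 proof (rule Sg.subringI)
  show "\<ominus>\<^bsub>Sig\<^esub> h \<in> B" if "h \<in> B" for h
   using minus_Sig[of h] that s B by (auto simp: subB_def)
 qed (use s in \<open>auto simp: subB_def\<close>)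
qed

lemma subBD:
 assumes "subB B"
 shows "a \<in> B ==> a \<in> CS" "one \<in> B" "a \<in> B ==> b \<in> B ==> mul a b \<in> B"
  "a \<in> B ==> b \<in> B ==> (\<lambda>si. a si + b si) \<in> B" "a \<in> B ==> (\<lambda>si. - a si) \<in> B" "(\<lambda>_. 0) \<in> B"
  "a \<in> B ==> b \<in> B ==> (\<lambda>si. a si - b si) \<in> B"
proof -
 show "a \<in> B ==> a \<in> CS" and one: "one \<in> B" and "a \<in> B ==> b \<in> B ==> mul a b \<in> B"
  and add: "a \<in> B ==> b \<in> B ==> (\<lambda>si. a si + b si) \<in> B" and m: "a \<in> B ==> (\<lambda>si. - a si) \<in> B" for a b
  using assms unfolding subB_def by blast+
 show "(\<lambda>_. 0) \<in> B" using add[OF one m[OF one]] by simp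
 show "a \<in> B ==> b \<in> B ==> (\<lambda>si. a si - b si) \<in> B" using add[OF _ m, of a b] by simp
qed

lemma subB_sum:
 assumes "subB B" "\<And>i. i \<in> A ==> g i \<in> B"
 shows "(\<lambda>rh. \<Sum>i\<in>A. g i rh) \<in> B"
 using assms(2)
proof (induct A rule: infinite_finite_induct)
 case (insert x A) thus ?case using subBD(4)[OF assms(1), of "g x" "\<lambda>rh. \<Sum>i\<in>A. g i rh"] by simp
qed (use subBD(6)[OF assms(1)] in auto)

lemma ring_sub: "subB B ==> ring (subSig G f B)"
 using Sg.subring_is_ring subB_iff by simp

lemma sub_simps [simp]:
 "carrier (subSig G f B) = B" "monoid.mult (subSig G f B) = mul" "monoid.one (subSig G f B) = one"
 "ring.zero (subSig G f B) = (\<lambda>_. 0)" "ring.add (subSig G f B) = (\<lambda>a b si. a si + b si)"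
 by (auto simp: Sigma_f_def one_def)

lemma minus_sub: "subB B ==> a \<in> B ==> \<ominus>\<^bsub>subSig G f B\<^esub> a = (\<lambda>si. - a si)"
proof -
 assume B: "subB B" and a: "a \<in> B"
 interpret ring "subSig G f B" by (rule ring_sub[OF B])
 show ?thesis by (rule minus_equality) (use a subBD(5)[OF B a] in auto)
qed

lemma finsum_sub:
 assumes B: "subB B" and A: "finite A" "\<And>i. i \<in> A ==> g i \<in> B"
 shows "finsum (subSig G f B) g A = (\<lambda>rh. \<Sum>i\<in>A. g i rh)"
proof -
 interpret ring "subSig G f B" by (rule ring_sub[OF B])
 show ?thesis using A
 proof (induct A)
  case empty thus ?case by simp
 next
  case (insert x A)
  have "finsum (subSig G f B) g (insert x A) = g x \<oplus>\<^bsub>subSig G f B\<^esub> finsum (subSig G f B) g A"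
   by (rule finsum_insert) (use insert in auto)
  thus ?case using insert by simp
 qed
qed

lemma subB_CS: "subB CS"
 using mul_CS one_CS by (auto simp: subB_def)

lemma sub_CS: "subSig G f CS = Sig"
 by (simp add: Sigma_f_def)

lemma jac_sub_iff:
 assumes B: "subB B"
 shows "y \<in> jac (subSig G f B) \<longleftrightarrow> y \<in> B \<and> (\<forall>r\<in>B. \<exists>u\<in>B. mul u (\<lambda>si. one si - mul r y si) = one)"
proof -
 interpret ring "subSig G f B" by (rule ring_sub[OF B])
 have "one \<ominus>\<^bsub>subSig G f B\<^esub> mul r y = (\<lambda>si. one si - mul r y si)" if "r \<in> B" "y \<in> B" for r
  using minus_sub[OF B subBD(3)[OF B that]] by (simp add: a_minus_def)
 thus ?thesis unfolding jac_iff by auto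
qed

primrec pw :: "(('k \<Rightarrow> 'k) \<Rightarrow> 'k) \<Rightarrow> nat \<Rightarrow> ('k \<Rightarrow> 'k) \<Rightarrow> 'k" where
 "pw a 0 = one"
| "pw a (Suc n) = mul a (pw a n)"

lemma pw_CS: "pw a n \<in> CS" by (cases n) (use one_CS mul_CS in auto)

lemma pw_nat_pow: "a \<in> CS ==> a [^]\<^bsub>Sig\<^esub> n = pw a n"
proof (induct n)
 case (Suc n)
 have "a [^]\<^bsub>Sig\<^esub> Suc n = a \<otimes>\<^bsub>Sig\<^esub> a [^]\<^bsub>Sig\<^esub> n" by (rule Sg.nat_pow_Suc2) (use Suc in simp)
 thus ?case using Suc by simp
qed simp

lemma pw_sub: "subB B ==> a \<in> B ==> pw a n \<in> B"
 by (induct n) (auto intro: subBD)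

lemma Q_pw: "si \<in> G ==> rh \<in> G ==> Q (pw a n) si rh = fpow G (Q a) n si rh"
proof (induct n arbitrary: si rh)
 case (Suc n)
 have "Q (pw a (Suc n)) si rh = fmul G (Q a) (Q (pw a n)) si rh" using Q_mult[OF Suc(2,3)] by simp
 also have "\<dots> = fpow G (Q a) (Suc n) si rh"
  unfolding fpow.simps fmul_def using Suc by (intro sum.cong) auto
 finally show ?case .
qed (simp add: Q_one)

text \<open>Coefficients stand on the left and are taken from \<open>K\<close>. Multiplicativity is
  obtained over the fixed field \<open>F\<close>, whose elements are central; hence the side
  conditions in \<open>ev_pCons\<close> and \<open>ev_mult\<close>.\<close>

definition ev :: "(('k \<Rightarrow> 'k) \<Rightarrow> 'k) \<Rightarrow> 'k poly \<Rightarrow> ('k \<Rightarrow> 'k) \<Rightarrow> 'k" where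
 "ev a p = (\<lambda>rh. \<Sum>i\<le>degree p. coeff p i * pw a i rh)"

lemma ev_le: "degree p \<le> n ==> ev a p = (\<lambda>rh. \<Sum>i\<le>n. coeff p i * pw a i rh)"
 unfolding ev_def fun_eq_iff
 by (intro allI sum.mono_neutral_left) (auto simp: coeff_eq_0)

lemma ev_CS: "ev a p \<in> CS"
 using pw_CS[of a] by (auto simp: ev_def)

lemma ev_0: "ev a 0 = (\<lambda>_. 0)" by (simp add: ev_def)

lemma ev_add: "ev a (p + q) = (\<lambda>rh. ev a p rh + ev a q rh)"
proof -
 let ?n = "max (degree p) (degree q)"
 have "degree (p + q) \<le> ?n" by (rule degree_add_le_max)
 thus ?thesis by (simp add: ev_le[of _ ?n] sum.distrib distrib_right)
qed

lemma ev_smult: "ev a (smult c p) = sm c (ev a p)"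
 using ev_le[OF degree_smult_le] by (simp add: ev_def sm_def sum_distrib_left mult.assoc)

lemma ev_minus: "ev a (- p) = (\<lambda>rh. - ev a p rh)"
 using ev_smult[of a "- 1" p] by (simp add: sm_def)

lemma ev_pCons:
 assumes "\<And>i. coeff p i \<in> F"
 shows "ev a (pCons c p) = (\<lambda>rh. c * one rh + mul a (ev a p) rh)"
proof -
 have "ev a (pCons c p) = (\<lambda>rh. \<Sum>i\<le>Suc (degree p). coeff (pCons c p) i * pw a i rh)"
  by (rule ev_le) (rule degree_pCons_le)
 also have "\<dots> = (\<lambda>rh. c * one rh + (\<Sum>i\<le>degree p. sm (coeff p i) (mul a (pw a i)) rh))"
  by (simp add: sum.atMost_Suc_shift sm_def del: sum.atMost_Suc)
 also have "\<dots> = (\<lambda>rh. c * one rh + (\<Sum>i\<le>degree p. mul a (sm (coeff p i) (pw a i)) rh))"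
  using assms by (simp add: mul_sm_right)
 also have "(\<lambda>rh. \<Sum>i\<le>degree p. mul a (sm (coeff p i) (pw a i)) rh) = mul a (ev a p)"
  unfolding mul_sum_right[symmetric] ev_def sm_def ..
 hence "(\<lambda>rh. c * one rh + (\<Sum>i\<le>degree p. mul a (sm (coeff p i) (pw a i)) rh)) = (\<lambda>rh. c * one rh + mul a (ev a p) rh)"
  by (simp add: fun_eq_iff)
 finally show ?thesis .
qed

lemma ev_mult:
 assumes "\<And>i. coeff p i \<in> F" "\<And>i. coeff q i \<in> F"
 shows "ev a (p * q) = mul (ev a p) (ev a q)"
 using assms(1)
proof (induct p)
 case 0 thus ?case by (simp add: ev_0 mul_zero)
next
 case (pCons c p)
 have pF: "coeff p i \<in> F" for i using pCons(3)[of "Suc i"] by simp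
 have pqF: "coeff (p * q) i \<in> F" for i
  using is_subringD(6)[OF is_subring_polys[OF F_subring], of p q] pF assms(2) by auto
 have "ev a (pCons c p * q) = (\<lambda>rh. sm c (ev a q) rh + mul a (ev a (p * q)) rh)"
  by (simp add: ev_add ev_smult ev_pCons[OF pqF])
 also have "\<dots> = (\<lambda>rh. mul (sm c one) (ev a q) rh + mul (mul a (ev a p)) (ev a q) rh)"
  using pCons(2)[OF pF] by (simp add: mul_sm_left mul_one_left[OF ev_CS] mul_assoc)
 also have "\<dots> = mul (ev a (pCons c p)) (ev a q)"
  unfolding ev_pCons[OF pF] mul_add_left[symmetric] by (simp add: sm_def)
 finally show ?case .
qed

lemma ev_const: "ev a [:c:] = sm c one"
 by (simp add: ev_def sm_def)

lemma ev_monom: "ev a (monom 1 n) = pw a n"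
proof (induct n)
 case 0 thus ?case by (simp add: ev_const monom_0 sm_def)
next
 case (Suc n)
 have F: "coeff (monom 1 n) i \<in> F" for i using is_subringD[OF F_subring] by auto
 show ?case using ev_pCons[OF F, of a 0] Suc by (simp add: monom_Suc)
qed

lemma ev_sub:
 assumes B: "subB B" "emb ` V \<subseteq> B" and a: "a \<in> B" and p: "\<And>i. coeff p i \<in> V"
 shows "ev a p \<in> B"
 unfolding ev_def
proof (rule subB_sum[OF B(1)])
 fix i
 have "mul (emb (coeff p i)) (pw a i) \<in> B" using B p pw_sub[OF B(1) a] subBD(3)[OF B(1)] by blast
 thus "(\<lambda>rh. coeff p i * pw a i rh) \<in> B" using mul_emb_left[OF pw_CS] by (simp add: sm_def)
qed

section \<open>Integral equations and traces from characteristic polynomials\<close>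

definition intrel :: "'k set \<Rightarrow> (('k \<Rightarrow> 'k) \<Rightarrow> 'k) \<Rightarrow> 'k poly \<Rightarrow> bool" where
 "intrel I a p \<longleftrightarrow> lead_coeff p = 1 \<and> (\<forall>i<degree p. coeff p i \<in> I) \<and> ev a p = (\<lambda>_. 0)"

lemma intrel_split:
 assumes "lead_coeff p = 1"
 shows "ev a p rh = pw a (degree p) rh + (\<Sum>i<degree p. coeff p i * pw a i rh)"
 using assms by (simp add: ev_def lessThan_Suc_atMost[symmetric] add.commute)

text \<open>Conjugation by \<open>\<tau>\<close> turns the matrix \<open>Q a\<close> into a matrix similar to it, by the cocycle identity.\<close>
lemma Q_fcp_F: "coeff (fcp G (Q a)) i \<in> F"
proof (rule fixed_in_F)
 fix tu assume t: "tu \<in> G"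
 interpret h: comm_ring_hom tu by (rule gal_hom[OF t])
 let ?p = "\<lambda>si. si \<circ> iv tu"
 let ?d = "\<lambda>si. iv (?p si) (f (?p si) tu)"
 have "map_poly tu (fcp G (Q a)) = fcp G (\<lambda>x y. tu (Q a x y))"
  using fcp_hom[OF finite_G gal_hom[OF t], of "Q a"] by simp
 also have "\<dots> = fcp G (Q a)"
 proof (rule fcp_similar[OF finite_G, where p = ?p and d = ?d])
  show "bij_betw ?p G G" by (rule bij_right) (use t in simp)
  show "?d x \<noteq> 0" if "x \<in> G" for x
  proof -
   have "?p x \<in> G" using that t by simp
   thus ?thesis using f_nz t gal_simps(7)[OF inv_in_G] by blast
  qed
  fix si rh assume s: "si \<in> G" and r: "rh \<in> G"
  define s' where "s' = ?p si" define r' where "r' = ?p rh"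
  have s': "s' \<in> G" "si = s' \<circ> tu" and r': "r' \<in> G" "rh = r' \<circ> tu"
   using s r t by (auto simp: s'_def r'_def comp_assoc)
  let ?al = "s' \<circ> iv r'"
  have al: "?al \<in> G" using s' r' by simp
  note [simp] = gal_simps[OF inv_in_G[OF s'(1)]]
  have "tu (Q a si rh) = iv s' (a ?al * f ?al (r' \<circ> tu))"
   using s' r' t by (simp add: Q_def comp_assoc inv_app[OF t])
  \<comment> \<open>The cocycle identity for this triple compares the conjugated entry with the
    entry at the shifted indices; the correction factors are exactly \<open>?d si\<close> and
    \<open>?d rh\<close>.\<close>
  moreover have "?al (f r' tu) * f ?al (r' \<circ> tu) = f ?al r' * f s' tu"
   using coc[OF al r'(1) t] r' by (simp add: comp_assoc)
  hence "iv s' (?al (f r' tu) * f ?al (r' \<circ> tu)) = iv s' (f ?al r' * f s' tu)" by simp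
  hence "iv r' (f r' tu) * iv s' (f ?al (r' \<circ> tu)) = iv s' (f ?al r') * iv s' (f s' tu)"
   using s' by (simp add: inv_app[OF s'(1)])
  moreover have "iv r' (f r' tu) \<noteq> 0" using r' t f_nz gal_simps(7)[OF inv_in_G[OF r'(1)]] by blast
  ultimately show "tu (Q a si rh) = ?d si * Q a (?p si) (?p rh) / ?d rh"
   unfolding s'_def[symmetric] r'_def[symmetric] by (simp add: Q_def field_simps)
 qed
 finally have "map_poly tu (fcp G (Q a)) = fcp G (Q a)" .
 thus "tu (coeff (fcp G (Q a)) i) = coeff (fcp G (Q a)) i"
  by (metis coeff_map_poly h.hom_zero)
qed

lemma ev_fcp: "ev a (fcp G (Q a)) = (\<lambda>_. 0)"
proof (rule Q_inj[OF ev_CS])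
 show "(\<lambda>_. 0) \<in> CS" by simp
 fix si assume s: "si \<in> G"
 have "Q (\<lambda>rh. \<Sum>i\<in>A. coeff (fcp G (Q a)) i * pw a i rh) si id = (\<Sum>i\<in>A. coeff (fcp G (Q a)) i * fpow G (Q a) i si id)" for A
 proof (induct A rule: infinite_finite_induct)
  case (insert x A)
  have "Q (\<lambda>rh. coeff (fcp G (Q a)) x * pw a x rh) si id = coeff (fcp G (Q a)) x * fpow G (Q a) x si id"
   using Q_sm[OF s Q_fcp_F, of a x "pw a x" id] Q_pw[OF s id_in_G] by (simp add: sm_def)
  thus ?case using insert(3) by (simp only: sum.insert[OF insert(1,2)] Q_add[OF s])
 qed (auto simp: Q_def gal_simps(1)[OF inv_in_G[OF s]])
 thus "Q (ev a (fcp G (Q a))) si id = Q (\<lambda>_. 0) si id"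
  unfolding ev_def fcp_monic(1)[OF finite_G]
  using fcp_cayley_hamilton[OF finite_G s id_in_G] by (simp add: Q_def gal_simps(1)[OF inv_in_G[OF s]])
qed

text \<open>The hypothesis says that left multiplication by \<open>a\<close> preserves the right
  \<open>loc M\<close>-lattice with basis \<open>x_sigma d_sigma\<close>. One maximal ideal is
  enough because the characteristic polynomial has coefficients in \<open>F\<close>, and
  \<open>F\<close> meets \<open>loc M\<close> in \<open>V\<close>.\<close>

lemma integral_if_lattice:
 assumes M: "ismax S M" and d: "\<And>si. si \<in> G ==> d si \<noteq> 0"
  and O: "\<And>si rh. si \<in> G ==> rh \<in> G ==> Q a si rh * d rh / d si \<in> loc M"
 shows "\<exists>p. intrel V a p"
proof -
 have e: "fcp G (Q a) = fcp G (\<lambda>si rh. Q a si rh * d rh / d si)"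
  by (rule fcp_similar[OF finite_G, where p = id and d = d]) (use d in auto)
 have "coeff (fcp G (Q a)) i \<in> loc M" for i
  unfolding e by (rule fcp_coeff_in_subring[OF finite_G loc_subring[OF M]]) (rule O)
 hence "coeff (fcp G (Q a)) i \<in> V" for i using loc_int_F[OF M _ Q_fcp_F] by blast
 hence "intrel V a (fcp G (Q a))"
  unfolding intrel_def using fcp_monic[OF finite_G, of "Q a"] ev_fcp by simp
 thus ?thesis by blast
qed

lemma integral_over_JV:
 assumes M: "ismax S M" and O: "\<And>si rh. si \<in> G ==> rh \<in> G ==> Q a si rh \<in> nloc M"
 shows "\<exists>p. intrel JV a p"
proof -
 have "coeff (fcp G (Q a)) i \<in> nloc M" if "i < card G" for i
  by (rule fcp_coeff_in_ideal[OF finite_G loc_subring[OF M] nonunits_ideal[OF loc_val[OF M]] O that])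
 hence "coeff (fcp G (Q a)) i \<in> JV" if "i < card G" for i using nloc_int_F[OF M Q_fcp_F] that by blast
 hence "intrel JV a (fcp G (Q a))"
  unfolding intrel_def using fcp_monic[OF finite_G, of "Q a"] ev_fcp by simp
 thus ?thesis by blast
qed

text \<open>Such an \<open>a\<close> is nilpotent modulo \<open>JV\<close>. Its characteristic
  polynomial divides a power of \<open>g\<close>, so the lower coefficients are non-units. The one
  next to the top is minus the trace of \<open>Q a\<close>, and the diagonal of \<open>Q a\<close>
  consists of the conjugates of \<open>a id\<close>.\<close>

lemma trace_in_JV:
 assumes a: "a \<in> CS" and g: "intrel JV a g"
 shows "Tr (a id) \<in> JV"
proof -
 obtain M where M: "ismax S M" using ex_max by blast
 note N = nloc_rules[OF M]
 have lg: "lead_coeff g = 1" and gJ: "\<And>i. i < degree g ==> coeff g i \<in> JV" and ga: "ev a g = (\<lambda>_. 0)"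
  using g by (auto simp: intrel_def)
 have gF: "coeff g i \<in> F" for i
  using gJ[of i] lg V_F is_subringD[OF F_subring] coeff_eq_0[of g i]
  by (cases i "degree g" rule: linorder_cases) (auto simp: nonunits_def)
 let ?m = "degree g" and ?n = "card G" and ?X = "fcp G (Q a)"
 have "(\<Sum>i\<le>?m. coeff g i * fpow G (Q a) i si rh) = 0" if s: "si \<in> G" "rh \<in> G" for si rh
 proof -
  have "Q (\<lambda>rh. \<Sum>i\<in>A. coeff g i * pw a i rh) si rh = (\<Sum>i\<in>A. coeff g i * fpow G (Q a) i si rh)" for A
  proof (induct A rule: infinite_finite_induct)
   case (insert x A)
   have "Q (\<lambda>rh. coeff g x * pw a x rh) si rh = coeff g x * fpow G (Q a) x si rh"
    using Q_sm[OF s(1) gF, of x "pw a x" rh] Q_pw[OF s] by (simp add: sm_def)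
   thus ?case using insert Q_add[OF s(1)] by simp
  qed (auto simp: Q_def gal_simps(1)[OF inv_in_G[OF s(1)]])
  from this[of "{..?m}"] show ?thesis
   using ga unfolding ev_def by (simp add: Q_def gal_simps(1)[OF inv_in_G[OF s(1)]])
 qed
 hence "?X dvd g ^ ?n" by (intro fcp_dvd_power[OF finite_G]) auto
 then obtain q where q: "g ^ ?n = ?X * q" unfolding dvd_def by blast
 have lX: "lead_coeff ?X = 1" "degree ?X = ?n" using fcp_monic[OF finite_G, of "Q a"] by auto
 have "lead_coeff (g ^ ?n) = 1" using lg by (simp add: lead_coeff_power)
 hence lq: "lead_coeff q = 1" using lX unfolding q lead_coeff_mult by simp
 have nz: "?X \<noteq> 0" "q \<noteq> 0" "g \<noteq> 0" using lX lq lg by auto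
 have deg: "degree ?X + degree q = ?n * ?m"
  using nz by (simp add: degree_mult_eq[symmetric] q[symmetric] degree_power_eq)
 have low: "coeff (?X * q) i \<in> nloc M" if "i < degree ?X + degree q" for i
 proof -
  have "(\<Prod>j<?n. g) - (\<Prod>j<?n. monom 1 ?m) \<in> {p. \<forall>i. coeff p i \<in> JV}"
  proof (rule prod_diff_in_ideal[OF is_subring_polys[OF V_subring] is_ideal_polys[OF V_subring JV_ideal]])
   have gV: "coeff g i \<in> V" for i
    using gJ[of i] lg V_rules coeff_eq_0[of g i]
    by (cases i "degree g" rule: linorder_cases) (auto simp: nonunits_def)
   thus "g \<in> {p. \<forall>i. coeff p i \<in> V}" by simp
   show "monom 1 ?m \<in> {p. \<forall>i. coeff p i \<in> V}" using V_rules by simp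
   have "coeff (g - monom 1 ?m) i \<in> JV" for i
    using gJ[of i] lg JV_rules(2) coeff_eq_0[of g i]
    by (cases i "degree g" rule: linorder_cases) auto
   thus "g - monom 1 ?m \<in> {p. \<forall>i. coeff p i \<in> JV}" by simp
  qed
  hence "coeff (g ^ ?n - monom 1 (?m * ?n)) i \<in> JV" by (simp add: monom_power)
  moreover have "coeff (monom (1::'k) (?m * ?n)) i = 0" using that deg by (simp add: mult.commute)
  ultimately have J: "coeff (?X * q) i \<in> JV" by (simp add: q[symmetric])
  hence "coeff (?X * q) i \<in> F" using V_F by (auto simp: nonunits_def)
  thus ?thesis using nloc_int_F[OF M] J by blast
 qed
 have "coeff ?X (?n - 1) \<in> nloc M"
  by (rule monic_factor_of_power_mod_nonunits[OF loc_val[OF M] lX(1) lq low]) (use lX card_G_pos in auto)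
 hence c: "coeff ?X (?n - 1) \<in> JV" using nloc_int_F[OF M Q_fcp_F] by blast
 have "coeff ?X (?n - 1) = - (\<Sum>si\<in>G. Q a si si)" by (rule fcp_trace) (auto simp: G_nonempty)
 also have "(\<Sum>si\<in>G. Q a si si) = (\<Sum>si\<in>G. iv si (a id))" by (rule sum.cong) (auto simp: Q_def)
 also have "\<dots> = Tr (a id)" unfolding Tr_def using sum.reindex_bij_betw[OF bij_inv, of "\<lambda>si. si (a id)"] by simp
 finally show ?thesis using c JV_rules(6) by fastforce
qed

text \<open>If the lowest unit coefficient of an integral equation of \<open>y\<close> sits in degree \<open>j\<close>, then quasi-regularity
  makes \<open>y ^ (j + 1)\<close> divisible by the generator of \<open>J(V)\<close>, and one substitutes into an equation of the quotient.\<close>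
lemma jac_integral_over_JV:
 assumes B: "subB B" "emb ` V \<subseteq> B" and int: "\<And>b. b \<in> B ==> \<exists>p. intrel V b p"
  and y: "y \<in> jac (subSig G f B)" and pi: "JV = {\<pi> * v | v. v \<in> V}"
 shows "\<exists>p. intrel JV y p"
proof -
 have yB: "y \<in> B" and yu: "\<And>r. r \<in> B ==> \<exists>u\<in>B. mul u (\<lambda>si. one si - mul r y si) = one"
  using y unfolding jac_sub_iff[OF B(1)] by auto
 have smB: "sm v b \<in> B" if "v \<in> V" "b \<in> B" for v b
 proof -
  have "emb v \<in> B" using B(2) that(1) by blast
  hence "mul (emb v) b \<in> B" using subBD(3)[OF B(1)] that(2) by blast
  thus ?thesis using mul_emb_left[OF subBD(1)[OF B(1) that(2)]] by simp
 qed
 obtain g where g: "lead_coeff g = 1" "\<And>i. i < degree g ==> coeff g i \<in> V" "ev y g = (\<lambda>_. 0)"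
  using int[OF yB] by (auto simp: intrel_def)
 have gV: "coeff g i \<in> V" for i
  using g(1) g(2)[of i] V_rules coeff_eq_0[of g i] by (cases i "degree g" rule: linorder_cases) auto
 \<comment> \<open>\<open>j\<close> exists because the leading coefficient is 1. Below
   \<open>j\<close> the polynomial \<open>g\<close> is \<pi> times \<open>p2\<close>; from
   \<open>j\<close> on it is \<open>X ^ j * h\<close>, where \<open>h\<close> has the unit
   \<open>c\<close> as constant term.\<close>
 define j where "j = (LEAST j. coeff g j \<notin> JV)"
 have "coeff g (degree g) \<notin> JV" using g(1) V_rules(1) by (simp add: nonunits_def)
 hence j: "coeff g j \<notin> JV" unfolding j_def by (rule LeastI)
 have jl: "coeff g i \<in> JV" if "i < j" for i using that not_less_Least unfolding j_def by blast
 define c where "c = coeff g j"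
 have c: "c \<in> V" "c \<noteq> 0" "inverse c \<in> V" using j gV[of j] by (auto simp: c_def nonunits_def)
 have "\<exists>v\<in>V. coeff g i = \<pi> * v" if "i < j" for i using jl[OF that] pi by blast
 then obtain v where v: "\<And>i. i < j ==> v i \<in> V" "\<And>i. i < j ==> coeff g i = \<pi> * v i" by metis
 define p2 where "p2 = (\<Sum>i<j. monom (v i) i)"
 define h where "h = poly_shift j g"
 have hc: "coeff h i = coeff g (i + j)" for i by (simp add: h_def coeff_poly_shift)
 have geq: "g = smult \<pi> p2 + monom 1 j * h"
  by (rule poly_eqI) (auto simp: p2_def coeff_sum coeff_monom_mult hc v not_less)
 \<comment> \<open>\<open>r\<close> is chosen to give \<open>h = c * (1 - X * r)\<close>. At
   \<open>y\<close> the second factor becomes one minus a left multiple of \<open>y\<close>, which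
   has a left inverse \<open>u\<close> because \<open>y\<close> is in the radical.\<close>
 define r where "r = smult (- inverse c) (poly_shift 1 h)"
 have heq: "h = smult c (1 - pCons 0 r)"
 proof (rule poly_eqI)
  fix i
  have "coeff h 0 = c" by (simp add: hc c_def)
  thus "coeff h i = coeff (smult c (1 - pCons 0 r)) i"
   using c(2) by (cases i) (auto simp: r_def coeff_poly_shift)
 qed
 have p2V: "coeff p2 i \<in> V" for i
  unfolding p2_def coeff_sum by (rule is_subring_sum[OF V_subring]) (use v(1) V_rules in auto)
 have rV: "coeff r i \<in> V" for i using c gV V_rules(3,6) by (auto simp: r_def coeff_poly_shift hc)
 have FV: "x \<in> V ==> x \<in> F" for x using V_F by blast
 have kF: "coeff (1 - pCons 0 r) i \<in> F" for i
  using rV V_rules FV by (auto simp: coeff_pCons split: nat.splits)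
 have mF: "coeff (monom 1 n) i \<in> F" for n i using is_subringD[OF F_subring] by auto
 have ry: "mul (ev y r) y = ev y (pCons 0 r)"
 proof -
  have "ev y [:0,1:] = y" using ev_monom[of y 1] subBD(1)[OF B(1) yB] by (simp add: monom_Suc monom_0 mul_one_right)
  moreover have "pCons 0 r = r * [:0,1:]" by simp
  ultimately show ?thesis using ev_mult[of r "[:0,1:]" y] rV FV is_subringD[OF F_subring]
   by (auto simp: coeff_pCons split: nat.splits)
 qed
 obtain u where u: "u \<in> B" "mul u (\<lambda>si. one si - mul (ev y r) y si) = one"
  using yu[OF ev_sub[OF B yB rV]] by blast
 have "ev y 1 = one" using ev_monom[of y 0] by (simp add: monom_0 one_pCons)
 hence "(\<lambda>si. one si - mul (ev y r) y si) = ev y (1 - pCons 0 r)"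
  unfolding diff_conv_add_uminus[of "1::'k poly"] ev_add ev_minus ry by simp
 hence uk: "mul u (ev y (1 - pCons 0 r)) = one" using u(2) by simp
 have rel: "ev y (monom 1 j * h) = sm (- \<pi>) (ev y p2)"
 proof -
  have "(\<lambda>rh. sm \<pi> (ev y p2) rh + ev y (monom 1 j * h) rh) = (\<lambda>_. 0)"
   using g(3) ev_add[of y "smult \<pi> p2" "monom 1 j * h"] geq by (simp add: ev_smult)
  thus ?thesis by (auto simp: fun_eq_iff sm_def add_eq_0_iff)
 qed
 \<comment> \<open>It will turn out that \<open>y ^ (j + 1)\<close> is \<pi> times \<open>b\<close>.
   The extra factor \<open>y\<close> keeps the exponent positive when \<open>j = 0\<close>, so that
   distinct powers of \<open>b\<close> belong to distinct powers of \<open>y\<close>.\<close>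
 define b where "b = sm (- inverse c) (mul u (mul (ev y p2) y))"
 have bB: "b \<in> B" unfolding b_def
  by (intro smB V_rules(3) c subBD(3)[OF B(1)] u(1) ev_sub[OF B yB p2V] yB)
 have piF: "\<pi> \<in> F" "c \<in> F" using pi V_rules(1) V_F c by (auto simp: nonunits_def) (metis (mono_tags, lifting) mem_Collect_eq mult.right_neutral subsetD)
 have "ev y (monom 1 j * h) = sm c (mul (ev y (1 - pCons 0 r)) (pw y j))"
 proof -
  have "monom 1 j * h = smult c ((1 - pCons 0 r) * monom 1 j)" unfolding heq by (simp add: mult.commute)
  thus ?thesis by (simp add: ev_smult ev_mult[OF kF mF] ev_monom)
 qed
 hence "mul (ev y (1 - pCons 0 r)) (pw y j) = sm (- (inverse c * \<pi>)) (ev y p2)"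
  using rel c(2) by (auto simp: fun_eq_iff sm_def field_simps)
 hence "mul u (mul (ev y (1 - pCons 0 r)) (pw y j)) = mul u (sm (- (inverse c * \<pi>)) (ev y p2))" by simp
 hence "pw y j = sm (- (inverse c * \<pi>)) (mul u (ev y p2))"
  using uk piF F_inverse is_subringD[OF F_subring]
  by (simp add: mul_assoc[symmetric] mul_one_left[OF pw_CS] mul_sm_right)
 hence "mul (pw y j) y = sm \<pi> b"
  unfolding b_def by (simp add: mul_sm_left mul_assoc) (simp add: sm_def mult_ac)
 moreover have "mul (pw y j) y = pw y (Suc j)"
  using subBD(1)[OF B(1) yB] by (induct j) (auto simp: mul_one_left mul_one_right mul_assoc)
 ultimately have pwb: "pw y (Suc j) = sm \<pi> b" by simp
 obtain q where q: "lead_coeff q = 1" "\<And>i. i < degree q ==> coeff q i \<in> V" "ev b q = (\<lambda>_. 0)"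
  using int[OF bB] by (auto simp: intrel_def)
 let ?k = "degree q" and ?J = "Suc j"
 have pwm: "pw y (?J * i) = sm (\<pi> ^ i) (pw b i)" for i
 proof (induct i)
  case 0 thus ?case by (simp add: sm_def)
 next
  case (Suc i)
  have add: "pw y (m + n) = mul (pw y m) (pw y n)" for m n
   by (induct m) (auto simp: mul_one_left[OF pw_CS] mul_assoc)
  have "pw y (?J * Suc i) = mul (pw y ?J) (pw y (?J * i))" using add[of ?J "?J * i"] by (simp only: mult_Suc_right)
  also have "\<dots> = mul (sm \<pi> b) (sm (\<pi> ^ i) (pw b i))" unfolding pwb Suc ..
  also have "\<dots> = sm (\<pi> ^ Suc i) (pw b (Suc i))"
   using is_subring_power[OF F_subring piF(1)] by (simp add: mul_sm_left mul_sm_right) (simp add: sm_def mult.assoc)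
  finally show ?case .
 qed
 \<comment> \<open>The equation \<open>q\<close> of \<open>b\<close>, multiplied by
   \<open>\<pi> ^ k\<close> and read in \<open>y\<close> through
   \<open>b = y ^ (j + 1) / \<pi>\<close>; every lower coefficient receives at least one factor
   \<pi>.\<close>
 define P where "P = (\<Sum>i\<le>?k. monom (\<pi> ^ (?k - i) * coeff q i) (?J * i))"
 have evP: "ev y P = (\<lambda>_. 0)"
 proof -
  have ev_sum: "ev y (sum t A) = (\<lambda>rh. \<Sum>i\<in>A. ev y (t i) rh)" for t and A :: "nat set"
   by (induct A rule: infinite_finite_induct) (auto simp: ev_0 ev_add)
  have "ev y (monom d n) = sm d (pw y n)" for d n
   using ev_smult[of y d "monom 1 n"] by (simp add: ev_monom smult_monom)
  hence "ev y P = (\<lambda>rh. \<Sum>i\<le>?k. \<pi> ^ (?k - i) * coeff q i * (\<pi> ^ i * pw b i rh))"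
   unfolding P_def ev_sum by (simp only: pwm sm_def)
  also have "\<dots> = (\<lambda>rh. \<Sum>i\<le>?k. \<pi> ^ ?k * (coeff q i * pw b i rh))"
  proof (rule ext, rule sum.cong[OF refl])
   fix rh i assume "i \<in> {..?k}"
   hence "\<pi> ^ ?k = \<pi> ^ (?k - i) * \<pi> ^ i" by (simp add: power_add[symmetric])
   thus "\<pi> ^ (?k - i) * coeff q i * (\<pi> ^ i * pw b i rh) = \<pi> ^ ?k * (coeff q i * pw b i rh)" by simp
  qed
  also have "\<dots> = (\<lambda>rh. \<pi> ^ ?k * ev b q rh)" by (simp add: ev_def sum_distrib_left)
  finally show ?thesis using q(3) by simp
 qed
 have Pc: "coeff P n = (\<Sum>i\<le>?k. if ?J * i = n then \<pi> ^ (?k - i) * coeff q i else 0)" for n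
  unfolding P_def coeff_sum by (intro sum.cong) auto
 have top: "coeff P (?J * ?k) = 1"
 proof -
  have "coeff P (?J * ?k) = (\<Sum>i\<le>?k. if i = ?k then 1 else 0)"
   unfolding Pc by (intro sum.cong refl) (use q(1) in \<open>auto simp del: mult_Suc\<close>)
  thus ?thesis by simp
 qed
 have lowP: "coeff P n \<in> JV" if "n < ?J * ?k" for n
  unfolding Pc
 proof (rule is_ideal_sum[OF V_subring JV_ideal])
  fix i assume i: "i \<in> {..?k}"
  show "(if ?J * i = n then \<pi> ^ (?k - i) * coeff q i else 0) \<in> JV"
  proof (cases "?J * i = n")
   case True
   hence "i < ?k" using that mult_less_cancel1[of ?J i ?k] by blast
   then obtain d where d: "?k - i = Suc d" by (metis Suc_diff_Suc)
   have "\<pi> ^ (?k - i) * coeff q i = \<pi> * (\<pi> ^ d * coeff q i)" unfolding d by simp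
   moreover have "\<pi> ^ d * coeff q i \<in> V"
   proof -
    have "\<pi> * 1 \<in> JV" unfolding pi using V_rules(1) by blast
    hence "\<pi> \<in> V" by (simp add: nonunits_def)
    thus ?thesis using V_rules(6) is_subring_power[OF V_subring] q(2)[OF \<open>i < ?k\<close>] by blast
   qed
   ultimately have "\<pi> ^ (?k - i) * coeff q i \<in> JV" unfolding pi by blast
   thus ?thesis using True by simp
  next
   case False thus ?thesis using JV_rules(2) by simp
  qed
 qed
 have dP: "degree P = ?J * ?k"
 proof (rule antisym)
  show "degree P \<le> ?J * ?k"
  proof (rule degree_le, intro allI impI)
   fix n assume "?J * ?k < n"
   hence "?J * i \<noteq> n" if "i \<le> ?k" for i using mult_le_mono2[OF that, of ?J] by linarith
   thus "coeff P n = 0" unfolding Pc by (intro sum.neutral) auto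
  qed
  show "?J * ?k \<le> degree P" by (rule le_degree) (simp add: top del: mult_Suc)
 qed
 have "intrel JV y P" unfolding intrel_def dP using top lowP evP by simp
 thus ?thesis by blast
qed

end

section \<open>The degree of a field over the fixed field of a finite group\<close>

context field
begin

lemma finsum_swap:
 assumes "finite A" "finite B" "\<And>a b. a \<in> A ==> b \<in> B ==> h a b \<in> carrier R"
 shows "(\<Oplus>a\<in>A. \<Oplus>b\<in>B. h a b) = (\<Oplus>b\<in>B. \<Oplus>a\<in>A. h a b)"
 using assms(1,3)
proof (induct A)
 case empty thus ?case using assms(2) by simp
next
 case (insert x A)
 have "(\<Oplus>a\<in>insert x A. \<Oplus>b\<in>B. h a b) = (\<Oplus>b\<in>B. h x b) \<oplus> (\<Oplus>a\<in>A. \<Oplus>b\<in>B. h a b)"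
  using insert by (intro finsum_insert) (auto intro!: finsum_closed)
 also have "\<dots> = (\<Oplus>b\<in>B. h x b) \<oplus> (\<Oplus>b\<in>B. \<Oplus>a\<in>A. h a b)" using insert by simp
 also have "\<dots> = (\<Oplus>b\<in>B. h x b \<oplus> (\<Oplus>a\<in>A. h a b))"
  using insert by (intro finsum_addf[symmetric]) (auto intro!: finsum_closed)
 also have "\<dots> = (\<Oplus>b\<in>B. \<Oplus>a\<in>insert x A. h a b)"
  using insert by (intro finsum_cong' refl) (auto intro!: finsum_closed finsum_insert[symmetric])
 finally show ?case .
qed

text \<open>Gaussian elimination, one equation at a time: a nonzero coefficient of the equation
  \<open>a\<close> is the pivot that removes the unknown \<open>b0\<close> from the others.\<close>

lemma underdetermined_system:
 assumes "finite A" "finite B" "card A < card B" "\<And>a b. a \<in> A ==> b \<in> B ==> c a b \<in> carrier R"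
 shows "\<exists>z. (\<forall>b\<in>B. z b \<in> carrier R) \<and> (\<exists>b\<in>B. z b \<noteq> \<zero>) \<and> (\<forall>a\<in>A. (\<Oplus>b\<in>B. c a b \<otimes> z b) = \<zero>)"
 using assms
proof (induct A arbitrary: B c)
 case empty
 then obtain b where "b \<in> B" by (metis card.empty card_gt_0_iff ex_in_conv)
 thus ?case by (intro exI[of _ "\<lambda>_. \<one>"]) auto
next
 case (insert a A)
 show ?case
 proof (cases "\<forall>b\<in>B. c a b = \<zero>")
  case True
  have "\<exists>z. (\<forall>b\<in>B. z b \<in> carrier R) \<and> (\<exists>b\<in>B. z b \<noteq> \<zero>) \<and> (\<forall>x\<in>A. (\<Oplus>b\<in>B. c x b \<otimes> z b) = \<zero>)"
   by (rule insert(3)) (use insert(1,2,4-6) in \<open>auto simp: card_insert_if\<close>)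
  then obtain z where z: "\<And>b. b \<in> B ==> z b \<in> carrier R" "\<exists>b\<in>B. z b \<noteq> \<zero>" "\<And>x. x \<in> A ==> (\<Oplus>b\<in>B. c x b \<otimes> z b) = \<zero>"
   by blast
  have "(\<Oplus>b\<in>B. c a b \<otimes> z b) = (\<Oplus>b\<in>B. \<zero>)" using True z by (intro finsum_cong') auto
  hence "(\<Oplus>b\<in>B. c a b \<otimes> z b) = \<zero>" by simp
  thus ?thesis using z by (intro exI[of _ z]) auto
 next
  case False
  then obtain b0 where b0: "b0 \<in> B" "c a b0 \<noteq> \<zero>" by blast
  let ?B = "B - {b0}" and ?i = "inv (c a b0)"
  have cc: "c x b \<in> carrier R" if "x \<in> insert a A" "b \<in> B" for x b using insert(6) that by blast
  have i: "?i \<in> carrier R" "?i \<otimes> c a b0 = \<one>" "c a b0 \<otimes> ?i = \<one>"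
   using b0 cc field_Units by auto
  define c' where "c' x b = c x b \<ominus> (c x b0 \<otimes> ?i) \<otimes> c a b" for x b
  have fB: "finite ?B" using insert(4) by simp
  have "card A < card ?B" using insert(1,2,4,5) b0 by (simp add: card_insert_if)
  moreover have "c' x b \<in> carrier R" if "x \<in> A" "b \<in> ?B" for x b
   using that cc b0 i by (auto simp: c'_def)
  ultimately obtain z where z: "\<And>b. b \<in> ?B ==> z b \<in> carrier R" "\<exists>b\<in>?B. z b \<noteq> \<zero>"
   "\<And>x. x \<in> A ==> (\<Oplus>b\<in>?B. c' x b \<otimes> z b) = \<zero>"
   using insert(3)[OF fB, of c'] by blast
  define s where "s x = (\<Oplus>b\<in>?B. c x b \<otimes> z b)" for x
  have sc: "s x \<in> carrier R" if "x \<in> insert a A" for x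
   unfolding s_def using that cc z by (intro finsum_closed) auto
  define z' where "z' b = (if b = b0 then \<ominus> (?i \<otimes> s a) else z b)" for b
  have z'c: "z' b \<in> carrier R" if "b \<in> B" for b using that z i sc[of a] by (auto simp: z'_def)
  have sum: "(\<Oplus>b\<in>B. c x b \<otimes> z' b) = c x b0 \<otimes> z' b0 \<oplus> s x" if x: "x \<in> insert a A" for x
  proof -
   have "(\<Oplus>b\<in>insert b0 ?B. c x b \<otimes> z' b) = c x b0 \<otimes> z' b0 \<oplus> (\<Oplus>b\<in>?B. c x b \<otimes> z' b)"
    using fB x cc z'c b0 by (intro finsum_insert) auto
   moreover have "(\<Oplus>b\<in>?B. c x b \<otimes> z' b) = s x"
    unfolding s_def using x cc z by (intro finsum_cong') (auto simp: z'_def)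
   ultimately show ?thesis using b0 by (simp add: insert_absorb)
  qed
  have sA: "s x = (c x b0 \<otimes> ?i) \<otimes> s a" if x: "x \<in> A" for x
  proof -
   let ?k = "c x b0 \<otimes> ?i"
   have k: "?k \<in> carrier R" using x cc b0 i by auto
   have "s x = (\<Oplus>b\<in>?B. c' x b \<otimes> z b \<oplus> ?k \<otimes> (c a b \<otimes> z b))"
    unfolding s_def
   proof (intro finsum_cong' refl)
    fix b assume b: "b \<in> ?B"
    have m: "c x b \<in> carrier R" "c a b \<in> carrier R" "z b \<in> carrier R" using b x cc z by auto
    show "c x b \<otimes> z b = c' x b \<otimes> z b \<oplus> ?k \<otimes> (c a b \<otimes> z b)"
     using m k unfolding c'_def by algebra
   qed (use x cc z k in \<open>auto simp: c'_def\<close>)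
   also have "\<dots> = (\<Oplus>b\<in>?B. c' x b \<otimes> z b) \<oplus> (\<Oplus>b\<in>?B. ?k \<otimes> (c a b \<otimes> z b))"
    using x cc z k by (intro finsum_addf) (auto simp: c'_def)
   also have "(\<Oplus>b\<in>?B. ?k \<otimes> (c a b \<otimes> z b)) = ?k \<otimes> s a"
    unfolding s_def using k cc z fB by (intro finsum_rdistr[symmetric]) auto
   finally show ?thesis using z(3)[OF x] k sc[of a] by simp
  qed
  have "(\<Oplus>b\<in>B. c x b \<otimes> z' b) = \<zero>" if x: "x \<in> insert a A" for x
  proof -
   have m: "c x b0 \<in> carrier R" "s a \<in> carrier R" "?i \<in> carrier R" using x cc b0 i sc by auto
   have e: "s x = (c x b0 \<otimes> ?i) \<otimes> s a"
   proof (cases "x = a")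
    case True thus ?thesis using i m by simp
   qed (use sA x in auto)
   have "c x b0 \<otimes> z' b0 \<oplus> s x = \<zero>" unfolding e z'_def using m by simp algebra
   thus ?thesis using sum[OF x] by simp
  qed
  moreover have "\<exists>b\<in>B. z' b \<noteq> \<zero>" using z(2) by (auto simp: z'_def)
  ultimately show ?thesis using z'c by blast
 qed
qed

text \<open>Evaluating the relation at \<open>y * x\<close> and subtracting \<open>g y\<close> times
  the relation at \<open>x\<close> removes \<open>g\<close>; induction then kills the remaining
  coefficients.\<close>

lemma dedekind_independence:
 assumes "finite H" "\<And>h. h \<in> H ==> h \<in> ring_hom R R"
  "\<And>h h'. h \<in> H ==> h' \<in> H ==> h \<noteq> h' ==> \<exists>x\<in>carrier R. h x \<noteq> h' x"
  "\<And>h. h \<in> H ==> c h \<in> carrier R" "\<And>x. x \<in> carrier R ==> (\<Oplus>h\<in>H. c h \<otimes> h x) = \<zero>" "h \<in> H"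
 shows "c h = \<zero>"
 using assms
proof (induct H arbitrary: c h)
 case empty
 from empty(5) show ?case by simp
next
 case (insert g H)
 have hc: "h x \<in> carrier R" if "h \<in> insert g H" "x \<in> carrier R" for h x
  using insert(4)[OF that(1)] that(2) by (rule ring_hom_closed)
 have zero: "c h = \<zero>" if h: "h \<in> H" for h
 proof -
  obtain y where y: "y \<in> carrier R" "h y \<noteq> g y" using insert(5)[of h g] h insert(2) by auto
  define d where "d h = c h \<otimes> (h y \<ominus> g y)" for h
  have dc: "d h \<in> carrier R" if "h \<in> insert g H" for h using that insert(6) hc y by (auto simp: d_def)
  have "(\<Oplus>h\<in>H. d h \<otimes> h x) = \<zero>" if x: "x \<in> carrier R" for x
  proof -
   have "(\<Oplus>h\<in>insert g H. d h \<otimes> h x) = (\<Oplus>h\<in>insert g H. c h \<otimes> h (y \<otimes> x) \<oplus> (\<ominus> g y) \<otimes> (c h \<otimes> h x))"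
   proof (intro finsum_cong' refl)
    fix k assume k: "k \<in> insert g H"
    have m: "c k \<in> carrier R" "k y \<in> carrier R" "g y \<in> carrier R" "k x \<in> carrier R"
     using k insert(6) hc x y by auto
    have "k (y \<otimes> x) = k y \<otimes> k x" using ring_hom_mult[OF insert(4)[OF k]] x y by auto
    thus "d k \<otimes> k x = c k \<otimes> k (y \<otimes> x) \<oplus> (\<ominus> g y) \<otimes> (c k \<otimes> k x)"
     unfolding d_def using m by (simp) algebra
   qed (use insert(6) hc x y in auto)
   also have "\<dots> = (\<Oplus>h\<in>insert g H. c h \<otimes> h (y \<otimes> x)) \<oplus> (\<Oplus>h\<in>insert g H. (\<ominus> g y) \<otimes> (c h \<otimes> h x))"
    using insert(6) hc x y by (intro finsum_addf) auto
   also have "(\<Oplus>h\<in>insert g H. (\<ominus> g y) \<otimes> (c h \<otimes> h x)) = (\<ominus> g y) \<otimes> (\<Oplus>h\<in>insert g H. c h \<otimes> h x)"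
    using insert(1,6) hc x y by (intro finsum_rdistr[symmetric]) auto
   finally have "(\<Oplus>h\<in>insert g H. d h \<otimes> h x) = \<zero>"
    using insert(7)[OF x] insert(7)[of "y \<otimes> x"] x y hc[of g y] by auto
   moreover have "(\<Oplus>h\<in>insert g H. d h \<otimes> h x) = d g \<otimes> g x \<oplus> (\<Oplus>h\<in>H. d h \<otimes> h x)"
    using insert(1,2) dc hc x by (intro finsum_insert) auto
   moreover have "d g = \<zero>" using hc[of g y] y insert(6)[of g] by (auto simp: d_def r_neg a_minus_def)
   moreover have "(\<Oplus>h\<in>H. d h \<otimes> h x) \<in> carrier R" using dc hc x by (intro finsum_closed) auto
   ultimately show ?thesis using hc[of g x] x by simp
  qed
  hence "d h = \<zero>" using insert(3)[of d h] insert(4,5) dc h by auto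
  moreover have "h y \<ominus> g y \<noteq> \<zero>" using y hc h by auto
  moreover have "h y \<ominus> g y \<in> carrier R" "c h \<in> carrier R" using y hc h insert(6) by auto
  ultimately show ?thesis unfolding d_def using integral by blast
 qed
 have "(\<Oplus>h\<in>insert g H. c h \<otimes> h \<one>) = c g \<otimes> g \<one> \<oplus> (\<Oplus>h\<in>H. c h \<otimes> h \<one>)"
  using insert(1,2,6) hc by (intro finsum_insert) auto
 moreover have "(\<Oplus>h\<in>H. c h \<otimes> h \<one>) = (\<Oplus>h\<in>H. \<zero>)" using zero hc by (intro finsum_cong') auto
 moreover have "g \<one> = \<one>" using ring_hom_one[OF insert(4)[of g]] by simp
 ultimately have "c g \<otimes> \<one> \<oplus> \<zero> = \<zero>" using insert(7)[OF one_closed] by simp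
 moreover have "c g \<in> carrier R" using insert(6) by blast
 ultimately have cg: "c g = \<zero>" by simp
 show ?case
 proof (cases "h = g")
  case True show ?thesis unfolding True by (rule cg)
 next
  case False show ?thesis by (rule zero, rule insertE[OF insert(8)]) (use False in blast)+
 qed
qed

lemma combine_finsum:
 "set Us \<subseteq> carrier R ==> (\<And>i. i < length Us ==> z i \<in> carrier R) ==>
  combine (map z [0..<length Us]) Us = (\<Oplus>i\<in>{..<length Us}. z i \<otimes> Us ! i)"
proof (induct Us arbitrary: z)
 case (Cons u Us)
 have "map z [0..<length (u # Us)] = z 0 # map (\<lambda>i. z (Suc i)) [0..<length Us]"
  by (simp add: upt_conv_Cons map_Suc_upt[symmetric] del: upt_Suc)
 hence "combine (map z [0..<length (u # Us)]) (u # Us) = z 0 \<otimes> u \<oplus> (\<Oplus>i\<in>{..<length Us}. z (Suc i) \<otimes> Us ! i)"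
  using Cons(1)[of "\<lambda>i. z (Suc i)"] Cons(2,3) by simp
 also have "(\<Oplus>i\<in>{..<length Us}. z (Suc i) \<otimes> Us ! i) = (\<Oplus>i\<in>Suc ` {..<length Us}. z i \<otimes> (u # Us) ! i)"
  using Cons(2,3) by (subst finsum_reindex) (auto intro!: finsum_cong' simp: nth_Cons' subset_iff)
 also have "z 0 \<otimes> u \<oplus> \<dots> = (\<Oplus>i\<in>insert 0 (Suc ` {..<length Us}). z i \<otimes> (u # Us) ! i)"
  using Cons(2,3) by (subst finsum_insert) (auto simp: subset_iff)
 also have "insert 0 (Suc ` {..<length Us}) = {..<length (u # Us)}"
  by (simp add: lessThan_Suc_eq_insert_0)
 finally show ?case .
qed simp

text \<open>Artin's theorem in a form that applies twice: to \<open>G\<close> on \<open>K\<close>,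
  and to the automorphisms of a residue field induced by a decomposition group. The hypotheses look
  at the carrier only, and \<open>perm\<close> states closure under composition up to equality
  there.\<close>

theorem artin_dimension:
 assumes fin: "finite H" and hom: "\<And>h. h \<in> H ==> h \<in> ring_hom R R"
  and dist: "\<And>h h'. h \<in> H ==> h' \<in> H ==> h \<noteq> h' ==> \<exists>x\<in>carrier R. h x \<noteq> h' x"
  and perm: "\<And>g. g \<in> H ==> \<exists>p. bij_betw p H H \<and> (\<forall>h\<in>H. \<forall>x\<in>carrier R. p h x = g (h x))"
  and id: "i \<in> H" "\<And>x. x \<in> carrier R ==> i x = x"
  and sub: "subfield K R" and K: "K = {x\<in>carrier R. \<forall>h\<in>H. h x = x}"
 shows "dimension (card H) K (carrier R)"
proof -
 have hc: "h x \<in> carrier R" if "h \<in> H" "x \<in> carrier R" for h x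
  using hom[OF that(1)] that(2) by (rule ring_hom_closed)
 have hsum: "g (finsum R t A) = (\<Oplus>a\<in>A. g (t a))" if g: "g \<in> H" and A: "finite A" "\<And>a. a \<in> A ==> t a \<in> carrier R" for g t and A :: "'x set"
  using A
 proof (induct A)
  case empty thus ?case using ring_hom_zero[OF hom[OF g]] ring_axioms by simp
 next
  case (insert a A)
  have m: "t \<in> A \<rightarrow> carrier R" using insert(4) by auto
  have "g (finsum R t (insert a A)) = g (t a \<oplus> finsum R t A)" using insert m by (subst finsum_insert) auto
  also have "\<dots> = g (t a) \<oplus> g (finsum R t A)"
   using insert m finsum_closed[OF m] by (intro ring_hom_add[OF hom[OF g]]) auto
  also have "\<dots> = (\<Oplus>a\<in>insert a A. g (t a))"
   using insert hc[OF g] by (subst finsum_insert) auto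
  finally show ?case .
 qed
 have trace_K: "(\<Oplus>h\<in>H. h x) \<in> K" if x: "x \<in> carrier R" for x
 proof -
  have "g (\<Oplus>h\<in>H. h x) = (\<Oplus>h\<in>H. h x)" if g: "g \<in> H" for g
  proof -
   obtain p where p: "bij_betw p H H" "\<And>h y. h \<in> H ==> y \<in> carrier R ==> p h y = g (h y)"
    using perm[OF g] by blast
   have "g (\<Oplus>h\<in>H. h x) = (\<Oplus>h\<in>H. g (h x))" using hsum[OF g fin] hc x by auto
   also have "\<dots> = (\<Oplus>h\<in>H. p h x)" using p x hc g by (intro finsum_cong') auto
   also have "\<dots> = (\<Oplus>h\<in>p ` H. h x)"
    using p(1) hc x by (subst finsum_reindex) (auto simp: bij_betw_def)
   finally show ?thesis using p(1) by (simp add: bij_betw_def)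
  qed
  thus ?thesis unfolding K using x hc by (auto intro!: finsum_closed)
 qed
 have trace_nz: "\<exists>a\<in>carrier R. (\<Oplus>h\<in>H. h a) \<noteq> \<zero>"
 proof (rule ccontr)
  assume n: "\<not> ?thesis"
  have "(\<Oplus>h\<in>H. \<one> \<otimes> h x) = \<zero>" if x: "x \<in> carrier R" for x
  proof -
   have "(\<Oplus>h\<in>H. \<one> \<otimes> h x) = (\<Oplus>h\<in>H. h x)" using hc x by (intro finsum_cong') auto
   thus ?thesis using n x by auto
  qed
  hence "\<one> = \<zero>"
   by (intro dedekind_independence[where c = "\<lambda>_. \<one>" and H = H and h = i, OF fin hom dist _ _ id(1)]) auto
  thus False by simp
 qed
 \<comment> \<open>More than \<open>card H\<close> vectors satisfy a relation with coefficients
   \<open>z j\<close> that is stable under all of \<open>H\<close>; summing over \<open>H\<close>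
   turns it into a relation over \<open>K\<close>, and the factor \<open>b\<close> makes the
   coefficient at \<open>j0\<close> the nonzero trace of \<open>a\<close>.\<close>
 have le: "length Us \<le> card H" if Us: "independent K Us" for Us
 proof (rule ccontr)
  assume n: "\<not> ?thesis"
  have Uc: "set Us \<subseteq> carrier R" using independent_in_carrier[OF Us] .
  hence ui: "Us ! j \<in> carrier R" if "j < length Us" for j using that nth_mem by blast
  let ?B = "{..<length Us}"
  have "card H < card ?B" using n by simp
  hence "\<exists>z. (\<forall>j\<in>?B. z j \<in> carrier R) \<and> (\<exists>j\<in>?B. z j \<noteq> \<zero>) \<and> (\<forall>h\<in>H. (\<Oplus>j\<in>?B. h (Us ! j) \<otimes> z j) = \<zero>)"
   by (intro underdetermined_system[OF fin]) (use hc ui in auto)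
  then obtain z where z: "\<And>j. j \<in> ?B ==> z j \<in> carrier R" "\<exists>j\<in>?B. z j \<noteq> \<zero>"
   "\<And>h. h \<in> H ==> (\<Oplus>j\<in>?B. h (Us ! j) \<otimes> z j) = \<zero>"
   by blast
  obtain j0 where j0: "j0 < length Us" "z j0 \<noteq> \<zero>" using z(2) by auto
  obtain a where a: "a \<in> carrier R" "(\<Oplus>h\<in>H. h a) \<noteq> \<zero>" using trace_nz by blast
  define b where "b = a \<otimes> inv (z j0)"
  have iz: "inv (z j0) \<in> carrier R" "inv (z j0) \<otimes> z j0 = \<one>" using z(1)[of j0] j0 field_Units by auto
  have b: "b \<in> carrier R" "b \<otimes> z j0 = a"
   using a iz z(1)[of j0] j0 by (auto simp: b_def m_assoc)
  define T where "T j = (\<Oplus>h\<in>H. h (b \<otimes> z j))" for j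
  have TK: "T j \<in> K" if "j < length Us" for j unfolding T_def using b z(1) that by (intro trace_K) auto
  have Tc: "T j \<in> carrier R" if "j < length Us" for j using TK[OF that] by (auto simp: K)
  have sol: "(\<Oplus>j\<in>?B. Us ! j \<otimes> g (z j)) = \<zero>" if g: "g \<in> H" for g
  proof -
   obtain p where p: "bij_betw p H H" "\<And>h y. h \<in> H ==> y \<in> carrier R ==> p h y = g (h y)"
    using perm[OF g] by blast
   then obtain h where h: "h \<in> H" "p h = i"
    using id(1) unfolding bij_betw_def by (metis imageE)
   have "(\<Oplus>j\<in>?B. Us ! j \<otimes> g (z j)) = (\<Oplus>j\<in>?B. g (h (Us ! j) \<otimes> z j))"
   proof (intro finsum_cong' refl)
    fix j assume j: "j \<in> ?B"
    have "g (h (Us ! j)) = Us ! j" using p(2)[OF h(1), of "Us ! j"] h id ui j by auto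
    thus "Us ! j \<otimes> g (z j) = g (h (Us ! j) \<otimes> z j)"
     using ring_hom_mult[OF hom[OF g], of "h (Us ! j)" "z j"] hc h ui z(1) j by auto
   qed (use g h hc ui z(1) in auto)
   also have "\<dots> = g (\<Oplus>j\<in>?B. h (Us ! j) \<otimes> z j)"
    using hsum[OF g, of ?B "\<lambda>j. h (Us ! j) \<otimes> z j"] hc h ui z(1) by auto
   also have "\<dots> = \<zero>" using z(3)[OF h(1)] ring_hom_zero[OF hom[OF g]] ring_axioms by simp
   finally show ?thesis .
  qed
  have "(\<Oplus>j\<in>?B. T j \<otimes> Us ! j) = (\<Oplus>j\<in>?B. \<Oplus>h\<in>H. h b \<otimes> (Us ! j \<otimes> h (z j)))"
  proof (intro finsum_cong' refl)
   fix j assume j: "j \<in> ?B"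
   have "T j \<otimes> Us ! j = (\<Oplus>h\<in>H. h (b \<otimes> z j) \<otimes> Us ! j)"
    unfolding T_def using hc b z(1) ui j fin by (intro finsum_ldistr) auto
   also have "\<dots> = (\<Oplus>h\<in>H. h b \<otimes> (Us ! j \<otimes> h (z j)))"
   proof (intro finsum_cong' refl)
    fix h assume h: "h \<in> H"
    have m: "h b \<in> carrier R" "h (z j) \<in> carrier R" "Us ! j \<in> carrier R" using hc h b z(1) ui j by auto
    have "h (b \<otimes> z j) = h b \<otimes> h (z j)" using ring_hom_mult[OF hom[OF h]] b z(1) j by auto
    thus "h (b \<otimes> z j) \<otimes> Us ! j = h b \<otimes> (Us ! j \<otimes> h (z j))" using m by (simp add: m_ac)
   qed (use hc b z(1) ui j in auto)
   finally show "T j \<otimes> Us ! j = (\<Oplus>h\<in>H. h b \<otimes> (Us ! j \<otimes> h (z j)))" .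
  qed (use hc b z(1) ui in \<open>auto intro!: finsum_closed\<close>)
  also have "\<dots> = (\<Oplus>h\<in>H. \<Oplus>j\<in>?B. h b \<otimes> (Us ! j \<otimes> h (z j)))"
   using hc b z(1) ui fin by (intro finsum_swap) auto
  also have "\<dots> = (\<Oplus>h\<in>H. h b \<otimes> (\<Oplus>j\<in>?B. Us ! j \<otimes> h (z j)))"
   using hc b z(1) ui by (intro finsum_cong' refl) (auto intro!: finsum_rdistr[symmetric] finsum_closed)
  also have "\<dots> = (\<Oplus>h\<in>H. \<zero>)" using sol hc b by (intro finsum_cong') auto
  finally have "(\<Oplus>j\<in>?B. T j \<otimes> Us ! j) = \<zero>" by simp
  hence comb: "combine (map T [0..<length Us]) Us = \<zero>" using combine_finsum[OF Uc Tc] by simp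
  have "T j0 = (\<Oplus>h\<in>H. h a)" unfolding T_def b ..
  hence "T j0 \<noteq> \<zero>" using a by simp
  moreover have "T j0 \<in> set (take (length Us) (map T [0..<length Us]))" using j0 by auto
  ultimately have "\<not> set (take (length Us) (map T [0..<length Us])) \<subseteq> {\<zero>}" by blast
  moreover have "set (map T [0..<length Us]) \<subseteq> K" using TK by auto
  ultimately show False using non_trivial_combine_imp_dependent[OF sub _ comb] Us by blast
 qed
 \<comment> \<open>Fewer than \<open>card H\<close> spanning vectors would leave a nontrivial
   solution \<open>c\<close> of the transposed system, which is a linear relation between the
   automorphisms.\<close>
 have ge: "card H \<le> length Us" if Us: "set Us \<subseteq> carrier R" "Span K Us = carrier R" for Us
 proof (rule ccontr)
  assume n: "\<not> ?thesis"
  let ?B = "{..<length Us}"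
  have ui: "Us ! j \<in> carrier R" if "j < length Us" for j using that nth_mem Us(1) by blast
  have "card ?B < card H" using n by simp
  hence "\<exists>c. (\<forall>h\<in>H. c h \<in> carrier R) \<and> (\<exists>h\<in>H. c h \<noteq> \<zero>) \<and> (\<forall>j\<in>?B. (\<Oplus>h\<in>H. h (Us ! j) \<otimes> c h) = \<zero>)"
   by (intro underdetermined_system[OF _ fin]) (use hc ui in auto)
  then obtain c where c: "\<And>h. h \<in> H ==> c h \<in> carrier R" "\<exists>h\<in>H. c h \<noteq> \<zero>"
   "\<And>j. j < length Us ==> (\<Oplus>h\<in>H. h (Us ! j) \<otimes> c h) = \<zero>"
   by blast
  have rel: "(\<Oplus>h\<in>H. c h \<otimes> h x) = \<zero>" if x: "x \<in> carrier R" for x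
  proof -
   have "x \<in> Span K Us" using x Us by simp
   then obtain Ks where Ks: "set Ks \<subseteq> K" "length Ks = length Us" "x = combine Ks Us"
    using Span_eq_combine_set_length_version[OF sub Us(1)] by auto
   define k where "k j = Ks ! j" for j
   have kK: "k j \<in> K" if "j < length Us" for j using that Ks nth_mem[of j Ks] by (auto simp: k_def)
   have kc: "k j \<in> carrier R" if "j < length Us" for j using kK[OF that] by (simp add: K)
   have "Ks = map k [0..<length Us]" using Ks(2) by (intro nth_equalityI) (auto simp: k_def)
   hence xe: "x = (\<Oplus>j\<in>?B. k j \<otimes> Us ! j)" using Ks(3) combine_finsum[OF Us(1) kc] by simp
   have "(\<Oplus>h\<in>H. c h \<otimes> h x) = (\<Oplus>h\<in>H. \<Oplus>j\<in>?B. k j \<otimes> (h (Us ! j) \<otimes> c h))"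
   proof (intro finsum_cong' refl)
    fix h assume h: "h \<in> H"
    have "h x = (\<Oplus>j\<in>?B. h (k j \<otimes> Us ! j))" unfolding xe
     by (rule hsum[OF h]) (use kc ui in auto)
    also have "\<dots> = (\<Oplus>j\<in>?B. k j \<otimes> h (Us ! j))"
    proof (intro finsum_cong' refl)
     fix j assume j: "j \<in> ?B"
     have "h (k j) = k j" using kK[of j] j h by (simp add: K)
     thus "h (k j \<otimes> Us ! j) = k j \<otimes> h (Us ! j)"
      using ring_hom_mult[OF hom[OF h], of "k j" "Us ! j"] kc ui j by auto
    qed (use kc hc h ui in auto)
    finally have "c h \<otimes> h x = (\<Oplus>j\<in>?B. c h \<otimes> (k j \<otimes> h (Us ! j)))"
     using c(1)[OF h] kc hc h ui by (simp add: finsum_rdistr Pi_iff)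
    also have "\<dots> = (\<Oplus>j\<in>?B. k j \<otimes> (h (Us ! j) \<otimes> c h))"
     using c(1)[OF h] kc hc h ui by (intro finsum_cong') (auto simp: m_ac)
    finally show "c h \<otimes> h x = (\<Oplus>j\<in>?B. k j \<otimes> (h (Us ! j) \<otimes> c h))" .
   qed (use c(1) kc hc ui in \<open>auto intro!: finsum_closed\<close>)
   also have "\<dots> = (\<Oplus>j\<in>?B. \<Oplus>h\<in>H. k j \<otimes> (h (Us ! j) \<otimes> c h))"
    using c(1) kc hc ui fin by (intro finsum_swap) auto
   also have "\<dots> = (\<Oplus>j\<in>?B. k j \<otimes> (\<Oplus>h\<in>H. h (Us ! j) \<otimes> c h))"
    using c(1) kc hc ui fin by (intro finsum_cong' refl) (auto intro!: finsum_rdistr[symmetric] finsum_closed)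
   also have "\<dots> = (\<Oplus>j\<in>?B. \<zero>)" using c(3) kc by (intro finsum_cong') auto
   finally show ?thesis by simp
  qed
  have "c h = \<zero>" if "h \<in> H" for h
   by (rule dedekind_independence[where H = H and c = c and h = h, OF fin hom dist c(1) rel that])
  thus False using c(2) by blast
 qed
 have ex: "\<exists>Us. independent K Us \<and> length Us = n" if "n \<le> card H" for n
  using that
 proof (induct n)
  case 0 thus ?case by (intro exI[of _ "[]"]) auto
 next
  case (Suc n)
  then obtain Us where Us: "independent K Us" "length Us = n" by auto
  have Uc: "set Us \<subseteq> carrier R" using independent_in_carrier[OF Us(1)] .
  have "Span K Us \<noteq> carrier R" using ge[OF Uc] Us(2) Suc(2) by auto
  then obtain u where "u \<in> carrier R" "u \<notin> Span K Us"
   using Span_in_carrier[OF subfieldE(3)[OF sub] Uc] by blast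
  hence "independent K (u # Us)" using Us by (intro li_Cons) auto
  thus ?case using Us by (intro exI[of _ "u # Us"]) auto
 qed
 obtain Us where Us: "independent K Us" "length Us = card H" using ex by blast
 have Uc: "set Us \<subseteq> carrier R" using independent_in_carrier[OF Us(1)] .
 have "Span K Us = carrier R"
 proof (rule ccontr)
  assume "Span K Us \<noteq> carrier R"
  then obtain u where "u \<in> carrier R" "u \<notin> Span K Us"
   using Span_in_carrier[OF subfieldE(3)[OF sub] Uc] by blast
  hence "independent K (u # Us)" using Us by (intro li_Cons) auto
  thus False using le[of "u # Us"] Us by simp
 qed
 thus ?thesis using dimensionI[OF sub Us(1)] Us(2) by simp
qed

end

section \<open>The inertia group of a tame extension\<close>

lemma monic_division:
 fixes h p :: "'a::comm_ring_1 poly"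
 assumes R: "is_subring R" and h: "lead_coeff h = 1" "\<And>i. coeff h i \<in> R" and p: "\<And>i. coeff p i \<in> R"
 shows "\<exists>u r. (\<forall>i. coeff u i \<in> R) \<and> (\<forall>i. coeff r i \<in> R) \<and> p = h * u + r \<and> (r = 0 \<or> degree r < degree h)"
 using p
proof (induct "degree p" arbitrary: p rule: less_induct)
 case less
 note R' = is_subringD[OF R]
 show ?case
 proof (cases "p = 0 \<or> degree p < degree h")
  case True
  thus ?thesis using less(2) R'(2) by (intro exI[of _ 0] exI[of _ p]) auto
 next
  case False
  hence dh: "degree h \<le> degree p" and p0: "p \<noteq> 0" by auto
  define m where "m = monom (lead_coeff p) (degree p - degree h)"
  define p' where "p' = p - h * m"
  have mR: "coeff m i \<in> R" for i using less(2) R'(2) by (auto simp: m_def)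
  have hmR: "coeff (h * m) i \<in> R" for i
   using is_subringD(6)[OF is_subring_polys[OF R], of h m] h(2) mR by auto
  have p'R: "coeff p' i \<in> R" for i using less(2) hmR R'(4) by (simp add: p'_def)
  have c: "coeff (h * m) i = (if i < degree p - degree h then 0 else lead_coeff p * coeff h (i - (degree p - degree h)))" for i
   unfolding m_def by (simp add: mult.commute[of h] coeff_monom_mult)
  have z: "coeff p' i = 0" if "i \<ge> degree p" for i
  proof (cases "i = degree p")
   case True thus ?thesis using h(1) dh by (simp add: p'_def c)
  next
   case False
   thus ?thesis using that dh by (simp add: p'_def c coeff_eq_0)
  qed
  have "\<exists>u r. (\<forall>i. coeff u i \<in> R) \<and> (\<forall>i. coeff r i \<in> R) \<and> p' = h * u + r \<and> (r = 0 \<or> degree r < degree h)"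
  proof (cases "degree p' < degree p")
   case True thus ?thesis using less(1)[of p'] p'R by blast
  next
   case False
   hence "p' = 0" using z[of "degree p'"] by simp
   thus ?thesis using R'(2) by (intro exI[of _ 0]) auto
  qed
  then obtain u r where ur: "\<And>i. coeff u i \<in> R" "\<And>i. coeff r i \<in> R" "p' = h * u + r" "r = 0 \<or> degree r < degree h" by blast
  have "p = h * (u + m) + r" using ur(3) by (simp add: p'_def algebra_simps)
  moreover have "coeff (u + m) i \<in> R" for i using ur(1) mR R'(5) by simp
  ultimately show ?thesis using ur by blast
 qed
qed

lemma poly_in_ideal:
 assumes R: "is_subring R" "is_ideal R I" and p: "\<And>i. coeff p i \<in> I" and x: "x \<in> R"
 shows "poly p x \<in> I"
 unfolding poly_altdef
 by (intro is_ideal_sum[OF R] is_idealD(5)[OF R] is_subring_power[OF R(1)] p x)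

lemma poly_in_subring:
 assumes R: "is_subring R" and p: "\<And>i. coeff p i \<in> R" and x: "x \<in> R"
 shows "poly p x \<in> R"
 unfolding poly_altdef
 by (intro is_subring_sum[OF R] is_subringD(6)[OF R] is_subring_power[OF R] p x)

lemma card_fibres:
 assumes "finite A" "\<And>a. a \<in> A ==> card {b\<in>A. g b = g a} = k"
 shows "card A = card (g ` A) * k"
proof -
 have "card A = (\<Sum>y\<in>g ` A. card {x\<in>A. g x = y})"
  using sum.image_gen[OF assms(1), of "\<lambda>_. 1 :: nat" g] by simp
 also have "\<dots> = (\<Sum>y\<in>g ` A. k)" using assms(2) by (intro sum.cong) auto
 finally show ?thesis by simp
qed

lemma jac_val: "is_val R ==> jac (subR R) = nonunits R"
proof (rule Set.set_eqI, rule iffI)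
 fix y assume R: "is_val R"
 note S = val_subring[OF R]
 {
  assume y: "y \<in> jac (subR R)"
  have "inverse y \<notin> R" if "y \<noteq> 0"
  proof
   assume "inverse y \<in> R"
   then obtain u where "u * (1 - inverse y * y) = 1" using y unfolding jac_subR_iff[OF S] by blast
   thus False using that by simp
  qed
  thus "y \<in> nonunits R" using y unfolding jac_subR_iff[OF S] by (auto simp: nonunits_def)
 next
  assume y: "y \<in> nonunits R"
  have "\<exists>u\<in>R. u * (1 - r * y) = 1" if r: "r \<in> R" for r
  proof -
   have "1 - r * y \<noteq> 0 \<and> inverse (1 - r * y) \<in> R"
    using nonunits_one_minus[OF R nonunits_mult[OF R r y]] unit_inverse[OF R] by blast
   thus ?thesis by (intro bexI[of _ "inverse (1 - r * y)"]) auto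
  qed
  thus "y \<in> jac (subR R)" unfolding jac_subR_iff[OF S] using y by (auto simp: nonunits_def)
 }
qed

lemma ismax_val:
 assumes R: "is_val R" shows "ismax R (nonunits R)"
 unfolding ismax_def
proof (intro conjI ballI nonunits_ideal[OF R] one_notin_nonunits[OF R])
 fix s assume "s \<in> R - nonunits R"
 hence "s \<noteq> 0 \<and> inverse s \<in> R" using unit_inverse[OF R] by blast
 thus "\<exists>u\<in>R. 1 - u * s \<in> nonunits R"
  using is_idealD(2)[OF val_subring[OF R] nonunits_ideal[OF R]] by (intro bexI[of _ "inverse s"]) auto
qed

context val_ext
begin

text \<open>Decomposition group and, next, inertia group. Inertia is tested on \<open>S\<close>
  rather than on the residue field; this amounts to the same because every residue class at
  \<open>M\<close> has a representative in \<open>S\<close>.\<close>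

definition Dgrp where "Dgrp M = {si\<in>G. si ` M = M}"
definition Igrp where "Igrp M = {si\<in>Dgrp M. \<forall>s\<in>S. si s - s \<in> M}"

lemma D_comp: "si \<in> Dgrp M ==> tu \<in> Dgrp M ==> si \<circ> tu \<in> Dgrp M"
 unfolding Dgrp_def using image_comp[of si tu M] by simp

lemma D_inv: "si \<in> Dgrp M ==> inv_into UNIV si \<in> Dgrp M"
 unfolding Dgrp_def using gal_image_inv(1)[of si M] by simp

lemma D_G: "si \<in> Dgrp M ==> si \<in> G" by (simp add: Dgrp_def)

lemma D_finite: "finite (Dgrp M)" by (rule finite_subset[OF _ finite_G]) (auto simp: Dgrp_def)

lemma inj_left:
 assumes t: "tu \<in> G" shows "inj_on (\<lambda>si. tu \<circ> si) (A :: ('k \<Rightarrow> 'k) set)"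
proof (rule inj_onI)
 fix a b assume "tu \<circ> a = tu \<circ> b"
 hence "inv_into UNIV tu \<circ> (tu \<circ> a) = inv_into UNIV tu \<circ> (tu \<circ> b)" by simp
 thus "a = b" by (simp add: inv_comp(3)[OF t])
qed

lemma card_G_D:
 assumes M: "ismax S M"
 shows "card G = card Maxs * card (Dgrp M)"
proof -
 have "card G = card ((\<lambda>si. si ` M) ` G) * card (Dgrp M)"
 proof (rule card_fibres[OF finite_G])
  fix tu assume t: "tu \<in> G"
  have "{si\<in>G. si ` M = tu ` M} = (\<lambda>si. tu \<circ> si) ` Dgrp M"
  proof (intro equalityI subsetI)
   fix si assume "si \<in> {si\<in>G. si ` M = tu ` M}"
   hence s: "si \<in> G" "si ` M = tu ` M" by auto
   have "(inv_into UNIV tu \<circ> si) ` M = inv_into UNIV tu ` tu ` M" using s by (metis image_comp)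
   hence "inv_into UNIV tu \<circ> si \<in> Dgrp M" using gal_image_inv(1)[OF t] s t by (simp add: Dgrp_def)
   thus "si \<in> (\<lambda>si. tu \<circ> si) ` Dgrp M" using inv_comp(4)[OF t] by (metis image_eqI)
  next
   fix si assume "si \<in> (\<lambda>si. tu \<circ> si) ` Dgrp M"
   then obtain rh where "rh \<in> Dgrp M" "si = tu \<circ> rh" by blast
   thus "si \<in> {si\<in>G. si ` M = tu ` M}"
    using t image_comp[of tu rh M] by (simp add: Dgrp_def)
  qed
  moreover have "inj_on (\<lambda>si. tu \<circ> si) (Dgrp M)" by (rule inj_left[OF t])
  ultimately show "card {si\<in>G. si ` M = tu ` M} = card (Dgrp M)" by (simp add: card_image)
 qed
 thus ?thesis using Maxs_eq[OF M] by simp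
qed

text \<open>The elimination step of the Dedekind independence proof, modulo \<open>M\<close>.\<close>
lemma congruent_coeff_sum:
 assumes M: "ismax S M" and H: "finite H" "H \<subseteq> G" and c: "\<And>h. h \<in> H ==> c h \<in> S" and h1: "h1 \<in> G"
  and rel: "\<And>s. s \<in> S ==> (\<Sum>h\<in>H. c h * h s) \<in> M"
 shows "(\<Sum>h | h \<in> H \<and> (\<forall>s\<in>S. h s - h1 s \<in> M). c h) \<in> M"
 using H c rel
proof (induct "card {h\<in>H. \<not> (\<forall>s\<in>S. h s - h1 s \<in> M)}" arbitrary: H c)
 case 0
 hence "{h\<in>H. \<not> (\<forall>s\<in>S. h s - h1 s \<in> M)} = {}" by simp
 hence "{h. h \<in> H \<and> (\<forall>s\<in>S. h s - h1 s \<in> M)} = H" by blast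
 moreover have "(\<Sum>h\<in>H. c h * h 1) = (\<Sum>h\<in>H. c h)" using 0(3) gal_simps(2) by (intro sum.cong) auto
 ultimately show ?case using 0(5)[OF S_rules(1)] by simp
next
 case (Suc n)
 note Mr = M_rules[OF M]
 let ?bad = "{h\<in>H. \<not> (\<forall>s\<in>S. h s - h1 s \<in> M)}"
 have "?bad \<noteq> {}" using Suc(2) by (metis card.empty nat.distinct(1))
 then obtain h0 y where h0: "h0 \<in> H" "y \<in> S" "h0 y - h1 y \<notin> M" by blast
 have hS: "h s \<in> S" if "h \<in> H" "s \<in> S" for h s using gal_S[of h s] that Suc(4) by auto
 have h1S: "h1 s \<in> S" if "s \<in> S" for s using gal_S[OF h1 that] .
 define c' where "c' h = c h * (h y - h0 y)" for h
 let ?H = "H - {h0}"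
 have "n = card {h\<in>?H. \<not> (\<forall>s\<in>S. h s - h1 s \<in> M)}"
 proof -
  have "{h\<in>?H. \<not> (\<forall>s\<in>S. h s - h1 s \<in> M)} = ?bad - {h0}" by blast
  moreover have "h0 \<in> ?bad" using h0 by blast
  ultimately show ?thesis using Suc(2) by (simp add: card_Diff_singleton)
 qed
 moreover have "c' h \<in> S" if "h \<in> ?H" for h
  using that Suc(5) hS h0 S_rules(4,6) by (auto simp: c'_def)
 moreover have "(\<Sum>h\<in>?H. c' h * h s) \<in> M" if s: "s \<in> S" for s
 proof -
  have "(\<Sum>h\<in>?H. c' h * h s) = (\<Sum>h\<in>H. c' h * h s)"
   using Suc(3) h0(1) by (intro sum.mono_neutral_left) (auto simp: c'_def)
  also have "\<dots> = (\<Sum>h\<in>H. c h * h (y * s) - h0 y * (c h * h s))"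
  proof (rule sum.cong[OF refl])
   fix h assume "h \<in> H"
   hence "h (y * s) = h y * h s" using gal_simps(4) Suc(4) by blast
   thus "c' h * h s = c h * h (y * s) - h0 y * (c h * h s)" by (simp add: c'_def algebra_simps)
  qed
  also have "\<dots> = (\<Sum>h\<in>H. c h * h (y * s)) - h0 y * (\<Sum>h\<in>H. c h * h s)"
   by (simp add: sum_subtractf sum_distrib_left)
  also have "\<dots> \<in> M"
   using Suc(6)[OF S_rules(6)[OF h0(2) s]] Mr(4)[OF hS[OF h0(1,2)] Suc(6)[OF s]] by (rule Mr(7))
  finally show ?thesis .
 qed
 ultimately have "(\<Sum>h | h \<in> ?H \<and> (\<forall>s\<in>S. h s - h1 s \<in> M). c' h) \<in> M"
  using Suc(1)[of ?H c'] Suc(3,4) by blast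
 moreover have "{h. h \<in> ?H \<and> (\<forall>s\<in>S. h s - h1 s \<in> M)} = {h. h \<in> H \<and> (\<forall>s\<in>S. h s - h1 s \<in> M)}"
  using h0 by blast
 ultimately have s1: "(\<Sum>h | h \<in> H \<and> (\<forall>s\<in>S. h s - h1 s \<in> M). c' h) \<in> M" by simp
 let ?E = "{h. h \<in> H \<and> (\<forall>s\<in>S. h s - h1 s \<in> M)}"
 have "(\<Sum>h\<in>?E. c h * (h y - h1 y)) \<in> M"
  by (rule is_ideal_sum[OF S_subring maxD(1)[OF M]]) (use Suc(5) h0 Mr(4) in auto)
 with s1 have "(\<Sum>h\<in>?E. c' h) - (\<Sum>h\<in>?E. c h * (h y - h1 y)) \<in> M" by (rule Mr(7))
 \<comment> \<open>For automorphisms congruent to \<open>h1\<close> the factor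
   \<open>h y - h0 y\<close> may be replaced by the constant \<open>h1 y - h0 y\<close>, which is
   outside \<open>M\<close> and can be cancelled.\<close>
 moreover have "(\<Sum>h\<in>?E. c' h) - (\<Sum>h\<in>?E. c h * (h y - h1 y)) = (\<Sum>h\<in>?E. c h) * - (h0 y - h1 y)"
  unfolding c'_def sum_subtractf[symmetric] sum_distrib_right
  by (rule sum.cong) (auto simp: algebra_simps)
 ultimately have p: "(\<Sum>h\<in>?E. c h) * - (h0 y - h1 y) \<in> M" by simp
 have "- (h0 y - h1 y) \<notin> M" using h0(3) Mr(6)[of "- (h0 y - h1 y)"] by auto
 moreover have "(\<Sum>h\<in>?E. c h) \<in> S" by (rule is_subring_sum[OF S_subring]) (use Suc(5) in auto)
 moreover have "- (h0 y - h1 y) \<in> S" using hS[OF h0(1,2)] h1S[OF h0(2)] S_rules(3,4) by blast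
 ultimately show ?case using maxD(5)[OF M _ _ p] by blast
qed

section \<open>Residue classes fixed by the decomposition group\<close>

context
 fixes M x g
 assumes M: "ismax S M" and x: "x \<in> S" and xD: "\<And>si. si \<in> Dgrp M ==> si x - x \<in> M"
  and xM': "\<And>M'. ismax S M' ==> M' \<noteq> M ==> x \<in> M'"
  and g: "\<And>i. coeff g i \<in> V" "poly g x \<in> M" "poly (pderiv g) x \<notin> M"
begin

text \<open>No residue field is formed here: its polynomials are represented by polynomials over
  \<open>S\<close>, taken modulo those with all coefficients in \<open>M\<close>.\<close>

private abbreviation PS where "PS \<equiv> {p. \<forall>i. coeff p i \<in> S}"
private abbreviation PM where "PM \<equiv> {p. \<forall>i. coeff p i \<in> M}"

private lemma PS: "is_subring PS" by (rule is_subring_polys[OF S_subring])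
private lemma PMi: "is_ideal PS PM" by (rule is_ideal_polys[OF S_subring maxD(1)[OF M]])

private lemma lin_PS: "[:- x, 1:] \<in> PS"
 using x S_rules(1-3) by (auto simp: coeff_pCons split: nat.splits)

private lemma synthetic:
 assumes p: "p \<in> PS"
 shows "\<exists>q\<in>PS. p = [:- x, 1:] * q + [:poly p x:]"
proof -
 obtain q r where qr: "q \<in> PS" "p = [:- x, 1:] * q + r" "r = 0 \<or> degree r < degree [:- x, 1:]"
  using monic_division[OF S_subring, of "[:- x, 1:]" p] p lin_PS by auto
 obtain c where c: "r = [:c:]" using qr(3) by (cases "r = 0") (auto elim: degree_eq_zeroE)
 have "poly p x = c" unfolding qr(2) c by simp
 thus ?thesis using qr c by blast
qed

private lemma cancel_lin:
 assumes p: "p \<in> PS" and lp: "[:- x, 1:] * p \<in> PM"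
 shows "p \<in> PM"
proof -
 note Mr = M_rules[OF M]
 have "coeff p i \<in> M" if "i \<le> Suc (degree p)" for i
  using that
 proof (induct rule: inc_induct)
  case base thus ?case using Mr(2) by (simp add: coeff_eq_0)
 next
  case (step n)
  have "coeff ([:- x, 1:] * p) (Suc n) = coeff p n - x * coeff p (Suc n)" by simp
  hence "coeff p n = coeff ([:- x, 1:] * p) (Suc n) + x * coeff p (Suc n)" by simp
  moreover have "coeff ([:- x, 1:] * p) (Suc n) \<in> M" using lp by blast
  moreover have "x * coeff p (Suc n) \<in> M" using Mr(4) x step(3) by blast
  ultimately show ?case using Mr(3) by metis
 qed
 moreover have "coeff p i \<in> M" if "i > Suc (degree p)" for i using that Mr(2) by (simp add: coeff_eq_0)
 ultimately show ?thesis by (auto simp: not_le[symmetric])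
qed

text \<open>The factors \<open>X - x\<close> are cancelled one by one: evaluation at
  \<open>x\<close> forces \<open>w\<close> to vanish there modulo \<open>M\<close>, because
  \<open>n\<close> does not, so \<open>w\<close> is divisible by \<open>X - x\<close> modulo
  \<open>M\<close>.\<close>

private lemma cancel_power:
 assumes n: "n \<in> PS" "poly n x \<notin> M" and w: "w \<in> PS" "n * w - [:0,1:] ^ k * [:- x, 1:] ^ m \<in> PM"
 shows "\<exists>w'\<in>PS. n * w' - [:0,1:] ^ k \<in> PM"
 using w
proof (induct m arbitrary: w)
 case 0 thus ?case by auto
next
 case (Suc m)
 have X: "[:0,1:] ^ k \<in> PS"
  by (rule is_subring_power[OF PS]) (use S_rules in \<open>auto simp: coeff_pCons split: nat.splits\<close>)
 have "poly (n * w - [:0,1:] ^ k * [:- x, 1:] ^ Suc m) x \<in> M"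
  using poly_in_ideal[OF S_subring maxD(1)[OF M] _ x] Suc(3) by blast
 hence "poly n x * poly w x \<in> M" by simp
 hence wx: "poly w x \<in> M"
  using maxD(5)[OF M] n poly_in_subring[OF S_subring _ x] Suc(2) by blast
 obtain w1 where w1: "w1 \<in> PS" "w = [:- x, 1:] * w1 + [:poly w x:]" using synthetic[OF Suc(2)] by blast
 have wc: "[:poly w x:] \<in> PM" using wx M_rules(2)[OF M] by (auto simp: coeff_pCons split: nat.splits)
 define d where "d = n * w1 - [:0,1:] ^ k * [:- x, 1:] ^ m"
 have "[:- x, 1:] * d = (n * w - [:0,1:] ^ k * [:- x, 1:] ^ Suc m) - n * [:poly w x:]"
 proof -
  have e: "n * w = n * ([:- x, 1:] * w1) + n * [:poly w x:]"
   using arg_cong[OF w1(2), of "\<lambda>v. n * v"] by (simp only: distrib_left)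
  show ?thesis unfolding d_def e by (simp only: power_Suc algebra_simps)
 qed
 also have "\<dots> \<in> PM" using is_idealD(4)[OF PS PMi n(1) wc] Suc(3) is_idealD(7)[OF PS PMi] by blast
 finally have "[:- x, 1:] * d \<in> PM" .
 moreover have "d \<in> PS" unfolding d_def
  by (intro is_subringD(4,6)[OF PS] n w1 X is_subring_power[OF PS] lin_PS)
 ultimately have "d \<in> PM" by (rule cancel_lin[rotated])
 thus ?case using Suc(1)[OF w1(1)] by (simp add: d_def)
qed

text \<open>Let \<open>h\<close> lift the minimal polynomial of the residue of \<open>x\<close> over
  that of \<open>V\<close>. It divides the polynomial of conjugates, which modulo \<open>M\<close>
  is a power of \<open>X\<close> times a power of \<open>X - x\<close>. Separability makes
  \<open>x\<close> a simple root, so modulo \<open>M\<close> the polynomial \<open>h\<close> is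
  \<open>X - x\<close> times a power of \<open>X\<close>, and one of its coefficients, an element of
  \<open>V\<close>, is congruent to \<open>- x\<close>.\<close>

lemma fixed_residue: "\<exists>v\<in>V. x - v \<in> M"
proof -
 note Mr = M_rules[OF M] and sub = S_subring and Mi = maxD(1)[OF M]
 have PSV: "p \<in> PS" if "\<And>i. coeff p i \<in> V" for p using that V_S by auto
 have JVM: "p \<in> PM" if "\<And>i. coeff p i \<in> JV" for p using that JV_in_max[OF M] by auto
 \<comment> \<open>A member of least degree lifts the minimal polynomial. A polynomial over
   \<open>V\<close> of smaller degree with root \<open>x\<close> modulo \<open>M\<close> has all
   coefficients in \<open>JV\<close>, since otherwise it could be truncated and made monic.\<close>
 define hs where "hs = {h. lead_coeff h = 1 \<and> (\<forall>i. coeff h i \<in> V) \<and> poly h x \<in> M}"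
 have "conj_poly x \<in> PS" unfolding conj_poly_def
  by (rule is_subring_prod[OF PS])
   (use gal_S[OF _ x] S_rules in \<open>auto simp: coeff_pCons split: nat.splits\<close>)
 hence cV: "coeff (conj_poly x) i \<in> V" for i using S_int_F conj_poly_props(1) by blast
 hence chs: "conj_poly x \<in> hs" using conj_poly_props(3,4) Mr(2) by (simp add: hs_def)
 obtain h where h: "h \<in> hs" and hmin: "\<And>h'. h' \<in> hs ==> degree h \<le> degree h'"
  using ex_has_least_nat[of "\<lambda>h. h \<in> hs" "conj_poly x" degree] chs by blast
 have h1: "lead_coeff h = 1" and hV: "\<And>i. coeff h i \<in> V" and hM: "poly h x \<in> M"
  using h by (auto simp: hs_def)
 have small: "r \<in> PM" if r: "\<And>i. coeff r i \<in> V" "poly r x \<in> M" "r = 0 \<or> degree r < degree h" for r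
 proof (rule JVM, rule ccontr)
  fix i assume n: "coeff r i \<notin> JV"
  let ?K = "{i. coeff r i \<notin> JV}"
  have "?K \<subseteq> {..degree r}" using JV_rules(2) by (auto intro!: le_degree)
  hence fin: "finite ?K" by (rule finite_subset) simp
  define k where "k = Max ?K"
  have k: "coeff r k \<notin> JV" using Max_in[OF fin] n unfolding k_def by blast
  have kmax: "coeff r i \<in> JV" if "i > k" for i using that Max_ge[OF fin, of i] unfolding k_def by force
  define c where "c = coeff r k"
  have c: "c \<noteq> 0" "c \<in> V" "inverse c \<in> V" using k r(1)[of k] by (auto simp: c_def nonunits_def)
  define r1 where "r1 = (\<Sum>i\<le>k. monom (coeff r i) i)"
  have r1c: "coeff r1 i = (if i \<le> k then coeff r i else 0)" for i
   unfolding r1_def by (auto simp: coeff_sum)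
  have d1: "degree r1 = k"
  proof (rule antisym)
   show "degree r1 \<le> k" by (rule degree_le) (simp add: r1c)
   show "k \<le> degree r1" by (rule le_degree) (use c in \<open>simp add: r1c c_def\<close>)
  qed
  have "r - r1 \<in> PM" by (rule JVM) (use kmax JV_rules(2) in \<open>auto simp: r1c\<close>)
  hence "poly (r - r1) x \<in> M" using poly_in_ideal[OF sub Mi _ x] by blast
  hence "poly r x - poly (r - r1) x \<in> M" using r(2) Mr(7) by blast
  hence r1M: "poly r1 x \<in> M" by simp
  have "smult (inverse c) r1 \<in> hs"
  proof -
   have "lead_coeff (smult (inverse c) r1) = 1" using c(1) by (simp add: d1 r1c c_def)
   moreover have "coeff (smult (inverse c) r1) i \<in> V" for i using c r(1) V_rules(2,6) by (simp add: r1c)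
   moreover have "inverse c * poly r1 x \<in> M" using Mr(4) c(3) V_S r1M by blast
   ultimately show ?thesis unfolding hs_def by simp
  qed
  hence "degree h \<le> k" using hmin[of "smult (inverse c) r1"] c(1) by (simp add: d1)
  moreover have "k \<le> degree r" using c(1) by (auto simp: c_def intro!: le_degree)
  moreover have "r \<noteq> 0" using c(1) by (auto simp: c_def)
  ultimately show False using r(3) by simp
 qed
 have divide: "\<exists>u. (\<forall>i. coeff u i \<in> V) \<and> p - h * u \<in> PM" if p: "\<And>i. coeff p i \<in> V" "poly p x \<in> M" for p
 proof -
  obtain u r where ur: "\<And>i. coeff u i \<in> V" "\<And>i. coeff r i \<in> V" "p = h * u + r" "r = 0 \<or> degree r < degree h"
   using monic_division[OF V_subring h1 hV p(1)] by blast
  have "poly r x = poly p x - poly h x * poly u x" by (simp add: ur(3))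
  moreover have "poly h x * poly u x \<in> M" using Mr(5)[OF _ hM] poly_in_subring[OF sub _ x] PSV[OF ur(1)] by blast
  ultimately have "poly r x \<in> M" using p(2) Mr(7) by simp
  hence "r \<in> PM" using small ur by blast
  thus ?thesis using ur by (intro exI[of _ u]) auto
 qed
 have dM: "pderiv p \<in> PM" if "p \<in> PM" for p
 proof -
  have "of_nat n \<in> S" for n by (induct n) (auto intro: S_rules)
  thus ?thesis using that Mr(4) by (auto simp: coeff_pderiv simp del: of_nat_Suc)
 qed
 \<comment> \<open>Separability passes from \<open>g\<close> to \<open>h\<close>: modulo
   \<open>M\<close>, \<open>g\<close> is a multiple of \<open>h\<close>, so a double root of
   \<open>h\<close> would be one of \<open>g\<close>.\<close>
 have h'M: "poly (pderiv h) x \<notin> M"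
 proof
  assume a: "poly (pderiv h) x \<in> M"
  obtain u where u: "\<And>i. coeff u i \<in> V" "g - h * u \<in> PM" using divide[OF g(1,2)] by blast
  have uS: "poly u x \<in> S" "poly (pderiv u) x \<in> S"
  proof -
   show "poly u x \<in> S" by (rule poly_in_subring[OF sub _ x]) (use u V_S in blast)
   have "of_nat n \<in> S" for n by (induct n) (auto intro: S_rules)
   hence "coeff (pderiv u) i \<in> S" for i
    unfolding coeff_pderiv by (rule S_rules(6)) (use u(1) V_S in auto)
   thus "poly (pderiv u) x \<in> S" by (intro poly_in_subring[OF sub _ x])
  qed
  have "poly (pderiv (g - h * u)) x \<in> M" using poly_in_ideal[OF sub Mi _ x] dM[OF u(2)] by blast
  moreover have "poly (pderiv g) x = poly (pderiv (g - h * u)) x + (poly h x * poly (pderiv u) x + poly (pderiv h) x * poly u x)"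
   by (simp add: pderiv_diff pderiv_mult algebra_simps)
  moreover have "poly h x * poly (pderiv u) x + poly (pderiv h) x * poly u x \<in> M"
   using Mr(3) Mr(5)[OF uS(2) hM] Mr(5)[OF uS(1) a] by blast
  ultimately show False using g(3) Mr(3) by simp
 qed
 obtain n where n: "n \<in> PS" "h = [:- x, 1:] * n + [:poly h x:]" using synthetic[OF PSV[OF hV]] by blast
 have hcM: "[:poly h x:] \<in> PM" using hM Mr(2) by (auto simp: coeff_pCons split: nat.splits)
 have "poly (pderiv h) x = poly n x"
  by (subst n(2)) (simp only: pderiv_add pderiv_mult, simp add: pderiv_pCons)
 hence nM: "poly n x \<notin> M" using h'M by simp
 have dh: "degree h \<noteq> 0"
 proof
  assume "degree h = 0"
  hence "h = [:1:]" using h1 by (auto elim!: degree_eq_zeroE)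
  thus False using hM ismaxD(2)[OF sub M] by simp
 qed
 have n0: "n \<noteq> 0" using nM Mr(2) by auto
 have dn: "degree h = Suc (degree n)" and ln: "lead_coeff n = 1"
 proof -
  have dl: "degree ([:- x, 1:] * n) = Suc (degree n)" using n0 by (subst degree_mult_eq) auto
  hence "degree ([:- x, 1:] * n + [:poly h x:]) = Suc (degree n)" by (subst degree_add_eq_left) auto
  thus d: "degree h = Suc (degree n)" using n(2) by simp
  have "coeff h (Suc (degree n)) = coeff ([:- x, 1:] * n) (Suc (degree n)) + coeff [:poly h x:] (Suc (degree n))"
   by (subst n(2)) simp
  thus "lead_coeff n = 1" using h1 d by (simp add: coeff_eq_0)
 qed
 obtain u where u: "\<And>i. coeff u i \<in> V" "conj_poly x - h * u \<in> PM" using divide[OF cV] conj_poly_props(4) Mr(2) by auto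
 let ?m = "card (Dgrp M)" and ?k = "card (G - Dgrp M)"
 \<comment> \<open>Conjugates of \<open>x\<close> under the decomposition group are congruent to
   \<open>x\<close>; all others lie in \<open>M\<close>, since \<open>x\<close> lies in every
   maximal ideal different from \<open>M\<close>.\<close>
 have "(\<Prod>si\<in>G. [:- si x, 1:]) - (\<Prod>si\<in>G. if si \<in> Dgrp M then [:- x, 1:] else [:0,1:]) \<in> PM"
 proof (rule prod_diff_in_ideal[OF PS PMi])
  fix si assume s: "si \<in> G"
  show "[:- si x, 1:] \<in> PS" using gal_S[OF s x] S_rules by (auto simp: coeff_pCons split: nat.splits)
  show "(if si \<in> Dgrp M then [:- x, 1:] else [:0,1:]) \<in> PS"
   using x S_rules by (auto simp: coeff_pCons split: nat.splits)
  show "[:- si x, 1:] - (if si \<in> Dgrp M then [:- x, 1:] else [:0,1:]) \<in> PM"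
  proof (cases "si \<in> Dgrp M")
   case True
   have "- (si x - x) \<in> M" using xD[OF True] Mr(6) by blast
   thus ?thesis using True Mr(2) by (auto simp: coeff_pCons split: nat.splits)
  next
   case False
   let ?t = "inv_into UNIV si"
   have "?t ` M \<noteq> M"
   proof
    assume "?t ` M = M"
    hence "si ` M = M" using gal_image_inv(2)[OF s, of M] by simp
    thus False using False s by (simp add: Dgrp_def)
   qed
   hence "x \<in> ?t ` M" using xM' gal_max[OF M inv_in_G[OF s]] by blast
   hence "si x \<in> M" using inv_app[OF s] by auto
   thus ?thesis using False Mr(2,6) by (auto simp: coeff_pCons split: nat.splits)
  qed
 qed
 moreover have "(\<Prod>si\<in>G. if si \<in> Dgrp M then [:- x, 1:] else [:0,1:]) = [:0,1:] ^ ?k * [:- x, 1:] ^ ?m"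
 proof -
  have "G \<inter> {si. si \<in> Dgrp M} = Dgrp M" "G \<inter> - {si. si \<in> Dgrp M} = G - Dgrp M" by (auto simp: Dgrp_def)
  thus ?thesis by (subst prod.If_cases) (auto simp: mult.commute)
 qed
 ultimately have "conj_poly x - [:0,1:] ^ ?k * [:- x, 1:] ^ ?m \<in> PM" by (simp add: conj_poly_def)
 hence "(conj_poly x - [:0,1:] ^ ?k * [:- x, 1:] ^ ?m) - (conj_poly x - h * u) \<in> PM"
  using u(2) is_idealD(7)[OF PS PMi] by blast
 moreover have "[:poly h x:] * u \<in> PM" using is_idealD(5)[OF PS PMi PSV[OF u(1)] hcM] by blast
 ultimately have "(conj_poly x - [:0,1:] ^ ?k * [:- x, 1:] ^ ?m) - (conj_poly x - h * u) - [:poly h x:] * u \<in> PM"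
  using is_idealD(7)[OF PS PMi] by blast
 moreover have "(conj_poly x - [:0,1:] ^ ?k * [:- x, 1:] ^ ?m) - (conj_poly x - h * u) - [:poly h x:] * u
   = n * ([:- x, 1:] * u) - [:0,1:] ^ ?k * [:- x, 1:] ^ ?m"
  by (subst n(2)) (simp only: algebra_simps)
 ultimately have "n * ([:- x, 1:] * u) - [:0,1:] ^ ?k * [:- x, 1:] ^ ?m \<in> PM" by (simp only:)
 then obtain w where w: "w \<in> PS" "n * w - [:0,1:] ^ ?k \<in> PM"
  using cancel_power[OF n(1) nM is_subringD(6)[OF PS lin_PS PSV[OF u(1)]]] by blast
 have wc: "coeff (n * w) i - (if i = ?k then 1 else 0) \<in> M" for i
 proof -
  have "coeff ([:0,1:] ^ ?k) i = (if i = ?k then 1 else 0 :: 'k)"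
   using coeff_monom[of "1::'k" ?k i] by (simp add: monom_altdef)
  moreover have "coeff (n * w - [:0,1:] ^ ?k) i \<in> M" using w(2) by blast
  ultimately show ?thesis by simp
 qed
 have wne: "\<exists>i. coeff w i \<notin> M"
 proof (rule ccontr)
  assume "\<not> ?thesis"
  hence "w \<in> PM" by blast
  hence "n * w \<in> PM" using is_idealD(4)[OF PS PMi n(1)] by blast
  hence "coeff (n * w) ?k \<in> M" by blast
  hence "coeff (n * w) ?k - (coeff (n * w) ?k - 1) \<in> M"
   by (rule Mr(7)) (use wc[of ?k] in simp)
  thus False using ismaxD(2)[OF sub M] by simp
 qed
 have finw: "finite {i. coeff w i \<notin> M}"
  by (rule finite_subset[of _ "{..degree w}"]) (use Mr(2) in \<open>auto intro!: le_degree\<close>)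
 \<comment> \<open>In \<open>n * w = X ^ ?k\<close> modulo \<open>M\<close>, compare the lowest and
   the highest coefficients outside \<open>M\<close>: \<open>i0 + j = ?k = degree n + l\<close>
   together with \<open>i0 \<le> degree n\<close> and \<open>j \<le> l\<close> forces
   \<open>i0 = degree n\<close>, so \<open>n\<close> is a power of \<open>X\<close> modulo
   \<open>M\<close>.\<close>
 define j where "j = (LEAST i. coeff w i \<notin> M)"
 define l where "l = Max {i. coeff w i \<notin> M}"
 define i0 where "i0 = (LEAST i. coeff n i \<notin> M)"
 have j: "coeff w j \<notin> M" "\<And>i. i < j ==> coeff w i \<in> M"
  using LeastI_ex[OF wne] not_less_Least unfolding j_def by blast+
 have l: "coeff w l \<notin> M" "\<And>i. i > l ==> coeff w i \<in> M"
  using Max_in[OF finw] wne Max_ge[OF finw] unfolding l_def by (blast, force)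
 have top: "coeff n (degree n) \<notin> M" using ln ismaxD(2)[OF sub M] by simp
 have i0: "coeff n i0 \<notin> M" "\<And>i. i < i0 ==> coeff n i \<in> M"
  using LeastI[of "\<lambda>i. coeff n i \<notin> M", OF top] not_less_Least unfolding i0_def by blast+
 have i0le: "i0 \<le> degree n" unfolding i0_def by (rule Least_le) (rule top)
 have jl: "j \<le> l" using j(2) l(1) not_less by blast
 have nS: "coeff n i \<in> S" and wS: "coeff w i \<in> S" for i using n(1) w(1) by auto
 have prodk: "a + b = ?k" if a: "coeff n a \<notin> M" "coeff w b \<notin> M"
  and z: "\<And>i. i \<le> a + b ==> i \<noteq> a ==> coeff n i * coeff w (a + b - i) \<in> M" for a b
 proof (rule ccontr)
  assume ne: "a + b \<noteq> ?k"
  have "coeff (n * w) (a + b) = coeff n a * coeff w b + (\<Sum>i\<in>{..a+b} - {a}. coeff n i * coeff w (a + b - i))"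
   by (simp add: coeff_mult sum.remove[of _ a])
  moreover have "(\<Sum>i\<in>{..a+b} - {a}. coeff n i * coeff w (a + b - i)) \<in> M"
   by (rule is_ideal_sum[OF sub Mi]) (use z in auto)
  moreover have "coeff (n * w) (a + b) \<in> M" using wc[of "a + b"] ne by simp
  ultimately have "coeff n a * coeff w b \<in> M" using Mr(7) by (metis add_diff_cancel_right')
  thus False using ismaxD(5)[OF sub M nS wS] a by blast
 qed
 have "i0 + j = ?k"
 proof (rule prodk[OF i0(1) j(1)])
  fix i assume i: "i \<le> i0 + j" "i \<noteq> i0"
  show "coeff n i * coeff w (i0 + j - i) \<in> M"
  proof (cases "i < i0")
   case True thus ?thesis using i0(2) Mr(5) wS by blast
  next
   case False
   hence "i0 + j - i < j" using i by auto
   thus ?thesis using j(2) Mr(4) nS by blast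
  qed
 qed
 moreover have "degree n + l = ?k"
 proof (rule prodk[OF top l(1)])
  fix i assume i: "i \<le> degree n + l" "i \<noteq> degree n"
  show "coeff n i * coeff w (degree n + l - i) \<in> M"
  proof (cases "i > degree n")
   case True thus ?thesis using Mr(2) by (simp add: coeff_eq_0)
  next
   case False
   hence "degree n + l - i > l" using i by auto
   thus ?thesis using l(2) Mr(4) nS by blast
  qed
 qed
 ultimately have i0d: "i0 = degree n" using i0le jl by auto
 let ?d = "degree n"
 have "coeff h ?d = coeff ([:- x, 1:] * n + [:poly h x:]) ?d" using n(2) by simp
 hence hd: "coeff h ?d = (- x) + ((case ?d of 0 \<Rightarrow> 0 | Suc e \<Rightarrow> coeff n e) + coeff [:poly h x:] ?d)"
  using ln by (cases ?d) (auto simp: algebra_simps)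
 moreover have "(case ?d of 0 \<Rightarrow> 0 | Suc e \<Rightarrow> coeff n e) \<in> M"
  using i0(2) i0d Mr(2) by (auto split: nat.splits)
 moreover have "coeff [:poly h x:] ?d \<in> M" using hcM by blast
 ultimately have "coeff h ?d - (- x) \<in> M" using Mr(3) by simp
 hence "x - (- coeff h ?d) \<in> M" by (simp add: add.commute)
 moreover have "- coeff h ?d \<in> V" using hV V_rules(3) by blast
 ultimately show ?thesis by blast
qed

end

end

section \<open>Lifting polynomials from the residue field\<close>

primrec list_poly :: "'a::comm_ring_1 list \<Rightarrow> 'a poly" where
 "list_poly [] = 0"
| "list_poly (v # vs) = monom v (length vs) + list_poly vs"

text \<open>The derivative without normalization: a leading coefficient may vanish in the residue
  field, so normalizing does not commute with reduction, whereas this list reduces entry by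
  entry.\<close>

primrec list_deriv :: "'a::comm_ring_1 list \<Rightarrow> 'a list" where
 "list_deriv [] = []"
| "list_deriv (v # vs) = (if vs = [] then [] else (of_nat (length vs) * v) # list_deriv vs)"

lemma length_list_deriv: "length (list_deriv vs) = length vs - 1"
proof (induct vs)
 case (Cons v vs) thus ?case by (cases vs) auto
qed simp

lemma list_poly_deriv: "list_poly (list_deriv vs) = pderiv (list_poly vs)"
 by (induct vs) (auto simp: pderiv_add pderiv_monom length_list_deriv)

lemma list_poly_coeff:
 assumes "is_subring R" "set vs \<subseteq> R"
 shows "coeff (list_poly vs) i \<in> R"
 using assms(2) by (induct vs) (auto intro: is_subringD[OF assms(1)])

section \<open>The residue field at M and the order of the inertia group\<close>

context val_ext
begin

lemma ident_in_G [simp]: "(\<lambda>x. x) \<in> G"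
 using id_in_G unfolding id_def .

context
 fixes M
 assumes M: "ismax S M"
begin

abbreviation kf where "kf \<equiv> residue_field (loc M)"
abbreviation cs where "cs x \<equiv> a_r_coset (subR (loc M)) (nloc M) x"

private lemma kf_eq: "kf = subR (loc M) Quot nloc M"
 unfolding residue_field_def jac_val[OF loc_val[OF M]] ..

private lemma max_loc: "maximalideal (nloc M) (subR (loc M))"
 using ismax_val[OF loc_val[OF M]] ismax_iff[OF loc_subring[OF M]] by blast

private lemma cring_loc: "cring (subR (loc M))" by (rule cring_subR[OF loc_subring[OF M]])

private lemma ideal_loc: "ideal (nloc M) (subR (loc M))"
 using max_loc by (rule maximalideal.axioms)

lemma field_kf: "field kf"
 unfolding kf_eq by (rule maximalideal.quotient_is_field[OF max_loc cring_loc])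

private lemma cs_hom: "(\<lambda>x. cs x) \<in> ring_hom (subR (loc M)) kf"
 unfolding kf_eq by (rule ideal.rcos_ring_hom[OF ideal_loc])

private lemma cs_simps:
 assumes "x \<in> loc M" "y \<in> loc M"
 shows "cs x \<otimes>\<^bsub>kf\<^esub> cs y = cs (x * y)" "cs x \<oplus>\<^bsub>kf\<^esub> cs y = cs (x + y)" "cs x \<in> carrier kf"
 using ring_hom_mult[OF cs_hom, of x y] ring_hom_add[OF cs_hom, of x y] ring_hom_closed[OF cs_hom, of x] assms by auto

private lemma cs_one: "\<one>\<^bsub>kf\<^esub> = cs 1"
 using ring_hom_one[OF cs_hom] by simp

private lemma cs_zero: "\<zero>\<^bsub>kf\<^esub> = cs 0"
proof -
 interpret field kf by (rule field_kf)
 have "0 \<in> loc M" using loc_rules(2)[OF M] .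
 hence "cs 0 \<oplus>\<^bsub>kf\<^esub> cs 0 = cs 0" "cs 0 \<in> carrier kf" using cs_simps[of 0 0] by auto
 thus ?thesis using r_neg[of "cs 0"] a_assoc[of "cs 0" "cs 0" "\<ominus>\<^bsub>kf\<^esub> cs 0"] by (simp add: r_neg)
qed

private lemma cs_eq: "x \<in> loc M ==> y \<in> loc M ==> cs x = cs y \<longleftrightarrow> x - y \<in> nloc M"
proof -
 assume xy: "x \<in> loc M" "y \<in> loc M"
 interpret cring "subR (loc M)" by (rule cring_loc)
 show ?thesis
  using quotient_eq_iff_same_a_r_cos[OF ideal_loc, of x y] xy diff_subR[OF loc_subring[OF M]] by simp
qed

private lemma cs_carrier: "carrier kf = (\<lambda>x. cs x) ` loc M"
 unfolding kf_eq FactRing_def by (auto simp: A_RCOSETS_def')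

private lemma D_loc:
 assumes s: "si \<in> Dgrp M"
 shows "si x \<in> loc M \<longleftrightarrow> x \<in> loc M" "si x \<in> nloc M \<longleftrightarrow> x \<in> nloc M" "si x \<in> M \<longleftrightarrow> x \<in> M"
 using loc_gal[OF M D_G[OF s], of x] nloc_gal[OF M D_G[OF s], of x] gal_max_mem[OF D_G[OF s], of x M] s
 by (auto simp: Dgrp_def)

private lemma cs_image:
 assumes s: "si \<in> Dgrp M" and x: "x \<in> loc M"
 shows "si ` cs x = cs (si x)"
proof -
 note sG = D_G[OF s]
 have c: "cs y = {h + y | h. h \<in> nloc M}" for y by (auto simp: a_r_coset_def')
 have "\<exists>h'. si (h + x) = h' + si x \<and> h' \<in> nloc M" if "h \<in> nloc M" for h
  using that D_loc(2)[OF s] gal_simps(3)[OF sG] by blast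
 moreover have "\<exists>h'. h + si x = si (h' + x) \<and> h' \<in> nloc M" if "h \<in> nloc M" for h
  using that D_loc(2)[OF s, of "inv_into UNIV si h"] gal_simps(3)[OF sG] inv_app[OF sG]
  by (intro exI[of _ "inv_into UNIV si h"]) auto
 ultimately show ?thesis unfolding c by (fastforce simp: image_iff)
qed

private lemma loc_rep: "x \<in> loc M ==> \<exists>s\<in>S. x - s \<in> nloc M"
proof -
 assume x: "x \<in> loc M"
 obtain t where t: "t \<in> S" "t \<notin> M" "x * t \<in> S" using loc_num[OF M x] by blast
 obtain u where u: "u \<in> S" "1 - u * t \<in> M" using maxD(3)[OF M] t by blast
 have "1 - u * t \<in> nloc M" using nloc_iff[OF M] u maxD(4)[OF M] by blast
 hence "x * (1 - u * t) \<in> nloc M" using nloc_rules(4)[OF M x] by blast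
 hence "x - u * (x * t) \<in> nloc M" by (simp add: algebra_simps)
 moreover have "u * (x * t) \<in> S" using S_rules(6) u t by blast
 ultimately show ?thesis by blast
qed

private lemma residue_sub_eq: "residue_sub (loc M) V = (\<lambda>x. cs x) ` V"
 unfolding residue_sub_def jac_val[OF loc_val[OF M]] by auto

private lemma V_loc: "v \<in> V ==> v \<in> loc M" using V_S S_loc[OF M] by blast

private lemma subfield_kf: "subfield ((\<lambda>x. cs x) ` V) kf"
proof -
 interpret k: field kf by (rule field_kf)
 have sub: "subring ((\<lambda>x. cs x) ` V) kf"
 proof (rule k.subringI)
  show "(\<lambda>x. cs x) ` V \<subseteq> carrier kf" using cs_simps(3) V_loc by blast
  show "\<one>\<^bsub>kf\<^esub> \<in> (\<lambda>x. cs x) ` V" unfolding cs_one using V_rules(1) by blast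
  fix a b assume "a \<in> (\<lambda>x. cs x) ` V"
  then obtain v where v: "v \<in> V" "a = cs v" by blast
  have "cs v \<oplus>\<^bsub>kf\<^esub> cs (- v) = \<zero>\<^bsub>kf\<^esub>"
   using cs_simps(2)[OF V_loc[OF v(1)] V_loc[OF V_rules(3)[OF v(1)]]] by (simp add: cs_zero)
  hence "cs (- v) \<oplus>\<^bsub>kf\<^esub> cs v = \<zero>\<^bsub>kf\<^esub>"
   using k.a_comm cs_simps(3) V_loc V_rules(3) v(1) by metis
  hence "\<ominus>\<^bsub>kf\<^esub> a = cs (- v)"
   unfolding v(2) by (rule k.minus_equality) (use cs_simps(3) V_loc V_rules(3) v(1) in blast)+
  thus "\<ominus>\<^bsub>kf\<^esub> a \<in> (\<lambda>x. cs x) ` V" using V_rules(3)[OF v(1)] by simp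
  assume "b \<in> (\<lambda>x. cs x) ` V"
  then obtain u where u: "u \<in> V" "b = cs u" by blast
  show "a \<otimes>\<^bsub>kf\<^esub> b \<in> (\<lambda>x. cs x) ` V" "a \<oplus>\<^bsub>kf\<^esub> b \<in> (\<lambda>x. cs x) ` V"
   unfolding v u using cs_simps[OF V_loc[OF v(1)] V_loc[OF u(1)]] V_rules(5,6) v(1) u(1) by auto
 qed
 show ?thesis
 proof (rule k.subfieldI'[OF sub])
  fix a assume "a \<in> (\<lambda>x. cs x) ` V - {\<zero>\<^bsub>kf\<^esub>}"
  then obtain v where v: "v \<in> V" "a = cs v" "cs v \<noteq> cs 0" by (auto simp: cs_zero)
  have "v \<notin> nloc M" using v(3) cs_eq[OF V_loc[OF v(1)] loc_rules(2)[OF M]] by simp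
  hence "v \<notin> JV" using nloc_int_F[OF M] V_F v(1) by blast
  hence i: "v \<noteq> 0" "inverse v \<in> V" using v(1) by (auto simp: nonunits_def)
  have "cs (inverse v) \<otimes>\<^bsub>kf\<^esub> cs v = \<one>\<^bsub>kf\<^esub>"
   using cs_simps(1)[OF V_loc[OF i(2)] V_loc[OF v(1)]] i(1) by (simp add: cs_one)
  moreover have "cs v \<otimes>\<^bsub>kf\<^esub> cs (inverse v) = \<one>\<^bsub>kf\<^esub>"
   using cs_simps(1)[OF V_loc[OF v(1)] V_loc[OF i(2)]] i(1) by (simp add: cs_one)
  ultimately have "inv\<^bsub>kf\<^esub> a = cs (inverse v)"
   unfolding v(2) by (intro k.inv_unique' [symmetric]) (use cs_simps(3) V_loc v(1) i(2) in blast)+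
  thus "inv\<^bsub>kf\<^esub> a \<in> (\<lambda>x. cs x) ` V" using i(2) by simp
 qed
qed

private lemma eval_lift:
 assumes x: "x \<in> loc M" and vs: "set vs \<subseteq> loc M"
 shows "ring.eval kf (map (\<lambda>v. cs v) vs) (cs x) = cs (poly (list_poly vs) x) \<and> poly (list_poly vs) x \<in> loc M"
 using vs
proof (induct vs)
 case Nil
 interpret field kf by (rule field_kf)
 show ?case by (simp add: cs_zero loc_rules(2)[OF M])
next
 case (Cons v vs)
 interpret field kf by (rule field_kf)
 have pw: "cs x [^]\<^bsub>kf\<^esub> n = cs (x ^ n) \<and> x ^ n \<in> loc M" for n :: nat
 proof (induct n)
  case 0 thus ?case by (simp add: cs_one loc_rules(1)[OF M])
 next
  case (Suc n)
  thus ?case using cs_simps(1)[of "x ^ n" x] x loc_rules(6)[OF M, of "x ^ n" x] by (simp add: mult.commute)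
 qed
 have v: "v \<in> loc M" using Cons(2) by simp
 have m: "v * x ^ length vs \<in> loc M" using loc_rules(6)[OF M v] pw by blast
 have "ring.eval kf (map (\<lambda>v. cs v) (v # vs)) (cs x) = cs v \<otimes>\<^bsub>kf\<^esub> cs x [^]\<^bsub>kf\<^esub> length vs \<oplus>\<^bsub>kf\<^esub> cs (poly (list_poly vs) x)"
  using Cons by simp
 also have "\<dots> = cs (v * x ^ length vs + poly (list_poly vs) x)"
  using pw[of "length vs"] cs_simps(1)[OF v, of "x ^ length vs"] cs_simps(2)[OF m, of "poly (list_poly vs) x"] Cons by simp
 finally show ?case using loc_rules(5)[OF M m, of "poly (list_poly vs) x"] Cons by (simp add: poly_monom)
qed

private lemma add_pow_lift:
 assumes v: "v \<in> loc M"
 shows "add_pow kf (n::nat) (cs v) = cs (of_nat n * v) \<and> of_nat n * v \<in> loc M"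
proof -
 interpret field kf by (rule field_kf)
 show ?thesis
 proof (induct n)
  case 0 thus ?case by (simp add: cs_zero loc_rules(2)[OF M])
 next
  case (Suc n)
  have "add_pow kf (Suc n) (cs v) = add_pow kf n (cs v) \<oplus>\<^bsub>kf\<^esub> cs v" by (rule add.nat_pow_Suc)
  thus ?case using Suc cs_simps(2)[OF _ v, of "of_nat n * v"] loc_rules(5)[OF M _ v, of "of_nat n * v"]
   by (simp add: algebra_simps)
 qed
qed

private lemma deriv_lift:
 assumes "set vs \<subseteq> loc M"
 shows "map (\<lambda>i. add_pow kf (length vs - 1 - i) (map (\<lambda>v. cs v) vs ! i)) [0..<length vs - 1] = map (\<lambda>v. cs v) (list_deriv vs)
  \<and> set (list_deriv vs) \<subseteq> loc M"
 using assms
proof (induct vs)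
 case (Cons v vs)
 show ?case
 proof (cases "vs = []")
  case False
  then obtain n where n: "length vs = Suc n" by (cases vs) auto
  have e: "[0..<length (v # vs) - 1] = 0 # map Suc [0..<length vs - 1]"
   using n by (simp add: upt_conv_Cons map_Suc_upt del: upt_Suc)
  have v: "v \<in> loc M" using Cons(2) by simp
  have "map (\<lambda>i. add_pow kf (length (v # vs) - 1 - i) (map (\<lambda>v. cs v) (v # vs) ! i)) [0..<length (v # vs) - 1]
    = add_pow kf (length vs) (cs v) # map (\<lambda>i. add_pow kf (length vs - 1 - i) (map (\<lambda>v. cs v) vs ! i)) [0..<length vs - 1]"
   unfolding e by simp
  thus ?thesis using Cons False add_pow_lift[OF v, of "length vs"] by simp
 qed simp
qed simp

text \<open>Evaluating the Bezout relation of \<open>p\<close> and its derivative at the residue of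
  \<open>x\<close> shows that the derivative does not vanish there; the coefficients are then lifted
  to \<open>V\<close>.\<close>

private lemma separable_lift:
 assumes sep: "separable_ext kf (residue_sub (loc M) V)" and x: "x \<in> loc M"
 shows "\<exists>g. (\<forall>i. coeff g i \<in> V) \<and> poly g x \<in> nloc M \<and> poly (pderiv g) x \<notin> nloc M"
proof -
 let ?K = "residue_sub (loc M) V"
 interpret k: field kf by (rule field_kf)
 have subK: "subring ?K kf" unfolding residue_sub_eq using subfieldE(1)[OF subfield_kf] .
 have cx: "cs x \<in> carrier kf" using cs_simps(3)[OF x x] .
 obtain p a b where p: "p \<in> carrier (?K[X]\<^bsub>kf\<^esub>)" "ring.eval kf p (cs x) = \<zero>\<^bsub>kf\<^esub>"
  and ab: "a \<in> carrier (?K[X]\<^bsub>kf\<^esub>)" "b \<in> carrier (?K[X]\<^bsub>kf\<^esub>)"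
  "a \<otimes>\<^bsub>?K[X]\<^bsub>kf\<^esub>\<^esub> p \<oplus>\<^bsub>?K[X]\<^bsub>kf\<^esub>\<^esub> b \<otimes>\<^bsub>?K[X]\<^bsub>kf\<^esub>\<^esub> pderiv_alg kf p = \<one>\<^bsub>?K[X]\<^bsub>kf\<^esub>\<^esub>"
  using sep cx unfolding separable_ext_def by blast
 have "set p \<subseteq> ?K" using p(1) unfolding univ_poly_carrier[symmetric] polynomial_def by auto
 hence "\<forall>C\<in>set p. \<exists>v\<in>V. C = cs v" unfolding residue_sub_eq by blast
 hence "\<exists>vs. set vs \<subseteq> V \<and> p = map (\<lambda>v. cs v) vs"
 proof (induct p)
  case (Cons C p)
  then obtain v vs where "v \<in> V" "C = cs v" "set vs \<subseteq> V" "p = map (\<lambda>v. cs v) vs" by auto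
  thus ?case by (intro exI[of _ "v # vs"]) auto
 qed auto
 then obtain vs where vs: "set vs \<subseteq> V" "p = map (\<lambda>v. cs v) vs" by blast
 have vl: "set vs \<subseteq> loc M" using vs V_loc by blast
 let ?d = "map (\<lambda>i. add_pow kf (length p - 1 - i) (p ! i)) [0..<length p - 1]"
 have d: "?d = map (\<lambda>v. cs v) (list_deriv vs)" and dl: "set (list_deriv vs) \<subseteq> loc M"
  using deriv_lift[OF vl] unfolding vs(2) by auto
 have dV: "set (list_deriv vs) \<subseteq> V"
 proof -
  have "of_nat n \<in> V" for n by (induct n) (auto intro: V_rules)
  thus ?thesis using vs(1) by (induct vs) (auto intro: V_rules(6))
 qed
 have dc: "set ?d \<subseteq> carrier kf" unfolding d using dl cs_simps(3) by auto
 have "set ?d \<subseteq> ?K" unfolding d residue_sub_eq using dV by auto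
 hence pd: "pderiv_alg kf p \<in> carrier (?K[X]\<^bsub>kf\<^esub>)"
  unfolding pderiv_alg_def univ_poly_carrier[symmetric] by (rule k.normalize_gives_polynomial)
 let ?e = "\<lambda>q. ring.eval kf q (cs x)"
 have hom: "?e \<in> ring_hom (?K[X]\<^bsub>kf\<^esub>) kf" by (rule k.eval_is_hom[OF subK cx])
 interpret P: ring "?K[X]\<^bsub>kf\<^esub>" by (rule k.univ_poly_is_ring[OF subK])
 have "?e (a \<otimes>\<^bsub>?K[X]\<^bsub>kf\<^esub>\<^esub> p \<oplus>\<^bsub>?K[X]\<^bsub>kf\<^esub>\<^esub> b \<otimes>\<^bsub>?K[X]\<^bsub>kf\<^esub>\<^esub> pderiv_alg kf p)
   = ?e a \<otimes>\<^bsub>kf\<^esub> ?e p \<oplus>\<^bsub>kf\<^esub> ?e b \<otimes>\<^bsub>kf\<^esub> ?e (pderiv_alg kf p)"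
  unfolding ring_hom_add[OF hom P.m_closed[OF ab(1) p(1)] P.m_closed[OF ab(2) pd]]
   ring_hom_mult[OF hom ab(1) p(1)] ring_hom_mult[OF hom ab(2) pd] ..
 hence "?e a \<otimes>\<^bsub>kf\<^esub> \<zero>\<^bsub>kf\<^esub> \<oplus>\<^bsub>kf\<^esub> ?e b \<otimes>\<^bsub>kf\<^esub> ?e (pderiv_alg kf p) = \<one>\<^bsub>kf\<^esub>"
  unfolding ab(3) p(2) ring_hom_one[OF hom] by simp
 moreover have "?e a \<in> carrier kf" "?e b \<in> carrier kf"
  using ring_hom_closed[OF hom] ab by auto
 ultimately have "?e (pderiv_alg kf p) \<noteq> \<zero>\<^bsub>kf\<^esub>" by (metis k.l_zero k.r_null k.one_not_zero k.zero_closed)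
 moreover have "?e (pderiv_alg kf p) = ?e ?d"
  unfolding pderiv_alg_def by (rule k.eval_normalize[OF dc cx])
 ultimately have "cs (poly (pderiv (list_poly vs)) x) \<noteq> cs 0"
  using eval_lift[OF x dl] unfolding d list_poly_deriv cs_zero by simp
 hence "poly (pderiv (list_poly vs)) x \<notin> nloc M"
  using cs_eq[OF _ loc_rules(2)[OF M]] eval_lift[OF x dl] unfolding list_poly_deriv by simp
 moreover have "poly (list_poly vs) x \<in> nloc M"
  using p(2) eval_lift[OF x vl] cs_eq[OF _ loc_rules(2)[OF M], of "poly (list_poly vs) x"]
  unfolding vs(2) cs_zero by simp
 ultimately show ?thesis using list_poly_coeff[OF V_subring vs(1)] by blast
qed

text \<open>Restriction to the carrier makes equality of functions coincide with equality of the
  induced automorphisms, so that they can be counted as a set.\<close>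

private definition act where "act si = restrict (\<lambda>C. si ` C) (carrier kf)"

private lemma act_cs: "si \<in> Dgrp M ==> x \<in> loc M ==> act si (cs x) = cs (si x)"
 using cs_image cs_simps(3) by (simp add: act_def)

private lemma act_eqI:
 assumes "\<And>x. x \<in> loc M ==> g (cs x) = h (cs x)"
 shows "restrict g (carrier kf) = restrict h (carrier kf)"
 using assms cs_carrier by (intro restrict_ext) auto

private lemma act_eq_iff:
 assumes s: "si \<in> Dgrp M" and t: "tu \<in> Dgrp M"
 shows "act si = act tu \<longleftrightarrow> (\<forall>s\<in>S. si s - tu s \<in> M)"
proof
 assume e: "act si = act tu"
 show "\<forall>s\<in>S. si s - tu s \<in> M"
 proof
  fix x assume x: "x \<in> S"
  hence xl: "x \<in> loc M" by (rule S_loc[OF M])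
  have "cs (si x) = cs (tu x)" using act_cs[OF s xl] act_cs[OF t xl] e by simp
  hence "si x - tu x \<in> nloc M" using cs_eq D_loc(1)[OF s] D_loc(1)[OF t] xl by blast
  moreover have "si x - tu x \<in> S" using gal_S[OF D_G[OF s] x] gal_S[OF D_G[OF t] x] S_rules(4) by blast
  ultimately show "si x - tu x \<in> M" using nloc_iff[OF M] by blast
 qed
next
 assume a: "\<forall>s\<in>S. si s - tu s \<in> M"
 have "si ` cs x = tu ` cs x" if x: "x \<in> loc M" for x
 proof -
  obtain r where r: "r \<in> S" "x - r \<in> nloc M" using loc_rep[OF x] by blast
  have rl: "r \<in> loc M" using S_loc[OF M r(1)] .
  have "si r - tu r \<in> nloc M" using a r nloc_iff[OF M] maxD(4)[OF M] by blast
  hence "cs (si r) = cs (tu r)" using cs_eq D_loc(1)[OF s] D_loc(1)[OF t] rl by blast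
  moreover have "cs x = cs r" using cs_eq[OF x rl] r by blast
  ultimately show ?thesis using cs_image[OF s rl] cs_image[OF t rl] by simp
 qed
 thus "act si = act tu" unfolding act_def by (intro act_eqI)
qed

text \<open>The automorphisms induced by \<open>Dgrp M\<close> have the residue field of
  \<open>V\<close> as fixed field, so Artin's theorem gives the residue degree. Separability enters
  in identifying the fixed field, through \<open>fixed_residue\<close>.\<close>

private lemma residue_dim:
 assumes sep: "separable_ext kf (residue_sub (loc M) V)"
 shows "ring.dim kf (residue_sub (loc M) V) (carrier kf) = card (act ` Dgrp M)"
proof -
 interpret k: field kf by (rule field_kf)
 have actc: "act si C = si ` C" if "C \<in> carrier kf" for si C using that by (simp add: act_def)
 have cl: "cs (si x) \<in> carrier kf" if "si \<in> Dgrp M" "x \<in> loc M" for si x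
  using cs_simps(3)[of "si x"] D_loc(1)[OF that(1)] that(2) by blast
 have act_comp: "act (tu \<circ> si) = restrict (\<lambda>C. tu ` act si C) (carrier kf)" for si tu
  by (simp add: act_def image_comp restrict_def fun_eq_iff)
 have "k.dimension (card (act ` Dgrp M)) ((\<lambda>x. cs x) ` V) (carrier kf)"
 proof (rule k.artin_dimension[where i = "act id"])
  show "finite (act ` Dgrp M)" using D_finite by blast
  show "act id \<in> act ` Dgrp M" by (rule imageI) (simp add: Dgrp_def)
  show "act id x = x" if "x \<in> carrier kf" for x using that by (simp add: act_def)
  show "subfield ((\<lambda>x. cs x) ` V) kf" by (rule subfield_kf)
  show "h \<in> ring_hom kf kf" if "h \<in> act ` Dgrp M" for h
  proof -
   obtain si where s: "si \<in> Dgrp M" "h = act si" using \<open>h \<in> act ` Dgrp M\<close> by blast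
   have sl: "si x \<in> loc M" if "x \<in> loc M" for x using D_loc(1)[OF s(1)] that by blast
   note gs = gal_simps[OF D_G[OF s(1)]]
   show ?thesis
   proof (rule ring_hom_memI)
    fix C assume "C \<in> carrier kf"
    then obtain x where x: "x \<in> loc M" "C = cs x" unfolding cs_carrier by blast
    show "h C \<in> carrier kf" unfolding s x act_cs[OF s(1) x(1)] using cl[OF s(1) x(1)] .
    fix C' assume "C' \<in> carrier kf"
    then obtain y where y: "y \<in> loc M" "C' = cs y" unfolding cs_carrier by blast
    show "h (C \<otimes>\<^bsub>kf\<^esub> C') = h C \<otimes>\<^bsub>kf\<^esub> h C'"
     unfolding s x y cs_simps(1)[OF x(1) y(1)] act_cs[OF s(1) x(1)] act_cs[OF s(1) y(1)]
      act_cs[OF s(1) loc_rules(6)[OF M x(1) y(1)]] cs_simps(1)[OF sl[OF x(1)] sl[OF y(1)]] gs ..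
    show "h (C \<oplus>\<^bsub>kf\<^esub> C') = h C \<oplus>\<^bsub>kf\<^esub> h C'"
     unfolding s x y cs_simps(2)[OF x(1) y(1)] act_cs[OF s(1) x(1)] act_cs[OF s(1) y(1)]
      act_cs[OF s(1) loc_rules(5)[OF M x(1) y(1)]] cs_simps(2)[OF sl[OF x(1)] sl[OF y(1)]] gs ..
   next
    show "h \<one>\<^bsub>kf\<^esub> = \<one>\<^bsub>kf\<^esub>"
     unfolding cs_one s act_cs[OF s(1) loc_rules(1)[OF M]] gs ..
   qed
  qed
  show "\<exists>x\<in>carrier kf. h x \<noteq> h' x" if hh: "h \<in> act ` Dgrp M" "h' \<in> act ` Dgrp M" "h \<noteq> h'" for h h'
  proof (rule ccontr)
   assume n: "\<not> ?thesis"
   obtain si tu where "h = act si" "h' = act tu" using hh by blast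
   hence "h C = h' C" for C using n by (cases "C \<in> carrier kf") (auto simp: act_def)
   thus False using hh(3) by blast
  qed
  show "\<exists>p. bij_betw p (act ` Dgrp M) (act ` Dgrp M) \<and> (\<forall>h\<in>act ` Dgrp M. \<forall>x\<in>carrier kf. p h x = g (h x))"
   if g: "g \<in> act ` Dgrp M" for g
  proof -
   obtain tu where t: "tu \<in> Dgrp M" "g = act tu" using g by blast
   define p where "p tu h = restrict (\<lambda>C. tu ` h C) (carrier kf)" for tu :: "'k \<Rightarrow> 'k" and h :: "'k set \<Rightarrow> 'k set"
   have pa: "p tu (act si) = act (tu \<circ> si)" for si tu unfolding p_def act_comp ..
   have "bij_betw (p tu) (act ` Dgrp M) (act ` Dgrp M)"
   proof (rule bij_betw_byWitness[where f' = "p (inv_into UNIV tu)"])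
    show "\<forall>a\<in>act ` Dgrp M. p (inv_into UNIV tu) (p tu a) = a"
     by (auto simp: pa inv_comp(3)[OF D_G[OF t(1)]])
    show "\<forall>a\<in>act ` Dgrp M. p tu (p (inv_into UNIV tu) a) = a"
     by (auto simp: pa inv_comp(4)[OF D_G[OF t(1)]])
    show "p tu ` act ` Dgrp M \<subseteq> act ` Dgrp M" using D_comp[OF t(1)] by (auto simp: pa)
    show "p (inv_into UNIV tu) ` act ` Dgrp M \<subseteq> act ` Dgrp M" using D_comp[OF D_inv[OF t(1)]] by (auto simp: pa)
   qed
   moreover have "p tu h C = g (h C)" if h: "h \<in> act ` Dgrp M" and C: "C \<in> carrier kf" for h C
   proof -
    obtain si where s: "si \<in> Dgrp M" "h = act si" using h by blast
    obtain x where x: "x \<in> loc M" "C = cs x" using C unfolding cs_carrier by blast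
    have "h C \<in> carrier kf" unfolding s x act_cs[OF s(1) x(1)] using cl[OF s(1) x(1)] .
    thus ?thesis using C t by (simp add: p_def actc)
   qed
   ultimately show ?thesis by blast
  qed
  show "(\<lambda>x. cs x) ` V = {x \<in> carrier kf. \<forall>h\<in>act ` Dgrp M. h x = x}"
  proof (intro equalityI subsetI)
   fix C assume "C \<in> (\<lambda>x. cs x) ` V"
   then obtain v where v: "v \<in> V" "C = cs v" by blast
   have "act si C = C" if s: "si \<in> Dgrp M" for si
    using act_cs[OF s V_loc[OF v(1)]] gal_simps(12)[OF D_G[OF s], of v] v V_F by auto
   thus "C \<in> {x \<in> carrier kf. \<forall>h\<in>act ` Dgrp M. h x = x}" using v cs_simps(3)[OF V_loc[OF v(1)] V_loc[OF v(1)]] by auto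
  next
   fix C assume C: "C \<in> {x \<in> carrier kf. \<forall>h\<in>act ` Dgrp M. h x = x}"
   then obtain y where y: "y \<in> loc M" "C = cs y" unfolding cs_carrier by blast
   obtain r where r: "r \<in> S" "y - r \<in> nloc M" using loc_rep[OF y(1)] by blast
   obtain e where e: "e \<in> S" "1 - e \<in> M" "\<And>M'. ismax S M' ==> M' \<noteq> M ==> e \<in> M'"
    using max_idempotent[OF M] by blast
   \<comment> \<open>The factor \<open>e\<close> keeps the residue class at \<open>M\<close> and
     moves the representative into all other maximal ideals, as \<open>fixed_residue\<close>
     demands.\<close>
   define x where "x = r * e"
   have xS: "x \<in> S" using r e S_rules(6) by (simp add: x_def)
   hence xl: "x \<in> loc M" by (rule S_loc[OF M])
   have "1 - e \<in> nloc M" using nloc_iff[OF M] e maxD(4)[OF M] by blast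
   hence "r * (1 - e) \<in> nloc M" using nloc_rules(4)[OF M S_loc[OF M r(1)]] by blast
   hence "(y - r) + r * (1 - e) \<in> nloc M" using r nloc_rules(3)[OF M] by blast
   hence "y - x \<in> nloc M" by (simp add: x_def algebra_simps)
   hence Cx: "C = cs x" using cs_eq[OF y(1) xl] y by blast
   have xD: "si x - x \<in> M" if s: "si \<in> Dgrp M" for si
   proof -
    have "act si C = C" using C s by blast
    hence "cs (si x) = cs x" using act_cs[OF s xl] Cx by simp
    hence "si x - x \<in> nloc M" using cs_eq D_loc(1)[OF s] xl by blast
    moreover have "si x - x \<in> S" using gal_S[OF D_G[OF s] xS] xS S_rules(4) by blast
    ultimately show ?thesis using nloc_iff[OF M] by blast
   qed
   have xM': "x \<in> M'" if "ismax S M'" "M' \<noteq> M" for M'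
    unfolding x_def using M_rules(4)[OF that(1) r(1)] e(3)[OF that] by blast
   obtain g where g: "\<And>i. coeff g i \<in> V" "poly g x \<in> nloc M" "poly (pderiv g) x \<notin> nloc M"
    using separable_lift[OF sep xl] by blast
   have gS: "coeff g i \<in> S" for i using g(1) V_S by blast
   have "of_nat n \<in> S" for n by (induct n) (auto intro: S_rules)
   hence "coeff (pderiv g) i \<in> S" for i using gS S_rules(6) by (auto simp: coeff_pderiv simp del: of_nat_Suc)
   hence gM: "poly (pderiv g) x \<notin> M" "poly g x \<in> M"
    using g nloc_iff[OF M] poly_in_subring[OF S_subring _ xS] gS by blast+
   have "\<exists>v\<in>V. x - v \<in> M"
    by (rule fixed_residue[where g = g, OF M xS]) (use xD xM' g(1) gM in auto)
   then obtain v where v: "v \<in> V" "x - v \<in> M" by blast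
   have "x - v \<in> nloc M" using nloc_iff[OF M] v maxD(4)[OF M] by blast
   hence "C = cs v" using Cx cs_eq[OF xl V_loc[OF v(1)]] by blast
   thus "C \<in> (\<lambda>x. cs x) ` V" using v by blast
  qed
 qed
 thus ?thesis using k.dimI[OF subfield_kf] unfolding residue_sub_eq over_def by blast
qed

private lemma card_D_I: "card (Dgrp M) = card (act ` Dgrp M) * card (Igrp M)"
proof (rule card_fibres[OF D_finite])
 fix tu assume t: "tu \<in> Dgrp M"
 note tG = D_G[OF t] and ti = D_inv[OF t]
 have "{si\<in>Dgrp M. act si = act tu} = (\<lambda>si. tu \<circ> si) ` Igrp M"
 proof (intro equalityI subsetI)
  fix si assume "si \<in> {si\<in>Dgrp M. act si = act tu}"
  hence s: "si \<in> Dgrp M" "\<And>s. s \<in> S ==> si s - tu s \<in> M" using act_eq_iff t by auto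
  have "(inv_into UNIV tu \<circ> si) s - s \<in> M" if "s \<in> S" for s
  proof -
   have "inv_into UNIV tu (si s - tu s) \<in> M" using D_loc(3)[OF ti] s(2)[OF that] by blast
   thus ?thesis using gal_simps(6)[OF D_G[OF ti]] inv_app[OF tG] by simp
  qed
  hence "inv_into UNIV tu \<circ> si \<in> Igrp M" using D_comp[OF ti s(1)] by (simp add: Igrp_def)
  thus "si \<in> (\<lambda>si. tu \<circ> si) ` Igrp M" using inv_comp(4)[OF tG] by (metis image_eqI)
 next
  fix si assume "si \<in> (\<lambda>si. tu \<circ> si) ` Igrp M"
  then obtain rh where r: "rh \<in> Igrp M" "si = tu \<circ> rh" by blast
  have rD: "rh \<in> Dgrp M" using r by (simp add: Igrp_def)
  have sD: "si \<in> Dgrp M" unfolding r(2) by (rule D_comp[OF t rD])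
  have "si s - tu s \<in> M" if "s \<in> S" for s
  proof -
   have "rh s - s \<in> M" using r that by (simp add: Igrp_def)
   hence "tu (rh s - s) \<in> M" using D_loc(3)[OF t] by blast
   thus ?thesis using gal_simps(6)[OF tG] by (simp add: r(2))
  qed
  thus "si \<in> {si\<in>Dgrp M. act si = act tu}" using act_eq_iff[OF sD t] sD by blast
 qed
 moreover have "inj_on (\<lambda>si. tu \<circ> si) (Igrp M)" by (rule inj_left[OF tG])
 ultimately show "card {si\<in>Dgrp M. act si = act tu} = card (Igrp M)" by (simp add: card_image)
qed

private lemma dim_K: "ring.dim Kring F UNIV = card G"
proof -
 interpret K: field "Kring :: 'k ring" by (rule field_Kring)
 have sub: "subfield F Kring" using galois by (simp add: finite_galois_def)
 have c: "carrier (Kring :: 'k ring) = UNIV" by (simp add: Kring_def)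
 have "K.dimension (card G) F (carrier Kring)"
 proof (rule K.artin_dimension[where i = id])
  show "h \<in> ring_hom Kring Kring" if "h \<in> G" for h
   by (rule ring_hom_memI) (auto simp: Kring_def gal_simps[OF that])
  show "\<exists>x\<in>carrier Kring. h x \<noteq> h' x" if "h \<noteq> h'" for h h' :: "'k \<Rightarrow> 'k"
   using that unfolding c by (auto simp: fun_eq_iff)
  show "\<exists>p. bij_betw p G G \<and> (\<forall>h\<in>G. \<forall>x\<in>carrier Kring. p h x = g (h x))" if "g \<in> G" for g
   by (rule exI[of _ "\<lambda>si. g \<circ> si"]) (use bij_left[OF that] in auto)
  show "F = {x \<in> carrier Kring. \<forall>h\<in>G. h x = x}"
   using galois unfolding c by (simp add: finite_galois_def)
 qed (use sub in auto)
 thus ?thesis using K.dimI[OF sub] unfolding over_def c by blast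
qed

text \<open>Counting \<open>card G\<close> as \<open>e f r\<close> by hypothesis, and as
  \<open>r\<close> times the order of the decomposition group, gives
  \<open>e = card (Igrp M)\<close>. If this number were in \<open>M\<close>, the least positive
  integer in \<open>JV\<close>, which is the residue characteristic, would divide it.\<close>

lemma inertia_order:
 assumes tame: "tame_defectless F V S"
 shows "of_nat (card (Igrp M)) \<notin> M"
proof
 assume a: "of_nat (card (Igrp M)) \<in> M"
 have max: "maximalideal M (subR S)" using M ismax_iff[OF S_subring] by blast
 define e where "e = ram_index F (loc M)"
 define r where "r = card {N. maximalideal N (subR S)}"
 have t: "ring.dim Kring F UNIV = e * ring.dim kf (residue_sub (loc M) V) (carrier kf) * r"
  "\<not> res_char V dvd e" "separable_ext kf (residue_sub (loc M) V)"
  using tame max unfolding tame_defectless_def e_def r_def Let_def by blast+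
 have r: "r = card Maxs" unfolding r_def using ismax_iff[OF S_subring] by simp
 define c where "c = card (act ` Dgrp M)"
 have h1: "card G = e * c * r" using t(1) unfolding dim_K residue_dim[OF t(3)] c_def .
 have h2: "card G = c * card (Igrp M) * r"
  unfolding c_def r card_D_I[symmetric] using card_G_D[OF M] by simp
 have cr: "c \<noteq> 0" "r \<noteq> 0" using h1 card_G_pos by (cases "c = 0"; cases "r = 0"; simp)+
 have "e * c = card (Igrp M) * c" using h1 h2 cr(2) by (metis mult.commute mult_cancel_right)
 hence "e = card (Igrp M)" using cr(1) by (metis mult_cancel_right)
 hence nd: "\<not> res_char V dvd card (Igrp M)" using t(2) by simp
 have ofV: "of_nat n \<in> V" for n by (induct n) (auto intro: V_rules)
 have nJ: "of_nat (card (Igrp M)) \<in> JV" using a max_int_V[OF M ofV] by blast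
 have pos: "card (Igrp M) > 0" using nd by (cases "card (Igrp M)") auto
 define m where "m = (LEAST n. n > 0 \<and> of_nat n \<in> JV)"
 have mJ: "m > 0 \<and> of_nat m \<in> JV" unfolding m_def by (rule LeastI[of _ "card (Igrp M)"]) (use pos nJ in blast)
 have "\<exists>n>0. (of_nat n :: 'k) \<in> JV" using pos nJ by blast
 hence rc: "res_char V = m" unfolding res_char_def jac_V m_def by (rule if_P)
 have "m dvd card (Igrp M)"
 proof -
  let ?n = "card (Igrp M)"
  have "(of_nat ?n :: 'k) = of_nat m * of_nat (?n div m) + of_nat (?n mod m)"
   by (simp flip: of_nat_mult of_nat_add)
  hence "(of_nat (?n mod m) :: 'k) = of_nat ?n - of_nat m * of_nat (?n div m)" by (simp add: algebra_simps)
  moreover have "of_nat m * of_nat (?n div m) \<in> JV" using JV_rules(5)[OF ofV] mJ by blast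
  ultimately have "of_nat (?n mod m) \<in> JV" using JV_rules(7) nJ by simp
  hence "\<not> ?n mod m > 0"
   using not_less_Least[of "?n mod m" "\<lambda>n. n > 0 \<and> of_nat n \<in> JV"] \<open>m > 0 \<and> of_nat m \<in> JV\<close>
   unfolding m_def by (metis mod_less_divisor)
  thus ?thesis by (simp add: dvd_eq_mod_eq_0)
 qed
 thus False using nd rc by simp
qed

text \<open>If all sums over the decomposition group lay in \<open>M\<close>, independence modulo
  \<open>M\<close> would put the number of automorphisms congruent to the identity, the order of the
  inertia group, into \<open>M\<close>. Multiplying by an \<open>e\<close> from the other maximal
  ideals makes the remaining summands of the trace vanish modulo \<open>M\<close>.\<close>

lemma trace_element:
 assumes tame: "tame_defectless F V S"
 shows "\<exists>t\<in>S. Tr t \<notin> JV \<and> (\<forall>M'. ismax S M' \<longrightarrow> M' \<noteq> M \<longrightarrow> t \<in> M')"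
proof -
 note Mr = M_rules[OF M]
 have "\<exists>s\<in>S. (\<Sum>si\<in>Dgrp M. si s) \<notin> M"
 proof (rule ccontr)
  assume "\<not> ?thesis"
  hence "(\<Sum>h | h \<in> Dgrp M \<and> (\<forall>s\<in>S. h s - id s \<in> M). 1) \<in> M"
   by (intro congruent_coeff_sum[OF M D_finite]) (auto simp: S_rules Dgrp_def)
  moreover have "{h. h \<in> Dgrp M \<and> (\<forall>s\<in>S. h s - id s \<in> M)} = Igrp M" by (auto simp: Igrp_def)
  ultimately show False using inertia_order[OF tame] by simp
 qed
 then obtain s where s: "s \<in> S" "(\<Sum>si\<in>Dgrp M. si s) \<notin> M" by blast
 obtain e where e: "e \<in> S" "1 - e \<in> M" "\<And>M'. ismax S M' ==> M' \<noteq> M ==> e \<in> M'"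
  using max_idempotent[OF M] by blast
 define t where "t = s * e"
 have tM': "t \<in> M'" if "ismax S M'" "M' \<noteq> M" for M'
  unfolding t_def using M_rules(4)[OF that(1) s(1)] e(3)[OF that] by blast
 have DG: "Dgrp M \<subseteq> G" by (auto simp: Dgrp_def)
 have "(\<Sum>si\<in>G - Dgrp M. si t) \<in> M"
 proof (rule is_ideal_sum[OF S_subring maxD(1)[OF M]])
  fix si assume sg: "si \<in> G - Dgrp M"
  hence sG: "si \<in> G" by blast
  let ?u = "inv_into UNIV si"
  have "?u ` M \<noteq> M"
  proof
   assume "?u ` M = M"
   hence "si ` M = M" using gal_image_inv(2)[OF sG, of M] by simp
   thus False using sg by (simp add: Dgrp_def)
  qed
  hence "t \<in> ?u ` M" using tM' gal_max[OF M inv_in_G[OF sG]] by blast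
  thus "si t \<in> M" using inv_app[OF sG] by auto
 qed
 moreover have "(\<Sum>si\<in>Dgrp M. si s) - (\<Sum>si\<in>Dgrp M. si t) \<in> M"
  unfolding sum_subtractf[symmetric]
 proof (rule is_ideal_sum[OF S_subring maxD(1)[OF M]])
  fix si assume sg: "si \<in> Dgrp M"
  have "si (1 - e) \<in> M" using D_loc(3)[OF sg] e(2) by blast
  hence "si s * si (1 - e) \<in> M" using Mr(4) gal_S[OF D_G[OF sg] s(1)] by blast
  thus "si s - si t \<in> M" by (simp add: t_def gal_simps[OF D_G[OF sg]] algebra_simps)
 qed
 moreover have "Tr t = (\<Sum>si\<in>G - Dgrp M. si t) + (\<Sum>si\<in>Dgrp M. si t)"
  unfolding Tr_def by (rule sum.subset_diff[OF DG finite_G])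
 ultimately have "Tr t \<notin> M"
 proof (intro notI)
  assume a: "Tr t \<in> M" "(\<Sum>si\<in>G - Dgrp M. si t) \<in> M" "(\<Sum>si\<in>Dgrp M. si s) - (\<Sum>si\<in>Dgrp M. si t) \<in> M"
   "Tr t = (\<Sum>si\<in>G - Dgrp M. si t) + (\<Sum>si\<in>Dgrp M. si t)"
  have "(\<Sum>si\<in>Dgrp M. si t) \<in> M" using Mr(7)[OF a(1,2)] a(4) by simp
  hence "((\<Sum>si\<in>Dgrp M. si s) - (\<Sum>si\<in>Dgrp M. si t)) + (\<Sum>si\<in>Dgrp M. si t) \<in> M" using a(3) Mr(3) by blast
  thus False using s(2) by simp
 qed
 hence "Tr t \<notin> JV" using JV_in_max[OF M] by blast
 moreover have "t \<in> S" using s e S_rules(6) by (simp add: t_def)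
 ultimately show ?thesis using tM' by blast
qed

end

text \<open>The inverse different of a tame extension is \<open>\<pi>\<inverse> J(S)\<close>.\<close>
lemma trace_dual:
 assumes tame: "tame_defectless F V S" and y: "\<And>s. s \<in> S ==> Tr (y * s) \<in> JV"
 shows "y \<in> JS"
proof (rule JS_if_loc, rule ccontr)
 fix M assume M: "ismax S M" and n: "y \<notin> nloc M"
 note Mr = M_rules[OF M]
 have yi: "y \<noteq> 0 \<and> inverse y \<in> loc M"
 proof (cases "y \<in> loc M")
  case True thus ?thesis using unit_inverse[OF loc_val[OF M]] n by blast
 next
  case False thus ?thesis using notin_val[OF loc_val[OF M]] nloc_rules(1)[OF M] by blast
 qed
 hence "y \<noteq> 0" "inverse y \<in> loc M" by auto
 \<comment> \<open>\<open>c\<close> clears the denominator of \<open>inverse y\<close>. With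
   \<open>u * c\<close> congruent to 1 at \<open>M\<close>, the elements \<open>t\<close> and
   \<open>c * (u * t)\<close> agree modulo \<open>JS\<close>. The latter is \<open>y\<close> times
   an element of \<open>S\<close>, so its trace is in \<open>JV\<close>, while that of
   \<open>t\<close> is not.\<close>
 then obtain c where c: "c \<in> S" "c \<notin> M" "inverse y * c \<in> S" using loc_num[OF M] by blast
 obtain u where u: "u \<in> S" "1 - u * c \<in> M" using maxD(3)[OF M] c by blast
 obtain t where t: "t \<in> S" "Tr t \<notin> JV" "\<And>M'. ismax S M' ==> M' \<noteq> M ==> t \<in> M'"
  using trace_element[OF M tame] by blast
 have "inverse y * c * (u * t) \<in> S" by (intro S_rules(6) c u t)
 hence "Tr (y * (inverse y * c * (u * t))) \<in> JV" by (rule y)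
 hence tr: "Tr (c * (u * t)) \<in> JV" using \<open>y \<noteq> 0\<close> by (simp add: mult.assoc[symmetric])
 have "t - c * (u * t) \<in> M'" if M': "ismax S M'" for M'
 proof (cases "M' = M")
  case True
  have "t * (1 - u * c) \<in> M" using Mr(4) t u by blast
  thus ?thesis unfolding True by (simp add: algebra_simps)
 next
  case False
  hence "t \<in> M'" using t M' by blast
  moreover from this have "c * (u * t) \<in> M'" using M_rules(4)[OF M'] c u by blast
  ultimately show ?thesis using M_rules(7)[OF M'] by blast
 qed
 moreover have "t - c * (u * t) \<in> S" by (intro S_rules(4,6) t c u)
 ultimately have "t - c * (u * t) \<in> JS" by (simp add: JS_def)
 hence "Tr (t - c * (u * t)) \<in> JV" by (rule Tr_JS)
 hence "Tr (t - c * (u * t)) + Tr (c * (u * t)) \<in> JV" using tr JV_rules(3) by blast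
 thus False using t(2) by (simp add: Tr_diff)
qed

end

section \<open>The radical of the crossed product order\<close>

context crossed
begin

text \<open>For fixed \<open>M\<close>, \<open>dl i j \<notin> M\<close> is the preorder of the
  graph on group elements instead of cosets. Transitivity comes from \<open>dl_mult\<close>; by
  \<open>dl_sym\<close>, equivalence of \<open>i\<close> and \<open>j\<close> is tested by
  \<open>f\<close> at \<open>iv i \<circ> j\<close> and its inverse.\<close>

definition dl :: "('k \<Rightarrow> 'k) \<Rightarrow> ('k \<Rightarrow> 'k) \<Rightarrow> 'k" where "dl i j = f i (iv i \<circ> j)"

lemma dl_S: "i \<in> G ==> j \<in> G ==> dl i j \<in> S" by (simp add: dl_def f_S)
lemma dl_nz: "i \<in> G ==> j \<in> G ==> dl i j \<noteq> 0" by (simp add: dl_def f_nz)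
lemma dl_refl: "i \<in> G ==> dl i i = 1" by (simp add: dl_def)
lemma dl_id_left: "i \<in> G ==> dl id i = 1" by (simp add: dl_def)
lemma dl_id_right: "i \<in> G ==> dl i id = f i (iv i)" by (simp add: dl_def)

lemma dl_mult:
 assumes "i \<in> G" "j \<in> G" "k \<in> G"
 shows "dl i j * dl j k = i (f (iv i \<circ> j) (iv j \<circ> k)) * dl i k"
 using coc[of i "iv i \<circ> j" "iv j \<circ> k"] assms by (simp add: dl_def comp_assoc)

lemma dl_sym:
 assumes "i \<in> G" "j \<in> G"
 shows "dl i j * dl j i = i (f (iv i \<circ> j) (iv (iv i \<circ> j)))"
 using dl_mult[OF assms assms(1)] dl_refl[OF assms(1)] assms by simp

lemma f_inv: "si \<in> G ==> si (f (iv si) si) = f si (iv si)"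
 using coc[of si "iv si" si] by simp

lemma f_inv': "si \<in> G ==> iv si (f si (iv si)) = f (iv si) si"
 using f_inv[of "iv si"] by simp

context
 fixes M
 assumes M: "ismax S M"
begin

lemma dl_trans:
 assumes "i \<in> G" "j \<in> G" "k \<in> G" "dl i j \<notin> M" "dl j k \<notin> M"
 shows "dl i k \<notin> M"
proof
 assume "dl i k \<in> M"
 hence "i (f (iv i \<circ> j) (iv j \<circ> k)) * dl i k \<in> M"
  using M_rules(4)[OF M] gal_S[OF assms(1) f_S, of "iv i \<circ> j" "iv j \<circ> k"] assms by simp
 hence "dl i j * dl j k \<in> M" using dl_mult[OF assms(1-3)] by simp
 thus False using maxD(5)[OF M] dl_S assms by blast
qed

text \<open>The number of elements strictly below is a rank function; it bounds the length of chains
  of strict steps.\<close>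

lemma strict_card:
 assumes s: "si \<in> G" and r: "rh \<in> G" and lt: "dl si rh \<notin> M" "dl rh si \<in> M"
 shows "card {tu\<in>G. dl tu si \<notin> M \<and> dl si tu \<in> M} < card {tu\<in>G. dl tu rh \<notin> M \<and> dl rh tu \<in> M}"
proof (rule psubset_card_mono)
 show "finite {tu\<in>G. dl tu rh \<notin> M \<and> dl rh tu \<in> M}" by simp
 have "{tu\<in>G. dl tu si \<notin> M \<and> dl si tu \<in> M} \<subseteq> {tu\<in>G. dl tu rh \<notin> M \<and> dl rh tu \<in> M}"
  using dl_trans s r lt by blast
 moreover have "si \<notin> {tu\<in>G. dl tu si \<notin> M \<and> dl si tu \<in> M}"
  using dl_refl[OF s] by auto
 ultimately show "{tu\<in>G. dl tu si \<notin> M \<and> dl si tu \<in> M} \<subset> {tu\<in>G. dl tu rh \<notin> M \<and> dl rh tu \<in> M}"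
  using s lt by blast
qed

end

abbreviation Af where "Af \<equiv> A_f_set G S"

lemma Af_iff: "a \<in> Af \<longleftrightarrow> a \<in> CS \<and> (\<forall>si\<in>G. a si \<in> S)"
 using S_rules(2) by (auto simp: A_f_set_def)

lemma Af_S: "a \<in> Af ==> a si \<in> S" by (simp add: A_f_set_def)

lemma xs_Af: "si \<in> G ==> s \<in> S ==> xs si s \<in> Af"
 using S_rules(2) by (auto simp: Af_iff xs_def)

lemma subB_Af: "subB Af"
 unfolding subB_def
proof (intro conjI ballI)
 show "Af \<subseteq> CS" by (auto simp: A_f_set_def)
 show "one \<in> Af" using S_rules(1,2) one_CS by (auto simp: Af_iff one_def)
 fix a assume a: "a \<in> Af"
 show "(\<lambda>si. - a si) \<in> Af" using a S_rules(3) by (auto simp: Af_iff)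
 fix b assume b: "b \<in> Af"
 show "(\<lambda>si. a si + b si) \<in> Af" using a b S_rules(5) by (auto simp: Af_iff)
 have "mul a b rh \<in> S" if r: "rh \<in> G" for rh
 proof -
  have "(\<Sum>si\<in>G. a si * si (b (iv si \<circ> rh)) * f si (iv si \<circ> rh)) \<in> S"
  proof (rule is_subring_sum[OF S_subring])
   fix si assume s: "si \<in> G"
   show "a si * si (b (iv si \<circ> rh)) * f si (iv si \<circ> rh) \<in> S"
    by (intro S_rules(6) Af_S[OF a] gal_S[OF s] Af_S[OF b] f_S) (use s r in auto)
  qed
  thus ?thesis using r by (simp add: cp_mult_def)
 qed
 thus "mul a b \<in> Af" using mul_CS by (auto simp: Af_iff)
qed

lemma emb_Af: "emb ` V \<subseteq> Af"
 using V_S S_rules(2) id_in_G by (auto simp: A_f_set_def emb_def)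

lemma Af_integral: "a \<in> Af ==> \<exists>p. intrel V a p"
proof -
 assume a: "a \<in> Af"
 obtain M where M: "ismax S M" using ex_max by blast
 show ?thesis
 proof (rule integral_if_lattice[OF M, of "\<lambda>_. 1"])
  fix si rh assume s: "si \<in> G" "rh \<in> G"
  have "Q a si rh \<in> S" unfolding Q_def
   by (intro gal_S[OF inv_in_G[OF s(1)]] S_rules(6) Af_S[OF a] f_S) (use s in auto)
  thus "Q a si rh * 1 / 1 \<in> loc M" using S_loc[OF M] by simp
 qed simp
qed

text \<open>The coefficient ideal of the radical at \<open>si\<close>. Localized at \<open>M\<close>
  it is everything if \<open>f si (iv si)\<close> lies in \<open>M\<close>, and the maximal ideal
  otherwise.\<close>

definition Iid where "Iid si = {s\<in>S. s * f si (iv si) \<in> JS}"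

definition Nid where "Nid = {a\<in>Af. \<forall>si\<in>G. a si \<in> Iid si}"

lemma Iid_add: "s \<in> Iid si ==> t \<in> Iid si ==> s + t \<in> Iid si"
 using S_rules(5) JS_rules(3) by (auto simp: Iid_def distrib_right)

lemma Iid_mult: "r \<in> S ==> s \<in> Iid si ==> r * s \<in> Iid si"
 using S_rules(6) JS_rules(4) by (auto simp: Iid_def mult.assoc)

lemma Iid_zero: "0 \<in> Iid si" using S_rules(2) JS_rules(2) by (auto simp: Iid_def)

lemma Iid_sum: "(\<And>i. i \<in> A ==> g i \<in> Iid si) ==> sum g A \<in> Iid si"
 by (induct A rule: infinite_finite_induct) (auto intro: Iid_add Iid_zero)

lemma JS_Iid: "si \<in> G ==> s \<in> JS ==> s \<in> Iid si"
 using JS_rules(1,5) f_S by (auto simp: Iid_def)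

lemma Iid_id: "Iid id = JS"
 using JS_rules(1) by (auto simp: Iid_def)

lemma xs_Nid: "si \<in> G ==> s \<in> Iid si ==> xs si s \<in> Nid"
 using xs_Af Iid_zero by (auto simp: Nid_def Iid_def[of si] xs_def)

lemma Nid_Af: "a \<in> Nid ==> a \<in> Af" by (simp add: Nid_def)

text \<open>The key divisibility: \<open>f(\<sigma>,\<beta>) f(\<sigma>\<beta>,(\<sigma>\<beta>)\<inverse>)\<close> is a multiple of \<open>\<sigma>(f(\<beta>,\<beta>\<inverse>))\<close>.\<close>
lemma Iid_left:
 assumes s: "si \<in> G" and b: "\<beta> \<in> G" and x: "x \<in> Iid \<beta>"
 shows "si x * f si \<beta> \<in> Iid (si \<circ> \<beta>)"
proof -
 let ?r = "si \<circ> \<beta>"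
 have r: "?r \<in> G" using s b by simp
 have e1: "f si \<beta> = dl si ?r" "f ?r (iv ?r) = dl ?r id" using s b by (auto simp: dl_def)
 have "dl ?r id * dl id si = ?r (f (iv ?r \<circ> id) (iv id \<circ> si)) * dl ?r si" by (rule dl_mult[OF r id_in_G s])
 hence e2: "dl ?r id = ?r (f (iv ?r) si) * dl ?r si" using s by (simp add: dl_id_left)
 have "dl si ?r * dl ?r si = si (f \<beta> (iv \<beta>))" using dl_sym[OF s r] s b by simp
 hence "si x * f si \<beta> * f ?r (iv ?r) = ?r (f (iv ?r) si) * si (x * f \<beta> (iv \<beta>))"
  unfolding e1 e2 by (simp add: gal_simps(4)[OF s])
 also have "\<dots> \<in> JS"
 proof (rule JS_rules(4))
  show "?r (f (iv ?r) si) \<in> S" by (intro gal_S[OF r] f_S inv_in_G r s)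
  show "si (x * f \<beta> (iv \<beta>)) \<in> JS" using x JS_gal[OF s] by (simp add: Iid_def)
 qed
 finally have "si x * f si \<beta> * f ?r (iv ?r) \<in> JS" .
 moreover have "si x * f si \<beta> \<in> S" using x gal_S[OF s] f_S[OF s b] S_rules(6) by (simp add: Iid_def)
 ultimately show ?thesis by (simp add: Iid_def)
qed

lemma Nid_left:
 assumes a: "a \<in> Af" and n: "n \<in> Nid"
 shows "mul a n \<in> Nid"
proof -
 have "mul a n rh \<in> Iid rh" if r: "rh \<in> G" for rh
 proof -
  have "(\<Sum>si\<in>G. a si * si (n (iv si \<circ> rh)) * f si (iv si \<circ> rh)) \<in> Iid rh"
  proof (rule Iid_sum)
   fix si assume s: "si \<in> G"
   have "si (n (iv si \<circ> rh)) * f si (iv si \<circ> rh) \<in> Iid (si \<circ> (iv si \<circ> rh))"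
    by (rule Iid_left[OF s]) (use n s r in \<open>auto simp: Nid_def\<close>)
   hence "si (n (iv si \<circ> rh)) * f si (iv si \<circ> rh) \<in> Iid rh" using s by simp
   thus "a si * si (n (iv si \<circ> rh)) * f si (iv si \<circ> rh) \<in> Iid rh"
    using Iid_mult[OF Af_S[OF a, of si]] by (simp add: mult.assoc)
  qed
  thus ?thesis using r by (simp add: cp_mult_def)
 qed
 thus ?thesis using subBD(3)[OF subB_Af a Nid_Af[OF n]] by (simp add: Nid_def)
qed

lemma pw_Suc_right: "a \<in> CS ==> pw a (Suc n) = mul (pw a n) a"
proof (induct n)
 case (Suc n)
 have "pw a (Suc (Suc n)) = mul a (mul (pw a n) a)" using Suc by simp
 also have "\<dots> = mul (pw a (Suc n)) a" by (simp only: pw.simps mul_assoc)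
 finally show ?case .
qed (simp add: mul_one_left mul_one_right)

text \<open>A coefficient of the \<open>k\<close>-th power outside \<open>M\<close> stems from a
  product of \<open>k\<close> coefficients of \<open>n\<close> that survives at \<open>M\<close>. As
  \<open>n\<close> is in \<open>Nid\<close>, each factor is then a strict step of the preorder at
  \<open>M\<close>, and fewer than \<open>card G\<close> strict steps are possible.\<close>

lemma Nid_nilpotent:
 assumes n: "n \<in> Nid" and r: "rh \<in> G"
 shows "pw n (card G) rh \<in> JS"
proof -
 have nA: "n \<in> Af" and nC: "n \<in> CS" using n Nid_Af Af_iff by auto
 have pS: "pw n k si \<in> S" for k si using pw_sub[OF subB_Af nA] Af_S by blast
 have "pw n (card G) rh \<in> M" if M: "ismax S M" for M
 proof (rule ccontr)
  note Mr = M_rules[OF M]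
  have key: "k \<le> card {tu\<in>G. dl tu rh \<notin> M \<and> dl rh tu \<in> M}" if "pw n k rh \<notin> M" "rh \<in> G" for k rh
   using that
  proof (induct k arbitrary: rh)
   case (Suc k)
   have ns: "(\<Sum>si\<in>G. pw n k si * si (n (iv si \<circ> rh)) * f si (iv si \<circ> rh)) \<notin> M"
    using Suc(2)[unfolded pw_Suc_right[OF nC]] Suc(3) by (simp add: cp_mult_def)
   have "\<exists>si\<in>G. pw n k si * si (n (iv si \<circ> rh)) * f si (iv si \<circ> rh) \<notin> M"
   proof (rule ccontr)
    assume "\<not> ?thesis"
    hence "(\<Sum>si\<in>G. pw n k si * si (n (iv si \<circ> rh)) * f si (iv si \<circ> rh)) \<in> M"
     by (intro is_ideal_sum[OF S_subring maxD(1)[OF M]]) blast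
    thus False using ns by blast
   qed
   then obtain si where s: "si \<in> G" "pw n k si * si (n (iv si \<circ> rh)) * f si (iv si \<circ> rh) \<notin> M" by blast
   let ?b = "iv si \<circ> rh"
   have bG: "?b \<in> G" using s Suc(3) by simp
   have m: "si (n ?b) \<in> S" "dl si rh \<in> S" using gal_S[OF s(1)] Af_S[OF nA] dl_S[OF s(1) Suc(3)] by auto
   have e: "f si ?b = dl si rh" by (simp add: dl_def)
   have a1: "pw n k si \<notin> M"
    using s(2) Mr(5)[of "si (n ?b) * dl si rh" "pw n k si"] m S_rules(6) by (auto simp: e mult.assoc)
   have a2: "dl si rh \<notin> M"
    using s(2) Mr(4)[of "pw n k si * si (n ?b)" "dl si rh"] m S_rules(6) pS by (auto simp: e)
   have a3: "si (n ?b) \<notin> M"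
    using s(2) Mr(4)[of "pw n k si * dl si rh" "si (n ?b)"] m S_rules(6) pS by (auto simp: e mult_ac)
   have "n ?b * f ?b (iv ?b) \<in> JS" using n bG by (auto simp: Nid_def Iid_def)
   hence "si (n ?b * f ?b (iv ?b)) \<in> JS" using JS_gal[OF s(1)] by blast
   hence "si (n ?b) * (dl si rh * dl rh si) \<in> M"
    unfolding dl_sym[OF s(1) Suc(3)] using M by (simp add: gal_simps(4)[OF s(1)] JS_def)
   hence "dl rh si \<in> M"
    using maxD(5)[OF M] a2 a3 m dl_S[OF Suc(3) s(1)] S_rules(6) by metis
   hence "card {tu\<in>G. dl tu si \<notin> M \<and> dl si tu \<in> M} < card {tu\<in>G. dl tu rh \<notin> M \<and> dl rh tu \<in> M}"
    using strict_card[OF M s(1) Suc(3) a2] by blast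
   thus ?case using Suc(1)[OF a1 s(1)] by simp
  qed simp
  assume "pw n (card G) rh \<notin> M"
  hence "card G \<le> card {tu\<in>G. dl tu rh \<notin> M \<and> dl rh tu \<in> M}" using key r by blast
  moreover have "card {tu\<in>G. dl tu rh \<notin> M \<and> dl rh tu \<in> M} < card G"
  proof (rule psubset_card_mono[OF finite_G])
   have "rh \<notin> {tu\<in>G. dl tu rh \<notin> M \<and> dl rh tu \<in> M}" using dl_refl[OF r] by auto
   thus "{tu\<in>G. dl tu rh \<notin> M \<and> dl rh tu \<in> M} \<subset> G" using r by blast
  qed
  ultimately show False by simp
 qed
 thus ?thesis using pS by (simp add: JS_def)
qed

lemma ev_one: "ev a 1 = one"
 using ev_monom[of a 0] by (simp add: monom_0 one_pCons)

lemma ev_diff: "ev a (p - q) = (\<lambda>rh. ev a p rh - ev a q rh)"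
 unfolding diff_conv_add_uminus[of p q] ev_add ev_minus by simp

lemma ev_X: "a \<in> CS ==> ev a [:0,1:] = a"
 using ev_monom[of a 1] by (simp add: monom_Suc monom_0 mul_one_right)

text \<open>The power \<open>w\<close> of \<open>n\<close> with exponent \<open>card G\<close> has a
  matrix with non-unit entries, so it satisfies a monic \<open>p\<close> with lower coefficients in
  \<open>JV\<close>. Since \<open>p(1)\<close> is a unit of \<open>V\<close>, division of
  \<open>p\<close> by \<open>X - 1\<close> inverts \<open>1 - w\<close>, and a geometric sum writes
  \<open>1 - w\<close> as a left multiple of \<open>1 - n\<close>.\<close>

lemma Nid_quasi_regular:
 assumes n: "n \<in> Nid"
 shows "\<exists>u\<in>Af. mul u (\<lambda>si. one si - n si) = one"
proof -
 obtain M where M: "ismax S M" using ex_max by blast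
 have nA: "n \<in> Af" and nC: "n \<in> CS" using n Nid_Af Af_iff by auto
 let ?m = "card G"
 define w where "w = pw n ?m"
 have wA: "w \<in> Af" unfolding w_def by (rule pw_sub[OF subB_Af nA])
 have wC: "w \<in> CS" using wA Af_iff by blast
 have "Q w si rh \<in> nloc M" if s: "si \<in> G" "rh \<in> G" for si rh
 proof -
  have "w (si \<circ> iv rh) * f (si \<circ> iv rh) rh \<in> JS"
   unfolding w_def by (intro JS_rules(5) f_S Nid_nilpotent[OF n]) (use s in auto)
  hence "Q w si rh \<in> JS" unfolding Q_def using JS_gal[OF inv_in_G[OF s(1)]] by blast
  thus ?thesis using nloc_iff[OF M] M by (simp add: JS_def)
 qed
 then obtain p where p: "intrel JV w p" using integral_over_JV[OF M] by blast
 have pl: "lead_coeff p = 1" and pJ: "\<And>i. i < degree p ==> coeff p i \<in> JV" and pw0: "ev w p = (\<lambda>_. 0)"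
  using p by (auto simp: intrel_def)
 have pV: "coeff p i \<in> V" for i
  using pJ[of i] pl V_rules(1,2) coeff_eq_0[of p i] by (cases i "degree p" rule: linorder_cases) (auto simp: nonunits_def)
 have lV: "coeff [:- 1, 1:] i \<in> V" for i
  using V_rules(1-3) by (auto simp: coeff_pCons split: nat.splits)
 have "\<exists>q r. (\<forall>i. coeff q i \<in> V) \<and> p = [:- 1, 1:] * q + r \<and> (r = 0 \<or> degree r < degree [:- 1 :: 'k, 1:])"
  using monic_division[OF V_subring _ lV pV] by auto
 then obtain q r where qr: "\<And>i. coeff q i \<in> V" "p = [:- 1, 1:] * q + r" "r = 0 \<or> degree r < degree [:- 1 :: 'k, 1:]"
  by blast
 obtain c where c: "r = [:c:]" using qr(3) by (cases "r = 0") (auto elim: degree_eq_zeroE)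
 have "poly p 1 = c" unfolding qr(2) c by simp
 moreover have "poly p 1 = 1 + (\<Sum>i<degree p. coeff p i)" using poly_monic_split[OF pl refl, of 1] by simp
 ultimately have cj: "c = 1 - (- (\<Sum>i<degree p. coeff p i))" by simp
 have "- (\<Sum>i<degree p. coeff p i) \<in> JV"
  by (intro JV_rules(6) is_ideal_sum[OF V_subring JV_ideal]) (use pJ in auto)
 hence cV: "c \<in> V" "inverse c \<in> V" using JV_one_minus cj by metis+
 have c0: "c \<noteq> 0"
 proof
  assume "c = 0"
  hence "- (\<Sum>i<degree p. coeff p i) = 1" unfolding cj by (metis right_minus_eq)
  hence "1 \<in> JV" using \<open>- (\<Sum>i<degree p. coeff p i) \<in> JV\<close> by simp
  thus False using V_rules(1) by (simp add: nonunits_def)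
 qed
 have FV: "v \<in> V ==> v \<in> F" for v using V_F by blast
 have qF: "coeff q i \<in> F" for i using qr(1) FV by blast
 have lF: "coeff [:- 1, 1:] i \<in> F" for i
  using is_subringD(1-3)[OF F_subring] by (auto simp: coeff_pCons split: nat.splits)
 have "p = q * [:- 1, 1:] + [:c:]" unfolding qr(2) c by (simp only: mult.commute)
 hence E1: "ev w p = (\<lambda>rh. mul (ev w q) (ev w [:- 1, 1:]) rh + sm c one rh)"
  by (simp only: ev_add ev_mult[OF qF lF] ev_const)
 have E2: "ev w [:- 1, 1:] = (\<lambda>rh. - (one rh - w rh))"
 proof -
  have "[:- 1, 1:] = [:0,1:] - (1 :: 'k poly)" by (simp add: one_pCons)
  thus ?thesis by (simp only: ev_diff ev_X[OF wC] ev_one) (simp add: fun_eq_iff)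
 qed
 have z: "(\<lambda>rh. - mul (ev w q) (\<lambda>rh. one rh - w rh) rh + sm c one rh) = (\<lambda>_. 0)"
  using pw0 unfolding E1 E2 mul_minus_right .
 have e1: "mul (ev w q) (\<lambda>rh. one rh - w rh) = sm c one"
 proof
  fix rh show "mul (ev w q) (\<lambda>rh. one rh - w rh) rh = sm c one rh"
   using minus_unique[OF fun_cong[OF z, of rh]] by simp
 qed
 define u0 where "u0 = sm (inverse c) (ev w q)"
 have u0: "mul u0 (\<lambda>rh. one rh - w rh) = one"
  unfolding u0_def mul_sm_left e1 using c0 by (simp add: sm_def mult.assoc[symmetric])
 have u0A: "u0 \<in> Af"
 proof -
  have "mul (emb (inverse c)) (ev w q) \<in> Af"
   using subBD(3)[OF subB_Af _ ev_sub[OF subB_Af emb_Af wA qr(1)]] emb_Af cV by blast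
  thus ?thesis unfolding u0_def using mul_emb_left[OF ev_CS] by simp
 qed
 define g where "g = (\<Sum>i<?m. [:0,1:] ^ i :: 'k poly)"
 have XF: "[:0,1:] ^ i \<in> {p. \<forall>j. coeff p j \<in> V}" for i
  by (rule is_subring_power[OF is_subring_polys[OF V_subring]]) (use V_rules(1,2) in \<open>auto simp: coeff_pCons split: nat.splits\<close>)
 have gV: "coeff g i \<in> V" for i
  using is_subring_sum[OF is_subring_polys[OF V_subring], of "{..<?m}" "\<lambda>i. [:0,1:] ^ i"] XF unfolding g_def by blast
 have gF: "coeff g i \<in> F" for i using gV FV by blast
 have oF: "coeff (1 - [:0,1:]) i \<in> F" for i
  using is_subringD[OF F_subring] by (auto simp: coeff_pCons one_pCons split: nat.splits)
 have "g * (1 - [:0,1:]) = 1 - [:0,1:] ^ ?m"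
  unfolding g_def using one_diff_power_eq[of "[:0,1:] :: 'k poly" ?m] by (simp only: mult.commute)
 hence "mul (ev n g) (ev n (1 - [:0,1:])) = ev n (1 - [:0,1:] ^ ?m)"
  using ev_mult[OF gF oF, of n] by simp
 moreover have "ev n ([:0,1:] ^ ?m) = w" using ev_monom[of n ?m] by (simp add: monom_altdef w_def)
 ultimately have e2: "mul (ev n g) (\<lambda>rh. one rh - n rh) = (\<lambda>rh. one rh - w rh)"
  by (simp only: ev_diff ev_one ev_X[OF nC])
 have "mul (mul u0 (ev n g)) (\<lambda>rh. one rh - n rh) = one" unfolding mul_assoc e2 u0 ..
 moreover have "mul u0 (ev n g) \<in> Af"
  using subBD(3)[OF subB_Af u0A ev_sub[OF subB_Af emb_Af nA gV]] .
 ultimately show ?thesis by blast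
qed

end

locale tame_crossed = crossed F V S f for F V S :: "'k::field set" and f +
 assumes tame: "tame_defectless F V S" and principal: "\<exists>\<pi>\<in>V. jac (subR V) = {\<pi> * v | v. v \<in> V}"
begin

lemma principal_JV: "\<exists>\<pi>. JV = {\<pi> * v | v. v \<in> V}"
 using principal jac_V by auto

text \<open>Stated for any integral \<open>B\<close>, because the extremality argument applies it to
  orders larger than \<open>Af\<close>.\<close>

lemma jac_trace:
 assumes B: "subB B" "emb ` V \<subseteq> B" and int: "\<And>b. b \<in> B ==> \<exists>p. intrel V b p"
  and y: "y \<in> jac (subSig G f B)"
 shows "Tr (y id) \<in> JV"
proof -
 obtain \<pi> where pi: "JV = {\<pi> * v | v. v \<in> V}" using principal_JV by blast
 have "y \<in> CS" using y subBD(1)[OF B(1)] unfolding jac_sub_iff[OF B(1)] by blast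
 thus ?thesis using jac_integral_over_JV[OF B int y pi] trace_in_JV by blast
qed

text \<open>For the harder inclusion, left multiplication by \<open>u x_(sigma^-1)\<close> moves the
  coefficient of \<open>a\<close> at sigma to the identity. All the resulting traces lie in
  \<open>JV\<close>, and trace duality puts \<open>a si * f si (iv si)\<close> into
  \<open>JS\<close>.\<close>

theorem jac_Af: "jac (subSig G f Af) = Nid"
proof (intro equalityI subsetI)
 fix n assume n: "n \<in> Nid"
 have "\<exists>u\<in>Af. mul u (\<lambda>si. one si - mul r n si) = one" if r: "r \<in> Af" for r
  by (rule Nid_quasi_regular[OF Nid_left[OF r n]])
 thus "n \<in> jac (subSig G f Af)" unfolding jac_sub_iff[OF subB_Af] using Nid_Af[OF n] by blast
next
 fix a assume a: "a \<in> jac (subSig G f Af)"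
 interpret R: ring "subSig G f Af" by (rule ring_sub[OF subB_Af])
 have aA: "a \<in> Af" using a unfolding jac_sub_iff[OF subB_Af] by blast
 have "a si \<in> Iid si" if s: "si \<in> G" for si
 proof -
  let ?y = "a si * f si (iv si)"
  have "Tr (?y * t) \<in> JV" if t: "t \<in> S" for t
  proof -
   define u where "u = iv si t"
   have u: "u \<in> S" "si u = t" using gal_S[OF inv_in_G[OF s] t] inv_app[OF s] by (auto simp: u_def)
   have "mul (xs (iv si) u) a \<in> jac (subSig G f Af)"
    using R.jac_lmult[OF a, of "xs (iv si) u"] xs_Af[OF inv_in_G[OF s] u(1)] by simp
   hence "Tr (mul (xs (iv si) u) a id) \<in> JV" using jac_trace[OF subB_Af emb_Af] Af_integral by blast
   moreover have "mul (xs (iv si) u) a id = u * iv si (a si) * f (iv si) si"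
    using mul_xs_left[OF inv_in_G[OF s] id_in_G, of u a] s by simp
   moreover have "si (u * iv si (a si) * f (iv si) si) = ?y * t"
    using u(2) inv_app[OF s] f_inv[OF s] by (simp add: gal_simps(4)[OF s])
   ultimately show ?thesis using Tr_gal[OF s] by metis
  qed
  hence "?y \<in> JS" by (rule trace_dual[OF tame])
  thus ?thesis using Af_S[OF aA] by (simp add: Iid_def)
 qed
 thus "a \<in> Nid" using aA by (simp add: Nid_def)
qed

end

section \<open>Orders, the graph, and the conditions on the cocycle\<close>

context crossed
begin

lemma finsum_Sig:
 assumes "finite A" "\<And>i. i \<in> A ==> g i \<in> CS"
 shows "finsum Sig g A = (\<lambda>rh. \<Sum>i\<in>A. g i rh)"
 using finsum_sub[OF subB_CS assms] unfolding sub_CS .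

lemma integral_iff_intrel:
 assumes x: "x \<in> CS"
 shows "(\<exists>(n::nat) c. (\<forall>i<n. c i \<in> V) \<and>
    x [^]\<^bsub>Sig\<^esub> n \<oplus>\<^bsub>Sig\<^esub> finsum Sig (\<lambda>i. emb (c i) \<otimes>\<^bsub>Sig\<^esub> x [^]\<^bsub>Sig\<^esub> i) {..<n} = \<zero>\<^bsub>Sig\<^esub>)
   \<longleftrightarrow> (\<exists>p. intrel V x p)" (is "?L \<longleftrightarrow> ?R")
proof -
 have e: "x [^]\<^bsub>Sig\<^esub> n \<oplus>\<^bsub>Sig\<^esub> finsum Sig (\<lambda>i. emb (c i) \<otimes>\<^bsub>Sig\<^esub> x [^]\<^bsub>Sig\<^esub> i) {..<n}
   = (\<lambda>rh. pw x n rh + (\<Sum>i<n. c i * pw x i rh))" for n :: nat and c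
 proof -
  have "finsum Sig (\<lambda>i. emb (c i) \<otimes>\<^bsub>Sig\<^esub> x [^]\<^bsub>Sig\<^esub> i) {..<n} = (\<lambda>rh. \<Sum>i<n. sm (c i) (pw x i) rh)"
   unfolding pw_nat_pow[OF x] Sig_simps mul_emb_left[OF pw_CS]
   by (rule finsum_Sig) (use sm_CS[OF pw_CS] in auto)
  thus ?thesis unfolding pw_nat_pow[OF x] by (simp add: sm_def)
 qed
 show ?thesis
 proof
  assume ?L
  then obtain n :: nat and c where c: "\<And>i. i < n ==> c i \<in> V" "(\<lambda>rh. pw x n rh + (\<Sum>i<n. c i * pw x i rh)) = (\<lambda>_. 0)"
   unfolding e by auto
  define p where "p = monom 1 n + (\<Sum>i<n. monom (c i) i)"
  have co: "coeff p i = (if i = n then 1 else if i < n then c i else 0)" for i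
   by (simp add: p_def coeff_sum)
  have d: "degree p = n"
  proof (rule antisym)
   show "degree p \<le> n" by (rule degree_le) (simp add: co)
   show "n \<le> degree p" by (rule le_degree) (simp add: co)
  qed
  have "lead_coeff p = 1" by (simp add: d co)
  hence "ev x p rh = 0" for rh
   using intrel_split[of p x rh] fun_cong[OF c(2), of rh] by (simp add: d co)
  hence "intrel V x p" using c(1) by (auto simp: intrel_def d co)
  thus ?R by blast
 next
  assume ?R
  then obtain p where p: "lead_coeff p = 1" "\<forall>i<degree p. coeff p i \<in> V" "ev x p = (\<lambda>_. 0)"
   unfolding intrel_def by blast
  have "(\<lambda>rh. pw x (degree p) rh + (\<Sum>i<degree p. coeff p i * pw x i rh)) = (\<lambda>_. 0)"
   using intrel_split[OF p(1), of x] p(3) by simp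
  thus ?L unfolding e using p(2) by (intro exI[of _ "degree p"] exI[of _ "coeff p"]) simp
 qed
qed

lemma CS_denom:
 assumes x: "x \<in> CS"
 shows "\<exists>v\<in>V. v \<noteq> 0 \<and> sm v x \<in> Af"
proof -
 have "\<exists>v\<in>V. v \<noteq> 0 \<and> (\<forall>si\<in>A. v * x si \<in> S)" if "finite A" for A
  using that
 proof induct
  case empty show ?case using V_rules(1) by (intro bexI[of _ 1]) auto
 next
  case (insert si A)
  then obtain v where v: "v \<in> V" "v \<noteq> 0" "\<forall>si\<in>A. v * x si \<in> S" by blast
  obtain u where u: "u \<in> V" "u \<noteq> 0" "u * x si \<in> S" using K_frac by blast
  have S': "u \<in> S" "v \<in> S" using u v V_S by auto
  have "\<forall>tu\<in>insert si A. u * v * x tu \<in> S"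
  proof
   fix tu assume "tu \<in> insert si A"
   hence "v * (u * x tu) \<in> S \<or> u * (v * x tu) \<in> S" using u v S' S_rules(6) by blast
   thus "u * v * x tu \<in> S" by (simp add: mult_ac)
  qed
  thus ?case using u v V_rules(6) by (intro bexI[of _ "u * v"]) auto
 qed
 from this[OF finite_G] obtain v where "v \<in> V" "v \<noteq> 0" "\<forall>si\<in>G. v * x si \<in> S" by blast
 thus ?thesis using sm_CS[OF x] by (intro bexI[of _ v]) (auto simp: Af_iff sm_def)
qed

lemma V_orderI:
 assumes B: "subB B" "Af \<subseteq> B" "\<And>b. b \<in> B ==> \<exists>p. intrel V b p"
 shows "V_order G f F V B"
 unfolding V_order_def
proof (intro conjI ballI)
 show "subring B Sig" using B(1) subB_iff by blast
 show "emb ` V \<subseteq> B" using emb_Af B(2) by blast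
 show "\<exists>(n::nat) c. (\<forall>i<n. c i \<in> V) \<and> x [^]\<^bsub>Sig\<^esub> n \<oplus>\<^bsub>Sig\<^esub>
     finsum Sig (\<lambda>i. emb (c i) \<otimes>\<^bsub>Sig\<^esub> x [^]\<^bsub>Sig\<^esub> i) {..<n} = \<zero>\<^bsub>Sig\<^esub>" if "x \<in> B" for x
  using integral_iff_intrel[OF subBD(1)[OF B(1) that]] B(3)[OF that] by blast
 show "carrier Sig = {finsum Sig (\<lambda>i. b i \<otimes>\<^bsub>Sig\<^esub> emb (c i)) {..<(n::nat)} | n b c. \<forall>i<n. b i \<in> B \<and> c i \<in> F}"
 proof (intro equalityI subsetI)
  fix x assume "x \<in> carrier Sig"
  hence x: "x \<in> CS" by simp
  then obtain v where v: "v \<in> V" "v \<noteq> 0" "sm v x \<in> Af" using CS_denom by blast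
  have iF: "inverse v \<in> F" using v V_F F_inverse by blast
  have "finsum Sig (\<lambda>i. sm v x \<otimes>\<^bsub>Sig\<^esub> emb (inverse v)) {..<1::nat} = (\<lambda>rh. \<Sum>i<1::nat. mul (sm v x) (emb (inverse v)) rh)"
   unfolding Sig_simps by (rule finsum_Sig) (use mul_CS in auto)
  also have "\<dots> = x" unfolding mul_emb_right[OF sm_CS[OF x] iF] using v(2) by (simp add: sm_def mult.assoc[symmetric])
  finally have "x = finsum Sig (\<lambda>i. sm v x \<otimes>\<^bsub>Sig\<^esub> emb (inverse v)) {..<1::nat}" by (rule sym)
  moreover have "\<forall>i<1::nat. sm v x \<in> B \<and> inverse v \<in> F" using v(3) B(2) iF by blast
  ultimately show "x \<in> {finsum Sig (\<lambda>i. b i \<otimes>\<^bsub>Sig\<^esub> emb (c i)) {..<(n::nat)} | n b c. \<forall>i<n. b i \<in> B \<and> c i \<in> F}"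
   unfolding mem_Collect_eq
   by (intro exI[of _ "1::nat"] exI[of _ "\<lambda>_. sm v x"] exI[of _ "\<lambda>_. inverse v"] conjI)
 next
  fix x assume "x \<in> {finsum Sig (\<lambda>i. b i \<otimes>\<^bsub>Sig\<^esub> emb (c i)) {..<(n::nat)} | n b c. \<forall>i<n. b i \<in> B \<and> c i \<in> F}"
  then obtain n :: nat and b c where "x = finsum Sig (\<lambda>i. b i \<otimes>\<^bsub>Sig\<^esub> emb (c i)) {..<n}" by blast
  thus "x \<in> carrier Sig" using mul_CS by (simp add: finsum_Sig[of "{..<n}"])
 qed
qed

lemma V_orderD:
 assumes "V_order G f F V B"
 shows "subB B" "emb ` V \<subseteq> B" "b \<in> B ==> \<exists>p. intrel V b p"
proof -
 show B: "subB B" and "emb ` V \<subseteq> B" using assms subB_iff unfolding V_order_def by blast+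
 show "\<exists>p. intrel V b p" if "b \<in> B"
  using assms integral_iff_intrel[OF subBD(1)[OF B that]] that unfolding V_order_def by blast
qed

lemma V_order_Af: "V_order G f F V Af"
 by (rule V_orderI[OF subB_Af subset_refl Af_integral])

section \<open>The conditions on the cocycle and the chain property\<close>

definition cond4 where "cond4 \<longleftrightarrow> (\<forall>M. ismax S M \<longrightarrow> (\<forall>si\<in>G. f si (iv si) \<notin> sq M))"
definition cond5 where "cond5 \<longleftrightarrow> (\<forall>M. ismax S M \<longrightarrow> (\<forall>si\<in>G. \<forall>tu\<in>G. f si tu \<notin> sq M))"

lemma sq_gal_inv:
 assumes M: "ismax S M" and s: "si \<in> G" and x: "si x \<in> sq M"
 shows "ismax S (iv si ` M)" "x \<in> sq (iv si ` M)"
 using gal_max[OF M inv_in_G[OF s]] sq_gal[OF M inv_in_G[OF s] x] inv_app[OF s] by auto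

text \<open>By the cocycle identity \<open>f si tu\<close> divides \<open>si (f tu (iv tu))\<close>,
  and automorphisms permute the ideals \<open>sq M\<close>.\<close>

lemma cond4_iff_cond5: "cond4 \<longleftrightarrow> cond5"
proof
 assume c: cond4
 have "f si tu \<notin> sq M" if M: "ismax S M" and s: "si \<in> G" "tu \<in> G" for M si tu
 proof
  assume "f si tu \<in> sq M"
  hence "f si tu * f (si \<circ> tu) (iv tu) \<in> sq M"
   using is_idealD(5)[OF S_subring sq_ideal[OF M]] f_S s by simp
  hence "si (f tu (iv tu)) \<in> sq M" using coc[OF s inv_in_G[OF s(2)]] s by simp
  thus False using sq_gal_inv[OF M s(1)] c s(2) unfolding cond4_def by blast
 qed
 thus cond5 unfolding cond5_def by blast
next
 assume cond5
 thus cond4 unfolding cond4_def cond5_def using inv_in_G by blast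
qed

lemma dl_sym_notin_sq:
 assumes c: cond4 and M: "ismax S M" and i: "i \<in> G" and j: "j \<in> G"
 shows "dl i j * dl j i \<notin> sq M"
proof
 assume "dl i j * dl j i \<in> sq M"
 hence "i (f (iv i \<circ> j) (iv (iv i \<circ> j))) \<in> sq M" using dl_sym[OF i j] by simp
 thus False using sq_gal_inv[OF M i] c i j unfolding cond4_def by (meson comp_in_G inv_in_G)
qed

lemma mult_in_sq: "a \<in> M ==> b \<in> M ==> a * b \<in> sq M"
 using ideal_prod.prod[of a M b M "subR S"] by simp

text \<open>Two factors in \<open>M\<close> would put their product into the square of
  \<open>M\<close>. So the preorder is total, which is the chain property.\<close>

lemma dl_total:
 assumes "cond4" "ismax S M" "i \<in> G" "j \<in> G"
 shows "dl i j \<notin> M \<or> dl j i \<notin> M"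
 using dl_sym_notin_sq[OF assms] mult_in_sq by blast

lemma graph_chain:
 assumes c: cond4 and M: "ismax S M"
 shows "Gr_chain G S f M"
proof -
 let ?H = "Hgrp G S f"
 let ?c = "\<lambda>si. (\<lambda>h. si \<circ> h) ` ?H"
 have le: "coset_le G S f M (?c si) (?c tu)" if "si \<in> G" "tu \<in> G" "dl si tu \<notin> M" for si tu
  using that unfolding coset_le_def dl_def by blast
 have "Gr_le G S f M P Q \<or> Gr_le G S f M Q P"
  if P: "P \<in> Gr_classes G S f M" and Q: "Q \<in> Gr_classes G S f M" for P Q
 proof -
  have cls: "\<exists>si\<in>G. ?c si \<in> P" if P: "P \<in> Gr_classes G S f M" for P
  proof -
   obtain C where C: "C \<in> gal_lcosets G ?H" "P = {D \<in> gal_lcosets G ?H. coset_le G S f M C D \<and> coset_le G S f M D C}"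
    using P unfolding Gr_classes_def by blast
   obtain si where s: "si \<in> G" "C = ?c si" using C(1) unfolding gal_lcosets_def by blast
   have "dl si si \<notin> M" using dl_refl[OF s(1)] maxD(2)[OF M] by simp
   hence "coset_le G S f M C C" using le[OF s(1) s(1)] s(2) by blast
   thus ?thesis using C s by blast
  qed
  obtain si tu where s: "si \<in> G" "?c si \<in> P" "tu \<in> G" "?c tu \<in> Q" using cls[OF P] cls[OF Q] by blast
  show ?thesis using dl_total[OF c M s(1,3)] le[OF s(1,3)] le[OF s(3,1)] s(2,4) unfolding Gr_le_def by blast
 qed
 thus ?thesis unfolding Gr_chain_def by blast
qed

lemma Nid_D: "a \<in> Nid ==> si \<in> G ==> a si \<in> Iid si"
 by (simp add: Nid_def)

lemma Nid_add: "a \<in> Nid ==> b \<in> Nid ==> (\<lambda>si. a si + b si) \<in> Nid"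
 using subBD(4)[OF subB_Af, of a b] Iid_add by (auto simp: Nid_def)

lemma Nid_minus: "a \<in> Nid ==> (\<lambda>si. - a si) \<in> Nid"
 using subBD(5)[OF subB_Af, of a] Iid_mult[of "- 1"] S_rules(1,3) by (auto simp: Nid_def)

section \<open>The left order of the radical\<close>

abbreviation LO where "LO \<equiv> left_order G f Nid"

lemma LO_iff: "x \<in> LO \<longleftrightarrow> x \<in> CS \<and> (\<forall>y\<in>Nid. mul x y \<in> Nid)"
 by (simp add: left_order_def)

lemma Af_LO: "Af \<subseteq> LO"
 using Nid_left Af_iff unfolding LO_iff subset_iff by blast

lemma subB_LO: "subB LO"
 unfolding subB_def
proof (intro conjI ballI)
 show "LO \<subseteq> CS" using LO_iff by blast
 show "one \<in> LO" using Af_LO subBD(2)[OF subB_Af] by blast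
 fix a assume a: "a \<in> LO"
 show "(\<lambda>si. - a si) \<in> LO" using a Nid_minus unfolding LO_iff by (auto simp: mul_minus_left)
 fix b assume b: "b \<in> LO"
 show "(\<lambda>si. a si + b si) \<in> LO" using a b Nid_add unfolding LO_iff by (auto simp: mul_add_left)
 show "mul a b \<in> LO" using a b mul_CS unfolding LO_iff by (simp add: mul_assoc)
qed

end

section \<open>The conditions in the presence of a uniformizer\<close>

locale tame_unif = tame_crossed F V S f + val_ext_unif F V S w
 for F V S :: "'k::field set" and f w
begin

lemma w_JS: "w \<in> JS" using w_S w_M by (simp add: JS_def)

lemma dJ: "x \<in> JS ==> ismax S M ==> x \<in> nloc M"
 using nloc_iff by (auto simp: JS_def)

lemma unit_cancel:
 assumes M: "ismax S M" and u: "u \<in> S" "u \<notin> M"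
 shows "x * u \<in> loc M \<longleftrightarrow> x \<in> loc M" "x * u \<in> nloc M \<longleftrightarrow> x \<in> nloc M"
proof -
 have i: "u \<noteq> 0" "inverse u \<in> loc M" "u \<in> loc M" using loc_unit[OF M u] S_loc[OF M u(1)] by auto
 have e: "x * u * inverse u = x" using i by simp
 show "x * u \<in> loc M \<longleftrightarrow> x \<in> loc M" using loc_rules(6)[OF M _ i(2), of "x * u"] loc_rules(6)[OF M _ i(3), of x] e by metis
 show "x * u \<in> nloc M \<longleftrightarrow> x \<in> nloc M" using nloc_rules(5)[OF M i(2), of "x * u"] nloc_rules(5)[OF M i(3), of x] e by metis
qed

text \<open>To lie outside the square of \<open>M\<close> is to have at most the value of
  \<open>w\<close>; in this form \<open>cond4\<close> permits divisions.\<close>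

lemma w_over:
 assumes M: "ismax S M" and u: "u \<in> S" "u \<notin> sq M"
 shows "u \<noteq> 0" "w / u \<in> loc M"
proof -
 show u0: "u \<noteq> 0" using u(2) is_idealD(2)[OF S_subring sq_ideal[OF M]] by blast
 show "w / u \<in> loc M"
 proof (rule ccontr)
  assume "w / u \<notin> loc M"
  hence "u / w \<in> nloc M" using not_div_nonunits[OF loc_val[OF M]] by blast
  hence "u / w / w \<in> loc M" using nloc_w[OF M] by blast
  hence "u \<in> sq M" using sq_w[OF M u(1)] by (simp add: power2_eq_square)
  thus False using u(2) by blast
 qed
qed

text \<open>An \<open>x\<close> in \<open>LO\<close> is tested on single terms of
  \<open>Nid\<close>. If \<open>f tu (iv tu)\<close> is a unit at \<open>M\<close>, a term at the
  identity suffices. Otherwise the coefficient ideal at \<open>iv tu\<close> is everything at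
  \<open>M\<close>, so \<open>x tu * f tu (iv tu)\<close> is a non-unit, and \<open>w_over\<close>
  divides by the second factor.\<close>

lemma cond4_LO:
 assumes c: cond4
 shows "LO = Af"
proof (rule antisym[OF _ Af_LO], rule subsetI)
 fix x assume x: "x \<in> LO"
 have xm: "mul x y \<in> Nid" if "y \<in> Nid" for y using x that LO_iff by blast
 have "x tu \<in> loc M" if t: "tu \<in> G" and M: "ismax S M" for tu M
 proof -
  note O = loc_rules[OF M] and N = nloc_rules[OF M]
  let ?u = "f tu (iv tu)"
  have uS: "?u \<in> S" using f_S t by simp
  show ?thesis
  proof (cases "?u \<in> M")
   case False
   have "xs id (iv tu w) \<in> Nid"
    using xs_Nid[OF id_in_G] JS_gal[OF inv_in_G[OF t]] w_JS unfolding Iid_id by blast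
   hence "mul x (xs id (iv tu w)) tu \<in> Iid tu" using xm t by (auto simp: Nid_def)
   hence "x tu * w * ?u \<in> nloc M"
    using mul_xs_right[OF id_in_G t, of x "iv tu w"] t inv_app[OF t] dJ[OF _ M] by (simp add: Iid_def)
   hence "x tu * w \<in> nloc M" using unit_cancel(2)[OF M uS False] by simp
   thus ?thesis using nloc_w[OF M] w_nz by simp
  next
   case True
   obtain e where e: "e \<in> S" "1 - e \<in> M" "\<And>M'. ismax S M' ==> M' \<noteq> M ==> e \<in> M'"
    using max_idempotent[OF M] by blast
   have eM: "e \<notin> M" using maxD(6)[OF M] e by blast
   have eu: "e * ?u \<in> JS"
   proof -
    have "e * ?u \<in> M'" if M': "ismax S M'" for M'
     using e True uS M_rules(4)[OF M', of e ?u] M_rules(5)[OF M' uS, of e] M' by (cases "M' = M") auto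
    thus ?thesis using e uS S_rules(6) by (simp add: JS_def)
   qed
   have "iv tu e * f (iv tu) tu = iv tu (e * ?u)"
    using f_inv'[OF t] by (simp add: gal_simps(4)[OF inv_in_G[OF t]])
   hence "iv tu e \<in> Iid (iv tu)"
    using eu JS_gal[OF inv_in_G[OF t]] gal_S[OF inv_in_G[OF t] e(1)] t by (simp add: Iid_def)
   hence "xs (iv tu) (iv tu e) \<in> Nid" using xs_Nid t by simp
   hence "mul x (xs (iv tu) (iv tu e)) id \<in> Iid id" by (intro Nid_D xm id_in_G)
   hence "x tu * e * ?u \<in> JS" unfolding Iid_id
    using mul_xs_right[OF inv_in_G[OF t] id_in_G, of x "iv tu e"] t inv_app[OF t] by simp
   hence "x tu * ?u * e \<in> nloc M" using dJ[OF _ M] by (simp add: mult_ac)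
   hence "x tu * ?u \<in> nloc M" using unit_cancel(2)[OF M e(1) eM] by simp
   hence "(x tu * ?u / w) * (w / ?u) \<in> loc M"
    using nloc_w[OF M] w_over(2)[OF M uS] c M t O(6) unfolding cond4_def by blast
   thus ?thesis using w_nz f_nz[OF t inv_in_G[OF t]] by simp
  qed
 qed
 hence "x tu \<in> S" if "tu \<in> G" for tu using that mem_S_if_loc by blast
 thus "x \<in> Af" using x unfolding LO_iff Af_iff by blast
qed

text \<open>If some \<open>f tu (iv tu)\<close> lies in the square of \<open>M\<close>, then
  \<open>(e / w) x_tu\<close> stabilizes \<open>Nid\<close> without lying in \<open>Af\<close>,
  provided \<open>tu\<close> is maximal in the preorder among such automorphisms.\<close>

lemma LO_cond4:
 assumes LO: "LO = Af"
 shows cond4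
proof (rule ccontr)
 assume "\<not> cond4"
 then obtain M tu0 where M: "ismax S M" and t0: "tu0 \<in> G" "f tu0 (iv tu0) \<in> sq M" unfolding cond4_def by blast
 note O = loc_rules[OF M] and N = nloc_rules[OF M] and sqi = is_idealD[OF S_subring sq_ideal[OF M]]
 let ?bad = "{tu\<in>G. f tu (iv tu) \<in> sq M}"
 \<comment> \<open>The number of elements below \<open>tu\<close> measures its height, so a maximum
   over \<open>?bad\<close> yields a maximal \<open>tu\<close>.\<close>
 let ?c = "\<lambda>tu. card {ap\<in>G. dl ap tu \<notin> M}"
 have fb: "finite ?bad" "?bad \<noteq> {}" using t0 by auto
 have "Max (?c ` ?bad) \<in> ?c ` ?bad"
  by (rule Max_in[OF finite_imageI[OF fb(1)]]) (use fb(2) in blast)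
 then obtain tu where tm: "Max (?c ` ?bad) = ?c tu" and tb: "tu \<in> ?bad" by (rule imageE)
 have tmax: "?c rh \<le> ?c tu" if "rh \<in> ?bad" for rh
  unfolding tm[symmetric] by (rule Max_ge[OF finite_imageI[OF fb(1)] imageI[OF that]])
 have t: "tu \<in> G" "dl tu id \<in> sq M" using tb by (auto simp: dl_id_right)
 obtain e where e: "e \<in> S" "1 - e \<in> M" "\<And>M'. ismax S M' ==> M' \<noteq> M ==> e \<in> M'"
  using max_idempotent[OF M] by blast
 have eM: "e \<notin> M" using maxD(6)[OF M] e by blast
 have "xs tu (e / w) \<in> LO" unfolding LO_iff
 proof (intro conjI ballI)
  show "xs tu (e / w) \<in> CS" by (rule xs_CS[OF t(1)])
  fix y assume y: "y \<in> Nid"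
  have "mul (xs tu (e / w)) y rh \<in> Iid rh" if r: "rh \<in> G" for rh
  proof -
   define si where "si = iv tu \<circ> rh"
   have s: "si \<in> G" "rh = tu \<circ> si" using t r by (auto simp: si_def)
   define z where "z = tu (y si) * dl tu rh"
   have yI: "y si \<in> Iid si" "y si \<in> S" using y s(1) by (auto simp: Nid_def Iid_def)
   have yS: "tu (y si) \<in> S" using gal_S[OF t(1) yI(2)] .
   have me: "mul (xs tu (e / w)) y rh = e * z / w"
    using mul_xs_left[OF t(1) r, of "e / w" y] by (simp add: z_def dl_def si_def)
   have zI: "z \<in> Iid rh" using Iid_left[OF t(1) s(1) yI(1)] s t unfolding z_def dl_def by simp
   have zS: "z \<in> S" using zI by (simp add: Iid_def)
   have rS: "dl rh id \<in> S" using dl_S r by simp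
   have zJ: "z * dl rh id \<in> JS" using zI r by (simp add: Iid_def dl_id_right)
   have prod: "dl tu rh * dl rh id \<in> sq M"
    using dl_mult[OF t(1) r id_in_G] sqi(4)[OF gal_S[OF t(1) f_S] t(2)] t(1) r by simp
   \<comment> \<open>If \<open>z\<close> were outside \<open>M\<close>, then \<open>rh\<close> would
     lie strictly above \<open>tu\<close>, and it would be bad as well because
     \<open>dl tu rh\<close> is a unit at \<open>M\<close>; this contradicts the choice of
     \<open>tu\<close>.\<close>
   have zM: "z \<in> M"
   proof (rule ccontr)
    assume z: "z \<notin> M"
    have a1: "dl tu rh \<notin> M" using z M_rules(4)[OF M yS] unfolding z_def by blast
    have "tu (y si * f si (iv si)) \<in> JS" using yI(1) JS_gal[OF t(1)] by (simp add: Iid_def)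
    hence "tu (y si) * (dl tu rh * dl rh tu) \<in> M"
     unfolding dl_sym[OF t(1) r] si_def[symmetric] using M by (simp add: gal_simps(4)[OF t(1)] JS_def)
    hence "z * dl rh tu \<in> M" by (simp add: z_def mult.assoc)
    hence a2: "dl rh tu \<in> M" using maxD(5)[OF M zS dl_S[OF r t(1)]] z by blast
    have "dl tu rh * dl rh id / w\<^sup>2 \<in> loc M" using prod sq_w[OF M S_rules(6)[OF dl_S[OF t(1) r] rS]] by blast
    hence "dl rh id / w\<^sup>2 * dl tu rh \<in> loc M" by (simp add: mult_ac)
    hence "dl rh id / w\<^sup>2 \<in> loc M" using unit_cancel(1)[OF M dl_S[OF t(1) r] a1] by blast
    hence "dl rh id \<in> sq M" using sq_w[OF M rS] by blast
    hence "rh \<in> ?bad" using r by (simp add: dl_id_right)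
    hence "?c rh \<le> ?c tu" by (rule tmax)
    moreover have "?c tu < ?c rh"
    proof (rule psubset_card_mono)
     have "{ap\<in>G. dl ap tu \<notin> M} \<subseteq> {ap\<in>G. dl ap rh \<notin> M}" using dl_trans[OF M _ t(1) r _ a1] by blast
     moreover have "rh \<in> {ap\<in>G. dl ap rh \<notin> M}" using r dl_refl[OF r] maxD(2)[OF M] by simp
     moreover have "rh \<notin> {ap\<in>G. dl ap tu \<notin> M}" using a2 by simp
     ultimately show "{ap\<in>G. dl ap tu \<notin> M} \<subset> {ap\<in>G. dl ap rh \<notin> M}" by blast
    qed simp
    ultimately show False by simp
   qed
   have m1: "e * z / w \<in> S"
   proof -
    have "e * z \<in> M'" if M': "ismax S M'" for M'
     using e zM zS M_rules(4)[OF M', of e z] M_rules(5)[OF M' zS, of e] M' by (cases "M' = M") auto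
    hence "e * z \<in> JS" using e zS S_rules(6) by (simp add: JS_def)
    thus ?thesis using JS_w by blast
   qed
   \<comment> \<open>At \<open>M\<close> the square of \<open>M\<close> pays for both divisions by
     \<open>w\<close>; at the other maximal ideals \<open>e\<close> pays for one and
     \<open>z * dl rh id\<close> for the other.\<close>
   have "e * z / w * dl rh id / w \<in> S"
   proof (rule mem_S_if_loc)
    fix M' assume M': "ismax S M'"
    show "e * z / w * dl rh id / w \<in> loc M'"
    proof (cases "M' = M")
     case True
     have "z * dl rh id \<in> sq M"
      using sqi(4)[OF yS prod] by (simp add: z_def mult.assoc)
     hence "e * (z * dl rh id / w\<^sup>2) \<in> loc M"
      using sq_w[OF M S_rules(6)[OF zS rS]] O(6)[OF S_loc[OF M e(1)]] by blast
     thus ?thesis using True by (simp add: power2_eq_square mult.assoc)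
    next
     case False
     hence "e / w \<in> loc M'" using nloc_w[OF M'] nloc_iff[OF M' e(1)] e(3)[OF M'] by blast
     moreover have "z * dl rh id / w \<in> loc M'" using zJ JS_w S_loc[OF M'] by blast
     ultimately have "(e / w) * (z * dl rh id / w) \<in> loc M'" using loc_rules(6)[OF M'] by blast
     thus ?thesis by (simp add: mult.assoc)
    qed
   qed
   hence "e * z / w * dl rh id \<in> JS" using JS_w by blast
   thus ?thesis unfolding me using m1 r by (simp add: Iid_def dl_id_right)
  qed
  moreover from this have "mul (xs tu (e / w)) y \<in> Af" using mul_CS by (simp add: Af_iff Iid_def)
  ultimately show "mul (xs tu (e / w)) y \<in> Nid" by (simp add: Nid_def)
 qed
 hence "xs tu (e / w) tu \<in> S" unfolding LO by (rule Af_S)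
 hence "e / w \<in> loc M" using S_loc[OF M] by (simp add: xs_def)
 hence "e \<in> M" using nloc_w[OF M] nloc_iff[OF M e(1)] by blast
 thus False using eM by blast
qed

text \<open>At \<open>M\<close>, \<open>Nid\<close> is the right lattice with basis
  \<open>x_sigma d_sigma\<close>, where \<open>d\<close> is 1 if \<open>f (iv si) si\<close> lies in
  \<open>M\<close> and \<open>w\<close> otherwise, and elements of \<open>LO\<close> preserve it.
  The arguments of \<open>f\<close> are reversed because scalars stand on the right.\<close>

lemma LO_integral:
 assumes a: "a \<in> LO"
 shows "\<exists>p. intrel V a p"
proof -
 obtain M where M: "ismax S M" using ex_max by blast
 note O = loc_rules[OF M]
 obtain e where e: "e \<in> S" "1 - e \<in> M" "\<And>M'. ismax S M' ==> M' \<noteq> M ==> e \<in> M'"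
  using max_idempotent[OF M] by blast
 have eM: "e \<notin> M" using maxD(6)[OF M] e by blast
 define d where "d si = (if f (iv si) si \<in> M then 1 else w)" for si
 show ?thesis
 proof (rule integral_if_lattice[OF M, of d])
  show "d si \<noteq> 0" for si using w_nz by (simp add: d_def)
  fix si rh assume s: "si \<in> G" and r: "rh \<in> G"
  let ?v = "f (iv rh) rh"
  have vS: "?v \<in> S" and uS: "f (iv si) si \<in> S" using f_S r s by auto
  have dS: "d rh \<in> S" using w_S S_rules(1) by (simp add: d_def)
  \<comment> \<open>The term \<open>x_rh t\<close>, with left coefficient \<open>rh t\<close>, is to
    lie in \<open>Nid\<close>. The factor \<open>e\<close> takes care of the other maximal ideals
    and is cancelled at the end.\<close>
  define t where "t = e * d rh"
  have tS: "t \<in> S" unfolding t_def by (rule S_rules(6)[OF e(1) dS])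
  have "t * ?v \<in> M'" if M': "ismax S M'" for M'
  proof (cases "M' = M")
   case True
   have "d rh * ?v \<in> M" using w_M[OF M] M_rules(5)[OF M vS] by (simp add: d_def)
   thus ?thesis using M_rules(4)[OF M e(1)] True by (simp add: t_def mult.assoc)
  next
   case False
   thus ?thesis using M_rules(5)[OF M' S_rules(6)[OF dS vS] e(3)[OF M' False]] by (simp add: t_def mult.assoc)
  qed
  hence tv: "t * ?v \<in> JS" using tS vS S_rules(6) by (simp add: JS_def)
  have "rh t * f rh (iv rh) = rh (t * ?v)" using f_inv[OF r] by (simp add: gal_simps(4)[OF r])
  hence "rh t \<in> Iid rh" using tv JS_gal[OF r] gal_S[OF r tS] by (simp add: Iid_def)
  hence "mul a (xs rh (rh t)) \<in> Nid" using xs_Nid[OF r] a LO_iff by blast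
  hence "mul a (xs rh (rh t)) si \<in> Iid si" using s by (simp add: Nid_def)
  moreover define c where "c = mul a (xs rh (rh t)) si"
  ultimately have cI: "c \<in> S" "c * f si (iv si) \<in> JS" by (auto simp: Iid_def)
  have c: "c = a (si \<circ> iv rh) * si t * f (si \<circ> iv rh) rh"
   unfolding c_def using mul_xs_right[OF r s, of a "rh t"] inv_app[OF r] by simp
  have q: "Q a si rh * t = iv si c"
   unfolding Q_def c using inv_app[OF s] by (simp add: gal_simps(4)[OF inv_in_G[OF s]])
  have u: "iv si c \<in> S" using gal_S[OF inv_in_G[OF s] cI(1)] .
  have "iv si (c * f si (iv si)) \<in> JS" using cI(2) JS_gal[OF inv_in_G[OF s]] by blast
  hence u2: "iv si c * f (iv si) si \<in> JS" using f_inv'[OF s] by (simp add: gal_simps(4)[OF inv_in_G[OF s]])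
  have "iv si c / d si \<in> loc M"
  proof (cases "f (iv si) si \<in> M")
   case True thus ?thesis using S_loc[OF M u] by (simp add: d_def)
  next
   case False
   have "iv si c \<in> nloc M" using dJ[OF u2 M] unit_cancel(2)[OF M uS False] by blast
   thus ?thesis using nloc_w[OF M] False by (simp add: d_def)
  qed
  hence "Q a si rh * d rh / d si * e \<in> loc M" unfolding q[symmetric] t_def by (simp add: mult_ac)
  thus "Q a si rh * d rh / d si \<in> loc M" using unit_cancel(1)[OF M e(1) eM] by blast
 qed
qed

text \<open>\<open>LO\<close> is itself an order, and \<open>Nid\<close> is a left ideal of it
  consisting of quasi-regular elements, hence contained in its radical.\<close>

lemma extremal_LO:
 assumes "extremal G f F V Af"
 shows "LO = Af"
proof -
 have "V_order G f F V LO" by (rule V_orderI[OF subB_LO Af_LO LO_integral])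
 moreover have "Nid \<subseteq> jac (subSig G f LO)"
 proof
  fix n assume n: "n \<in> Nid"
  have "n \<in> LO" using Nid_Af[OF n] Af_LO by blast
  moreover have "\<exists>u\<in>LO. mul u (\<lambda>si. one si - mul r n si) = one" if "r \<in> LO" for r
   using Nid_quasi_regular[of "mul r n"] that n Af_LO unfolding LO_iff by blast
  ultimately show "n \<in> jac (subSig G f LO)" unfolding jac_sub_iff[OF subB_LO] by blast
 qed
 ultimately show ?thesis using assms Af_LO unfolding extremal_def jac_Af by blast
qed

text \<open>If the radical of a larger order \<open>B\<close> contains \<open>Nid\<close>, products
  of \<open>b\<close> in \<open>B\<close> with terms of \<open>Nid\<close> have identity
  coefficients with trace in \<open>JV\<close>. Trace duality then forces every coefficient of
  \<open>b\<close> into \<open>S\<close>.\<close>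

lemma cond4_extremal:
 assumes c: cond4
 shows "extremal G f F V Af"
 unfolding extremal_def jac_Af
proof (intro conjI allI impI V_order_Af)
 fix B assume B: "V_order G f F V B \<and> Af \<subseteq> B \<and> Nid \<subseteq> jac (subSig G f B)"
 note O = V_orderD[OF conjunct1[OF B]]
 interpret R: ring "subSig G f B" by (rule ring_sub[OF O(1)])
 have "b si \<in> S" if b: "b \<in> B" and s: "si \<in> G" for b si
 proof -
  let ?u = "f si (iv si)"
  have uS: "?u \<in> S" and u0: "?u \<noteq> 0" using f_S f_nz s by auto
  have wu: "w / ?u \<in> S"
   by (rule mem_S_if_loc) (use w_over(2)[OF _ uS] c s in \<open>auto simp: cond4_def\<close>)
  have "Tr (b si * w * t) \<in> JV" if t: "t \<in> S" for t
  proof -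
   \<comment> \<open>\<open>v\<close> is made so that the product below has identity coefficient
     \<open>b si * (w * t)\<close>. It lies in \<open>S\<close> because \<open>cond4\<close> makes
     \<open>w\<close> divisible by \<open>f si (iv si)\<close>.\<close>
   define v where "v = iv si (w / ?u * t)"
   have v: "v \<in> S" unfolding v_def by (intro gal_S[OF inv_in_G[OF s]] S_rules(6) wu t)
   have sv: "si v * ?u = w * t" unfolding v_def inv_app[OF s] using u0 by simp
   have "v * f (iv si) si = iv si (w * t)"
    unfolding v_def f_inv'[OF s, symmetric] gal_simps(4)[OF inv_in_G[OF s], symmetric] using u0 by simp
   hence "v * f (iv si) si \<in> JS" using JS_gal[OF inv_in_G[OF s]] JS_rules(5)[OF t w_JS] by simp
   hence "v \<in> Iid (iv si)" using v s by (simp add: Iid_def)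
   hence "xs (iv si) v \<in> jac (subSig G f B)" using xs_Nid[OF inv_in_G[OF s]] B by blast
   hence "mul b (xs (iv si) v) \<in> jac (subSig G f B)" using R.jac_lmult[of "xs (iv si) v" b] b by simp
   hence "Tr (mul b (xs (iv si) v) id) \<in> JV" using jac_trace[OF O(1,2)] O(3) by blast
   moreover have "mul b (xs (iv si) v) id = b si * (si v * ?u)"
    using mul_xs_right[OF inv_in_G[OF s] id_in_G, of b v] s by (simp add: mult.assoc)
   ultimately show ?thesis unfolding sv by (simp add: mult.assoc)
  qed
  hence "b si * w \<in> JS" by (rule trace_dual[OF tame])
  thus ?thesis using JS_w w_nz by simp
 qed
 hence "B \<subseteq> Af" using subBD(1)[OF O(1)] unfolding Af_iff subset_iff by blast
 thus "B = Af" using B by blast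
qed

end

context tame_crossed
begin

text \<open>A generator of \<open>JV\<close> equal to 0 means \<open>V = F\<close>; a nonzero one
  leads to a uniformizer of \<open>S\<close>.\<close>

lemma uniformizer_cases:
 obtains "JV = {0}" | w where "tame_unif F V S f w"
proof -
 obtain \<pi> where pi: "JV = {\<pi> * v | v. v \<in> V}" using principal_JV by blast
 show ?thesis
 proof (cases "\<pi> = 0")
  case True
  hence "JV = {0}" using pi V_rules(1) by auto
  thus ?thesis using that(1) by blast
 next
  case False
  then obtain w where "w \<in> S" "w \<noteq> 0" "\<forall>M. ismax S M \<longrightarrow> w \<in> M \<and> (\<forall>x\<in>nloc M. x / w \<in> loc M)"
   using uniformizer[OF pi] by blast
  hence "tame_unif F V S f w" by unfold_locales auto
  thus ?thesis using that(2) by blast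
 qed
qed

lemma trivial_conditions:
 assumes J: "JV = {0}"
 shows cond4 "LO = Af" "extremal G f F V Af"
proof -
 have SU: "S = UNIV" using trivial_val(2)[OF J] .
 have A: "Af = CS" using SU by (auto simp: A_f_set_def)
 show "LO = Af" using Af_LO LO_iff A by blast
 show "extremal G f F V Af"
  unfolding extremal_def
 proof (intro conjI allI impI V_order_Af)
  fix B assume B: "V_order G f F V B \<and> Af \<subseteq> B \<and> jac (subSig G f Af) \<subseteq> jac (subSig G f B)"
  have "subB B" using V_orderD(1) B by blast
  hence "B \<subseteq> CS" unfolding subB_def by blast
  thus "B = Af" using B A by blast
 qed
 have "sq M \<subseteq> {0}" if M: "ismax S M" for M
 proof
  fix x assume "x \<in> sq M"
  thus "x \<in> {0}" by (induct rule: ideal_prod.induct) (use trivial_val(3)[OF J M] in auto)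
 qed
 thus cond4 unfolding cond4_def using f_nz inv_in_G by blast
qed

theorem cond4_iff_LO: "cond4 \<longleftrightarrow> LO = Af"
proof (rule uniformizer_cases)
 fix w assume "tame_unif F V S f w"
 then interpret tame_unif F V S f w .
 show ?thesis using cond4_LO LO_cond4 by blast
qed (use trivial_conditions in blast)

theorem cond4_iff_extremal: "cond4 \<longleftrightarrow> extremal G f F V Af"
proof (rule uniformizer_cases)
 fix w assume "tame_unif F V S f w"
 then interpret tame_unif F V S f w .
 show ?thesis using cond4_extremal extremal_LO LO_cond4 by blast
qed (use trivial_conditions in blast)

end

section \<open>Projectivity of the radical\<close>

context crossed
begin

lemma lideal_sub_iff:
 assumes B: "subB B"
 shows "lideal (subSig G f B) I \<longleftrightarrow> I \<subseteq> B \<and> (\<lambda>_. 0) \<in> I \<and> (\<forall>x\<in>I. \<forall>y\<in>I. (\<lambda>si. x si + y si) \<in> I) \<and>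
  (\<forall>x\<in>I. (\<lambda>si. - x si) \<in> I) \<and> (\<forall>r\<in>B. \<forall>x\<in>I. mul r x \<in> I)"
proof (cases "I \<subseteq> B")
 case True
 have "(\<forall>x\<in>I. \<ominus>\<^bsub>subSig G f B\<^esub> x \<in> I) \<longleftrightarrow> (\<forall>x\<in>I. (\<lambda>si. - x si) \<in> I)"
  by (rule ball_cong[OF refl]) (use minus_sub[OF B] True in auto)
 thus ?thesis unfolding lideal_def sub_simps by simp
qed (simp add: lideal_def)

lemma lideal_subD:
 assumes "subB B" "lideal (subSig G f B) I"
 shows "x \<in> I ==> x \<in> B" "(\<lambda>_. 0) \<in> I" "x \<in> I ==> y \<in> I ==> (\<lambda>si. x si + y si) \<in> I"
  "r \<in> B ==> x \<in> I ==> mul r x \<in> I"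
 using assms(2) unfolding lideal_sub_iff[OF assms(1)] by blast+

lemma lideal_sub_sum:
 assumes "subB B" "lideal (subSig G f B) I" "\<And>i. i \<in> A ==> g i \<in> I"
 shows "(\<lambda>rh. \<Sum>i\<in>A. g i rh) \<in> I"
 using assms(3)
proof (induct A rule: infinite_finite_induct)
 case (insert x A) thus ?case using lideal_subD(3)[OF assms(1,2), of "g x" "\<lambda>rh. \<Sum>i\<in>A. g i rh"] by simp
qed (use lideal_subD(2)[OF assms(1,2)] in auto)

lemma lideal_Nid: "lideal (subSig G f Af) Nid"
 unfolding lideal_sub_iff[OF subB_Af]
proof (intro conjI ballI)
 show "Nid \<subseteq> Af" using Nid_Af by blast
 show "(\<lambda>_. 0) \<in> Nid" using subBD(6)[OF subB_Af] Iid_zero by (simp add: Nid_def)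
qed (use Nid_add Nid_minus Nid_left in auto)

lemma max_indicator:
 assumes u: "u \<in> S"
 shows "\<exists>c\<in>S. \<forall>M. ismax S M \<longrightarrow> (if u \<in> M then 1 - c \<in> M else c \<in> M)"
proof -
 obtain e where e: "\<And>M. ismax S M ==> e M \<in> S" "\<And>M. ismax S M ==> 1 - e M \<in> M"
  "\<And>M M'. ismax S M ==> ismax S M' ==> M' \<noteq> M ==> e M \<in> M'"
  using max_idempotent by (metis mem_Collect_eq)
 define T where "T = {M \<in> Maxs. u \<in> M}"
 have fT: "finite T" using finite_Maxs by (simp add: T_def)
 define c where "c = (\<Sum>M\<in>T. e M)"
 have cS: "c \<in> S" unfolding c_def by (rule is_subring_sum[OF S_subring]) (use e(1) in \<open>simp add: T_def\<close>)
 have "if u \<in> M then 1 - c \<in> M else c \<in> M" if M: "ismax S M" for M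
 proof -
  have r: "(\<Sum>M'\<in>T - {M}. e M') \<in> M"
   by (rule is_ideal_sum[OF S_subring maxD(1)[OF M]]) (use e(3) M in \<open>auto simp: T_def\<close>)
  show ?thesis
  proof (cases "u \<in> M")
   case True
   hence "M \<in> T" using M by (simp add: T_def)
   hence eq: "1 - c = (1 - e M) - (\<Sum>M'\<in>T - {M}. e M')" unfolding c_def sum.remove[OF fT \<open>M \<in> T\<close>] by simp
   have "1 - c \<in> M" unfolding eq by (rule M_rules(7)[OF M e(2)[OF M] r])
   thus ?thesis using True by simp
  next
   case False
   hence "T - {M} = T" by (auto simp: T_def)
   thus ?thesis using False r by (simp add: c_def)
  qed
 qed
 thus ?thesis using cS by blast
qed

end

context tame_crossed
begin

lemma JS_principal: "\<exists>w\<in>JS. \<forall>x\<in>JS. \<exists>r\<in>S. x = r * w"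
proof (rule uniformizer_cases)
 assume J: "JV = {0}"
 obtain M where M: "ismax S M" using ex_max by blast
 have "x = 0" if "x \<in> JS" for x using that M trivial_val(3)[OF J M] by (auto simp: JS_def)
 thus ?thesis using JS_rules(2) S_rules(1) by (intro bexI[of _ 0]) auto
next
 fix w assume "tame_unif F V S f w"
 then interpret tame_unif F V S f w .
 have "x = (x / w) * w" for x using w_nz by simp
 thus ?thesis using JS_w w_JS by blast
qed

text \<open>Semihereditarity speaks about finitely generated ideals, so the radical must be shown to
  be one. In each degree \<open>c\<close> is congruent to 1 at the maximal ideals containing
  \<open>f si (iv si)\<close> and to 0 at the others; then \<open>s * (1 - c)\<close> lies in
  \<open>JS\<close>, which has a single generator, for every \<open>s\<close> in the coefficient
  ideal.\<close>

lemma fg_Nid: "fg_lideal (subSig G f Af) Nid"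
proof -
 obtain w where w: "w \<in> JS" "\<And>x. x \<in> JS ==> \<exists>r\<in>S. x = r * w" using JS_principal by blast
 have "\<exists>c\<in>Iid si. \<forall>s\<in>Iid si. s * (1 - c) \<in> JS" if s: "si \<in> G" for si
 proof -
  let ?u = "f si (iv si)"
  have uS: "?u \<in> S" using f_S s by simp
  obtain c where c: "c \<in> S" "\<And>M. ismax S M ==> (if ?u \<in> M then 1 - c \<in> M else c \<in> M)"
   using max_indicator[OF uS] by blast
  have "c * ?u \<in> M" if M: "ismax S M" for M
   using c(2)[OF M] M_rules(4)[OF M c(1)] M_rules(5)[OF M uS] by (simp split: if_splits)
  hence "c \<in> Iid si" using c(1) uS S_rules(6) by (simp add: Iid_def JS_def)
  moreover have "s * (1 - c) \<in> JS" if s: "s \<in> Iid si" for s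
  proof -
   have sS: "s \<in> S" "s * ?u \<in> JS" using s by (auto simp: Iid_def)
   have cS: "1 - c \<in> S" using c(1) S_rules(1,4) by blast
   have "s * (1 - c) \<in> M" if M: "ismax S M" for M
   proof (cases "?u \<in> M")
    case True thus ?thesis using c(2)[OF M] M_rules(4)[OF M sS(1)] by simp
   next
    case False
    have "s * ?u \<in> M" using sS(2) M by (simp add: JS_def)
    hence "s \<in> M" using maxD(5)[OF M sS(1) uS] False by blast
    thus ?thesis using M_rules(5)[OF M cS] by blast
   qed
   thus ?thesis using sS cS S_rules(6) by (simp add: JS_def)
  qed
  ultimately show ?thesis by blast
 qed
 then obtain c where c: "\<And>si. si \<in> G ==> c si \<in> Iid si"
  "\<And>si s. si \<in> G ==> s \<in> Iid si ==> s * (1 - c si) \<in> JS" by metis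
 define Y where "Y = (\<lambda>si. xs si w) ` G \<union> (\<lambda>si. xs si (c si)) ` G"
 have Yf: "finite Y" by (simp add: Y_def)
 have YN: "Y \<subseteq> Nid" unfolding Y_def using xs_Nid c(1) JS_Iid[OF _ w(1)] by blast
 have "Nid \<subseteq> L" if L: "lideal (subSig G f Af) L" "Y \<subseteq> L" for L
 proof
  fix n assume n: "n \<in> Nid"
  have nC: "n \<in> CS" using Nid_Af[OF n] Af_iff by blast
  have "xs si (n si) \<in> L" if s: "si \<in> G" for si
  proof -
   have ns: "n si \<in> Iid si" "n si \<in> S" using Nid_D[OF n s] by (auto simp: Iid_def)
   obtain r where r: "r \<in> S" "n si * (1 - c si) = r * w" using w(2)[OF c(2)[OF s ns(1)]] by blast
   have l: "mul (xs id a) (xs si b) = xs si (a * b)" for a b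
    using mul_xs_xs[OF id_in_G s, of a b] s by simp
   have "xs si (n si * c si) \<in> L"
    unfolding l[symmetric] by (rule lideal_subD(4)[OF subB_Af L(1) xs_Af[OF id_in_G ns(2)]]) (use L(2) s in \<open>auto simp: Y_def\<close>)
   moreover have "xs si (r * w) \<in> L"
    unfolding l[symmetric] by (rule lideal_subD(4)[OF subB_Af L(1) xs_Af[OF id_in_G r(1)]]) (use L(2) s in \<open>auto simp: Y_def\<close>)
   ultimately have "(\<lambda>rh. xs si (n si * c si) rh + xs si (r * w) rh) \<in> L" by (rule lideal_subD(3)[OF subB_Af L(1)])
   moreover have "(\<lambda>rh. xs si (n si * c si) rh + xs si (r * w) rh) = xs si (n si)"
    unfolding r(2)[symmetric] by (auto simp: xs_def fun_eq_iff algebra_simps)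
   ultimately show ?thesis by simp
  qed
  hence "(\<lambda>rh. \<Sum>si\<in>G. xs si (n si) rh) \<in> L" by (rule lideal_sub_sum[OF subB_Af L(1)])
  thus "n \<in> L" using CS_decomp[OF nC] by simp
 qed
 hence "Nid = \<Inter>{L. lideal (subSig G f Af) L \<and> Y \<subseteq> L}" using lideal_Nid YN by blast
 thus ?thesis unfolding fg_lideal_def using lideal_Nid Yf YN by blast
qed

end

section \<open>A dual basis of the radical and what it says about the cocycle\<close>

context tame_unif
begin

lemma emb_xs: "emb c = xs id c" by (auto simp: emb_def xs_def)

lemma JV_nonzero: "\<exists>c\<in>JV. c \<noteq> 0"
proof (rule ccontr)
 assume "\<not> ?thesis"
 hence J: "JV = {0}" using JV_rules(2) by blast
 obtain M where M: "ismax S M" using ex_max by blast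
 show False using w_M[OF M] trivial_val(3)[OF J M] w_nz by blast
qed

text \<open>The section is evaluated at a nonzero \<open>c\<close> of \<open>JV\<close>, which is
  central and lies in \<open>Nid\<close>. Division by \<open>c\<close> gives elements
  \<open>q z\<close> of the full algebra such that the section is right multiplication by
  them.\<close>

lemma dual_basis:
 assumes "proj_left (subSig G f Af) Nid"
 shows "\<exists>Z q. finite Z \<and> Z \<subseteq> Nid \<and> (\<forall>z. \<forall>y\<in>Nid. mul y (q z) \<in> Af) \<and> (\<lambda>rh. \<Sum>z\<in>Z. mul (q z) z rh) = one"
proof -
 obtain s where s: "\<And>x z. x \<in> Nid ==> s x z \<in> Af" "\<And>x z. x \<in> Nid ==> z \<notin> Nid ==> s x z = (\<lambda>_. 0)"
   "\<And>x. x \<in> Nid ==> finite {z. s x z \<noteq> (\<lambda>_. 0)}"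
   "\<And>r x. r \<in> Af ==> x \<in> Nid ==> s (mul r x) = (\<lambda>z. mul r (s x z))"
   "\<And>x. x \<in> Nid ==> finsum (subSig G f Af) (\<lambda>z. mul (s x z) z) {z. s x z \<noteq> (\<lambda>_. 0)} = x"
  using assms unfolding proj_left_def proj_mod_def sub_simps by blast
 obtain c where c: "c \<in> JV" "c \<noteq> 0" using JV_nonzero by blast
 have cV: "c \<in> V" using c by (simp add: nonunits_def)
 have cF: "c \<in> F" "inverse c \<in> F" using cV V_F F_inverse c(2) by auto
 have cN: "emb c \<in> Nid" unfolding emb_xs by (rule xs_Nid[OF id_in_G]) (use Iid_id JV_JS c in auto)
 have cA: "emb c \<in> Af" using Nid_Af[OF cN] .
 define Z where "Z = {z. s (emb c) z \<noteq> (\<lambda>_. 0)}"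
 define q where "q z = sm (inverse c) (s (emb c) z)" for z
 have Zf: "finite Z" and ZN: "Z \<subseteq> Nid" using s(2,3)[OF cN] by (auto simp: Z_def)
 have "mul y (q z) \<in> Af" if y: "y \<in> Nid" for y z
 proof -
  have yC: "y \<in> CS" using Nid_Af[OF y] Af_iff by blast
  have "mul y (emb c) = mul (emb c) y" unfolding mul_emb_left[OF yC] mul_emb_right[OF yC cF(1)] ..
  hence "mul y (s (emb c) z) = mul (emb c) (s y z)"
   using s(4)[OF Nid_Af[OF y] cN] s(4)[OF cA y] by metis
  moreover have sC: "s y z \<in> CS" using s(1)[OF y] Af_iff by blast
  ultimately have "mul y (q z) = sm (inverse c) (sm c (s y z))"
   unfolding q_def mul_sm_right[OF cF(2)] by (simp add: mul_emb_left)
  also have "\<dots> = s y z" using c(2) by (simp add: sm_def mult.assoc[symmetric])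
  finally show ?thesis using s(1)[OF y] by simp
 qed
 moreover have "(\<lambda>rh. \<Sum>z\<in>Z. mul (q z) z rh) = one"
 proof -
  have "finsum (subSig G f Af) (\<lambda>z. mul (s (emb c) z) z) Z = (\<lambda>rh. \<Sum>z\<in>Z. mul (s (emb c) z) z rh)"
   by (rule finsum_sub[OF subB_Af Zf]) (use subBD(3)[OF subB_Af] s(1)[OF cN] Nid_Af ZN in blast)
  hence e: "(\<lambda>rh. \<Sum>z\<in>Z. mul (s (emb c) z) z rh) = emb c" using s(5)[OF cN] by (simp add: Z_def)
  have "(\<lambda>rh. \<Sum>z\<in>Z. mul (q z) z rh) = sm (inverse c) (\<lambda>rh. \<Sum>z\<in>Z. mul (s (emb c) z) z rh)"
   unfolding q_def mul_sm_left by (simp add: sm_def sum_distrib_left)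
  also have "\<dots> = sm (inverse c) (emb c)" unfolding e ..
  also have "\<dots> = one" unfolding emb_one using c(2) by (simp add: sm_def mult.assoc[symmetric])
  finally show ?thesis .
 qed
 ultimately show ?thesis using Zf ZN by blast
qed

context
 fixes M
 assumes M: "ismax S M"
begin

text \<open>\<open>ep i j\<close> generates at \<open>M\<close> the image under \<open>i\<close> of
  the coefficient ideal \<open>Iid (iv i \<circ> j)\<close>; by \<open>dl_sym\<close>, the product
  in the test is the image of \<open>f\<close> at that element and its inverse.\<close>

definition ep where "ep i j = (if dl i j * dl j i \<in> M then 1 else w)"

lemma ep_nz: "ep i j \<noteq> 0" using w_nz by (simp add: ep_def)

lemma ep_S: "ep i j \<in> S" using w_S S_rules(1) by (simp add: ep_def)

lemma ep_self: "ep i j * (dl i j * dl j i) \<in> M" if "i \<in> G" "j \<in> G"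
 using M_rules(5)[OF M S_rules(6)[OF dl_S dl_S] w_M[OF M]] that by (simp add: ep_def)

lemma div_ep:
 assumes z: "z \<in> S" "z * (dl i j * dl j i) \<in> nloc M" and i: "i \<in> G" and j: "j \<in> G"
 shows "z / ep i j \<in> loc M"
proof (cases "dl i j * dl j i \<in> M")
 case True thus ?thesis using S_loc[OF M z(1)] by (simp add: ep_def)
next
 case False
 hence "z \<in> nloc M" using z unit_cancel(2)[OF M S_rules(6)[OF dl_S[OF i j] dl_S[OF j i]]] by blast
 thus ?thesis using nloc_w[OF M] False by (simp add: ep_def)
qed

lemma notin_nloc_inverse: "x \<notin> nloc M ==> x \<noteq> 0 \<and> inverse x \<in> loc M"
proof -
 assume x: "x \<notin> nloc M"
 show ?thesis
 proof (cases "x \<in> loc M")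
  case True thus ?thesis using unit_inverse[OF loc_val[OF M] True x] by blast
 next
  case False thus ?thesis using notin_val[OF loc_val[OF M] False] nloc_rules(1)[OF M] by blast
 qed
qed

text \<open>The \<open>id\<close>-coefficient of the dual basis relation \<open>1 = \<Sum> q\<^sub>z z\<close> is a unit at every maximal ideal, hence some
  summand is; \<open>Nid q\<^sub>z \<subseteq> A\<^sub>f\<close> bounds its first factor and \<open>z \<in> Nid\<close> the second one.\<close>
lemma dual_basis_local:
 assumes pr: "proj_left (subSig G f Af) Nid" and j: "j \<in> G"
 shows "\<exists>k\<in>G. \<forall>i\<in>G. ep i j * dl i j / (ep k j * dl k j * dl i k) \<in> loc M"
proof -
 obtain Z q where Z: "finite Z" "Z \<subseteq> Nid" and qA: "\<And>y z. y \<in> Nid ==> mul y (q z) \<in> Af"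
  and q1: "(\<lambda>rh. \<Sum>z\<in>Z. mul (q z) z rh) = one"
  using dual_basis[OF pr] by blast
 \<comment> \<open>The identity coefficient is studied at \<open>iv j\<close> applied to
   \<open>M\<close>, because applying \<open>j\<close> afterwards brings everything to
   \<open>M\<close> and to the functions \<open>dl\<close>.\<close>
 define M' where "M' = iv j ` M"
 have M': "ismax S M'" unfolding M'_def by (rule gal_max[OF M inv_in_G[OF j]])
 have jM: "j ` M' = M" unfolding M'_def by (rule gal_image_inv(2)[OF j])
 note ids = is_ideal_sum[OF loc_subring[OF M'] nonunits_ideal[OF loc_val[OF M']]]
 define t where "t z ap = q z ap * ap (z (iv ap)) * f ap (iv ap)" for z ap
 have "\<exists>z\<in>Z. \<exists>ap\<in>G. t z ap \<notin> nloc M'"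
 proof (rule ccontr)
  assume n: "\<not> ?thesis"
  have "mul (q z) z id \<in> nloc M'" if z: "z \<in> Z" for z
  proof -
   have "(\<Sum>ap\<in>G. t z ap) \<in> nloc M'" by (rule ids) (use n z in blast)
   thus ?thesis using id_in_G by (simp add: cp_mult_def t_def)
  qed
  hence "(\<Sum>z\<in>Z. mul (q z) z id) \<in> nloc M'" by (rule ids)
  hence "1 \<in> nloc M'" using fun_cong[OF q1, of id] by (simp add: one_def)
  thus False using one_notin_nonunits[OF loc_val[OF M']] by blast
 qed
 then obtain z ap where z: "z \<in> Z" and a: "ap \<in> G" and tn: "t z ap \<notin> nloc M'" by blast
 define k where "k = j \<circ> ap"
 have k: "k \<in> G" using j a by (simp add: k_def)
 have jk: "iv j \<circ> k = ap" "iv k \<circ> j = iv ap" using j a by (auto simp: k_def comp_assoc)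
 define q' where "q' = j (q z ap)"
 define z' where "z' = k (z (iv ap))"
 have zI: "z (iv ap) \<in> S" "z (iv ap) * f (iv ap) ap \<in> JS" using Nid_D[of z "iv ap"] z Z(2) a by (auto simp: Iid_def)
 have z'S: "z' \<in> S" unfolding z'_def by (rule gal_S[OF k zI(1)])
 have "k (z (iv ap) * f (iv ap) ap) \<in> JS" using zI(2) JS_gal[OF k] by blast
 moreover have "k (f (iv ap) ap) = dl k j * dl j k" using dl_sym[OF k j] jk a by simp
 ultimately have "z' * (dl k j * dl j k) \<in> JS" by (simp add: z'_def gal_simps(4)[OF k])
 hence z'e: "z' / ep k j \<in> loc M" by (intro div_ep z'S k j dJ[OF _ M])
 have "j (t z ap) \<notin> nloc M" using tn nloc_gal[OF M' j] jM by simp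
 moreover have "j (t z ap) = q' * z' * (dl j k * dl k j)"
  using dl_sym[OF j k] jk by (simp add: t_def q'_def z'_def k_def gal_simps(4)[OF j])
 ultimately have "q' * z' * (dl j k * dl k j) \<notin> nloc M" by (simp only: not_False_eq_True)
 hence inv: "q' * z' * (dl j k * dl k j) \<noteq> 0" "inverse (q' * z' * (dl j k * dl k j)) \<in> loc M"
  using notin_nloc_inverse by blast+
 obtain e where e: "e \<in> S" "1 - e \<in> M" "\<And>M'. ismax S M' ==> M' \<noteq> M ==> e \<in> M'"
  using max_idempotent[OF M] by blast
 have eM: "e \<notin> M" using maxD(6)[OF M] e by blast
 have "ep i j * dl i j / (ep k j * dl k j * dl i k) \<in> loc M" if i: "i \<in> G" for i
 proof -
  \<comment> \<open>For each \<open>i\<close> a local generator of the coefficient ideal at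
    \<open>si\<close> is multiplied by \<open>q z\<close>, which bounds \<open>q'\<close> after
    applying \<open>i\<close>. Combined with the bound on \<open>z'\<close> and the inverse of
    \<open>q' * z' * (dl j k * dl k j)\<close>, this eliminates both unknowns.\<close>
  define si where "si = iv i \<circ> j"
  have s: "si \<in> G" "i \<circ> si = j" using i j by (auto simp: si_def)
  define s where "s = iv i (e * ep i j)"
  have i_s: "i s = e * ep i j" unfolding s_def by (rule inv_app(2)[OF i])
  have sS: "s \<in> S" unfolding s_def by (intro gal_S[OF inv_in_G[OF i]] S_rules(6) e(1) ep_S)
  have "i (s * f si (iv si)) = e * (ep i j * (dl i j * dl j i))"
   using dl_sym[OF i j] i_s by (simp add: si_def gal_simps(4)[OF i])
  moreover have "e * (ep i j * (dl i j * dl j i)) \<in> JS"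
  proof -
   have m: "ep i j * (dl i j * dl j i) \<in> S" by (intro S_rules(6) ep_S dl_S i j)
   have "e * (ep i j * (dl i j * dl j i)) \<in> M'" if M': "ismax S M'" for M'
    using M_rules(4)[OF M' e(1)] M_rules(5)[OF M' m] ep_self[OF i j] e(3)[OF M'] by (cases "M' = M") auto
   thus ?thesis using S_rules(6)[OF e(1) m] by (simp add: JS_def)
  qed
  ultimately have "s * f si (iv si) \<in> JS" using JS_gal[OF i] by metis
  hence "s \<in> Iid si" using sS by (simp add: Iid_def)
  hence "mul (xs si s) (q z) (si \<circ> ap) \<in> S" using qA[OF xs_Nid[OF s(1)]] Af_S by blast
  hence "s * si (q z ap) * f si ap \<in> S" using mul_xs_left[OF s(1), of "si \<circ> ap" s "q z"] s(1) a by simp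
  hence "i (s * si (q z ap) * f si ap) \<in> loc M" using gal_S[OF i] S_loc[OF M] by blast
  moreover have "i (si (q z ap)) = q'" using s(2) by (auto simp: q'_def fun_eq_iff)
  moreover have "i (f si ap) = dl i j * dl j k / dl i k"
   using dl_mult[OF i j k] dl_nz[OF i k] jk by (simp add: si_def field_simps)
  ultimately have "(ep i j * q' * (dl i j * dl j k / dl i k)) * e \<in> loc M"
   using i_s by (simp add: gal_simps(4)[OF i] mult_ac)
  hence "ep i j * q' * (dl i j * dl j k / dl i k) \<in> loc M" using unit_cancel(1)[OF M e(1) eM] by blast
  hence "ep i j * q' * (dl i j * dl j k / dl i k) * (z' / ep k j) * inverse (q' * z' * (dl j k * dl k j)) \<in> loc M"
   using z'e inv(2) loc_rules(6)[OF M] by blast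
  moreover have "ep i j * q' * (dl i j * dl j k / dl i k) * (z' / ep k j) * inverse (q' * z' * (dl j k * dl k j))
    = ep i j * dl i j / (ep k j * dl k j * dl i k)"
   using inv(1) dl_nz[OF i k] ep_nz by (simp add: field_simps)
  ultimately show ?thesis by simp
 qed
 thus ?thesis using k by blast
qed

lemma dl_div: "i \<in> G ==> j \<in> G ==> k \<in> G ==> dl i j * dl j k / dl i k \<in> loc M"
 using dl_mult[of i j k] dl_nz[of i k] S_loc[OF M gal_S[OF _ f_S]] by simp

text \<open>Call \<open>i\<close> and \<open>k\<close> near if \<open>dl i k * dl k i\<close>
  divides \<open>w\<close> at \<open>M\<close>. Multiplying nearness of \<open>i\<close> and
  \<open>j\<close> by \<open>ch\<close> and by a transitivity quotient from \<open>dl_div\<close>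
  cancels every occurrence of \<open>j\<close>.\<close>

lemma near_step:
 assumes i: "i \<in> G" and j: "j \<in> G" and k: "k \<in> G"
  and ch: "ep i j * dl i j / (ep k j * dl k j * dl i k) \<in> loc M"
  and g: "w / (dl i j * dl j i) \<in> loc M"
 shows "w / (dl i k * dl k i) \<in> loc M"
proof -
 note O = loc_rules[OF M]
 have "w / (ep i j * (dl i j * dl j i)) \<in> loc M"
 proof (cases "dl i j * dl j i \<in> M")
  case True thus ?thesis using g by (simp add: ep_def)
 next
  case False
  have "inverse (dl i j * dl j i) \<in> loc M" using loc_unit[OF M S_rules(6)[OF dl_S[OF i j] dl_S[OF j i]] False] by blast
  moreover have "w / (w * (dl i j * dl j i)) = inverse (dl i j * dl j i)"
   using w_nz by (simp add: divide_inverse mult.assoc[symmetric])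
  ultimately show ?thesis using False by (simp only: ep_def if_False)
 qed
 hence "w / (ep i j * (dl i j * dl j i)) * (ep i j * dl i j / (ep k j * dl k j * dl i k)) * (dl k j * dl j i / dl k i) * ep k j \<in> loc M"
  using ch dl_div[OF k j i] S_loc[OF M ep_S] O(6) by blast
 moreover have "w / (ep i j * (dl i j * dl j i)) * (ep i j * dl i j / (ep k j * dl k j * dl i k)) * (dl k j * dl j i / dl k i) * ep k j
   = w / (dl i k * dl k i)"
  using dl_nz[OF i j] dl_nz[OF j i] dl_nz[OF k j] dl_nz[OF i k] dl_nz[OF k i] ep_nz by (simp add: field_simps)
 ultimately show ?thesis by simp
qed

text \<open>\<open>\<phi> j\<close> is the index found by \<open>dual_basis_local\<close>. Its
  iterates from \<open>i\<close> stay near \<open>i\<close> and end in a cycle of the finite group.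
  Going around the cycle with an arbitrary \<open>x\<close> shows that \<open>x\<close> is
  equivalent to one of its members, hence near \<open>i\<close> as well.\<close>

lemma near_all:
 assumes pr: "proj_left (subSig G f Af) Nid" and i: "i \<in> G" and x: "x \<in> G"
 shows "w / (dl i x * dl x i) \<in> loc M"
proof -
 note O = loc_rules[OF M]
 obtain \<phi> where phi: "\<And>j. j \<in> G ==> \<phi> j \<in> G"
  "\<And>i j. j \<in> G ==> i \<in> G ==> ep i j * dl i j / (ep (\<phi> j) j * dl (\<phi> j) j * dl i (\<phi> j)) \<in> loc M"
  using dual_basis_local[OF pr] by metis
 define y where "y n = (\<phi> ^^ n) i" for n
 have yS: "y (Suc n) = \<phi> (y n)" for n by (simp add: y_def)
 have yG: "y n \<in> G" for n by (induct n) (use i phi(1) in \<open>auto simp: yS\<close>, simp add: y_def i)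
 have near: "w / (dl i (y n) * dl (y n) i) \<in> loc M" for n
 proof (induct n)
  case 0 show ?case using S_loc[OF M w_S] dl_refl[OF i] by (simp add: y_def)
 next
  case (Suc n) show ?case unfolding yS by (rule near_step[OF i yG phi(1)[OF yG] phi(2)[OF yG i] Suc])
 qed
 have "\<not> inj y" using finite_subset[of "range y" G] yG finite_G range_inj_infinite by blast
 then obtain a0 b0 where "y a0 = y b0" "a0 \<noteq> b0" by (auto simp: inj_def)
 then obtain a b where ab: "a < b" "y a = y b" by (cases "a0 < b0") (auto simp: not_less, metis nat_less_le)
 define m where "m = b - a"
 have m: "m > 0" "y (a + m) = y a" using ab by (auto simp: m_def)
 define c where "c n = ep (y (Suc n)) (y n) * dl (y (Suc n)) (y n)" for n
 have cS: "c n \<in> S" for n unfolding c_def by (intro S_rules(6) ep_S dl_S yG)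
 have c0: "c n \<noteq> 0" for n unfolding c_def using ep_nz dl_nz[OF yG yG] by simp
 \<comment> \<open>Once around the cycle the two outer factors \<open>dl x\<close> cancel, and the
   product of the \<open>c\<close> is seen to divide the product of the \<open>ep x\<close>.\<close>
 have tel: "(\<Prod>r<n. ep x (y (a + r))) * dl x (y a) / ((\<Prod>r<n. c (a + r)) * dl x (y (a + n))) \<in> loc M" for n
 proof (induct n)
  case 0 show ?case using dl_nz[OF x yG] O(1) by simp
 next
  case (Suc n)
  let ?P = "\<Prod>r<n. ep x (y (a + r))" and ?C = "\<Prod>r<n. c (a + r)"
  have "ep x (y (a + n)) * dl x (y (a + n)) / (c (a + n) * dl x (y (a + Suc n))) \<in> loc M"
   using phi(2)[OF yG x, of "a + n"] by (simp add: c_def yS)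
  hence "(?P * dl x (y a) / (?C * dl x (y (a + n)))) * (ep x (y (a + n)) * dl x (y (a + n)) / (c (a + n) * dl x (y (a + Suc n)))) \<in> loc M"
   using Suc O(6) by blast
  moreover have "(?P * dl x (y a) / (?C * dl x (y (a + n)))) * (ep x (y (a + n)) * dl x (y (a + n)) / (c (a + n) * dl x (y (a + Suc n))))
    = (\<Prod>r<Suc n. ep x (y (a + r))) * dl x (y a) / ((\<Prod>r<Suc n. c (a + r)) * dl x (y (a + Suc n)))"
   using dl_nz[OF x yG, of "a + n"] by (simp add: mult_ac)
  ultimately show ?case by metis
 qed
 have q: "(\<Prod>r<m. ep x (y (a + r))) / (\<Prod>r<m. c (a + r)) \<in> loc M"
  using tel[of m] dl_nz[OF x yG, of a] m(2) by simp
 \<comment> \<open>If no \<open>c\<close> were in \<open>M\<close>, every step of the cycle would go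
   strictly down in the preorder.\<close>
 have "\<exists>r<m. c (a + r) \<in> M"
 proof (rule ccontr)
  assume n: "\<not> ?thesis"
  have step: "dl (y (Suc (a + r))) (y (a + r)) \<notin> M" "dl (y (Suc (a + r))) (y (a + r)) * dl (y (a + r)) (y (Suc (a + r))) \<in> M"
   if "r < m" for r
  proof -
   have cn: "c (a + r) \<notin> M" using n that by blast
   thus "dl (y (Suc (a + r))) (y (a + r)) \<notin> M" using M_rules(4)[OF M ep_S] unfolding c_def by blast
   show "dl (y (Suc (a + r))) (y (a + r)) * dl (y (a + r)) (y (Suc (a + r))) \<in> M"
   proof (rule ccontr)
    assume "dl (y (Suc (a + r))) (y (a + r)) * dl (y (a + r)) (y (Suc (a + r))) \<notin> M"
    hence "c (a + r) = w * dl (y (Suc (a + r))) (y (a + r))" by (simp add: c_def ep_def)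
    thus False using cn M_rules(5)[OF M dl_S[OF yG yG] w_M[OF M]] by simp
   qed
  qed
  have "n \<le> m ==> n > 0 ==> dl (y (a + n)) (y (Suc a)) \<notin> M" for n
  proof (induct n)
   case (Suc n)
   show ?case
   proof (cases "n = 0")
    case True thus ?thesis using dl_refl[OF yG] maxD(2)[OF M] by simp
   next
    case False
    have "dl (y (a + n)) (y (Suc a)) \<notin> M" using Suc False by simp
    moreover have "dl (y (Suc (a + n))) (y (a + n)) \<notin> M" using step(1)[of n] Suc by simp
    ultimately show ?thesis using dl_trans[OF M yG yG yG] by simp
   qed
  qed simp
  from this[of m] have "dl (y a) (y (Suc a)) \<notin> M" using m by simp
  moreover have "dl (y (Suc a)) (y a) \<notin> M" "dl (y (Suc a)) (y a) * dl (y a) (y (Suc a)) \<in> M" using step[of 0] m by auto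
  ultimately show False using maxD(5)[OF M dl_S[OF yG yG] dl_S[OF yG yG]] by blast
 qed
 then obtain r0 where r0: "r0 < m" "c (a + r0) \<in> M" by blast
 \<comment> \<open>The product of the \<open>c\<close> is a non-unit, so not all \<open>ep x\<close>
   on the cycle are 1; the value \<open>w\<close> means that \<open>x\<close> is equivalent at
   \<open>M\<close> to that member.\<close>
 have "\<exists>r<m. ep x (y (a + r)) = w"
 proof (rule ccontr)
  assume "\<not> ?thesis"
  hence "ep x (y (a + r)) = 1" if "r < m" for r using that by (auto simp: ep_def split: if_splits)
  hence "inverse (\<Prod>r<m. c (a + r)) \<in> loc M" using q by (simp add: divide_inverse)
  moreover have "(\<Prod>r<m. c (a + r)) \<in> nloc M"
  proof -
   have "(\<Prod>r<m. c (a + r)) = c (a + r0) * (\<Prod>r\<in>{..<m} - {r0}. c (a + r))"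
    by (rule prod.remove) (use r0 in auto)
   moreover have "(\<Prod>r\<in>{..<m} - {r0}. c (a + r)) \<in> S" by (rule is_subring_prod[OF S_subring]) (rule cS)
   ultimately have "(\<Prod>r<m. c (a + r)) \<in> M" using M_rules(5)[OF M _ r0(2)] by simp
   thus ?thesis using nloc_iff[OF M] maxD(4)[OF M] by blast
  qed
  ultimately show False using c0 by (auto simp: nonunits_def)
 qed
 then obtain r where r: "r < m" "ep x (y (a + r)) = w" by blast
 define u where "u = y (a + r)"
 have uG: "u \<in> G" and nu: "w / (dl i u * dl u i) \<in> loc M" using yG near by (auto simp: u_def)
 have "dl x u * dl u x \<notin> M"
 proof
  assume "dl x u * dl u x \<in> M"
  hence "w = 1" using r(2) by (simp add: ep_def u_def)
  thus False using w_M[OF M] maxD(2)[OF M] by simp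
 qed
 hence i1: "inverse (dl x u * dl u x) \<in> loc M" using loc_unit[OF M S_rules(6)[OF dl_S[OF x uG] dl_S[OF uG x]]] by blast
 have "w / (dl i u * dl u i) * inverse (dl x u * dl u x) * (dl i u * dl u x / dl i x) * (dl x u * dl u i / dl x i) \<in> loc M"
  using nu i1 dl_div[OF i uG x] dl_div[OF x uG i] O(6) by blast
 moreover have "w / (dl i u * dl u i) * inverse (dl x u * dl u x) * (dl i u * dl u x / dl i x) * (dl x u * dl u i / dl x i) = w / (dl i x * dl x i)"
  using dl_nz[OF i uG] dl_nz[OF uG i] dl_nz[OF x uG] dl_nz[OF uG x] dl_nz[OF i x] dl_nz[OF x i] by (simp add: field_simps)
 ultimately show ?thesis by (simp only:)
qed

end

text \<open>Nearness of the identity and \<open>si\<close> says that \<open>f si (iv si)\<close>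
  divides \<open>w\<close> at \<open>M\<close>, whereas elements of \<open>sq M\<close> are
  multiples of the square of \<open>w\<close> there.\<close>

lemma proj_cond4:
 assumes pr: "proj_left (subSig G f Af) Nid"
 shows cond4
 unfolding cond4_def
proof (intro allI impI ballI notI)
 fix M si assume M: "ismax S M" and s: "si \<in> G" and q: "f si (iv si) \<in> sq M"
 have u: "f si (iv si) \<in> S" "f si (iv si) \<noteq> 0" using f_S f_nz s by auto
 have "w / f si (iv si) \<in> loc M"
  using near_all[OF M pr id_in_G s] s by (simp add: dl_id_left dl_id_right)
 moreover have "f si (iv si) / w\<^sup>2 \<in> loc M" using q sq_w[OF M u(1)] by blast
 ultimately have "(w / f si (iv si)) * (f si (iv si) / w\<^sup>2) \<in> loc M" using loc_rules(6)[OF M] by blast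
 moreover have "(w / f si (iv si)) * (f si (iv si) / w\<^sup>2) = inverse w" using u(2) w_nz by (simp add: power2_eq_square field_simps)
 ultimately show False using w_nloc[OF M] w_nz by (simp add: nonunits_def)
qed

end

context tame_crossed
begin

theorem proj_Nid_cond4:
 assumes "proj_left (subSig G f Af) Nid"
 shows cond4
proof (rule uniformizer_cases)
 fix w assume "tame_unif F V S f w"
 then interpret tame_unif F V S f w .
 show cond4 by (rule proj_cond4[OF assms])
qed (rule trivial_conditions)

end

section \<open>Finitely generated left ideals\<close>

context crossed
begin

lemma mul_xs_sm:
 assumes s: "si \<in> G"
 shows "mul (xs si s) (sm k y) = sm (si k) (mul (xs si s) y)"
proof
 fix rh show "mul (xs si s) (sm k y) rh = sm (si k) (mul (xs si s) y) rh"
 proof (cases "rh \<in> G")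
  case True
  show ?thesis unfolding sm_def[of "si k"] mul_xs_left[OF s True] by (simp add: sm_def gal_simps(4)[OF s])
 next
  case False thus ?thesis by (simp add: sm_def cp_mult_def)
 qed
qed

lemma xs_sm: "xs si (a * b) = sm a (xs si b)" by (auto simp: xs_def sm_def)

lemma sm_sm: "sm a (sm b x) = sm (a * b) x" by (simp add: sm_def mult.assoc)

lemma xs_one: "xs id 1 = one" by (auto simp: xs_def one_def)

text \<open>The inverse of \<open>x_sigma\<close> in the full algebra, as \<open>xi_left\<close> and
  \<open>xi_right\<close> confirm.\<close>

definition xi where "xi si = xs (iv si) (inverse (f (iv si) si))"

lemma xi_CS: "si \<in> G ==> xi si \<in> CS" unfolding xi_def by (rule xs_CS) simp

lemma xi_left: "si \<in> G ==> mul (xi si) (xs si 1) = one"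
 unfolding xi_def using mul_xs_xs[of "iv si" si "inverse (f (iv si) si)" 1] f_nz[of "iv si" si]
 by (simp add: gal_simps(2) xs_one)

lemma xi_right: "si \<in> G ==> mul (xs si 1) (xi si) = one"
 unfolding xi_def using mul_xs_xs[of si "iv si" 1 "inverse (f (iv si) si)"] f_nz[of si "iv si"]
 by (simp add: gal_simps(8) xs_one f_inv)

lemma xi_sm: "si \<in> G ==> mul (xi si) (sm k y) = sm (iv si k) (mul (xi si) y)"
 unfolding xi_def by (rule mul_xs_sm) simp

lemma xi_xs:
 assumes s: "si \<in> G" and y: "y \<in> CS"
 shows "mul (xi si) (mul (xs si (si t)) y) = sm t y"
proof -
 have "mul (xi si) (xs si (si t)) = sm t one"
  using xs_sm[of si "si t" 1] xi_sm[OF s, of "si t" "xs si 1"] xi_left[OF s] inv_app(1)[OF s] by simp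
 thus ?thesis by (simp add: mul_assoc[symmetric] mul_sm_left mul_one_left[OF y])
qed

text \<open>\<open>kp tu si\<close> is the scalar with \<open>x_(si tu^-1) x_tu = x_si kp\<close>.
  Since a left ideal is stable under the first factor, it measures how far the lattice belonging to
  \<open>tu\<close> must be shrunk to fit into the one of \<open>si\<close>.\<close>

definition kp where "kp tu si = iv si (f (si \<circ> iv tu) tu)"

lemma kp_S: "tu \<in> G ==> si \<in> G ==> kp tu si \<in> S"
 unfolding kp_def using gal_S[OF inv_in_G[of si] f_S[of "si \<circ> iv tu" tu]] by simp

lemma kp_nz: "tu \<in> G ==> si \<in> G ==> kp tu si \<noteq> 0"
 unfolding kp_def using gal_simps(7)[of "iv si"] f_nz[of "si \<circ> iv tu" tu] by simp

lemma kp_refl: "si \<in> G ==> kp si si = 1"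
 unfolding kp_def using gal_simps(2)[of "iv si"] by simp

lemma kp_app: "si \<in> G ==> si (kp tu si) = f (si \<circ> iv tu) tu"
 unfolding kp_def by (rule inv_app(2))

lemma kp_mult:
 assumes s: "si \<in> G" and t: "tu \<in> G" and u: "\<upsilon> \<in> G"
 shows "kp si tu * kp tu \<upsilon> = iv \<upsilon> (f (\<upsilon> \<circ> iv tu) (tu \<circ> iv si)) * kp si \<upsilon>"
proof -
 let ?a = "\<upsilon> \<circ> iv tu" and ?b = "tu \<circ> iv si"
 have "?a (f ?b si) * f ?a tu = f ?a ?b * f (\<upsilon> \<circ> iv si) si"
  using coc[of ?a ?b si] s t u by (simp add: comp_assoc)
 hence "iv \<upsilon> (?a (f ?b si)) * iv \<upsilon> (f ?a tu) = iv \<upsilon> (f ?a ?b) * iv \<upsilon> (f (\<upsilon> \<circ> iv si) si)"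
  using gal_simps(4)[OF inv_in_G[OF u]] by metis
 moreover have "iv \<upsilon> (?a x) = iv tu x" for x using inv_app(1)[OF u] by simp
 ultimately show ?thesis unfolding kp_def by simp
qed

lemma mul_xs_xi:
 assumes s: "si \<in> G" and t: "tu \<in> G"
 shows "mul (xs si 1) (sm a (xi tu)) = xs (si \<circ> iv tu) (si (a / kp tu si))"
proof -
 have nz: "f (si \<circ> iv tu) tu \<noteq> 0" "si (f (iv tu) tu) \<noteq> 0"
  using f_nz[of "si \<circ> iv tu" tu] f_nz[of "iv tu" tu] gal_simps(7)[OF s] s t by auto
 have "si (f (iv tu) tu) = f si (iv tu) * f (si \<circ> iv tu) tu" using coc[of si "iv tu" tu] s t by simp
 hence e: "inverse (si (f (iv tu) tu)) * f si (iv tu) = inverse (f (si \<circ> iv tu) tu)" using nz by (simp add: field_simps)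
 have "mul (xs si 1) (sm a (xi tu)) = sm (si a) (xs (si \<circ> iv tu) (inverse (si (f (iv tu) tu)) * f si (iv tu)))"
  unfolding mul_xs_sm[OF s] xi_def mul_xs_xs[OF s inv_in_G[OF t]] by (simp add: gal_simps(8)[OF s])
 also have "\<dots> = xs (si \<circ> iv tu) (si a * inverse (f (si \<circ> iv tu) tu))" unfolding e xs_sm ..
 also have "si a * inverse (f (si \<circ> iv tu) tu) = si (a / kp tu si)"
  unfolding gal_simps(9)[OF s] kp_app[OF s] by (simp add: divide_inverse)
 finally show ?thesis .
qed

lemma kp_sym_notin_sq:
 assumes c: cond4 and M: "ismax S M" and s: "si \<in> G" and t: "tu \<in> G"
 shows "kp si tu * kp tu si \<notin> sq M"
proof
 let ?a = "si \<circ> iv tu"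
 have "kp si tu * kp tu si = iv si (f ?a (iv ?a))"
  using kp_mult[OF s t s] kp_refl[OF s] s t by simp
 moreover assume "kp si tu * kp tu si \<in> sq M"
 ultimately have "iv si (f ?a (iv ?a)) \<in> sq M" by simp
 thus False using sq_gal_inv[OF M inv_in_G[OF s]] c s t unfolding cond4_def by (meson comp_in_G inv_in_G)
qed

definition Klin :: "((('k \<Rightarrow> 'k) \<Rightarrow> 'k) \<Rightarrow> 'k) \<Rightarrow> bool" where
 "Klin \<mu> \<longleftrightarrow> (\<forall>x y. \<mu> (\<lambda>rh. x rh + y rh) = \<mu> x + \<mu> y) \<and> (\<forall>k x. \<mu> (sm k x) = k * \<mu> x)"

lemma KlinD:
 assumes "Klin \<mu>"
 shows "\<mu> (\<lambda>rh. x rh + y rh) = \<mu> x + \<mu> y" "\<mu> (sm k x) = k * \<mu> x"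
 using assms by (auto simp: Klin_def)

lemma Klin_sum:
 assumes "Klin \<mu>"
 shows "\<mu> (\<lambda>rh. \<Sum>i\<in>A. c i * g i rh) = (\<Sum>i\<in>A. c i * \<mu> (g i))"
proof -
 have z: "\<mu> (\<lambda>_. 0) = 0" using KlinD(2)[OF assms, of 0 "\<lambda>_. 0"] by (simp add: sm_def)
 show ?thesis
 proof (induct A rule: infinite_finite_induct)
  case (insert x A)
  have "\<mu> (\<lambda>rh. \<Sum>i\<in>insert x A. c i * g i rh) = \<mu> (\<lambda>rh. sm (c x) (g x) rh + (\<Sum>i\<in>A. c i * g i rh))"
   using insert by (simp add: sm_def)
  thus ?case using insert by (simp add: KlinD[OF assms])
 qed (auto simp: z)
qed

definition avg where
 "avg \<Lambda> y = (\<lambda>\<zeta>. \<Sum>si\<in>G. mul (xs si 1) (\<Lambda> (mul (xi si) y)) \<zeta>)"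

text \<open>Summing \<open>x\<^sub>\<sigma> \<Lambda> x\<^sub>\<sigma>\<inverse>\<close> over the group turns a \<open>K\<close>-linear map into a \<open>\<Sigma>\<^sub>f\<close>-linear one.\<close>
lemma avg_linear:
 assumes add: "\<And>x y. \<Lambda> (\<lambda>rh. x rh + y rh) = (\<lambda>rh. \<Lambda> x rh + \<Lambda> y rh)" and hom: "\<And>k x. \<Lambda> (sm k x) = sm k (\<Lambda> x)"
 shows avg_add: "avg \<Lambda> (\<lambda>rh. x rh + y rh) = (\<lambda>rh. avg \<Lambda> x rh + avg \<Lambda> y rh)"
  and avg_mul: "a \<in> CS ==> avg \<Lambda> (mul a y) = mul a (avg \<Lambda> y)"
proof -
 show avg_add: "avg \<Lambda> (\<lambda>rh. x rh + y rh) = (\<lambda>rh. avg \<Lambda> x rh + avg \<Lambda> y rh)" for x y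
  unfolding avg_def mul_add_right add sum.distrib ..
 have avg0: "avg \<Lambda> (\<lambda>_. 0) = (\<lambda>_. 0)"
 proof -
  have "\<Lambda> (\<lambda>_. 0) = (\<lambda>_. 0)" using hom[of 0 "\<lambda>_. 0"] by (simp add: sm_def)
  thus ?thesis by (simp add: avg_def mul_zero)
 qed
 have avg_sum: "avg \<Lambda> (\<lambda>rh. \<Sum>i\<in>A. g i rh) = (\<lambda>rh. \<Sum>i\<in>A. avg \<Lambda> (g i) rh)" for A :: "('k \<Rightarrow> 'k) set" and g
  by (induct A rule: infinite_finite_induct) (auto simp: avg_add avg0)
 have x: "avg \<Lambda> (mul (xs rh s) y) = mul (xs rh s) (avg \<Lambda> y)" if r: "rh \<in> G" for rh s
 proof -
  have key: "mul (xs (rh \<circ> si) 1) (\<Lambda> (mul (xi (rh \<circ> si)) (mul (xs rh s) y))) = mul (xs rh s) (mul (xs si 1) (\<Lambda> (mul (xi si) y)))"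
   if s: "si \<in> G" for si
  proof -
   let ?r = "rh \<circ> si"
   have rG: "?r \<in> G" using r s by simp
   define c where "c = iv ?r (s * f rh si)"
   have c: "?r c = s * f rh si" unfolding c_def by (rule inv_app(2)[OF rG])
   have p: "mul (xs rh s) (xs si 1) = xs ?r (?r c)" unfolding c using mul_xs_xs[OF r s, of s 1] by (simp add: gal_simps(2)[OF r])
   have "mul (xi ?r) (xs rh s) = mul (mul (xi ?r) (xs rh s)) (mul (xs si 1) (xi si))"
    unfolding xi_right[OF s] by (rule mul_one_right[OF mul_CS, symmetric])
   also have "\<dots> = mul (xi ?r) (mul (xs ?r (?r c)) (xi si))" unfolding p[symmetric] by (simp only: mul_assoc)
   also have "\<dots> = sm c (xi si)" by (rule xi_xs[OF rG xi_CS[OF s]])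
   finally have "mul (xi ?r) (mul (xs rh s) y) = sm c (mul (xi si) y)"
    unfolding mul_assoc[symmetric] by (simp add: mul_sm_left)
   hence "mul (xs ?r 1) (\<Lambda> (mul (xi ?r) (mul (xs rh s) y))) = sm (?r c) (mul (xs ?r 1) (\<Lambda> (mul (xi si) y)))"
    by (simp only: hom mul_xs_sm[OF rG])
   also have "\<dots> = mul (xs ?r (?r c)) (\<Lambda> (mul (xi si) y))" using xs_sm[of ?r "?r c" 1] by (simp add: mul_sm_left)
   also have "\<dots> = mul (xs rh s) (mul (xs si 1) (\<Lambda> (mul (xi si) y)))" unfolding p[symmetric] mul_assoc ..
   finally show ?thesis .
  qed
  have "avg \<Lambda> (mul (xs rh s) y) = (\<lambda>\<zeta>. \<Sum>si\<in>G. mul (xs (rh \<circ> si) 1) (\<Lambda> (mul (xi (rh \<circ> si)) (mul (xs rh s) y))) \<zeta>)"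
   unfolding avg_def
  proof
   fix \<zeta>
   show "(\<Sum>si\<in>G. mul (xs si 1) (\<Lambda> (mul (xi si) (mul (xs rh s) y))) \<zeta>) = (\<Sum>si\<in>G. mul (xs (rh \<circ> si) 1) (\<Lambda> (mul (xi (rh \<circ> si)) (mul (xs rh s) y))) \<zeta>)"
    using sum.reindex_bij_betw[OF bij_left[OF r], of "\<lambda>si. mul (xs si 1) (\<Lambda> (mul (xi si) (mul (xs rh s) y))) \<zeta>"] by simp
  qed
  also have "\<dots> = (\<lambda>\<zeta>. \<Sum>si\<in>G. mul (xs rh s) (mul (xs si 1) (\<Lambda> (mul (xi si) y))) \<zeta>)"
   by (rule ext, rule sum.cong[OF refl]) (simp only: key)
  also have "\<dots> = mul (xs rh s) (avg \<Lambda> y)" unfolding avg_def mul_sum_right ..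
  finally show ?thesis .
 qed
 show "avg \<Lambda> (mul a y) = mul a (avg \<Lambda> y)" if a: "a \<in> CS"
 proof -
  have "avg \<Lambda> (mul (\<lambda>rh. \<Sum>si\<in>G. xs si (a si) rh) y) = (\<lambda>rh. \<Sum>si\<in>G. avg \<Lambda> (mul (xs si (a si)) y) rh)"
   unfolding mul_sum_left avg_sum ..
  also have "\<dots> = (\<lambda>rh. \<Sum>si\<in>G. mul (xs si (a si)) (avg \<Lambda> y) rh)"
   by (rule ext, rule sum.cong[OF refl]) (simp only: x)
  also have "\<dots> = mul (\<lambda>rh. \<Sum>si\<in>G. xs si (a si) rh) (avg \<Lambda> y)" unfolding mul_sum_left ..
  finally show ?thesis using CS_decomp[OF a] by simp
 qed
qed

text \<open>\<open>Af\<close> is spanned over \<open>S\<close> by the \<open>x_rh\<close>, so the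
  products of the \<open>x_rh\<close> with ideal generators generate the ideal as a left
  \<open>S\<close>-module.\<close>

lemma fg_module_generators:
 assumes "fg_lideal (subSig G f Af) L"
 shows "\<exists>Z. finite Z \<and> Z \<subseteq> L \<and> (\<forall>y\<in>L. \<exists>c. (\<forall>z\<in>Z. c z \<in> S) \<and> y = (\<lambda>rh. \<Sum>z\<in>Z. c z * z rh))"
proof -
 obtain Y where Y: "finite Y" "Y \<subseteq> L" "L = \<Inter>{I. lideal (subSig G f Af) I \<and> Y \<subseteq> I}" and L: "lideal (subSig G f Af) L"
  using assms unfolding fg_lideal_def by blast
 note Ld = lideal_subD[OF subB_Af L]
 define Z where "Z = (\<lambda>(rh, y). mul (xs rh 1) y) ` (G \<times> Y)"
 have Zf: "finite Z" using Y(1) by (simp add: Z_def)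
 have ZL: "Z \<subseteq> L" unfolding Z_def using Ld(4)[OF xs_Af[OF _ S_rules(1)]] Y(2) by auto
 define W where "W = {y. \<exists>c. (\<forall>z\<in>Z. c z \<in> S) \<and> y = (\<lambda>rh. \<Sum>z\<in>Z. c z * z rh)}"
 have W0: "(\<lambda>_. 0) \<in> W" unfolding W_def using S_rules(2) by (intro CollectI exI[of _ "\<lambda>_. 0"]) simp
 have Wadd: "(\<lambda>rh. x rh + y rh) \<in> W" if x: "x \<in> W" and y: "y \<in> W" for x y
 proof -
  obtain c where c: "\<forall>z\<in>Z. c z \<in> S" "x = (\<lambda>rh. \<Sum>z\<in>Z. c z * z rh)" using x unfolding W_def by blast
  obtain d where d: "\<forall>z\<in>Z. d z \<in> S" "y = (\<lambda>rh. \<Sum>z\<in>Z. d z * z rh)" using y unfolding W_def by blast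
  show ?thesis unfolding W_def using c d S_rules(5)
   by (intro CollectI exI[of _ "\<lambda>z. c z + d z"]) (simp add: distrib_right sum.distrib)
 qed
 have Wsm: "sm s x \<in> W" if x: "x \<in> W" and s: "s \<in> S" for x s
 proof -
  obtain c where c: "\<forall>z\<in>Z. c z \<in> S" "x = (\<lambda>rh. \<Sum>z\<in>Z. c z * z rh)" using x unfolding W_def by blast
  show ?thesis unfolding W_def using c S_rules(6)[OF s]
   by (intro CollectI exI[of _ "\<lambda>z. s * c z"]) (simp add: sm_def sum_distrib_left mult.assoc)
 qed
 have Wsum: "(\<And>i. i \<in> A ==> g i \<in> W) ==> (\<lambda>rh. \<Sum>i\<in>A. g i rh) \<in> W" for g and A :: "'b set"
  by (induct A rule: infinite_finite_induct) (auto simp: W0 intro: Wadd)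
 have WZ: "z \<in> W" if z: "z \<in> Z" for z
 proof -
  have "(\<lambda>rh. \<Sum>z'\<in>Z. (if z' = z then 1 else 0) * z' rh) = z"
   using z Zf by (simp add: if_distrib[of "\<lambda>a. a * _"] cong: if_cong)
  thus ?thesis unfolding W_def using S_rules(1,2) by (intro CollectI exI[of _ "\<lambda>z'. if z' = z then 1 else 0"]) auto
 qed
 have Wmul: "mul (xs rh s) x \<in> W" if x: "x \<in> W" and r: "rh \<in> G" and s: "s \<in> S" for rh s x
 proof -
  obtain c where c: "\<forall>z\<in>Z. c z \<in> S" "x = (\<lambda>rh. \<Sum>z\<in>Z. c z * z rh)" using x unfolding W_def by blast
  have "mul (xs rh s) z \<in> W" if z: "z \<in> Z" for z
  proof -
   obtain rh' y where y: "rh' \<in> G" "y \<in> Y" "z = mul (xs rh' 1) y" using z unfolding Z_def by auto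
   have "mul (xs rh s) z = sm (s * f rh rh') (mul (xs (rh \<circ> rh') 1) y)"
    unfolding y mul_assoc[symmetric] mul_xs_xs[OF r y(1)]
    using xs_sm[of "rh \<circ> rh'" "s * f rh rh'" 1] by (simp add: gal_simps(2)[OF r] mul_sm_left)
   moreover have "mul (xs (rh \<circ> rh') 1) y \<in> Z"
    unfolding Z_def using y r by (intro image_eqI[of _ _ "(rh \<circ> rh', y)"]) auto
   ultimately show ?thesis using Wsm[OF WZ S_rules(6)[OF s f_S[OF r y(1)]]] by simp
  qed
  hence "(\<lambda>\<zeta>. \<Sum>z\<in>Z. sm (rh (c z)) (mul (xs rh s) z) \<zeta>) \<in> W"
   by (intro Wsum Wsm gal_S[OF r]) (use c(1) in auto)
  moreover have "mul (xs rh s) x = (\<lambda>\<zeta>. \<Sum>z\<in>Z. sm (rh (c z)) (mul (xs rh s) z) \<zeta>)"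
  proof -
   have xe: "x = (\<lambda>\<zeta>. \<Sum>z\<in>Z. sm (c z) z \<zeta>)" unfolding c(2) by (simp add: sm_def)
   have "mul (xs rh s) x = (\<lambda>\<zeta>. \<Sum>z\<in>Z. mul (xs rh s) (sm (c z) z) \<zeta>)" unfolding xe by (rule mul_sum_right)
   thus ?thesis by (simp only: mul_xs_sm[OF r])
  qed
  ultimately show ?thesis by simp
 qed
 have "lideal (subSig G f Af) W" unfolding lideal_sub_iff[OF subB_Af]
 proof (intro conjI ballI)
  show "W \<subseteq> Af"
  proof
   fix x assume "x \<in> W"
   then obtain c where c: "\<forall>z\<in>Z. c z \<in> S" "x = (\<lambda>rh. \<Sum>z\<in>Z. c z * z rh)" unfolding W_def by blast
   show "x \<in> Af" unfolding c(2)
   proof (rule subB_sum[OF subB_Af])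
    fix z assume z: "z \<in> Z"
    have zA: "z \<in> Af" using Ld(1) ZL z by blast
    thus "(\<lambda>rh. c z * z rh) \<in> Af" using c(1) z S_rules(6) by (auto simp: Af_iff)
   qed
  qed
  show "(\<lambda>si. - x si) \<in> W" if "x \<in> W" for x
   using Wsm[OF that S_rules(3)[OF S_rules(1)]] by (simp add: sm_def)
  show "mul r x \<in> W" if r: "r \<in> Af" and x: "x \<in> W" for r x
  proof -
   have "(\<lambda>\<zeta>. \<Sum>rh\<in>G. mul (xs rh (r rh)) x \<zeta>) \<in> W" by (rule Wsum) (rule Wmul[OF x _ Af_S[OF r]])
   thus ?thesis unfolding mul_sum_left[symmetric] using CS_decomp[of r] r Af_iff by simp
  qed
 qed (use W0 Wadd in auto)
 moreover have "Y \<subseteq> W"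
 proof
  fix y assume y: "y \<in> Y"
  have yC: "y \<in> CS" using y Y(2) Ld(1) Af_iff by blast
  have "mul (xs id 1) y \<in> Z" unfolding Z_def using y id_in_G by (intro image_eqI[of _ _ "(id, y)"]) auto
  thus "y \<in> W" using WZ mul_one_left[OF yC] by (simp add: xs_one)
 qed
 ultimately have "L \<subseteq> W" using Y(3) by blast
 thus ?thesis using Zf ZL unfolding W_def by blast
qed

text \<open>The localization at \<open>M\<close> of \<open>x_si^-1 L\<close>, with denominators
  \<open>t\<close> outside \<open>M\<close>; \<open>xs si (si t)\<close> is \<open>x_si t\<close>
  with the scalar moved to the left.\<close>

definition Lo where "Lo M L si = {x\<in>CS. \<exists>t\<in>S. t \<notin> M \<and> mul (xs si (si t)) x \<in> L}"

context
 fixes M L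
 assumes M: "ismax S M" and L: "lideal (subSig G f Af) L"
begin

lemma L_sm: "s \<in> S ==> y \<in> L ==> sm s y \<in> L"
proof -
 assume s: "s \<in> S" and y: "y \<in> L"
 have yC: "y \<in> CS" using lideal_subD(1)[OF subB_Af L y] Af_iff by blast
 have "mul (xs id s) y \<in> L" by (rule lideal_subD(4)[OF subB_Af L xs_Af[OF id_in_G s] y])
 thus ?thesis using xs_sm[of id s 1] mul_one_left[OF yC] by (simp add: xs_one mul_sm_left)
qed

lemma mul_xs_prod: "si \<in> G ==> mul (xs si (si (a * b))) x = sm (si a) (mul (xs si (si b)) x)"
 by (simp add: gal_simps(4) xs_sm mul_sm_left)

lemma Lo_CS: "x \<in> Lo M L si ==> x \<in> CS" by (simp add: Lo_def)

lemma Lo_scale: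
 assumes s: "si \<in> G" and a: "a \<in> loc M" and x: "x \<in> Lo M L si"
 shows "sm a x \<in> Lo M L si"
proof -
 obtain t where t: "t \<in> S" "t \<notin> M" "mul (xs si (si t)) x \<in> L" using x by (auto simp: Lo_def)
 obtain u where u: "u \<in> S" "u \<notin> M" "a * u \<in> S" using loc_num[OF M a] by blast
 have "mul (xs si (si (u * t))) (sm a x) = sm (si (a * u)) (mul (xs si (si t)) x)"
  unfolding mul_xs_prod[OF s] mul_xs_sm[OF s] sm_sm by (simp add: gal_simps(4)[OF s] mult.commute)
 hence "mul (xs si (si (u * t))) (sm a x) \<in> L" using L_sm[OF gal_S[OF s u(3)] t(3)] by simp
 moreover have "u * t \<in> S" "u * t \<notin> M" using u t S_rules(6) M_mult_notin[OF M] by auto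
 ultimately show ?thesis using sm_CS[OF Lo_CS[OF x]] by (auto simp: Lo_def)
qed

lemma Lo_add:
 assumes s: "si \<in> G" and x: "x \<in> Lo M L si" and y: "y \<in> Lo M L si"
 shows "(\<lambda>rh. x rh + y rh) \<in> Lo M L si"
proof -
 obtain t where t: "t \<in> S" "t \<notin> M" "mul (xs si (si t)) x \<in> L" using x by (auto simp: Lo_def)
 obtain u where u: "u \<in> S" "u \<notin> M" "mul (xs si (si u)) y \<in> L" using y by (auto simp: Lo_def)
 have "mul (xs si (si (u * t))) x \<in> L" unfolding mul_xs_prod[OF s] by (rule L_sm[OF gal_S[OF s u(1)] t(3)])
 moreover have "mul (xs si (si (u * t))) y \<in> L"
  unfolding mult.commute[of u t] mul_xs_prod[OF s] by (rule L_sm[OF gal_S[OF s t(1)] u(3)])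
 ultimately have "mul (xs si (si (u * t))) (\<lambda>rh. x rh + y rh) \<in> L"
  unfolding mul_add_right by (rule lideal_subD(3)[OF subB_Af L])
 moreover have "u * t \<in> S" "u * t \<notin> M" using u t S_rules(6) M_mult_notin[OF M] by auto
 moreover have "(\<lambda>rh. x rh + y rh) \<in> CS" using Lo_CS[OF x] Lo_CS[OF y] by simp
 ultimately show ?thesis by (auto simp: Lo_def)
qed

lemma Lo_zero: "(\<lambda>_. 0) \<in> Lo M L si"
 using lideal_subD(2)[OF subB_Af L] S_rules(1) maxD(2)[OF M] by (auto simp: Lo_def mul_zero)

lemma Lo_sum:
 assumes s: "si \<in> G" and g: "\<And>i. i \<in> A ==> g i \<in> Lo M L si"
 shows "(\<lambda>rh. \<Sum>i\<in>A. g i rh) \<in> Lo M L si"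
 using g by (induct A rule: infinite_finite_induct) (auto simp: Lo_zero intro: Lo_add[OF s])

lemma L_Lo:
 assumes s: "si \<in> G" and y: "y \<in> L"
 shows "mul (xi si) y \<in> Lo M L si"
proof -
 have yC: "y \<in> CS" using lideal_subD(1)[OF subB_Af L y] Af_iff by blast
 have "mul (xs si (si 1)) (mul (xi si) y) = y"
  unfolding mul_assoc[symmetric] gal_simps(2)[OF s] xi_right[OF s] by (rule mul_one_left[OF yC])
 thus ?thesis using y mul_CS S_rules(1) maxD(2)[OF M] by (auto simp: Lo_def)
qed

lemma Lo_kp:
 assumes s: "si \<in> G" and t: "tu \<in> G" and x: "x \<in> Lo M L tu"
 shows "sm (kp tu si) x \<in> Lo M L si"
proof -
 obtain a where a: "a \<in> S" "a \<notin> M" "mul (xs tu (tu a)) x \<in> L" using x by (auto simp: Lo_def)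
 have "mul (xs (si \<circ> iv tu) 1) (mul (xs tu (tu a)) x) \<in> L"
  by (rule lideal_subD(4)[OF subB_Af L xs_Af[OF _ S_rules(1)] a(3)]) (use s t in simp)
 moreover have "mul (xs (si \<circ> iv tu) 1) (xs tu (tu a)) = xs si (si (kp tu si * a))"
  using mul_xs_xs[of "si \<circ> iv tu" tu 1 "tu a"] s t inv_app(1)[OF t]
  by (simp add: comp_assoc gal_simps(4)[OF s] kp_app[OF s] mult.commute)
 ultimately have "mul (xs si (si (kp tu si * a))) x \<in> L" by (simp add: mul_assoc[symmetric])
 hence "mul (xs si (si a)) (sm (kp tu si) x) \<in> L" unfolding mul_xs_prod[OF s] mul_xs_sm[OF s] .
 thus ?thesis using a sm_CS[OF Lo_CS[OF x]] by (auto simp: Lo_def)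
qed

lemma Lo_kp_scale:
 assumes s: "si \<in> G" and t: "tu \<in> G" and x: "x \<in> Lo M L tu" and a: "a / kp tu si \<in> loc M"
 shows "sm a x \<in> Lo M L si"
 using Lo_scale[OF s a Lo_kp[OF s t x]] kp_nz[OF t s] by (simp add: sm_sm)

end

text \<open>One system serves all lattices at once: as far as the coordinates in \<open>A\<close>
  are concerned, \<open>Lo M L si\<close> is spanned over \<open>loc M\<close> by the vectors
  \<open>kp (ta i) si * l i\<close>. Zero vectors \<open>l i\<close> are allowed, so
  \<open>L\<close> may have any rank.\<close>

definition coords where
 "coords M L A lam l ta \<longleftrightarrow> (\<forall>i\<in>A. Klin (lam i) \<and> ta i \<in> G \<and> l i \<in> Lo M L (ta i) \<and>
   (\<forall>si\<in>G. \<forall>x\<in>Lo M L si. lam i x / kp (ta i) si \<in> loc M)) \<and>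
  (\<forall>si\<in>G. \<forall>x\<in>Lo M L si. \<forall>rh\<in>A. x rh = (\<Sum>i\<in>A. lam i x * l i rh))"

lemma coordsD:
 assumes "coords M L A lam l ta"
 shows "i \<in> A ==> Klin (lam i)" "i \<in> A ==> ta i \<in> G" "i \<in> A ==> l i \<in> Lo M L (ta i)"
  "i \<in> A ==> si \<in> G ==> x \<in> Lo M L si ==> lam i x / kp (ta i) si \<in> loc M"
  "si \<in> G ==> x \<in> Lo M L si ==> rh \<in> A ==> x rh = (\<Sum>i\<in>A. lam i x * l i rh)"
 using assms by (simp_all add: coords_def)

lemma val_finite_max:
 assumes val: "is_val R" and fin: "finite C" and nz: "\<exists>c\<in>C. c \<noteq> (0::'k)"
 shows "\<exists>m\<in>C. m \<noteq> 0 \<and> (\<forall>c\<in>C. c / m \<in> R)"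
 using fin nz
proof (induct C)
 case (insert c C)
 note Rr = is_subringD[OF val_subring[OF val]]
 show ?case
 proof (cases "\<exists>c\<in>C. c \<noteq> 0")
  case False
  hence "c \<noteq> 0" "\<forall>d\<in>insert c C. d / c \<in> R" using insert Rr(1,2) by auto
  thus ?thesis by blast
 next
  case True
  then obtain m where m: "m \<in> C" "m \<noteq> 0" "\<forall>d\<in>C. d / m \<in> R" using insert by blast
  show ?thesis
  proof (cases "c / m \<in> R")
   case True thus ?thesis using m by blast
  next
   case False
   hence c: "c \<noteq> 0" "m / c \<in> R" using val_total[OF val, of c m] Rr(2) by auto
   have "d / c \<in> R" if "d \<in> insert c C" for d
   proof (cases "d = c")
    case True thus ?thesis using c Rr(1) by simp
   next
    case False
    hence "(d / m) * (m / c) \<in> R" using m(3) that c(2) Rr(6) by blast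
    thus ?thesis using m(2) by simp
   qed
   thus ?thesis using c by blast
  qed
 qed
qed simp

end

section \<open>Dual bases of finitely generated left ideals\<close>

context tame_crossed
begin

text \<open>Outside the square of \<open>M\<close> the value is at most that of a generator, hence
  at most that of any non-unit.\<close>

lemma nloc_div_notin_sq:
 assumes M: "ismax S M" and k: "k \<in> S" "k \<notin> sq M" and a: "a \<in> nloc M"
 shows "a / k \<in> loc M"
proof (rule uniformizer_cases)
 assume J: "JV = {0}"
 have "loc M = UNIV" using S_loc[OF M] trivial_val(2)[OF J] by blast
 thus ?thesis by simp
next
 fix w assume "tame_unif F V S f w"
 then interpret tame_unif F V S f w .
 have "(a / w) * (w / k) \<in> loc M" using w_div[OF M a] w_over(2)[OF M k] loc_rules(6)[OF M] by blast
 thus ?thesis using w_nz by simp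
qed

text \<open>\<open>t0\<close> lies in all maximal ideals but \<open>M\<close>, so the factor
  \<open>u * c\<close>, congruent to 1 at \<open>M\<close> and containing the common denominator
  \<open>c\<close>, alters its trace only by an element of \<open>JV\<close>; the unit trace is then
  scaled to 1. Denominators at one maximal ideal are thus removed globally.\<close>

lemma trace_clearing:
 assumes M: "ismax S M" and C: "finite C" "C \<subseteq> loc M"
 shows "\<exists>t\<in>S. Tr t = 1 \<and> (\<forall>b\<in>C. t * b \<in> S)"
proof -
 have "\<exists>c\<in>S. c \<notin> M \<and> (\<forall>b\<in>C. c * b \<in> S)" using C
 proof (induct C)
  case empty thus ?case using S_rules(1) maxD(2)[OF M] by blast
 next
  case (insert b C)
  then obtain c where c: "c \<in> S" "c \<notin> M" "\<forall>b\<in>C. c * b \<in> S" by blast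
  obtain u where u: "u \<in> S" "u \<notin> M" "b * u \<in> S" using loc_num[OF M] insert by blast
  have "u * c * d \<in> S" if "d \<in> insert b C" for d
  proof -
   have "c * (b * u) \<in> S" "d \<in> C ==> u * (c * d) \<in> S" using c u S_rules(6) by auto
   thus ?thesis using that by (auto simp: mult_ac)
  qed
  moreover have "u * c \<in> S" "u * c \<notin> M" using c u S_rules(6) M_mult_notin[OF M] by auto
  ultimately show ?case by blast
 qed
 then obtain c where c: "c \<in> S" "c \<notin> M" "\<forall>b\<in>C. c * b \<in> S" by blast
 obtain u where u: "u \<in> S" "1 - u * c \<in> M" using maxD(3)[OF M] c by blast
 obtain t0 where t0: "t0 \<in> S" "Tr t0 \<notin> JV" "\<And>M'. ismax S M' ==> M' \<noteq> M ==> t0 \<in> M'"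
  using trace_element[OF M tame] by blast
 define t where "t = t0 * u * c"
 have tS: "t \<in> S" using t0 u c S_rules(6) by (simp add: t_def)
 have ucS: "1 - u * c \<in> S" by (intro S_rules(4) S_rules(1) S_rules(6) u(1) c(1))
 have "t0 * (1 - u * c) \<in> M'" if M': "ismax S M'" for M'
  using M_rules(4)[OF M' t0(1)] M_rules(5)[OF M' ucS] t0(3)[OF M'] u(2) by (cases "M' = M") auto
 hence "t0 * (1 - u * c) \<in> JS" using S_rules(6)[OF t0(1) ucS] by (simp add: JS_def)
 moreover have "t0 * (1 - u * c) = t0 - t" by (simp add: t_def algebra_simps)
 ultimately have "Tr t0 - Tr t \<in> JV" using Tr_JS Tr_diff by metis
 hence TJ: "Tr t \<notin> JV" using t0(2) JV_rules(3)[of "Tr t0 - Tr t" "Tr t"] by auto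
 have "Tr t \<in> S" unfolding Tr_def by (rule is_subring_sum[OF S_subring]) (rule gal_S[OF _ tS])
 hence "Tr t \<in> V" using S_int_F Tr_in_F by blast
 hence T: "Tr t \<noteq> 0" "inverse (Tr t) \<in> V" using TJ by (auto simp: nonunits_def)
 have iF: "inverse (Tr t) \<in> F" and iS: "inverse (Tr t) \<in> S" using T V_F V_S by auto
 have "Tr (k * t) = k * Tr t" if k: "k \<in> F" for k
  unfolding Tr_def sum_distrib_left by (rule sum.cong[OF refl]) (simp add: gal_simps(4,12) k)
 from this[OF iF]
 have "Tr (inverse (Tr t) * t) = 1" using T by simp
 moreover have "inverse (Tr t) * t * b \<in> S" if "b \<in> C" for b
 proof -
  have "inverse (Tr t) * (t0 * u) * (c * b) \<in> S" using iS t0 u c that S_rules(6) by blast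
  thus ?thesis by (simp add: t_def mult_ac)
 qed
 ultimately show ?thesis using S_rules(6)[OF iS tS] by blast
qed

context
 fixes M L Z
 assumes c4: cond4 and M: "ismax S M" and L: "lideal (subSig G f Af) L"
  and Z: "finite Z" "Z \<subseteq> L" "\<And>y. y \<in> L ==> \<exists>c. (\<forall>z\<in>Z. c z \<in> S) \<and> y = (\<lambda>rh. \<Sum>z\<in>Z. c z * z rh)"
begin

private abbreviation "LL \<equiv> Lo M L"

lemma kp_trans:
 assumes "si \<in> G" "tu \<in> G" "\<upsilon> \<in> G" "kp si tu \<notin> M" "kp tu \<upsilon> \<notin> M"
 shows "kp si \<upsilon> \<notin> M"
proof
 assume "kp si \<upsilon> \<in> M"
 hence "kp si tu * kp tu \<upsilon> \<in> M"
  unfolding kp_mult[OF assms(1-3)] by (intro M_rules(4)[OF M] gal_S[OF inv_in_G[OF assms(3)]] f_S) (use assms in auto)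
 thus False using M_mult_notin[OF M kp_S kp_S] assms by blast
qed

lemma xi_module:
 assumes s: "si \<in> G" and y: "y \<in> L"
 shows "\<exists>c. (\<forall>z\<in>Z. c z \<in> S) \<and> mul (xi si) y = (\<lambda>rh. \<Sum>z\<in>Z. c z * mul (xi si) z rh)"
proof -
 obtain c where c: "\<forall>z\<in>Z. c z \<in> S" "y = (\<lambda>rh. \<Sum>z\<in>Z. c z * z rh)" using Z(3)[OF y] by blast
 have ye: "y = (\<lambda>rh. \<Sum>z\<in>Z. sm (c z) z rh)" unfolding c(2) by (simp add: sm_def)
 have "mul (xi si) y = (\<lambda>rh. \<Sum>z\<in>Z. mul (xi si) (sm (c z) z) rh)" unfolding ye by (rule mul_sum_right)
 also have "\<dots> = (\<lambda>rh. \<Sum>z\<in>Z. iv si (c z) * mul (xi si) z rh)" unfolding xi_sm[OF s] by (simp add: sm_def)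
 finally show ?thesis using c(1) gal_S[OF inv_in_G[OF s]] by (intro exI[of _ "\<lambda>z. iv si (c z)"]) simp
qed

text \<open>The functional takes its largest value on some \<open>LL \<tau>\<close>; taking \<open>\<tau>\<close> minimal forces
  strictly smaller values on the lattices below it, which is the room needed to divide by \<open>kp \<tau> \<sigma>\<close>.\<close>
lemma dominant_value:
 assumes mu: "Klin \<mu>" and ex: "\<exists>si\<in>G. \<exists>x\<in>LL si. \<mu> x \<noteq> 0"
 shows "\<exists>tu\<in>G. \<exists>l\<in>LL tu. \<mu> l \<noteq> 0 \<and> (\<forall>si\<in>G. \<forall>x\<in>LL si. \<mu> x / \<mu> l / kp tu si \<in> loc M)"
proof -
 note O = loc_rules[OF M]
 \<comment> \<open>On each lattice the values of the functional are
   \<open>loc M\<close>-combinations of its values at the generators, so only finitely many values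
   have to be compared.\<close>
 have ex_c: "\<exists>c. (\<forall>z\<in>Z. c z \<in> loc M) \<and> \<mu> x = (\<Sum>z\<in>Z. c z * \<mu> (mul (xi si) z))"
  if s: "si \<in> G" and x: "x \<in> LL si" for si x
 proof -
  obtain t where t: "t \<in> S" "t \<notin> M" "mul (xs si (si t)) x \<in> L" using x by (auto simp: Lo_def)
  have ti: "t \<noteq> 0" "inverse t \<in> loc M" using loc_unit[OF M t(1,2)] by auto
  obtain c where c: "\<forall>z\<in>Z. c z \<in> S" "mul (xi si) (mul (xs si (si t)) x) = (\<lambda>rh. \<Sum>z\<in>Z. c z * mul (xi si) z rh)"
   using xi_module[OF s t(3)] by blast
  have "sm t x = (\<lambda>rh. \<Sum>z\<in>Z. c z * mul (xi si) z rh)" using c(2) xi_xs[OF s Lo_CS[OF M L x]] by simp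
  hence "t * \<mu> x = (\<Sum>z\<in>Z. c z * \<mu> (mul (xi si) z))" using Klin_sum[OF mu, of c "\<lambda>z. mul (xi si) z" Z] KlinD(2)[OF mu, of t x] by simp
  hence "\<mu> x = inverse t * (\<Sum>z\<in>Z. c z * \<mu> (mul (xi si) z))" using ti(1) by (simp add: field_simps)
  also have "\<dots> = (\<Sum>z\<in>Z. (inverse t * c z) * \<mu> (mul (xi si) z))" by (simp add: sum_distrib_left mult.assoc)
  finally show ?thesis using c(1) ti(2) S_loc[OF M] O(6) by (intro exI[of _ "\<lambda>z. inverse t * c z"]) auto
 qed
 define C where "C = (\<lambda>(si, z). \<mu> (mul (xi si) z)) ` (G \<times> Z)"
 have Cf: "finite C" using Z(1) by (simp add: C_def)
 have Cm: "\<mu> (mul (xi si) z) \<in> C" if "si \<in> G" "z \<in> Z" for si z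
  unfolding C_def using that by (intro image_eqI[of _ _ "(si, z)"]) auto
 have "\<exists>c\<in>C. c \<noteq> 0"
 proof (rule ccontr)
  assume n: "\<not> ?thesis"
  obtain si x where x: "si \<in> G" "x \<in> LL si" "\<mu> x \<noteq> 0" using ex by blast
  obtain c where c: "\<mu> x = (\<Sum>z\<in>Z. c z * \<mu> (mul (xi si) z))" using ex_c[OF x(1,2)] by blast
  have "\<mu> (mul (xi si) z) = 0" if "z \<in> Z" for z using Cm[OF x(1) that] n by blast
  thus False using c x(3) by simp
 qed
 then obtain m where m: "m \<in> C" "m \<noteq> 0" "\<forall>c\<in>C. c / m \<in> loc M"
  using val_finite_max[OF loc_val[OF M] Cf] by blast
 have bd: "\<mu> x / m \<in> loc M" if s: "si \<in> G" and x: "x \<in> LL si" for si x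
 proof -
  obtain c where c: "\<forall>z\<in>Z. c z \<in> loc M" "\<mu> x = (\<Sum>z\<in>Z. c z * \<mu> (mul (xi si) z))" using ex_c[OF s x] by blast
  have "(\<Sum>z\<in>Z. c z * (\<mu> (mul (xi si) z) / m)) \<in> loc M"
  proof (rule is_subring_sum[OF loc_subring[OF M]])
   fix z assume z: "z \<in> Z"
   show "c z * (\<mu> (mul (xi si) z) / m) \<in> loc M"
    by (rule O(6)) (use c(1) z m(3) Cm[OF s z] in auto)
  qed
  thus ?thesis unfolding c(2) by (simp add: sum_divide_distrib)
 qed
 define T where "T = {tu\<in>G. \<exists>x\<in>LL tu. \<mu> x = m}"
 \<comment> \<open>\<open>n tu\<close> counts the elements below \<open>tu\<close>; a lattice
   attaining the value \<open>m\<close> is taken for which this count is least.\<close>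
 define n where "n tu = card {ap\<in>G. kp ap tu \<notin> M}" for tu
 obtain tu0 z0 where t0: "tu0 \<in> G" "z0 \<in> Z" "m = \<mu> (mul (xi tu0) z0)" using m(1) unfolding C_def by auto
 have "tu0 \<in> T" unfolding T_def using t0 L_Lo[OF M L t0(1)] Z(2) by blast
 then obtain tu where tT: "tu \<in> T" and tmin: "\<And>si. si \<in> T ==> n tu \<le> n si"
  using ex_has_least_nat[of "\<lambda>tu. tu \<in> T" tu0 n] by blast
 then obtain l where t: "tu \<in> G" and l: "l \<in> LL tu" "\<mu> l = m" unfolding T_def by blast
 have "\<mu> x / m / kp tu si \<in> loc M" if s: "si \<in> G" and x: "x \<in> LL si" for si x
 proof (cases "kp tu si \<in> M")
  case False
  have "inverse (kp tu si) \<in> loc M" using loc_unit[OF M kp_S[OF t s] False] by blast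
  thus ?thesis using bd[OF s x] O(6) unfolding divide_inverse by blast
 next
  case True
  \<comment> \<open>By \<open>cond4\<close> not both \<open>kp si tu\<close> and
    \<open>kp tu si\<close> are in \<open>M\<close>, and neither is in its square. So
    \<open>si\<close> is strictly below \<open>tu\<close> and its lattice does not attain the value
    \<open>m\<close>.\<close>
  note sq = kp_sym_notin_sq[OF c4 M s t] and sqi = is_idealD[OF S_subring sq_ideal[OF M]]
  have st: "kp si tu \<notin> M" using sq True mult_in_sq by blast
  have nsq: "kp tu si \<notin> sq M" using sq sqi(4)[OF kp_S[OF s t]] by blast
  have "si \<notin> T"
  proof
   assume "si \<in> T"
   hence "n tu \<le> n si" by (rule tmin)
   moreover have "n si < n tu" unfolding n_def
   proof (rule psubset_card_mono)
    have "{ap\<in>G. kp ap si \<notin> M} \<subseteq> {ap\<in>G. kp ap tu \<notin> M}" using kp_trans[OF _ s t _ st] by blast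
    moreover have "tu \<in> {ap\<in>G. kp ap tu \<notin> M}" using t kp_refl[OF t] maxD(2)[OF M] by simp
    moreover have "tu \<notin> {ap\<in>G. kp ap si \<notin> M}" using True by simp
    ultimately show "{ap\<in>G. kp ap si \<notin> M} \<subset> {ap\<in>G. kp ap tu \<notin> M}" by blast
   qed simp
   ultimately show False by simp
  qed
  have "\<mu> x / m \<in> nloc M"
  proof (rule ccontr)
   assume nn: "\<mu> x / m \<notin> nloc M"
   have i: "\<mu> x / m \<noteq> 0" "inverse (\<mu> x / m) \<in> loc M"
    using unit_inverse[OF loc_val[OF M] bd[OF s x] nn] by auto
   have "\<mu> (sm (inverse (\<mu> x / m)) x) = m" using KlinD(2)[OF mu] i(1) by (simp add: field_simps)
   hence "si \<in> T" unfolding T_def using Lo_scale[OF M L s i(2) x] s by blast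
   thus False using \<open>si \<notin> T\<close> by blast
  qed
  thus ?thesis by (rule nloc_div_notin_sq[OF M kp_S[OF t s] nsq])
 qed
 thus ?thesis using t l m(2) by blast
qed

text \<open>Gaussian elimination over a valuation ring, for all lattices simultaneously: subtract
  the part already expressed, take coordinate \<open>r\<close> of the remainder as functional, and
  use a vector on which it is dominant as new pivot.\<close>

lemma local_coordinates:
 assumes "finite A" "A \<subseteq> G"
 shows "\<exists>lam l ta. coords M L A lam l ta"
 using assms
proof (induct A)
 case (insert r A)
 then obtain lam l ta where "coords M L A lam l ta" by blast
 note h = coordsD[OF this]
 define p where "p x = (\<lambda>rh. x rh - (\<Sum>i\<in>A. lam i x * l i rh))" for x
 define \<mu> where "\<mu> x = p x r" for x
 have mu: "Klin \<mu>" unfolding Klin_def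
 proof (intro conjI allI)
  fix x y k
  have "(\<Sum>i\<in>A. lam i (\<lambda>rh. x rh + y rh) * l i r) = (\<Sum>i\<in>A. lam i x * l i r + lam i y * l i r)"
   by (rule sum.cong[OF refl]) (use KlinD(1)[OF h(1)] in \<open>simp add: distrib_right\<close>)
  thus "\<mu> (\<lambda>rh. x rh + y rh) = \<mu> x + \<mu> y" by (simp add: \<mu>_def p_def sum.distrib)
  have "(\<Sum>i\<in>A. lam i (sm k x) * l i r) = (\<Sum>i\<in>A. k * (lam i x * l i r))"
   by (rule sum.cong[OF refl]) (use KlinD(2)[OF h(1)] in simp)
  thus "\<mu> (sm k x) = k * \<mu> x" by (simp add: \<mu>_def p_def sum_distrib_left[symmetric] right_diff_distrib) (simp add: sm_def)
 qed
 have pL: "p x \<in> LL si" if s: "si \<in> G" and x: "x \<in> LL si" for si x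
 proof -
  have "(\<lambda>rh. \<Sum>i\<in>A. sm (lam i x) (l i) rh) \<in> LL si"
   by (rule Lo_sum[OF M L s]) (rule Lo_kp_scale[OF M L s h(2) h(3) h(4)[OF _ s x]])
  hence "sm (- 1) (\<lambda>rh. \<Sum>i\<in>A. sm (lam i x) (l i) rh) \<in> LL si"
   by (rule Lo_scale[OF M L s loc_rules(3)[OF M loc_rules(1)[OF M]]])
  from Lo_add[OF M L s x this] show ?thesis by (simp add: p_def sm_def)
 qed
 have p0: "p x rh = 0" if "si \<in> G" "x \<in> LL si" "rh \<in> A" for si x rh
  using h(5)[OF that] by (simp add: p_def)
 have "\<exists>lamr lr tr. Klin lamr \<and> tr \<in> G \<and> lr \<in> LL tr \<and> (\<forall>si\<in>G. \<forall>x\<in>LL si. lamr x / kp tr si \<in> loc M) \<and>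
   (\<forall>rh\<in>A. lr rh = 0) \<and> (\<forall>si\<in>G. \<forall>x\<in>LL si. \<mu> x = lamr x * lr r)"
 proof (cases "\<exists>si\<in>G. \<exists>x\<in>LL si. \<mu> x \<noteq> 0")
  \<comment> \<open>If the coordinate vanishes on all lattices, a zero vector with zero functional
    is added.\<close>
  case False
  have "Klin (\<lambda>_. 0)" by (simp add: Klin_def)
  moreover have "\<forall>si\<in>G. \<forall>x\<in>LL si. 0 / kp id si \<in> loc M" using loc_rules(2)[OF M] by simp
  moreover have "\<forall>si\<in>G. \<forall>x\<in>LL si. \<mu> x = 0 * 0" using False by simp
  ultimately show ?thesis using id_in_G Lo_zero[OF M L, of id]
   by (intro exI[of _ "\<lambda>_. 0"] exI[of _ "\<lambda>_. 0"] exI[of _ id]) simp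
 next
  case True
  then obtain tu l' where t: "tu \<in> G" and l': "l' \<in> LL tu" "\<mu> l' \<noteq> 0"
   and bd: "\<forall>si\<in>G. \<forall>x\<in>LL si. \<mu> x / \<mu> l' / kp tu si \<in> loc M" using dominant_value[OF mu] by blast
  have "Klin (\<lambda>x. \<mu> x / \<mu> l')" using KlinD[OF mu] by (simp add: Klin_def add_divide_distrib)
  moreover have "\<forall>rh\<in>A. p l' rh = 0" using p0[OF t l'(1)] by blast
  moreover have "\<forall>si\<in>G. \<forall>x\<in>LL si. \<mu> x = \<mu> x / \<mu> l' * p l' r" using l'(2) by (simp add: \<mu>_def)
  ultimately show ?thesis using t bd pL[OF t l'(1)]
   by (intro exI[of _ "\<lambda>x. \<mu> x / \<mu> l'"] exI[of _ "p l'"] exI[of _ tu]) simp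
 qed
 then obtain lamr lr tr where e: "Klin lamr" "tr \<in> G" "lr \<in> LL tr" "\<forall>si\<in>G. \<forall>x\<in>LL si. lamr x / kp tr si \<in> loc M"
   "\<forall>rh\<in>A. lr rh = 0" "\<forall>si\<in>G. \<forall>x\<in>LL si. \<mu> x = lamr x * lr r" by blast
 let ?lam = "lam(r := lamr)" and ?l = "l(r := lr)" and ?ta = "ta(r := tr)"
 have sums: "(\<Sum>i\<in>insert r A. ?lam i x * ?l i rh) = lamr x * lr rh + (\<Sum>i\<in>A. lam i x * l i rh)" for x rh
 proof -
  have "(\<Sum>i\<in>A. ?lam i x * ?l i rh) = (\<Sum>i\<in>A. lam i x * l i rh)"
   by (rule sum.cong[OF refl]) (use insert(2) in auto)
  thus ?thesis using insert(1,2) by simp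
 qed
 show ?case
 proof (rule exI[of _ ?lam], rule exI[of _ ?l], rule exI[of _ ?ta], unfold coords_def, intro conjI ballI)
  fix si x rh assume a: "si \<in> G" "x \<in> LL si" "rh \<in> insert r A"
  show "x rh = (\<Sum>i\<in>insert r A. ?lam i x * ?l i rh)"
  proof (cases "rh \<in> A")
   case True thus ?thesis unfolding sums using e(5) h(5)[OF a(1,2) True] by simp
  next
   case False
   hence "rh = r" using a(3) by simp
   moreover have "x r - (\<Sum>i\<in>A. lam i x * l i r) = lamr x * lr r" using e(6) a(1,2) by (simp add: \<mu>_def p_def)
   ultimately show ?thesis unfolding sums by (simp add: algebra_simps)
  qed
 next
  fix i assume i: "i \<in> insert r A"
  show "Klin (?lam i)" using i h(1) e(1) by (cases "i = r") auto
  show "?ta i \<in> G" using i h(2) e(2) by (cases "i = r") auto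
  show "?l i \<in> LL (?ta i)" using i h(3) e(3) by (cases "i = r") auto
  fix si x assume sx: "si \<in> G" "x \<in> LL si"
  show "?lam i x / kp (?ta i) si \<in> loc M"
   using i h(4)[OF _ sx] e(4) sx by (cases "i = r") auto
 qed
next
 case empty show ?case unfolding coords_def by simp
qed

text \<open>Averaging, with weight \<open>tt\<close>, turns each coordinate functional into a left
  linear map. As the vectors \<open>l i\<close> reconstruct every lattice, these maps reproduce
  \<open>y\<close> times the trace of \<open>tt\<close>, which is 1, and \<open>tt\<close> absorbs
  the denominators that would keep their values outside \<open>Af\<close>.\<close>

lemma proj_left_if_generated: "proj_left (subSig G f Af) L"
proof -
 have LC: "y \<in> CS" if "y \<in> L" for y using lideal_subD(1)[OF subB_Af L that] Af_iff by blast
 obtain lam l ta where "coords M L G lam l ta" using local_coordinates[OF finite_G subset_refl] by blast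
 note h = coordsD[OF this]
 have lC: "l i \<in> CS" if "i \<in> G" for i using Lo_CS[OF M L h(3)[OF that]] .
 have "\<exists>t\<in>S. t \<notin> M \<and> mul (xs (ta i) (ta i t)) (l i) \<in> L" if "i \<in> G" for i using h(3)[OF that] by (simp add: Lo_def)
 then obtain t where t: "\<And>i. i \<in> G ==> t i \<in> S" "\<And>i. i \<in> G ==> t i \<notin> M"
  "\<And>i. i \<in> G ==> mul (xs (ta i) (ta i (t i))) (l i) \<in> L" by metis
 \<comment> \<open>\<open>z i\<close> is \<open>l i\<close> moved back into the ideal, at the cost
   of a denominator \<open>t i\<close> outside \<open>M\<close>.\<close>
 define z where "z i = mul (xs (ta i) (ta i (t i))) (l i)" for i
 have t0: "t i \<noteq> 0" if "i \<in> G" for i using loc_unit[OF M t(1,2)[OF that]] by blast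
 \<comment> \<open>The coefficient that averaging produces before multiplication with
   \<open>tt\<close>, up to the automorphism \<open>si\<close>. On the finitely many generators it
   lies in \<open>loc M\<close>, so one \<open>tt\<close> clears them all.\<close>
 define b where "b i si y = lam i (mul (xi si) y) / t i / kp (ta i) si" for i si y
 define C where "C = (\<lambda>(i, si, y). b i si y) ` (G \<times> G \<times> Z)"
 have Cf: "finite C" using Z(1) by (simp add: C_def)
 have "C \<subseteq> loc M"
 proof
  fix c assume "c \<in> C"
  then obtain i si y where c: "i \<in> G" "si \<in> G" "y \<in> Z" "c = b i si y" unfolding C_def by auto
  have "lam i (mul (xi si) y) / kp (ta i) si * inverse (t i) \<in> loc M"
   using h(4)[OF c(1,2) L_Lo[OF M L c(2)]] c(3) Z(2) loc_unit[OF M t(1,2)[OF c(1)]] loc_rules(6)[OF M] by blast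
  thus "c \<in> loc M" unfolding c(4) b_def by (simp add: divide_inverse mult_ac)
 qed
 then obtain tt where tt: "tt \<in> S" "Tr tt = 1" "\<forall>c\<in>C. tt * c \<in> S" using trace_clearing[OF M Cf] by blast
 have bS: "tt * b i si y \<in> S" if i: "i \<in> G" and s: "si \<in> G" and y: "y \<in> L" for i si y
 proof -
  obtain c where c: "\<forall>z\<in>Z. c z \<in> S" "mul (xi si) y = (\<lambda>rh. \<Sum>z\<in>Z. c z * mul (xi si) z rh)"
   using xi_module[OF s y] by blast
  have "tt * b i si y = (\<Sum>z\<in>Z. c z * (tt * b i si z))"
   unfolding b_def c(2) Klin_sum[OF h(1)[OF i]] by (simp add: sum_divide_distrib sum_distrib_left mult_ac)
  moreover have "(\<Sum>z\<in>Z. c z * (tt * b i si z)) \<in> S"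
  proof (rule is_subring_sum[OF S_subring])
   fix z assume z: "z \<in> Z"
   have "b i si z \<in> C" unfolding C_def using i s z by (intro image_eqI[of _ _ "(i, si, z)"]) auto
   thus "c z * (tt * b i si z) \<in> S" using tt(3) c(1) z S_rules(6) by blast
  qed
  ultimately show ?thesis by simp
 qed
 define \<Lambda> where "\<Lambda> i y = sm (tt * lam i y / t i) (xi (ta i))" for i y
 define \<psi> where "\<psi> i = avg (\<Lambda> i)" for i
 have Ladd: "\<Lambda> i (\<lambda>rh. x rh + y rh) = (\<lambda>rh. \<Lambda> i x rh + \<Lambda> i y rh)" if "i \<in> G" for i x y
  unfolding \<Lambda>_def KlinD(1)[OF h(1)[OF that]] by (simp add: sm_def distrib_left distrib_right add_divide_distrib)
 have Lhom: "\<Lambda> i (sm k x) = sm k (\<Lambda> i x)" if "i \<in> G" for i k x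
  unfolding \<Lambda>_def KlinD(2)[OF h(1)[OF that]] sm_sm by (simp add: mult_ac)
 have psi_add: "\<psi> i (\<lambda>rh. x rh + y rh) = (\<lambda>rh. \<psi> i x rh + \<psi> i y rh)" if "i \<in> G" for i x y
  unfolding \<psi>_def by (rule avg_add[OF Ladd[OF that] Lhom[OF that]])
 have psi_mul: "\<psi> i (mul a y) = mul a (\<psi> i y)" if "i \<in> G" "a \<in> CS" for i a y
  unfolding \<psi>_def by (rule avg_mul[OF Ladd[OF that(1)] Lhom[OF that(1)] that(2)])
 have psi_Af: "\<psi> i y \<in> Af" if i: "i \<in> G" and y: "y \<in> L" for i y
  unfolding \<psi>_def avg_def
 proof (rule subB_sum[OF subB_Af])
  fix si assume s: "si \<in> G"
  have "mul (xs si 1) (\<Lambda> i (mul (xi si) y)) = xs (si \<circ> iv (ta i)) (si (tt * b i si y))"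
   unfolding \<Lambda>_def mul_xs_xi[OF s h(2)[OF i]] b_def by simp
  thus "mul (xs si 1) (\<Lambda> i (mul (xi si) y)) \<in> Af"
   using xs_Af[OF _ gal_S[OF s bS[OF i s y]], of "si \<circ> iv (ta i)"] s h(2)[OF i] by simp
 qed
 have repr: "(\<lambda>\<zeta>. \<Sum>i\<in>G. mul (\<psi> i y) (z i) \<zeta>) = y" if y: "y \<in> L" for y
 proof -
  have t1: "mul (\<psi> i y) (z i) = (\<lambda>\<zeta>. \<Sum>si\<in>G. mul (xs si 1) (sm (tt * lam i (mul (xi si) y)) (l i)) \<zeta>)" if i: "i \<in> G" for i
  proof -
   have "mul (\<Lambda> i x) (z i) = sm (tt * lam i x) (l i)" for x
    unfolding \<Lambda>_def z_def mul_sm_left xi_xs[OF h(2)[OF i] lC[OF i]] sm_sm using t0[OF i] by simp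
   thus ?thesis unfolding \<psi>_def avg_def mul_sum_left mul_assoc by simp
  qed
  have u: "(\<lambda>\<zeta>. \<Sum>i\<in>G. sm (tt * lam i (mul (xi si) y)) (l i) \<zeta>) = sm tt (mul (xi si) y)" if s: "si \<in> G" for si
  proof
   fix \<zeta>
   have "(\<Sum>i\<in>G. lam i (mul (xi si) y) * l i \<zeta>) = mul (xi si) y \<zeta>"
   proof (cases "\<zeta> \<in> G")
    case True thus ?thesis using h(5)[OF s L_Lo[OF M L s y] True] by simp
   next
    case False
    have "l i \<zeta> = 0" if "i \<in> G" for i using lC[OF that] False by simp
    thus ?thesis using False by (simp add: cp_mult_def)
   qed
   thus "(\<Sum>i\<in>G. sm (tt * lam i (mul (xi si) y)) (l i) \<zeta>) = sm tt (mul (xi si) y) \<zeta>"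
    by (simp add: sm_def mult.assoc sum_distrib_left[symmetric])
  qed
  \<comment> \<open>Exchanging the sums lets the coordinates reassemble \<open>x_si^-1 y\<close>
    inside; what remains is \<open>x_si tt x_si^-1 y\<close>, summed over the group.\<close>
  have "(\<lambda>\<zeta>. \<Sum>i\<in>G. mul (\<psi> i y) (z i) \<zeta>) = (\<lambda>\<zeta>. \<Sum>i\<in>G. \<Sum>si\<in>G. mul (xs si 1) (sm (tt * lam i (mul (xi si) y)) (l i)) \<zeta>)"
   by (rule ext, rule sum.cong[OF refl]) (simp only: t1)
  also have "\<dots> = (\<lambda>\<zeta>. \<Sum>si\<in>G. mul (xs si 1) (\<lambda>\<zeta>. \<Sum>i\<in>G. sm (tt * lam i (mul (xi si) y)) (l i) \<zeta>) \<zeta>)"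
   unfolding mul_sum_right by (rule ext, rule sum.swap)
  also have "\<dots> = (\<lambda>\<zeta>. \<Sum>si\<in>G. si tt * y \<zeta>)"
  proof (rule ext, rule sum.cong[OF refl])
   fix \<zeta> si assume s: "si \<in> G"
   have "mul (xs si 1) (sm tt (mul (xi si) y)) = sm (si tt) y"
    unfolding mul_xs_sm[OF s] mul_assoc[symmetric] xi_right[OF s] mul_one_left[OF LC[OF y]] ..
   thus "mul (xs si 1) (\<lambda>\<zeta>. \<Sum>i\<in>G. sm (tt * lam i (mul (xi si) y)) (l i) \<zeta>) \<zeta> = si tt * y \<zeta>"
    unfolding u[OF s] by (simp add: sm_def)
  qed
  also have "\<dots> = y" using tt(2) by (simp add: sum_distrib_right[symmetric] Tr_def)
  finally show ?thesis .
 qed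
 \<comment> \<open>The section is indexed by elements of the ideal, and different \<open>i\<close>
   may give the same \<open>z i\<close>; their components are added.\<close>
 define s where "s y x = (\<lambda>\<zeta>. \<Sum>i\<in>{i\<in>G. z i = x}. \<psi> i y \<zeta>)" for y x
 have zL: "z i \<in> L" if "i \<in> G" for i unfolding z_def by (rule t(3)[OF that])
 have sA: "s y x \<in> Af" if "y \<in> L" for y x
  unfolding s_def by (rule subB_sum[OF subB_Af]) (use psi_Af that in simp)
 have supp: "s y x = (\<lambda>_. 0)" if "x \<notin> z ` G" for y x
 proof -
  have e: "{i\<in>G. z i = x} = {}" using that by blast
  show ?thesis unfolding s_def e by simp
 qed
 have fin: "finite {x. s y x \<noteq> (\<lambda>_. 0)}" for y
  by (rule finite_subset[of _ "z ` G"]) (use supp in auto)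
 have smul: "s (mul r y) = (\<lambda>x. mul r (s y x))" if r: "r \<in> Af" for r y
 proof
  fix x
  have rC: "r \<in> CS" using r Af_iff by blast
  show "s (mul r y) x = mul r (s y x)"
   unfolding s_def mul_sum_right by (rule ext, rule sum.cong[OF refl]) (use psi_mul[OF _ rC] in simp)
 qed
 have sadd: "s (\<lambda>si. x si + y si) = (\<lambda>v si. s x v si + s y v si)" for x y
  unfolding s_def sum.distrib[symmetric]
  by (rule ext, rule ext, rule sum.cong[OF refl]) (use psi_add in simp)
 have ssum: "finsum (subSig G f Af) (\<lambda>x. mul (s y x) x) {x. s y x \<noteq> (\<lambda>_. 0)} = y" if y: "y \<in> L" for y
 proof -
  let ?U = "{x. s y x \<noteq> (\<lambda>_. 0)}"
  have UL: "?U \<subseteq> z ` G" using supp by blast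
  have "finsum (subSig G f Af) (\<lambda>x. mul (s y x) x) ?U = (\<lambda>rh. \<Sum>x\<in>?U. mul (s y x) x rh)"
  proof (rule finsum_sub[OF subB_Af fin])
   fix x assume "x \<in> ?U"
   hence "x \<in> L" using UL zL by blast
   thus "mul (s y x) x \<in> Af" by (intro subBD(3)[OF subB_Af] sA y lideal_subD(1)[OF subB_Af L])
  qed
  also have "\<dots> = (\<lambda>rh. \<Sum>x\<in>z ` G. mul (s y x) x rh)"
   by (rule ext, rule sum.mono_neutral_left) (use UL in \<open>auto simp: mul_zero\<close>)
  also have "\<dots> = (\<lambda>rh. \<Sum>x\<in>z ` G. \<Sum>i\<in>{i\<in>G. z i = x}. mul (\<psi> i y) (z i) rh)"
   unfolding s_def mul_sum_left by (intro ext sum.cong refl) auto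
  also have "\<dots> = (\<lambda>rh. \<Sum>i\<in>G. mul (\<psi> i y) (z i) rh)"
   by (rule ext, rule sum.image_gen[OF finite_G, symmetric])
  also have "\<dots> = y" by (rule repr[OF y])
  finally show ?thesis .
 qed
 show ?thesis unfolding proj_left_def proj_mod_def sub_simps
 proof (rule exI[of _ s], intro conjI ballI allI impI)
  fix y x assume "x \<notin> L"
  hence "x \<notin> z ` G" using zL by blast
  thus "s y x = (\<lambda>_. 0)" by (rule supp)
 qed (simp_all add: sA fin sadd smul ssum)
qed

end

lemma fg_lideal_proj:
 assumes c4: cond4 and L: "fg_lideal (subSig G f Af) L"
 shows "proj_left (subSig G f Af) L"
proof -
 obtain M where M: "ismax S M" using ex_max by blast
 obtain Z where Z: "finite Z" "Z \<subseteq> L" "\<And>y. y \<in> L ==> \<exists>c. (\<forall>z\<in>Z. c z \<in> S) \<and> y = (\<lambda>rh. \<Sum>z\<in>Z. c z * z rh)"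
  using fg_module_generators[OF L] by blast
 have "lideal (subSig G f Af) L" using L by (simp add: fg_lideal_def)
 thus ?thesis using proj_left_if_generated[OF c4 M _ Z] by blast
qed

end

section \<open>The opposite crossed product\<close>

context crossed
begin

text \<open>The cocycle for which \<open>opp\<close> below is an anti-isomorphism:
  \<open>opp\<close> fixes scalars and sends \<open>x_sigma\<close> to the basis element of
  \<open>sigma^-1\<close>, scalars being moved to the left afterwards.\<close>

definition opf where "opf si tu = (si \<circ> tu) (f (iv tu) (iv si))"

definition opp where "opp a = (\<lambda>si. if si \<in> G then si (a (iv si)) else 0)"

abbreviation opmul where "opmul \<equiv> cp_mult G opf"

lemma opf_cocycle: "normalized_cocycle G S opf"
 unfolding normalized_cocycle_def
proof (intro conjI ballI)
 fix si assume s: "si \<in> G"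
 show "opf id si = 1" "opf si id = 1" using s by (auto simp: opf_def gal_simps(2)[OF s])
 fix tu assume t: "tu \<in> G"
 have "si \<circ> tu \<in> G" using s t by simp
 thus "opf si tu \<in> S - {0}" unfolding opf_def
  using gal_S[of "si \<circ> tu" "f (iv tu) (iv si)"] gal_simps(7)[of "si \<circ> tu" "f (iv tu) (iv si)"] f_S f_nz s t by simp
 fix \<gamma> assume g: "\<gamma> \<in> G"
 let ?r = "si \<circ> (tu \<circ> \<gamma>)"
 have rG: "?r \<in> G" using s t g by simp
 have "si (opf tu \<gamma>) * opf si (tu \<circ> \<gamma>) = ?r (f (iv \<gamma>) (iv tu) * f (iv \<gamma> \<circ> iv tu) (iv si))"
  using t g by (simp add: opf_def gal_simps(4)[OF rG, unfolded comp_apply])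
 also have "f (iv \<gamma>) (iv tu) * f (iv \<gamma> \<circ> iv tu) (iv si) = iv \<gamma> (f (iv tu) (iv si)) * f (iv \<gamma>) (iv tu \<circ> iv si)"
  using coc[of "iv \<gamma>" "iv tu" "iv si"] s t g by simp
 also have "?r \<dots> = opf si tu * opf (si \<circ> tu) \<gamma>"
  using s t by (simp add: opf_def gal_simps(4)[OF rG, unfolded comp_apply] inv_app(2)[OF g])
 finally show "si (opf tu \<gamma>) * opf si (tu \<circ> \<gamma>) = opf si tu * opf (si \<circ> tu) \<gamma>" .
qed

lemma opp_CS: "opp a \<in> CS" by (simp add: opp_def)

lemma opp_opp:
 assumes a: "a \<in> CS"
 shows "opp (opp a) = a"
proof
 fix si show "opp (opp a) si = a si"
  using a inv_app(2)[of si] by (cases "si \<in> G") (simp_all add: opp_def)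
qed

lemma opp_Af: "a \<in> Af ==> opp a \<in> Af"
 using opp_CS[of a] gal_S Af_S[of a] by (simp add: Af_iff opp_def)

lemma opp_zero: "opp (\<lambda>_. 0) = (\<lambda>_. 0)" by (auto simp: opp_def gal_simps(1))

lemma opp_add: "opp (\<lambda>si. a si + b si) = (\<lambda>si. opp a si + opp b si)"
 by (rule ext) (simp add: opp_def gal_simps(3))

lemma opp_minus: "opp (\<lambda>si. - a si) = (\<lambda>si. - opp a si)"
 by (rule ext) (simp add: opp_def gal_simps(5))

lemma opp_sum: "opp (\<lambda>si. \<Sum>i\<in>A. g i si) = (\<lambda>si. \<Sum>i\<in>A. opp (g i) si)"
 by (induct A rule: infinite_finite_induct) (simp_all add: opp_zero opp_add)

lemma opp_mul: "opp (mul a b) = opmul (opp b) (opp a)"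
proof
 fix rh show "opp (mul a b) rh = opmul (opp b) (opp a) rh"
 proof (cases "rh \<in> G")
  case r: True
  have "opp (mul a b) rh = rh (\<Sum>ap\<in>G. a ap * ap (b (iv ap \<circ> iv rh)) * f ap (iv ap \<circ> iv rh))"
   using r by (simp add: opp_def cp_mult_def)
  also have "(\<Sum>ap\<in>G. a ap * ap (b (iv ap \<circ> iv rh)) * f ap (iv ap \<circ> iv rh))
    = (\<Sum>si\<in>G. a (iv rh \<circ> si) * (iv rh \<circ> si) (b (iv si)) * f (iv rh \<circ> si) (iv si))"
  proof -
   have "(\<Sum>ap\<in>G. a ap * ap (b (iv ap \<circ> iv rh)) * f ap (iv ap \<circ> iv rh))
    = (\<Sum>si\<in>G. a (iv rh \<circ> si) * (iv rh \<circ> si) (b (iv (iv rh \<circ> si) \<circ> iv rh)) * f (iv rh \<circ> si) (iv (iv rh \<circ> si) \<circ> iv rh))"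
    using sum.reindex_bij_betw[OF bij_left[OF inv_in_G[OF r]], of "\<lambda>ap. a ap * ap (b (iv ap \<circ> iv rh)) * f ap (iv ap \<circ> iv rh)"] by simp
   also have "\<dots> = (\<Sum>si\<in>G. a (iv rh \<circ> si) * (iv rh \<circ> si) (b (iv si)) * f (iv rh \<circ> si) (iv si))"
    by (rule sum.cong[OF refl]) (use r in \<open>simp add: comp_assoc\<close>)
   finally show ?thesis .
  qed
  also have "rh \<dots> = (\<Sum>si\<in>G. opp b si * si (opp a (iv si \<circ> rh)) * opf si (iv si \<circ> rh))"
   unfolding gal_sum[OF r]
  proof (rule sum.cong[OF refl])
   fix si assume s: "si \<in> G"
   have e: "iv (iv si \<circ> rh) = iv rh \<circ> si" "iv si \<circ> rh \<in> G" "si \<circ> (iv si \<circ> rh) = rh" using s r by auto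
   have o1: "opp b si = si (b (iv si))" using s by (simp add: opp_def)
   have o2: "si (opp a (iv si \<circ> rh)) = rh (a (iv rh \<circ> si))"
    unfolding opp_def e(1) using e(2) inv_app(2)[OF s] by simp
   have o3: "opf si (iv si \<circ> rh) = rh (f (iv rh \<circ> si) (iv si))" unfolding opf_def e(1,3) ..
   show "rh (a (iv rh \<circ> si) * (iv rh \<circ> si) (b (iv si)) * f (iv rh \<circ> si) (iv si))
     = opp b si * si (opp a (iv si \<circ> rh)) * opf si (iv si \<circ> rh)"
    unfolding o1 o2 o3 using inv_app(2)[OF r] by (simp add: gal_simps(4)[OF r] mult_ac)
  qed
  finally show ?thesis using r by (simp add: cp_mult_def)
 next
  case False thus ?thesis by (simp add: opp_def cp_mult_def)
 qed
qed

lemma rideal_sub_iff: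
 assumes B: "subB B"
 shows "rideal (subSig G f B) I \<longleftrightarrow> I \<subseteq> B \<and> (\<lambda>_. 0) \<in> I \<and> (\<forall>x\<in>I. \<forall>y\<in>I. (\<lambda>si. x si + y si) \<in> I) \<and>
  (\<forall>x\<in>I. (\<lambda>si. - x si) \<in> I) \<and> (\<forall>r\<in>B. \<forall>x\<in>I. mul x r \<in> I)"
proof (cases "I \<subseteq> B")
 case True
 have "(\<forall>x\<in>I. \<ominus>\<^bsub>subSig G f B\<^esub> x \<in> I) \<longleftrightarrow> (\<forall>x\<in>I. (\<lambda>si. - x si) \<in> I)"
  by (rule ball_cong[OF refl]) (use minus_sub[OF B] True in auto)
 thus ?thesis unfolding rideal_def sub_simps by simp
qed (simp add: rideal_def)

end

context tame_crossed
begin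

lemma tame_crossed_opf: "tame_crossed F V S opf"
 by unfold_locales (use opf_cocycle tame principal in auto)

text \<open>\<open>opp\<close> carries right ideals of \<open>Af\<close> to left ideals of the
  opposite crossed product, together with their generators, and carries a section back; so the
  result on left ideals is applied there.\<close>

lemma fg_rideal_proj:
 assumes c4: cond4 and fg: "fg_rideal (subSig G f Af) I"
 shows "proj_right (subSig G f Af) I"
proof -
 interpret o: tame_crossed F V S opf by (rule tame_crossed_opf)
 have c4': o.cond4
 proof -
  \<comment> \<open>On a pair of inverse elements the two cocycles agree, so \<open>cond4\<close> is
    the same condition for both.\<close>
  have "opf si (iv si) = f si (iv si)" if "si \<in> G" for si using that by (simp add: opf_def)
  thus ?thesis using c4 unfolding o.cond4_def cond4_def by simp
 qed
 obtain Y where I: "rideal (subSig G f Af) I" and Y: "finite Y" "Y \<subseteq> I" "I = \<Inter>{K. rideal (subSig G f Af) K \<and> Y \<subseteq> K}"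
  using fg unfolding fg_rideal_def by blast
 have Ir: "I \<subseteq> Af" "(\<lambda>_. 0) \<in> I" "\<And>x y. x \<in> I ==> y \<in> I ==> (\<lambda>si. x si + y si) \<in> I"
   "\<And>x. x \<in> I ==> (\<lambda>si. - x si) \<in> I" "\<And>r x. r \<in> Af ==> x \<in> I ==> mul x r \<in> I"
  using I unfolding rideal_sub_iff[OF subB_Af] by blast+
 have AC: "a \<in> Af ==> a \<in> CS" for a using Af_iff by blast
 have AO: "a \<in> Af ==> opp (opp a) = a" for a using opp_opp[OF AC] .
 have mo: "mul (opp a) r = opp (opmul (opp r) a)" if "a \<in> Af" "r \<in> Af" for a r
  using opp_opp[OF mul_CS[of "opp a" r]] opp_mul[of "opp a" r] AO[OF that(1)] by simp
 define J where "J = opp ` I"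
 have lJ: "lideal (subSig G opf Af) J" unfolding o.lideal_sub_iff[OF o.subB_Af]
 proof (intro conjI ballI)
  show "J \<subseteq> Af" using Ir(1) opp_Af by (auto simp: J_def)
  show "(\<lambda>_. 0) \<in> J" unfolding J_def using Ir(2) opp_zero by (metis image_eqI)
  fix x assume "x \<in> J"
  then obtain a where a: "a \<in> I" "x = opp a" unfolding J_def by blast
  show "(\<lambda>si. - x si) \<in> J" unfolding J_def a(2) using opp_minus[of a] Ir(4)[OF a(1)] by (metis image_eqI)
  show "opmul r x \<in> J" if r: "r \<in> Af" for r
  proof -
   have "opmul r x = opp (mul a (opp r))" unfolding opp_mul a(2) AO[OF r] ..
   thus ?thesis unfolding J_def using Ir(5)[OF opp_Af[OF r] a(1)] by blast
  qed
  fix y assume "y \<in> J"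
  then obtain b where b: "b \<in> I" "y = opp b" unfolding J_def by blast
  show "(\<lambda>si. x si + y si) \<in> J" unfolding J_def a(2) b(2) using opp_add[of a b] Ir(3)[OF a(1) b(1)] by (metis image_eqI)
 qed
 have "J \<subseteq> K" if K: "lideal (subSig G opf Af) K" "opp ` Y \<subseteq> K" for K
 proof
  note Kd = K(1)[unfolded o.lideal_sub_iff[OF o.subB_Af]]
  have KA: "k \<in> Af" if "k \<in> K" for k using Kd that by blast
  have "rideal (subSig G f Af) (opp ` K)" unfolding rideal_sub_iff[OF subB_Af]
  proof (intro conjI ballI)
   show "opp ` K \<subseteq> Af" using KA opp_Af by blast
   have "(\<lambda>_. 0) \<in> K" using Kd by blast
   thus "(\<lambda>_. 0) \<in> opp ` K" using opp_zero by (metis image_eqI)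
   fix x assume "x \<in> opp ` K"
   then obtain a where a: "a \<in> K" "x = opp a" by blast
   have "(\<lambda>si. - a si) \<in> K" using Kd a(1) by blast
   thus "(\<lambda>si. - x si) \<in> opp ` K" unfolding a(2) using opp_minus[of a] by (metis image_eqI)
   show "mul x r \<in> opp ` K" if r: "r \<in> Af" for r
   proof -
    have "opmul (opp r) a \<in> K" using Kd a(1) opp_Af[OF r] by blast
    thus ?thesis unfolding a(2) mo[OF KA[OF a(1)] r] by blast
   qed
   fix y assume "y \<in> opp ` K"
   then obtain b where b: "b \<in> K" "y = opp b" by blast
   have "(\<lambda>si. a si + b si) \<in> K" using Kd a(1) b(1) by blast
   thus "(\<lambda>si. x si + y si) \<in> opp ` K" unfolding a(2) b(2) using opp_add[of a b] by (metis image_eqI)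
  qed
  moreover have "Y \<subseteq> opp ` K"
  proof
   fix y assume y: "y \<in> Y"
   have "opp (opp y) = y" using AO y Y(2) Ir(1) by blast
   moreover have "opp y \<in> K" using K(2) y by blast
   ultimately show "y \<in> opp ` K" by (metis image_eqI)
  qed
  ultimately have IK: "I \<subseteq> opp ` K" using Y(3) by blast
  fix x assume "x \<in> J"
  then obtain a where a: "a \<in> I" "x = opp a" unfolding J_def by blast
  obtain k where k: "k \<in> K" "a = opp k" using IK a(1) by blast
  show "x \<in> K" unfolding a(2) k(2) AO[OF KA[OF k(1)]] by (rule k(1))
 qed
 moreover have YJ: "opp ` Y \<subseteq> J" using Y(2) by (auto simp: J_def)
 ultimately have "J = \<Inter>{K. lideal (subSig G opf Af) K \<and> opp ` Y \<subseteq> K}" using lJ by blast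
 hence "fg_lideal (subSig G opf Af) J" unfolding fg_lideal_def using lJ Y(1) YJ by (intro conjI exI[of _ "opp ` Y"]) auto
 hence "proj_left (subSig G opf Af) J" by (rule o.fg_lideal_proj[OF c4'])
 then obtain s where s: "\<And>x z. x \<in> J ==> s x z \<in> Af" "\<And>x z. x \<in> J ==> z \<notin> J ==> s x z = (\<lambda>_. 0)"
   "\<And>x. x \<in> J ==> finite {z. s x z \<noteq> (\<lambda>_. 0)}"
   "\<And>x y. x \<in> J ==> y \<in> J ==> s (\<lambda>si. x si + y si) = (\<lambda>z si. s x z si + s y z si)"
   "\<And>r x. r \<in> Af ==> x \<in> J ==> s (opmul r x) = (\<lambda>z. opmul r (s x z))"
   "\<And>x. x \<in> J ==> finsum (subSig G opf Af) (\<lambda>z. opmul (s x z) z) {z. s x z \<noteq> (\<lambda>_. 0)} = x"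
  unfolding proj_left_def proj_mod_def o.sub_simps by blast
 \<comment> \<open>Outside \<open>I\<close> the value is set to 0 explicitly: \<open>opp\<close> is
   injective only on functions supported on \<open>G\<close>, so \<open>opp z\<close> may lie in
   \<open>J\<close> although \<open>z\<close> is not in \<open>I\<close>.\<close>
 define t where "t x z = (if z \<in> I then opp (s (opp x) (opp z)) else (\<lambda>_. 0))" for x z
 have IJ: "opp x \<in> J" if "x \<in> I" for x using that by (simp add: J_def)
 have IO: "opp (opp x) = x" if "x \<in> I" for x using AO Ir(1) that by blast
 have sz: "opp (s (opp x) z) = (\<lambda>_. 0) \<longleftrightarrow> s (opp x) z = (\<lambda>_. 0)" if "x \<in> I" for x z
  using AO[OF s(1)[OF IJ[OF that], of z]] opp_zero by metis
 have bij: "bij_betw opp {z. t x z \<noteq> (\<lambda>_. 0)} {z. s (opp x) z \<noteq> (\<lambda>_. 0)}" if x: "x \<in> I" for x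
 proof (rule bij_betw_byWitness[where f' = opp])
  have tI: "z \<in> I \<and> s (opp x) (opp z) \<noteq> (\<lambda>_. 0)" if "t x z \<noteq> (\<lambda>_. 0)" for z
   using that sz[OF x] unfolding t_def by (metis (no_types))
  have sJ: "z \<in> J" if "s (opp x) z \<noteq> (\<lambda>_. 0)" for z using s(2)[OF IJ[OF x]] that by blast
  have JO: "opp (opp z) = z \<and> opp z \<in> I" if zJ: "z \<in> J" for z
  proof -
   obtain a where "a \<in> I" "z = opp a" using zJ unfolding J_def by blast
   thus ?thesis using IO by simp
  qed
  show "\<forall>z\<in>{z. t x z \<noteq> (\<lambda>_. 0)}. opp (opp z) = z" using tI IO by blast
  show "\<forall>z\<in>{z. s (opp x) z \<noteq> (\<lambda>_. 0)}. opp (opp z) = z" using sJ JO by blast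
  show "opp ` {z. t x z \<noteq> (\<lambda>_. 0)} \<subseteq> {z. s (opp x) z \<noteq> (\<lambda>_. 0)}" using tI by blast
  have "t x (opp z) \<noteq> (\<lambda>_. 0)" if z: "s (opp x) z \<noteq> (\<lambda>_. 0)" for z
   using JO[OF sJ[OF z]] sz[OF x, of z] z by (simp add: t_def)
  thus "opp ` {z. s (opp x) z \<noteq> (\<lambda>_. 0)} \<subseteq> {z. t x z \<noteq> (\<lambda>_. 0)}" by blast
 qed
 have tA: "t x z \<in> Af" if "x \<in> I" for x z
  using opp_Af[OF s(1)[OF IJ[OF that]]] subBD(6)[OF subB_Af] by (simp add: t_def)
 have fin: "finite {z. t x z \<noteq> (\<lambda>_. 0)}" if "x \<in> I" for x
  using bij_betw_finite[OF bij[OF that]] s(3)[OF IJ[OF that]] by blast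
 have tadd: "t (\<lambda>si. x si + y si) = (\<lambda>z si. t x z si + t y z si)" if "x \<in> I" "y \<in> I" for x y
 proof
  fix z show "t (\<lambda>si. x si + y si) z = (\<lambda>si. t x z si + t y z si)"
   unfolding t_def opp_add s(4)[OF IJ[OF that(1)] IJ[OF that(2)]] by simp
 qed
 have tmul: "t (mul x r) = (\<lambda>z. mul (t x z) r)" if x: "x \<in> I" and r: "r \<in> Af" for x r
 proof
  fix z
  have "opp (opmul (opp r) (s (opp x) (opp z))) = mul (opp (s (opp x) (opp z))) r"
   by (rule mo[OF s(1)[OF IJ[OF x]] r, symmetric])
  thus "t (mul x r) z = mul (t x z) r"
   unfolding t_def opp_mul s(5)[OF opp_Af[OF r] IJ[OF x]] by (simp add: mul_zero)
 qed
 have tsum: "finsum (subSig G f Af) (\<lambda>z. mul z (t x z)) {z. t x z \<noteq> (\<lambda>_. 0)} = x" if x: "x \<in> I" for x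
 proof -
  let ?U = "{z. t x z \<noteq> (\<lambda>_. 0)}" and ?W = "{z. s (opp x) z \<noteq> (\<lambda>_. 0)}"
  have UI: "z \<in> I" if "z \<in> ?U" for z using that unfolding t_def by (auto split: if_splits)
  have "finsum (subSig G f Af) (\<lambda>z. mul z (t x z)) ?U = (\<lambda>rh. \<Sum>z\<in>?U. mul z (t x z) rh)"
   by (rule finsum_sub[OF subB_Af fin[OF x]]) (use subBD(3)[OF subB_Af] Ir(1) UI tA[OF x] in blast)
  also have "\<dots> = (\<lambda>rh. \<Sum>z\<in>?U. opp (opmul (s (opp x) (opp z)) (opp z)) rh)"
  proof (rule ext, rule sum.cong[OF refl])
   fix rh z assume "z \<in> ?U"
   hence z: "z \<in> I" by (rule UI)
   let ?s = "s (opp x) (opp z)"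
   have "opp (mul z (opp ?s)) = opmul ?s (opp z)" unfolding opp_mul AO[OF s(1)[OF IJ[OF x]]] ..
   hence "mul z (opp ?s) = opp (opmul ?s (opp z))" using opp_opp[OF mul_CS] by metis
   thus "mul z (t x z) rh = opp (opmul ?s (opp z)) rh" using z by (simp add: t_def)
  qed
  also have "\<dots> = (\<lambda>rh. \<Sum>z\<in>?W. opp (opmul (s (opp x) z) z) rh)"
   using sum.reindex_bij_betw[OF bij[OF x], of "\<lambda>z. opp (opmul (s (opp x) z) z) _"] by simp
  also have "\<dots> = opp (\<lambda>rh. \<Sum>z\<in>?W. opmul (s (opp x) z) z rh)" unfolding opp_sum ..
  also have "(\<lambda>rh. \<Sum>z\<in>?W. opmul (s (opp x) z) z rh) = finsum (subSig G opf Af) (\<lambda>z. opmul (s (opp x) z) z) ?W"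
  proof (rule o.finsum_sub[OF o.subB_Af s(3)[OF IJ[OF x]], symmetric])
   fix z assume "z \<in> ?W"
   hence "z \<in> J" using s(2)[OF IJ[OF x]] by blast
   hence "z \<in> Af" using lideal_def[of "subSig G opf Af" J] lJ by auto
   thus "opmul (s (opp x) z) z \<in> Af" using o.subBD(3)[OF o.subB_Af s(1)[OF IJ[OF x]]] by blast
  qed
  also have "\<dots> = opp x" by (rule s(6)[OF IJ[OF x]])
  also have "opp (opp x) = x" by (rule IO[OF x])
  finally show ?thesis .
 qed
 show ?thesis unfolding proj_right_def proj_mod_def sub_simps
 proof (rule exI[of _ t], intro conjI ballI allI impI)
  show "t x z = (\<lambda>_. 0)" if "z \<notin> I" for x z using that by (simp add: t_def)
 qed (simp_all add: tA fin tadd tmul tsum)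
qed

text \<open>For the forward direction a single ideal has to be tested: the radical, which is
  finitely generated.\<close>

theorem semihereditary_iff_cond4: "semihereditary (subSig G f Af) \<longleftrightarrow> cond4"
proof
 assume "semihereditary (subSig G f Af)"
 thus cond4 using fg_Nid proj_Nid_cond4 unfolding semihereditary_def by blast
next
 assume cond4
 thus "semihereditary (subSig G f Af)" unfolding semihereditary_def using fg_lideal_proj fg_rideal_proj by blast
qed

theorem proj_jac_iff_cond4: "proj_left (subSig G f Af) Nid \<longleftrightarrow> cond4"
 using proj_Nid_cond4 fg_lideal_proj fg_Nid by blast

end

theorem theorem3p4:
  fixes F V S :: "'k::field set"
    and f :: "('k \<Rightarrow> 'k) \<Rightarrow> ('k \<Rightarrow> 'k) \<Rightarrow> 'k"
  assumes galois: "finite_galois F"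
    and val: "valuation_domain_of F V"
    and principal: "\<exists>\<pi>\<in>V. jac (subR V) = {\<pi> * v | v. v \<in> V}"
    and tame: "tame_defectless F V S"
    and S_def: "S = int_closure V"
    and cocycle: "normalized_cocycle (gal F) S f"
  shows "(semihereditary (subSig (gal F) f (A_f_set (gal F) S))
            \<longleftrightarrow> extremal (gal F) f F V (A_f_set (gal F) S))
       \<and> (extremal (gal F) f F V (A_f_set (gal F) S)
            \<longleftrightarrow> left_order (gal F) f (jac (subSig (gal F) f (A_f_set (gal F) S))) = A_f_set (gal F) S)
       \<and> (left_order (gal F) f (jac (subSig (gal F) f (A_f_set (gal F) S))) = A_f_set (gal F) S
            \<longleftrightarrow> (\<forall>M. maximalideal M (subR S) \<longrightarrow>
                   (\<forall>\<sigma>\<in>gal F. f \<sigma> (Hilbert_Choice.inv \<sigma>) \<notin> ideal_prod (subR S) M M)))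
       \<and> ((\<forall>M. maximalideal M (subR S) \<longrightarrow>
                   (\<forall>\<sigma>\<in>gal F. f \<sigma> (Hilbert_Choice.inv \<sigma>) \<notin> ideal_prod (subR S) M M))
            \<longleftrightarrow> (\<forall>M. maximalideal M (subR S) \<longrightarrow>
                   (\<forall>\<sigma>\<in>gal F. \<forall>\<tau>\<in>gal F. f \<sigma> \<tau> \<notin> ideal_prod (subR S) M M)))
       \<and> ((\<forall>M. maximalideal M (subR S) \<longrightarrow>
                   (\<forall>\<sigma>\<in>gal F. \<forall>\<tau>\<in>gal F. f \<sigma> \<tau> \<notin> ideal_prod (subR S) M M))
            \<longleftrightarrow> proj_left (subSig (gal F) f (A_f_set (gal F) S))
                   (jac (subSig (gal F) f (A_f_set (gal F) S))))
       \<and> (semihereditary (subSig (gal F) f (A_f_set (gal F) S)) \<longrightarrow>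
            (\<forall>M. maximalideal M (subR S) \<longrightarrow> Gr_chain (gal F) S f M))"
proof -
 interpret tame_crossed F V S f
  by unfold_locales (use assms in auto)
 have max: "maximalideal M (subR S) \<longleftrightarrow> ismax S M" for M using ismax_iff[OF S_subring] by blast
 have c4: "(\<forall>M. maximalideal M (subR S) \<longrightarrow> (\<forall>si\<in>gal F. f si (Hilbert_Choice.inv si) \<notin> ideal_prod (subR S) M M)) \<longleftrightarrow> cond4"
  unfolding max cond4_def ..
 have c5: "(\<forall>M. maximalideal M (subR S) \<longrightarrow> (\<forall>si\<in>gal F. \<forall>tu\<in>gal F. f si tu \<notin> ideal_prod (subR S) M M)) \<longleftrightarrow> cond4"
  unfolding max cond4_iff_cond5 cond5_def ..
 show ?thesis
  unfolding c4 c5 jac_Af cond4_iff_LO[symmetric] cond4_iff_extremal[symmetric] semihereditary_iff_cond4 proj_jac_iff_cond4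
  unfolding max by (intro conjI refl impI allI) (rule graph_chain)
qed

end
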